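(* Let $R$ and $S$ be rings, let $d\ge 1$ be an integer, let $n$ be an integer or $n=\infty$ with $n>d+1$, and let ${}_S(K_{d-1})_R$ be a special semidualizing bimodule (with respect to some super finitely presented bimodule ${}_SC_R$). Then the classes $\mathcal{I}_{K_{d-1}}^{(n,d)}(R)$ and $\mathcal{F}_{K_{d-1}}^{(n,d)}(S)$ are closed under direct summands.
   Context: Rings are associative with unity; modules are unital left modules; right $R$-modules are identified with left $R^{op}$-modules. A module $U$ over a ring $T$ is finitely $n$-presented ($n$ finite) if there is an exact sequence $F_n\to F_{n-1}\to\cdots\to F_0\to U\to 0$ of $T$-modules with each $F_i$ finitely generated free; for $n=\infty$, finitely $\infty$-presented means super finitely presented, i.e. there is an exact sequence $\cdots\to F_1\to F_0\to U\to 0$ with each $F_i$ finitely generated free. An $S$-module $M$ is $(n,d)$-injective if $\mathrm{Ext}_S^{d+1}(U,M)=0$ for every finitely $n$-presented $S$-module $U$. An $R$-module $N$ is $(n,d)$-flat if $\mathrm{Tor}^R_{d+1}(U,N)=0$ for every finitely $n$-presented $R^{op}$-module $U$. $\mathcal{I}^{(n,d)}(S)$ and $\mathcal{F}^{(n,d)}(R)$ denote the classes of all $(n,d)$-injective $S$-modules and all $(n,d)$-flat $R$-modules. An $(S,R)$-bimodule $K$ is semidualizing if: ${}_SK$ and $K_R$ each have a resolution by finitely generated projectives (over $S$, resp. $R^{op}$); the homothety maps $S\to\mathrm{Hom}_{R^{op}}(K,K)$ and $R\to\mathrm{Hom}_S(K,K)$ are isomorphisms; and $\mathrm{Ext}_S^i(K,K)=0=\mathrm{Ext}_{R^{op}}^i(K,K)$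 for all $i\ge1$. Special semidualizing: let ${}_SC_R$ be a super finitely presented bimodule, i.e. there is an exact sequence of $(S,R)$-bimodules $\cdots\to F_1\to F_0\to C\to 0$ with each $F_i$ finitely generated free as a left $S$-module and as a right $R$-module. Put $K_{d-1}=\mathrm{Ker}(F_{d-1}\to F_{d-2})$ (with $F_{-1}=C$), the $(d-1)$th syzygy. If $K_{d-1}$ is a semidualizing $(S,R)$-bimodule, then $K_{d-1}$ is called a special semidualizing bimodule (with respect to $C$). $\mathcal{I}_{K_{d-1}}^{(n,d)}(R)$ is the class of $R$-modules (isomorphic to one) of the form $\mathrm{Hom}_S(K_{d-1},I)$ with $I\in\mathcal{I}^{(n,d)}(S)$; $\mathcal{F}_{K_{d-1}}^{(n,d)}(S)$ is the class of $S$-modules (isomorphic to one) of the form $K_{d-1}\otimes_RF$ with $F\in\mathcal{F}^{(n,d)}(R)$. *)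

theory Defs
  imports "HOL-Algebra.Module" "HOL-Algebra.Free_Abelian_Groups" "HOL-Library.Extended_Nat"
begin

section \<open>Modules and bimodules over noncommutative rings\<close>

text \<open>
  The locale \<^locale>\<open>module\<close> requires a commutative ring of scalars, so left modules over an
  arbitrary ring are introduced here. They reuse the record type \<open>module\<close>, whose
  components \<open>mult\<close> and \<open>one\<close> are ignored throughout.
\<close>

locale left_module = R?: ring R + M?: abelian_group M
  for R :: "('r, 'e) ring_scheme" (structure) and M :: "('r, 'm, 'x) module_scheme" (structure) +
  assumes smult_closed [simp, intro]:
      "\<lbrakk>a \<in> carrier R; x \<in> carrier M\<rbrakk> \<Longrightarrow> a \<odot>\<^bsub>M\<^esub> x \<in> carrier M"
    and smult_l_distr:
      "\<lbrakk>a \<in> carrier R; b \<in> carrier R; x \<in> carrier M\<rbrakk> \<Longrightarrow>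
        (a \<oplus> b) \<odot>\<^bsub>M\<^esub> x = a \<odot>\<^bsub>M\<^esub> x \<oplus>\<^bsub>M\<^esub> b \<odot>\<^bsub>M\<^esub> x"
    and smult_r_distr:
      "\<lbrakk>a \<in> carrier R; x \<in> carrier M; y \<in> carrier M\<rbrakk> \<Longrightarrow>
        a \<odot>\<^bsub>M\<^esub> (x \<oplus>\<^bsub>M\<^esub> y) = a \<odot>\<^bsub>M\<^esub> x \<oplus>\<^bsub>M\<^esub> a \<odot>\<^bsub>M\<^esub> y"
    and smult_assoc1:
      "\<lbrakk>a \<in> carrier R; b \<in> carrier R; x \<in> carrier M\<rbrakk> \<Longrightarrow>
        (a \<otimes> b) \<odot>\<^bsub>M\<^esub> x = a \<odot>\<^bsub>M\<^esub> (b \<odot>\<^bsub>M\<^esub> x)"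
    and smult_one [simp]:
      "x \<in> carrier M \<Longrightarrow> \<one> \<odot>\<^bsub>M\<^esub> x = x"

definition op_ring :: "('r, 'e) ring_scheme \<Rightarrow> ('r, 'e) ring_scheme" where
  "op_ring R = R\<lparr>monoid.mult := (\<lambda>x y. y \<otimes>\<^bsub>R\<^esub> x)\<rparr>"

definition left_hom ::
  "('r, 'e) ring_scheme \<Rightarrow> ('r, 'm, 'x) module_scheme \<Rightarrow> ('r, 'n, 'y) module_scheme \<Rightarrow> ('m \<Rightarrow> 'n) set"
  where
  "left_hom R M N = {f \<in> carrier M \<rightarrow> carrier N.
     (\<forall>x\<in>carrier M. \<forall>y\<in>carrier M. f (x \<oplus>\<^bsub>M\<^esub> y) = f x \<oplus>\<^bsub>N\<^esub> f y) \<and>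
     (\<forall>r\<in>carrier R. \<forall>x\<in>carrier M. f (r \<odot>\<^bsub>M\<^esub> x) = r \<odot>\<^bsub>N\<^esub> f x)}"

definition module_iso ::
  "('r, 'e) ring_scheme \<Rightarrow> ('r, 'm, 'x) module_scheme \<Rightarrow> ('r, 'n, 'y) module_scheme \<Rightarrow> bool" where
  "module_iso R M N \<longleftrightarrow> (\<exists>f\<in>left_hom R M N. bij_betw f (carrier M) (carrier N))"

definition direct_sum ::
  "('r, 'm, 'x) module_scheme \<Rightarrow> ('r, 'n, 'y) module_scheme \<Rightarrow> ('r, 'm \<times> 'n) module" where
  "direct_sum M N =
     \<lparr>carrier = carrier M \<times> carrier N, mult = undefined, one = undefined,
      ring.zero = (\<zero>\<^bsub>M\<^esub>, \<zero>\<^bsub>N\<^esub>),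
      add = (\<lambda>(x, y) (x', y'). (x \<oplus>\<^bsub>M\<^esub> x', y \<oplus>\<^bsub>N\<^esub> y')),
      smult = (\<lambda>r (x, y). (r \<odot>\<^bsub>M\<^esub> x, r \<odot>\<^bsub>N\<^esub> y))\<rparr>"

record ('s, 'r, 'k) bimodule = "('s, 'k) module" +
  rsmult :: "'k \<Rightarrow> 'r \<Rightarrow> 'k"

definition right_part :: "('s, 'r, 'k, 'x) bimodule_scheme \<Rightarrow> ('r, 'k) module" where
  "right_part K =
     \<lparr>carrier = carrier K, mult = undefined, one = undefined,
      ring.zero = \<zero>\<^bsub>K\<^esub>, add = ring.add K, smult = (\<lambda>r x. rsmult K x r)\<rparr>"

definition is_bimodule ::
  "('s, 'e) ring_scheme \<Rightarrow> ('r, 'e') ring_scheme \<Rightarrow> ('s, 'r, 'k, 'x) bimodule_scheme \<Rightarrow> bool" where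
  "is_bimodule S R K \<longleftrightarrow> left_module S K \<and> left_module (op_ring R) (right_part K) \<and>
     (\<forall>s\<in>carrier S. \<forall>r\<in>carrier R. \<forall>x\<in>carrier K.
        rsmult K (s \<odot>\<^bsub>K\<^esub> x) r = s \<odot>\<^bsub>K\<^esub> rsmult K x r)"


section \<open>Free modules and resolutions\<close>

definition free_module :: "('r, 'e) ring_scheme \<Rightarrow> 'b set \<Rightarrow> ('r, 'b \<Rightarrow> 'r) module" where
  "free_module R B =
     \<lparr>carrier = {f. range f \<subseteq> carrier R \<and> finite {b. f b \<noteq> \<zero>\<^bsub>R\<^esub>} \<and> {b. f b \<noteq> \<zero>\<^bsub>R\<^esub>} \<subseteq> B},
      mult = undefined, one = undefined,
      ring.zero = (\<lambda>_. \<zero>\<^bsub>R\<^esub>), add = (\<lambda>f g b. f b \<oplus>\<^bsub>R\<^esub> g b), smult = (\<lambda>r f b. r \<otimes>\<^bsub>R\<^esub> f b)\<rparr>"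

definition fg_free :: "('r, 'e) ring_scheme \<Rightarrow> ('r, 'm, 'x) module_scheme \<Rightarrow> bool" where
  "fg_free R M \<longleftrightarrow> left_module R M \<and> (\<exists>k::nat. module_iso R M (free_module R {..<k}))"

text \<open>A complement of \<open>P\<close> in \<open>R\<^sup>k\<close> is a submodule of \<open>R\<^sup>k\<close>, which justifies the type of \<open>Q\<close>.\<close>

definition fg_projective :: "('r, 'e) ring_scheme \<Rightarrow> ('r, 'm, 'x) module_scheme \<Rightarrow> bool" where
  "fg_projective R P \<longleftrightarrow> left_module R P \<and>
     (\<exists>(Q :: ('r, nat \<Rightarrow> 'r) module) (k::nat).
        left_module R Q \<and> module_iso R (direct_sum P Q) (free_module R {..<k}))"

text \<open>
  In a complex \<open>\<dots> \<rightarrow> P 1 \<rightarrow> P 0 \<rightarrow> U\<close> the map \<open>P (i + 1) \<rightarrow> P i\<close> is \<open>\<delta> i\<close> and the augmentation is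
  \<open>\<epsilon>\<close>; \<open>syzygy P \<delta> \<epsilon> U i\<close> is \<open>Ker (P i \<rightarrow> P (i - 1))\<close>, where \<open>P (- 1) = U\<close>.
\<close>

definition syzygy ::
  "(nat \<Rightarrow> ('r, 'p, 'x) module_scheme) \<Rightarrow> (nat \<Rightarrow> 'p \<Rightarrow> 'p) \<Rightarrow> ('p \<Rightarrow> 'u) \<Rightarrow> ('r, 'u, 'y) module_scheme
     \<Rightarrow> nat \<Rightarrow> 'p set" where
  "syzygy P \<delta> \<epsilon> U i =
     (case i of 0 \<Rightarrow> kernel (add_monoid (P 0)) (add_monoid U) \<epsilon>
      | Suc j \<Rightarrow> kernel (add_monoid (P (Suc j))) (add_monoid (P j)) (\<delta> j))"

text \<open>Exactness of \<open>P n \<rightarrow> \<dots> \<rightarrow> P 0 \<rightarrow> U \<rightarrow> 0\<close>, unbounded to the left if \<open>n = \<infinity>\<close>.\<close>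

definition exact_resolution ::
  "('r, 'e) ring_scheme \<Rightarrow> enat \<Rightarrow> (nat \<Rightarrow> ('r, 'p, 'x) module_scheme) \<Rightarrow> (nat \<Rightarrow> 'p \<Rightarrow> 'p)
     \<Rightarrow> ('p \<Rightarrow> 'u) \<Rightarrow> ('r, 'u, 'y) module_scheme \<Rightarrow> bool" where
  "exact_resolution R n P \<delta> \<epsilon> U \<longleftrightarrow>
     left_module R U \<and> (\<forall>i. enat i \<le> n \<longrightarrow> left_module R (P i)) \<and>
     \<epsilon> \<in> left_hom R (P 0) U \<and> \<epsilon> ` carrier (P 0) = carrier U \<and>
     (\<forall>i. enat (Suc i) \<le> n \<longrightarrow> \<delta> i \<in> left_hom R (P (Suc i)) (P i) \<and>
        \<delta> i ` carrier (P (Suc i)) = syzygy P \<delta> \<epsilon> U i)"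

text \<open>
  Finitely generated free, and likewise finitely generated projective, modules embed in some \<open>R\<^sup>k\<close>.
  So the element type \<open>nat \<Rightarrow> 'r\<close> loses no resolutions in the next two definitions.
\<close>

definition finitely_presented :: "('r, 'e) ring_scheme \<Rightarrow> enat \<Rightarrow> ('r, 'u, 'y) module_scheme \<Rightarrow> bool"
  where
  "finitely_presented R n U \<longleftrightarrow>
     (\<exists>(F :: nat \<Rightarrow> ('r, nat \<Rightarrow> 'r) module) \<delta> \<epsilon>.
        exact_resolution R n F \<delta> \<epsilon> U \<and> (\<forall>i. enat i \<le> n \<longrightarrow> fg_free R (F i)))"

definition has_fg_projective_resolution ::
  "('r, 'e) ring_scheme \<Rightarrow> ('r, 'u, 'y) module_scheme \<Rightarrow> bool" where
  "has_fg_projective_resolution R U \<longleftrightarrow>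
     (\<exists>(P :: nat \<Rightarrow> ('r, nat \<Rightarrow> 'r) module) \<delta> \<epsilon>.
        exact_resolution R \<infinity> P \<delta> \<epsilon> U \<and> (\<forall>i. fg_projective R (P i)))"


section \<open>A functorial free resolution\<close>

text \<open>
  Ext and Tor are defined for arbitrary modules through one explicit free resolution of \<open>U\<close>:
  \<open>F 0\<close> is free on the elements of \<open>U\<close>, and \<open>F (i + 1)\<close> is free on the formal linear
  combinations \<open>l\<close> of basis elements of \<open>F i\<close> whose value lies in \<open>Ker (F i \<rightarrow> F (i - 1))\<close>, the basis
  element \<open>Rel l\<close> being sent to that value. The datatype makes all these bases subsets of
  a single type.
\<close>

datatype ('r, 'u) gen = Gen 'u | Rel "('r \<times> ('r, 'u) gen) list"

definition comb_value :: "('r, 'e) ring_scheme \<Rightarrow> ('r \<times> 'b) list \<Rightarrow> 'b \<Rightarrow> 'r" where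
  "comb_value R l = foldr (\<lambda>(r, b) v. v(b := r \<oplus>\<^bsub>R\<^esub> v b)) l (\<lambda>_. \<zero>\<^bsub>R\<^esub>)"

text \<open>The linear extension of a map \<open>h\<close> from the basis elements to \<open>M\<close>.\<close>

definition linear_ext ::
  "('r, 'e) ring_scheme \<Rightarrow> ('r, 'm, 'x) module_scheme \<Rightarrow> ('b \<Rightarrow> 'm) \<Rightarrow> ('b \<Rightarrow> 'r) \<Rightarrow> 'm" where
  "linear_ext R M h f = (\<Oplus>\<^bsub>M\<^esub>b\<in>{b. f b \<noteq> \<zero>\<^bsub>R\<^esub>}. f b \<odot>\<^bsub>M\<^esub> h b)"

definition std_aug ::
  "('r, 'e) ring_scheme \<Rightarrow> ('r, 'u, 'y) module_scheme \<Rightarrow> (('r, 'u) gen \<Rightarrow> 'r) \<Rightarrow> 'u" where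
  "std_aug R U = linear_ext R U (\<lambda>g. case g of Gen u \<Rightarrow> u | Rel l \<Rightarrow> \<zero>\<^bsub>U\<^esub>)"

definition std_diff ::
  "('r, 'e) ring_scheme \<Rightarrow> (('r, 'u) gen \<Rightarrow> 'r) \<Rightarrow> (('r, 'u) gen \<Rightarrow> 'r)" where
  "std_diff R = linear_ext R (free_module R UNIV)
     (\<lambda>g. case g of Gen u \<Rightarrow> (\<lambda>_. \<zero>\<^bsub>R\<^esub>) | Rel l \<Rightarrow> comb_value R l)"

primrec std_basis ::
  "('r, 'e) ring_scheme \<Rightarrow> ('r, 'u, 'y) module_scheme \<Rightarrow> nat \<Rightarrow> ('r, 'u) gen set" where
  "std_basis R U 0 = Gen ` carrier U"
| "std_basis R U (Suc i) =
     {Rel l | l. set l \<subseteq> carrier R \<times> std_basis R U i \<and>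
        (if i = 0 then std_aug R U (comb_value R l) = \<zero>\<^bsub>U\<^esub>
         else std_diff R (comb_value R l) = (\<lambda>_. \<zero>\<^bsub>R\<^esub>))}"

definition std_res ::
  "('r, 'e) ring_scheme \<Rightarrow> ('r, 'u, 'y) module_scheme \<Rightarrow> nat \<Rightarrow> ('r, ('r, 'u) gen \<Rightarrow> 'r) module" where
  "std_res R U i = free_module R (std_basis R U i)"


section \<open>Hom and Ext\<close>

definition hom_group ::
  "('r, 'e) ring_scheme \<Rightarrow> ('r, 'm, 'x) module_scheme \<Rightarrow> ('r, 'n, 'y) module_scheme \<Rightarrow> ('m \<Rightarrow> 'n) monoid"
  where
  "hom_group R M N =
     \<lparr>carrier = left_hom R M N \<inter> extensional (carrier M),
      mult = (\<lambda>f g. \<lambda>x\<in>carrier M. f x \<oplus>\<^bsub>N\<^esub> g x),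
      one = (\<lambda>x\<in>carrier M. \<zero>\<^bsub>N\<^esub>)\<rparr>"

text \<open>The left \<open>R\<close>-module \<open>Hom\<^sub>S(K, I)\<close> for an \<open>(S, R)\<close>-bimodule \<open>K\<close>.\<close>

definition hom_module ::
  "('s, 'e) ring_scheme \<Rightarrow> ('s, 'r, 'k, 'x) bimodule_scheme \<Rightarrow> ('s, 'i, 'y) module_scheme
     \<Rightarrow> ('r, 'k \<Rightarrow> 'i) module" where
  "hom_module S K I =
     \<lparr>carrier = carrier (hom_group S K I), mult = undefined, one = undefined,
      ring.zero = monoid.one (hom_group S K I), add = monoid.mult (hom_group S K I),
      smult = (\<lambda>r f. \<lambda>x\<in>carrier K. f (rsmult K x r))\<rparr>"

definition Ext ::
  "('r, 'e) ring_scheme \<Rightarrow> nat \<Rightarrow> ('r, 'u, 'x) module_scheme \<Rightarrow> ('r, 'm, 'y) module_scheme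
     \<Rightarrow> ((('r, 'u) gen \<Rightarrow> 'r) \<Rightarrow> 'm) set monoid" where
  "Ext R i U M =
     (let C = (\<lambda>j. hom_group R (std_res R U j) M);
          D = (\<lambda>j \<phi>. compose (carrier (std_res R U (Suc j))) \<phi> (std_diff R));
          Z = kernel (C i) (C (Suc i)) (D i);
          B = (case i of 0 \<Rightarrow> {\<one>\<^bsub>C 0\<^esub>} | Suc j \<Rightarrow> D j ` carrier (C j))
      in (C i)\<lparr>carrier := Z\<rparr> Mod B)"


section \<open>Tensor products and Tor\<close>

text \<open>
  For a right \<open>R\<close>-module \<open>A\<close>, given as a left module over the opposite ring, and a left
  \<open>R\<close>-module \<open>N\<close>: the free abelian group on pairs modulo the bilinear, \<open>R\<close>-balanced relations.
\<close>

definition tensor_rel ::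
  "('r, 'e) ring_scheme \<Rightarrow> ('r, 'a, 'x) module_scheme \<Rightarrow> ('r, 'n, 'y) module_scheme
     \<Rightarrow> ('a \<times> 'n \<Rightarrow>\<^sub>0 int) set" where
  "tensor_rel R A N = generate (free_Abelian_group (carrier A \<times> carrier N))
     ({frag_of (a \<oplus>\<^bsub>A\<^esub> a', x) - frag_of (a, x) - frag_of (a', x) | a a' x.
         a \<in> carrier A \<and> a' \<in> carrier A \<and> x \<in> carrier N} \<union>
      {frag_of (a, x \<oplus>\<^bsub>N\<^esub> x') - frag_of (a, x) - frag_of (a, x') | a x x'.
         a \<in> carrier A \<and> x \<in> carrier N \<and> x' \<in> carrier N} \<union>
      {frag_of (r \<odot>\<^bsub>A\<^esub> a, x) - frag_of (a, r \<odot>\<^bsub>N\<^esub> x) | r a x.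
         r \<in> carrier R \<and> a \<in> carrier A \<and> x \<in> carrier N})"

definition tensor_group ::
  "('r, 'e) ring_scheme \<Rightarrow> ('r, 'a, 'x) module_scheme \<Rightarrow> ('r, 'n, 'y) module_scheme
     \<Rightarrow> ('a \<times> 'n \<Rightarrow>\<^sub>0 int) set monoid" where
  "tensor_group R A N = free_Abelian_group (carrier A \<times> carrier N) Mod tensor_rel R A N"

text \<open>
  The map \<open>f \<otimes> N\<close> on cosets, for a homomorphism \<open>f\<close> from some right module to \<open>A\<close>.
  All members of the union coincide.
\<close>

definition tensor_map ::
  "('r, 'e) ring_scheme \<Rightarrow> ('r, 'a, 'x) module_scheme \<Rightarrow> ('r, 'n, 'y) module_scheme \<Rightarrow> ('b \<Rightarrow> 'a)
     \<Rightarrow> ('b \<times> 'n \<Rightarrow>\<^sub>0 int) set \<Rightarrow> ('a \<times> 'n \<Rightarrow>\<^sub>0 int) set" where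
  "tensor_map R A N f X =
     (\<Union>c\<in>X. tensor_rel R A N #>\<^bsub>free_Abelian_group (carrier A \<times> carrier N)\<^esub>
        frag_extend (\<lambda>(b, x). frag_of (f b, x)) c)"

text \<open>The left \<open>S\<close>-module \<open>K \<otimes>\<^sub>R N\<close> for an \<open>(S, R)\<close>-bimodule \<open>K\<close>.\<close>

definition tensor_module ::
  "('r, 'e) ring_scheme \<Rightarrow> ('s, 'r, 'k, 'x) bimodule_scheme \<Rightarrow> ('r, 'n, 'y) module_scheme
     \<Rightarrow> ('s, ('k \<times> 'n \<Rightarrow>\<^sub>0 int) set) module" where
  "tensor_module R K N =
     \<lparr>carrier = carrier (tensor_group R (right_part K) N), mult = undefined, one = undefined,
      ring.zero = monoid.one (tensor_group R (right_part K) N),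
      add = monoid.mult (tensor_group R (right_part K) N),
      smult = (\<lambda>s. tensor_map R (right_part K) N (\<lambda>x. s \<odot>\<^bsub>K\<^esub> x))\<rparr>"

text \<open>Here \<open>U\<close> is a right \<open>R\<close>-module, resolved over the opposite ring.\<close>

definition Tor ::
  "('r, 'e) ring_scheme \<Rightarrow> nat \<Rightarrow> ('r, 'u, 'x) module_scheme \<Rightarrow> ('r, 'n, 'y) module_scheme
     \<Rightarrow> ((('r, 'u) gen \<Rightarrow> 'r) \<times> 'n \<Rightarrow>\<^sub>0 int) set set monoid" where
  "Tor R i U N =
     (let F = std_res (op_ring R) U;
          C = (\<lambda>j. tensor_group R (F j) N);
          D = (\<lambda>j. tensor_map R (F j) N (std_diff (op_ring R)));
          Z = (case i of 0 \<Rightarrow> carrier (C 0) | Suc j \<Rightarrow> kernel (C (Suc j)) (C j) (D j));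
          B = D i ` carrier (C (Suc i))
      in (C i)\<lparr>carrier := Z\<rparr> Mod B)"


section \<open>\<open>(n, d)\<close>-injective and \<open>(n, d)\<close>-flat modules\<close>

text \<open>
  Every finitely \<open>n\<close>-presented module is finitely generated, hence isomorphic to a quotient of some
  \<open>R\<^sup>k\<close>, whose elements are cosets. So the type of \<open>U\<close> below covers all of them up to isomorphism.
\<close>

definition nd_injective ::
  "('r, 'e) ring_scheme \<Rightarrow> enat \<Rightarrow> nat \<Rightarrow> ('r, 'm, 'x) module_scheme \<Rightarrow> bool" where
  "nd_injective R n d M \<longleftrightarrow> left_module R M \<and>
     (\<forall>U :: ('r, (nat \<Rightarrow> 'r) set) module.
        finitely_presented R n U \<longrightarrow> trivial_group (Ext R (d + 1) U M))"

definition nd_flat ::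
  "('r, 'e) ring_scheme \<Rightarrow> enat \<Rightarrow> nat \<Rightarrow> ('r, 'm, 'x) module_scheme \<Rightarrow> bool" where
  "nd_flat R n d N \<longleftrightarrow> left_module R N \<and>
     (\<forall>U :: ('r, (nat \<Rightarrow> 'r) set) module.
        finitely_presented (op_ring R) n U \<longrightarrow> trivial_group (Tor R (d + 1) U N))"


section \<open>Special semidualizing bimodules\<close>

text \<open>
  The homothety maps are automatically compatible with multiplication and with the
  bimodule structures, so being an isomorphism is a statement about additive groups.
\<close>

definition semidualizing ::
  "('s, 'e) ring_scheme \<Rightarrow> ('r, 'e') ring_scheme \<Rightarrow> ('s, 'r, 'k, 'x) bimodule_scheme \<Rightarrow> bool" where
  "semidualizing S R K \<longleftrightarrow> is_bimodule S R K \<and>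
     has_fg_projective_resolution S K \<and>
     has_fg_projective_resolution (op_ring R) (right_part K) \<and>
     (\<lambda>s. \<lambda>x\<in>carrier K. s \<odot>\<^bsub>K\<^esub> x)
       \<in> iso (add_monoid S) (hom_group (op_ring R) (right_part K) (right_part K)) \<and>
     (\<lambda>r. \<lambda>x\<in>carrier K. rsmult K x r) \<in> iso (add_monoid R) (hom_group S K K) \<and>
     (\<forall>i\<ge>1. trivial_group (Ext S i K K) \<and>
            trivial_group (Ext (op_ring R) i (right_part K) (right_part K)))"

text \<open>
  A map of bimodules is a map that is linear on both sides, so a bimodule resolution is
  one that is exact over \<open>S\<close> and over the opposite of \<open>R\<close>.
\<close>

definition super_fp_resolution ::
  "('s, 'e) ring_scheme \<Rightarrow> ('r, 'e') ring_scheme \<Rightarrow> (nat \<Rightarrow> ('s, 'r, 'f) bimodule)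
     \<Rightarrow> (nat \<Rightarrow> 'f \<Rightarrow> 'f) \<Rightarrow> ('f \<Rightarrow> 'c) \<Rightarrow> ('s, 'r, 'c) bimodule \<Rightarrow> bool" where
  "super_fp_resolution S R F \<delta> \<epsilon> C \<longleftrightarrow>
     is_bimodule S R C \<and> (\<forall>i. is_bimodule S R (F i)) \<and>
     exact_resolution S \<infinity> F \<delta> \<epsilon> C \<and>
     exact_resolution (op_ring R) \<infinity> (\<lambda>i. right_part (F i)) \<delta> \<epsilon> (right_part C) \<and>
     (\<forall>i. fg_free S (F i) \<and> fg_free (op_ring R) (right_part (F i)))"

text \<open>\<open>K\<close> is the syzygy \<open>Ker (F (d - 1) \<rightarrow> F (d - 2))\<close>, so it lives in the same type as the \<open>F i\<close>.\<close>

definition special_semidualizing ::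
  "('s, 'e) ring_scheme \<Rightarrow> ('r, 'e') ring_scheme \<Rightarrow> nat \<Rightarrow> ('s, 'r, 'c) bimodule
     \<Rightarrow> ('s, 'r, 'k) bimodule \<Rightarrow> bool" where
  "special_semidualizing S R d C K \<longleftrightarrow>
     (\<exists>F \<delta> \<epsilon>. super_fp_resolution S R F \<delta> \<epsilon> C \<and>
        K = (F (d - 1))\<lparr>carrier := syzygy F \<delta> \<epsilon> C (d - 1)\<rparr>) \<and>
     semidualizing S R K"

text \<open>
  The classes \<open>\<I>\<^sub>K\<^sup>(\<^sup>n\<^sup>,\<^sup>d\<^sup>)(R)\<close> and \<open>\<F>\<^sub>K\<^sup>(\<^sup>n\<^sup>,\<^sup>d\<^sup>)(S)\<close>. The first argument fixes the type
  of the elements of the module \<open>I\<close>, respectively \<open>F\<close>, over which HOL cannot quantify existentially;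
  the paper's classes are the unions over all such types.
\<close>

definition I_class ::
  "'i itself \<Rightarrow> ('s, 'e) ring_scheme \<Rightarrow> ('r, 'e') ring_scheme \<Rightarrow> enat \<Rightarrow> nat
     \<Rightarrow> ('s, 'r, 'k) bimodule \<Rightarrow> ('r, 'm) module set" where
  "I_class _ S R n d K =
     {M. left_module R M \<and>
        (\<exists>I :: ('s, 'i) module. nd_injective S n d I \<and> module_iso R M (hom_module S K I))}"

definition F_class ::
  "'f itself \<Rightarrow> ('s, 'e) ring_scheme \<Rightarrow> ('r, 'e') ring_scheme \<Rightarrow> enat \<Rightarrow> nat
     \<Rightarrow> ('s, 'r, 'k) bimodule \<Rightarrow> ('s, 'm) module set" where
  "F_class _ S R n d K =
     {M. left_module S M \<and>
        (\<exists>F :: ('r, 'f) module. nd_flat R n d F \<and> module_iso S M (tensor_module R K F))}"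

end

theory Submission
  imports Defs
begin

text \<open>
  Let \<open>K = K\<^sub>d\<^sub>-\<^sub>1\<close>, the \<open>d\<close>-th syzygy of \<open>C\<close>. Dimension shifting along the resolution of \<open>C\<close> gives
  \<open>Ext\<^sup>i(K, I) = 0\<close> for \<open>i \<ge> 1\<close> and every \<open>(n, d)\<close>-injective \<open>I\<close>. Dualizing a free resolution of \<open>K\<close> over
  the opposite of \<open>R\<close> into \<open>K\<close> gives, because \<open>K\<close> is semidualizing, an exact sequence of \<open>S\<close>-modules
  \<open>0 \<rightarrow> S \<rightarrow> X\<^sub>0 \<rightarrow> X\<^sub>1 \<rightarrow> \<dots>\<close> whose terms \<open>X\<^sub>i\<close> are finite powers of \<open>K\<close>. By mapping cones its modules of
  cocycles \<open>Z\<^sub>i\<close> (with \<open>Z\<^sub>0 = S\<close>) are super finitely presented, so that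
  \<open>Ext\<^sup>1(Z\<^sub>i, I) = Ext\<^sup>d\<^sup>+\<^sup>1(Z\<^sub>i\<^sub>+\<^sub>d, I) = 0\<close>: homomorphisms \<open>Z\<^sub>i \<rightarrow> I\<close> extend to \<open>X\<^sub>i\<close>.

  Hence every element of \<open>I\<close> is the image of \<open>1 \<in> S\<close> under a homomorphism \<open>X\<^sub>0 \<rightarrow> I\<close>, that is, under a tuple of
  elements of \<open>Hom\<^sub>S(K, I)\<close>, and a tuple killing \<open>1\<close> factors through \<open>X\<^sub>1\<close>. So a decomposition
  \<open>Hom\<^sub>S(K, I) = A \<oplus> B\<close> comes from a decomposition \<open>I = I\<^sub>A \<oplus> I\<^sub>B\<close> with \<open>Hom\<^sub>S(K, I\<^sub>A) = A\<close>, and the retract \<open>I\<^sub>A\<close> of \<open>I\<close>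
  is again \<open>(n, d)\<close>-injective. For flat modules, with the two sides of \<open>K\<close> exchanged, the same
  argument for Tor shows that \<open>Z\<^sub>i \<otimes> F \<rightarrow> X\<^sub>i \<otimes> F\<close> is injective, so \<open>F \<rightarrow> Hom\<^sub>S(K, K \<otimes> F)\<close> is bijective and a
  decomposition \<open>K \<otimes> F = A \<oplus> B\<close> comes from the submodules \<open>{y. \<forall>k. k \<otimes> y \<in> A}\<close> and \<open>{y. \<forall>k. k \<otimes> y \<in> B}\<close>.
\<close>

section \<open>Modules over noncommutative rings\<close>

text \<open>\<open>I_class\<close> and \<open>F_class\<close> fix the element type of the witness,
  so a summand \<open>A\<close> of \<open>Hom(K, I)\<close> cannot be answered by
  \<open>K \<otimes> A\<close>, which lives in a new type. The witness has to be a submodule of the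
  given \<open>I\<close> or \<open>F\<close> that is cut out by \<open>A\<close>. The evaluation map
  from \<open>K \<otimes> Hom(K, I)\<close> to \<open>I\<close> is therefore expressed through
  tuples: its surjectivity becomes the extension of homomorphisms from \<open>Z 0\<close>, its
  injectivity the extension from \<open>Z 1\<close>. Types shape the homological part as well.
  \<open>Ext\<close> and \<open>Tor\<close> come from one functorial resolution and are tested on
  modules of one element type. Vanishing is first moved to arbitrary projective resolutions by chain
  homotopies, in the elementwise forms \<open>ext_van\<close> and \<open>tor_van\<close>; two facts
  about mapping cones, one for degree 0 and one for positive degrees, replace the long exact
  sequences. The shift from \<open>Z i\<close> to \<open>Z (i + d)\<close> works because powers of
  \<open>K\<close> are acyclic, so that in \<open>0 -> Z i -> X i -> Z (i + 1) -> 0\<close> the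
  index and the degree may be raised together.\<close>

lemma (in abelian_group) eq_of_diff_eq_zero:
  "\<lbrakk>x \<in> carrier G; y \<in> carrier G; x \<ominus> y = \<zero>\<rbrakk> \<Longrightarrow> x = y"
  by (metis a_inv_closed minus_equality minus_minus a_minus_def)

lemma (in abelian_group) add_diff_cancel_left:
  "\<lbrakk>x \<in> carrier G; y \<in> carrier G\<rbrakk> \<Longrightarrow> (x \<oplus> y) \<ominus> x = y"
  by (metis a_closed a_comm a_inv_closed a_minus_def r_neg1)

lemma (in abelian_group) diff_eq_diff:
  assumes c: "a \<in> carrier G" "b \<in> carrier G" "a' \<in> carrier G" "b' \<in> carrier G" and eq: "a \<oplus> b = a' \<oplus> b'"
  shows "a \<ominus> a' = b' \<ominus> b"
proof -
  have "b' = \<ominus> a' \<oplus> (a \<oplus> b)" using c by (simp add: eq r_neg1)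
  also have "\<dots> = b \<oplus> (a \<ominus> a')" using c by (simp add: a_minus_def a_ac)
  finally show ?thesis using c by (simp add: add_diff_cancel_left)
qed

lemma (in comm_group) idempotent_eq_one: "\<lbrakk>x \<in> carrier G; x \<otimes> x = x\<rbrakk> \<Longrightarrow> x = \<one>"
  by simp

lemma preimage_ex: "f ` A = B \<Longrightarrow> y \<in> B \<Longrightarrow> \<exists>x\<in>A. f x = y"
  by auto

context left_module
begin

lemma smult_l_null [simp]: "x \<in> carrier M \<Longrightarrow> \<zero> \<odot>\<^bsub>M\<^esub> x = \<zero>\<^bsub>M\<^esub>"
proof -
  assume x: "x \<in> carrier M"
  have "\<zero> \<odot>\<^bsub>M\<^esub> x \<oplus>\<^bsub>M\<^esub> \<zero> \<odot>\<^bsub>M\<^esub> x = (\<zero> \<oplus> \<zero>) \<odot>\<^bsub>M\<^esub> x"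
    using x by (simp only: smult_l_distr R.zero_closed)
  also have "\<dots> = \<zero> \<odot>\<^bsub>M\<^esub> x" by simp
  finally show ?thesis using x by (simp add: M.add.l_cancel_one)
qed

lemma smult_r_null [simp]: "r \<in> carrier R \<Longrightarrow> r \<odot>\<^bsub>M\<^esub> \<zero>\<^bsub>M\<^esub> = \<zero>\<^bsub>M\<^esub>"
proof -
  assume r: "r \<in> carrier R"
  have "r \<odot>\<^bsub>M\<^esub> \<zero>\<^bsub>M\<^esub> \<oplus>\<^bsub>M\<^esub> r \<odot>\<^bsub>M\<^esub> \<zero>\<^bsub>M\<^esub> = r \<odot>\<^bsub>M\<^esub> (\<zero>\<^bsub>M\<^esub> \<oplus>\<^bsub>M\<^esub> \<zero>\<^bsub>M\<^esub>)"
    using r by (simp only: smult_r_distr M.zero_closed)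
  also have "\<dots> = r \<odot>\<^bsub>M\<^esub> \<zero>\<^bsub>M\<^esub>" by simp
  finally show ?thesis using r by (simp add: M.add.l_cancel_one)
qed

lemma smult_l_minus: "\<lbrakk>r \<in> carrier R; x \<in> carrier M\<rbrakk> \<Longrightarrow> (\<ominus> r) \<odot>\<^bsub>M\<^esub> x = \<ominus>\<^bsub>M\<^esub> (r \<odot>\<^bsub>M\<^esub> x)"
  by (rule M.minus_equality[symmetric])
    (simp_all add: smult_l_distr[symmetric] R.l_neg)

lemma smult_r_minus: "\<lbrakk>r \<in> carrier R; x \<in> carrier M\<rbrakk> \<Longrightarrow> r \<odot>\<^bsub>M\<^esub> (\<ominus>\<^bsub>M\<^esub> x) = \<ominus>\<^bsub>M\<^esub> (r \<odot>\<^bsub>M\<^esub> x)"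
  by (rule M.minus_equality[symmetric])
    (simp_all add: smult_r_distr[symmetric] M.l_neg)

lemma finsum_smult:
  "\<lbrakk>r \<in> carrier R; f \<in> A \<rightarrow> carrier M\<rbrakk> \<Longrightarrow>
    r \<odot>\<^bsub>M\<^esub> (\<Oplus>\<^bsub>M\<^esub>i\<in>A. f i) = (\<Oplus>\<^bsub>M\<^esub>i\<in>A. r \<odot>\<^bsub>M\<^esub> f i)"
  by (induction A rule: infinite_finite_induct) (auto simp: smult_r_distr Pi_iff)

lemma minus_eq_zero_iff:
  "\<lbrakk>x \<in> carrier M; y \<in> carrier M\<rbrakk> \<Longrightarrow> x \<ominus>\<^bsub>M\<^esub> y = \<zero>\<^bsub>M\<^esub> \<longleftrightarrow> x = y"
  by (metis M.a_inv_closed M.minus_equality M.minus_minus a_minus_def M.r_neg)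

lemma add_minus_cancel:
  "\<lbrakk>x \<in> carrier M; y \<in> carrier M\<rbrakk> \<Longrightarrow> y \<oplus>\<^bsub>M\<^esub> (x \<ominus>\<^bsub>M\<^esub> y) = x"
  by (metis M.a_comm M.a_inv_closed M.a_assoc a_minus_def M.l_neg M.r_zero)

end

lemma (in left_module) neg_zero [simp]: "\<ominus>\<^bsub>M\<^esub> \<zero>\<^bsub>M\<^esub> = \<zero>\<^bsub>M\<^esub>"
  by (rule M.minus_equality) simp_all

lemma left_moduleI:
  assumes "ring R"
    and "\<And>x y. \<lbrakk>x \<in> carrier M; y \<in> carrier M\<rbrakk> \<Longrightarrow> x \<oplus>\<^bsub>M\<^esub> y \<in> carrier M"
    and "\<zero>\<^bsub>M\<^esub> \<in> carrier M"
    and "\<And>x y z. \<lbrakk>x \<in> carrier M; y \<in> carrier M; z \<in> carrier M\<rbrakk> \<Longrightarrow>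
        (x \<oplus>\<^bsub>M\<^esub> y) \<oplus>\<^bsub>M\<^esub> z = x \<oplus>\<^bsub>M\<^esub> (y \<oplus>\<^bsub>M\<^esub> z)"
    and "\<And>x y. \<lbrakk>x \<in> carrier M; y \<in> carrier M\<rbrakk> \<Longrightarrow> x \<oplus>\<^bsub>M\<^esub> y = y \<oplus>\<^bsub>M\<^esub> x"
    and "\<And>x. x \<in> carrier M \<Longrightarrow> \<zero>\<^bsub>M\<^esub> \<oplus>\<^bsub>M\<^esub> x = x"
    and "\<And>x. x \<in> carrier M \<Longrightarrow> \<exists>y \<in> carrier M. y \<oplus>\<^bsub>M\<^esub> x = \<zero>\<^bsub>M\<^esub>"
    and "\<And>a x. \<lbrakk>a \<in> carrier R; x \<in> carrier M\<rbrakk> \<Longrightarrow> a \<odot>\<^bsub>M\<^esub> x \<in> carrier M"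
    and "\<And>a b x. \<lbrakk>a \<in> carrier R; b \<in> carrier R; x \<in> carrier M\<rbrakk> \<Longrightarrow>
        (a \<oplus>\<^bsub>R\<^esub> b) \<odot>\<^bsub>M\<^esub> x = a \<odot>\<^bsub>M\<^esub> x \<oplus>\<^bsub>M\<^esub> b \<odot>\<^bsub>M\<^esub> x"
    and "\<And>a x y. \<lbrakk>a \<in> carrier R; x \<in> carrier M; y \<in> carrier M\<rbrakk> \<Longrightarrow>
        a \<odot>\<^bsub>M\<^esub> (x \<oplus>\<^bsub>M\<^esub> y) = a \<odot>\<^bsub>M\<^esub> x \<oplus>\<^bsub>M\<^esub> a \<odot>\<^bsub>M\<^esub> y"
    and "\<And>a b x. \<lbrakk>a \<in> carrier R; b \<in> carrier R; x \<in> carrier M\<rbrakk> \<Longrightarrow>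
        (a \<otimes>\<^bsub>R\<^esub> b) \<odot>\<^bsub>M\<^esub> x = a \<odot>\<^bsub>M\<^esub> (b \<odot>\<^bsub>M\<^esub> x)"
    and "\<And>x. x \<in> carrier M \<Longrightarrow> \<one>\<^bsub>R\<^esub> \<odot>\<^bsub>M\<^esub> x = x"
  shows "left_module R M"
  by (intro left_module.intro left_module_axioms.intro abelian_groupI) (use assms in auto)

lemma left_module_ring: "left_module R M \<Longrightarrow> ring R"
  by (simp add: left_module_def)

lemma submodule:
  assumes "left_module R M" and sub: "A \<subseteq> carrier M" "\<zero>\<^bsub>M\<^esub> \<in> A"
    and add: "\<And>x y. \<lbrakk>x \<in> A; y \<in> A\<rbrakk> \<Longrightarrow> x \<oplus>\<^bsub>M\<^esub> y \<in> A"
    and smult: "\<And>r x. \<lbrakk>r \<in> carrier R; x \<in> A\<rbrakk> \<Longrightarrow> r \<odot>\<^bsub>M\<^esub> x \<in> A"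
  shows "left_module R (M\<lparr>carrier := A\<rparr>)"
proof -
  interpret left_module R M by fact
  \<comment> \<open>Negatives come from the scalar \<open>- 1\<close>, so closure under addition and
    scalars suffices.\<close>
  have "\<exists>y\<in>A. y \<oplus>\<^bsub>M\<^esub> x = \<zero>\<^bsub>M\<^esub>" if x: "x \<in> A" for x
  proof (rule bexI)
    show "(\<ominus>\<^bsub>R\<^esub> \<one>\<^bsub>R\<^esub>) \<odot>\<^bsub>M\<^esub> x \<in> A" using x by (simp add: smult)
    have "x \<in> carrier M" using x sub by auto
    then show "(\<ominus>\<^bsub>R\<^esub> \<one>\<^bsub>R\<^esub>) \<odot>\<^bsub>M\<^esub> x \<oplus>\<^bsub>M\<^esub> x = \<zero>\<^bsub>M\<^esub>"
      by (simp add: smult_l_minus M.l_neg)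
  qed
  then show ?thesis
    by (intro left_moduleI)
      (use sub in \<open>auto simp: add smult subset_iff M.a_ac smult_l_distr smult_r_distr
        smult_assoc1 left_module_ring[OF assms(1)]\<close>)
qed

section \<open>Homomorphisms of left modules\<close>

lemma left_homI:
  assumes "\<And>x. x \<in> carrier M \<Longrightarrow> f x \<in> carrier N"
    and "\<And>x y. \<lbrakk>x \<in> carrier M; y \<in> carrier M\<rbrakk> \<Longrightarrow> f (x \<oplus>\<^bsub>M\<^esub> y) = f x \<oplus>\<^bsub>N\<^esub> f y"
    and "\<And>r x. \<lbrakk>r \<in> carrier R; x \<in> carrier M\<rbrakk> \<Longrightarrow> f (r \<odot>\<^bsub>M\<^esub> x) = r \<odot>\<^bsub>N\<^esub> f x"
  shows "f \<in> left_hom R M N"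
  using assms by (auto simp: left_hom_def)

lemma left_hom_closed: "\<lbrakk>f \<in> left_hom R M N; x \<in> carrier M\<rbrakk> \<Longrightarrow> f x \<in> carrier N"
  and left_hom_add: "\<lbrakk>f \<in> left_hom R M N; x \<in> carrier M; y \<in> carrier M\<rbrakk> \<Longrightarrow>
    f (x \<oplus>\<^bsub>M\<^esub> y) = f x \<oplus>\<^bsub>N\<^esub> f y"
  and left_hom_smult: "\<lbrakk>f \<in> left_hom R M N; r \<in> carrier R; x \<in> carrier M\<rbrakk> \<Longrightarrow>
    f (r \<odot>\<^bsub>M\<^esub> x) = r \<odot>\<^bsub>N\<^esub> f x"
  by (auto simp: left_hom_def)

lemma left_hom_zero:
  assumes "f \<in> left_hom R M N" "left_module R M" "left_module R N"
  shows "f \<zero>\<^bsub>M\<^esub> = \<zero>\<^bsub>N\<^esub>"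
proof -
  interpret M: left_module R M by fact
  interpret N: left_module R N by fact
  have "f (\<zero>\<^bsub>R\<^esub> \<odot>\<^bsub>M\<^esub> \<zero>\<^bsub>M\<^esub>) = \<zero>\<^bsub>R\<^esub> \<odot>\<^bsub>N\<^esub> f \<zero>\<^bsub>M\<^esub>"
    by (rule left_hom_smult[OF assms(1)]) simp_all
  with assms(1) show ?thesis by (simp add: left_hom_closed)
qed

lemma left_hom_neg:
  assumes "f \<in> left_hom R M N" "left_module R M" "left_module R N" "x \<in> carrier M"
  shows "f (\<ominus>\<^bsub>M\<^esub> x) = \<ominus>\<^bsub>N\<^esub> f x"
proof -
  interpret M: left_module R M by fact
  interpret N: left_module R N by fact
  have "f (\<ominus>\<^bsub>M\<^esub> x) \<oplus>\<^bsub>N\<^esub> f x = f (\<ominus>\<^bsub>M\<^esub> x \<oplus>\<^bsub>M\<^esub> x)"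
    using assms by (simp add: left_hom_add)
  also have "\<dots> = \<zero>\<^bsub>N\<^esub>" using assms by (simp add: M.M.l_neg left_hom_zero)
  finally show ?thesis using assms by (intro N.M.minus_equality[symmetric]) (auto simp: left_hom_closed)
qed

lemma left_hom_diff:
  assumes "f \<in> left_hom R M N" "left_module R M" "left_module R N" "x \<in> carrier M" "y \<in> carrier M"
  shows "f (x \<ominus>\<^bsub>M\<^esub> y) = f x \<ominus>\<^bsub>N\<^esub> f y"
proof -
  interpret M: left_module R M by fact
  show ?thesis using assms by (simp add: a_minus_def left_hom_add left_hom_neg)
qed

lemma left_hom_finsum:
  assumes "f \<in> left_hom R M N" "left_module R M" "left_module R N" "g \<in> A \<rightarrow> carrier M"
  shows "f (\<Oplus>\<^bsub>M\<^esub>i\<in>A. g i) = (\<Oplus>\<^bsub>N\<^esub>i\<in>A. f (g i))"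
proof -
  interpret M: left_module R M by fact
  interpret N: left_module R N by fact
  show ?thesis
    using assms(4) by (induction A rule: infinite_finite_induct)
      (auto simp: left_hom_zero[OF assms(1-3)] left_hom_add[OF assms(1)] left_hom_closed[OF assms(1)]
        Pi_iff)
qed

lemma left_hom_id: "(\<lambda>x. x) \<in> left_hom R M M"
  by (auto intro: left_homI)

lemma left_hom_compose:
  "\<lbrakk>f \<in> left_hom R M N; g \<in> left_hom R N P\<rbrakk> \<Longrightarrow> (\<lambda>x. g (f x)) \<in> left_hom R M P"
  by (intro left_homI) (auto simp: left_hom_closed left_hom_add left_hom_smult)

lemma left_hom_const_zero:
  assumes "left_module R N"
  shows "(\<lambda>x. \<zero>\<^bsub>N\<^esub>) \<in> left_hom R M N"
proof -
  interpret N: left_module R N by fact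
  show ?thesis by (auto intro: left_homI)
qed

lemma left_hom_plus:
  assumes "left_module R N" "f \<in> left_hom R M N" "g \<in> left_hom R M N"
  shows "(\<lambda>x. f x \<oplus>\<^bsub>N\<^esub> g x) \<in> left_hom R M N"
proof -
  interpret N: left_module R N by fact
  show ?thesis
    using assms
    by (intro left_homI) (simp_all add: left_hom_closed left_hom_add left_hom_smult N.smult_r_distr N.M.a_ac)
qed

lemma left_hom_uminus:
  assumes "left_module R N" "f \<in> left_hom R M N"
  shows "(\<lambda>x. \<ominus>\<^bsub>N\<^esub> f x) \<in> left_hom R M N"
proof -
  interpret N: left_module R N by fact
  show ?thesis
    using assms
    by (intro left_homI) (simp_all add: left_hom_closed left_hom_add left_hom_smult N.smult_r_minus N.M.minus_add)
qed

lemma left_hom_minus: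
  assumes "left_module R N" "f \<in> left_hom R M N" "g \<in> left_hom R M N"
  shows "(\<lambda>x. f x \<ominus>\<^bsub>N\<^esub> g x) \<in> left_hom R M N"
  unfolding a_minus_def by (intro left_hom_plus left_hom_uminus assms)

lemma left_hom_cong:
  assumes "left_module R M" "f \<in> left_hom R M N" "\<And>x. x \<in> carrier M \<Longrightarrow> g x = f x"
  shows "g \<in> left_hom R M N"
proof -
  interpret M: left_module R M by fact
  show ?thesis
    using assms by (intro left_homI) (simp_all add: left_hom_closed left_hom_add left_hom_smult)
qed

text \<open>Two decompositions of one element differ by something in \<open>A\<close> and in
  \<open>B\<close>, hence by zero. So the \<open>A\<close>-part is unique, and uniqueness makes it
  linear. In this form the splittings of \<open>I\<close> and \<open>F\<close> feed the lemmas on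
  retracts.\<close>

lemma internal_sum_projection:
  assumes M: "left_module R M" and A: "A \<subseteq> carrier M" and B: "B \<subseteq> carrier M"
    and A0: "\<zero>\<^bsub>M\<^esub> \<in> A" and B0: "\<zero>\<^bsub>M\<^esub> \<in> B"
    and Aadd: "\<And>x y. \<lbrakk>x \<in> A; y \<in> A\<rbrakk> \<Longrightarrow> x \<oplus>\<^bsub>M\<^esub> y \<in> A" and Badd: "\<And>x y. \<lbrakk>x \<in> B; y \<in> B\<rbrakk> \<Longrightarrow> x \<oplus>\<^bsub>M\<^esub> y \<in> B"
    and Asmult: "\<And>r x. \<lbrakk>r \<in> carrier R; x \<in> A\<rbrakk> \<Longrightarrow> r \<odot>\<^bsub>M\<^esub> x \<in> A"
    and Bsmult: "\<And>r x. \<lbrakk>r \<in> carrier R; x \<in> B\<rbrakk> \<Longrightarrow> r \<odot>\<^bsub>M\<^esub> x \<in> B"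
    and sum: "\<And>x. x \<in> carrier M \<Longrightarrow> \<exists>a\<in>A. \<exists>b\<in>B. x = a \<oplus>\<^bsub>M\<^esub> b"
    and disjoint: "\<And>x. \<lbrakk>x \<in> A; x \<in> B\<rbrakk> \<Longrightarrow> x = \<zero>\<^bsub>M\<^esub>"
  shows "\<exists>p\<in>left_hom R M (M\<lparr>carrier := A\<rparr>). \<forall>x\<in>A. p x = x"
proof -
  interpret M: left_module R M by fact
  have "\<forall>x\<in>carrier M. \<exists>a. a \<in> A \<and> (\<exists>b\<in>B. x = a \<oplus>\<^bsub>M\<^esub> b)" using sum by blast
  from bchoice[OF this] obtain p where p: "\<And>x. x \<in> carrier M \<Longrightarrow> p x \<in> A"
    "\<And>x. x \<in> carrier M \<Longrightarrow> \<exists>b\<in>B. x = p x \<oplus>\<^bsub>M\<^esub> b" by blast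
  have cA: "x \<in> carrier M" if "x \<in> A" for x using that A by blast
  have cB: "x \<in> carrier M" if "x \<in> B" for x using that B by blast
  have unique: "a = a'" if ab: "a \<in> A" "a' \<in> A" "b \<in> B" "b' \<in> B" "a \<oplus>\<^bsub>M\<^esub> b = a' \<oplus>\<^bsub>M\<^esub> b'" for a a' b b'
  proof -
    note c = cA[OF ab(1)] cA[OF ab(2)] cB[OF ab(3)] cB[OF ab(4)]
    have neg: "\<ominus>\<^bsub>M\<^esub> x = (\<ominus>\<^bsub>R\<^esub> \<one>\<^bsub>R\<^esub>) \<odot>\<^bsub>M\<^esub> x" if "x \<in> carrier M" for x
      using that by (simp add: M.smult_l_minus)
    have "a \<ominus>\<^bsub>M\<^esub> a' = b' \<ominus>\<^bsub>M\<^esub> b"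
      by (rule M.M.diff_eq_diff[OF c(1,3,2,4) ab(5)])
    moreover have "a \<ominus>\<^bsub>M\<^esub> a' \<in> A"
      unfolding a_minus_def using ab c by (simp add: neg Aadd Asmult del: M.smult_l_minus)
    moreover have "b' \<ominus>\<^bsub>M\<^esub> b \<in> B"
      unfolding a_minus_def using ab c by (simp add: neg Badd Bsmult)
    ultimately have "a \<ominus>\<^bsub>M\<^esub> a' = \<zero>\<^bsub>M\<^esub>" using disjoint by simp
    then show ?thesis using c by (simp add: M.minus_eq_zero_iff)
  qed
  have "p \<in> left_hom R M (M\<lparr>carrier := A\<rparr>)"
  proof (rule left_homI)
    fix x y assume xy: "x \<in> carrier M" "y \<in> carrier M"
    obtain b where b: "b \<in> B" "x = p x \<oplus>\<^bsub>M\<^esub> b" using p(2)[OF xy(1)] by blast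
    obtain c where c: "c \<in> B" "y = p y \<oplus>\<^bsub>M\<^esub> c" using p(2)[OF xy(2)] by blast
    obtain e where e: "e \<in> B" "x \<oplus>\<^bsub>M\<^esub> y = p (x \<oplus>\<^bsub>M\<^esub> y) \<oplus>\<^bsub>M\<^esub> e" using p(2)[of "x \<oplus>\<^bsub>M\<^esub> y"] xy by blast
    have "(p x \<oplus>\<^bsub>M\<^esub> b) \<oplus>\<^bsub>M\<^esub> (p y \<oplus>\<^bsub>M\<^esub> c) = (p x \<oplus>\<^bsub>M\<^esub> p y) \<oplus>\<^bsub>M\<^esub> (b \<oplus>\<^bsub>M\<^esub> c)"
      using cA[OF p(1)[OF xy(1)]] cA[OF p(1)[OF xy(2)]] cB[OF b(1)] cB[OF c(1)] by (simp add: M.M.a_ac)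
    then have "p (x \<oplus>\<^bsub>M\<^esub> y) \<oplus>\<^bsub>M\<^esub> e = (p x \<oplus>\<^bsub>M\<^esub> p y) \<oplus>\<^bsub>M\<^esub> (b \<oplus>\<^bsub>M\<^esub> c)"
      using b(2) c(2) e(2) by simp
    then show "p (x \<oplus>\<^bsub>M\<^esub> y) = p x \<oplus>\<^bsub>M\<lparr>carrier := A\<rparr>\<^esub> p y"
      using unique[OF p(1) Aadd[OF p(1) p(1)] e(1) Badd[OF b(1) c(1)]] xy by simp
  next
    fix r x assume rx: "r \<in> carrier R" "x \<in> carrier M"
    obtain b where b: "b \<in> B" "x = p x \<oplus>\<^bsub>M\<^esub> b" using p(2)[OF rx(2)] by blast
    obtain e where e: "e \<in> B" "r \<odot>\<^bsub>M\<^esub> x = p (r \<odot>\<^bsub>M\<^esub> x) \<oplus>\<^bsub>M\<^esub> e" using p(2)[of "r \<odot>\<^bsub>M\<^esub> x"] rx by blast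
    have "r \<odot>\<^bsub>M\<^esub> (p x \<oplus>\<^bsub>M\<^esub> b) = r \<odot>\<^bsub>M\<^esub> p x \<oplus>\<^bsub>M\<^esub> r \<odot>\<^bsub>M\<^esub> b"
      using cA[OF p(1)[OF rx(2)]] cB[OF b(1)] rx by (simp add: M.smult_r_distr)
    then have "p (r \<odot>\<^bsub>M\<^esub> x) \<oplus>\<^bsub>M\<^esub> e = r \<odot>\<^bsub>M\<^esub> p x \<oplus>\<^bsub>M\<^esub> r \<odot>\<^bsub>M\<^esub> b"
      using b(2) e(2) by simp
    then show "p (r \<odot>\<^bsub>M\<^esub> x) = r \<odot>\<^bsub>M\<lparr>carrier := A\<rparr>\<^esub> p x"
      using unique[OF p(1) Asmult[OF rx(1) p(1)] e(1) Bsmult[OF rx(1) b(1)]] rx by simp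
  qed (simp add: p(1))
  moreover have "p x = x" if x: "x \<in> A" for x
  proof -
    obtain b where b: "b \<in> B" "x = p x \<oplus>\<^bsub>M\<^esub> b" using p(2)[OF cA[OF x]] by blast
    from unique[OF x p(1)[OF cA[OF x]] B0 b(1)] b(2) cA[OF x] show ?thesis by simp
  qed
  ultimately show ?thesis by blast
qed

lemma left_hom_inv_into:
  assumes "left_module R M" "f \<in> left_hom R M N" "bij_betw f (carrier M) (carrier N)"
  shows "inv_into (carrier M) f \<in> left_hom R N M"
proof -
  interpret M: left_module R M by fact
  let ?g = "inv_into (carrier M) f"
  have g: "?g y \<in> carrier M" "f (?g y) = y" if "y \<in> carrier N" for y
    using assms(3) that by (auto simp: bij_betw_def inv_into_into f_inv_into_f)
  have inj: "x = y" if "f x = f y" "x \<in> carrier M" "y \<in> carrier M" for x y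
    using assms(3) that by (auto simp: bij_betw_def inj_on_def)
  have surj: "f ` carrier M = carrier N" using assms(3) by (simp add: bij_betw_def)
  show ?thesis
  proof (intro left_homI)
    fix x y assume xy: "x \<in> carrier N" "y \<in> carrier N"
    \<comment> \<open>Only \<open>M\<close> is known to be a module here; closure of
      \<open>carrier N\<close> is pulled back through the bijection \<open>f\<close>.\<close>
    then have "x \<oplus>\<^bsub>N\<^esub> y \<in> carrier N"
      using g[of x] g[of y] left_hom_add[OF assms(2), of "?g x" "?g y"] left_hom_closed[OF assms(2)]
      by (metis M.M.a_closed)
    with xy show "?g (x \<oplus>\<^bsub>N\<^esub> y) = ?g x \<oplus>\<^bsub>M\<^esub> ?g y"
      by (intro inj) (simp_all add: g left_hom_add[OF assms(2)])
  next
    fix r x assume rx: "r \<in> carrier R" "x \<in> carrier N"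
    then have "r \<odot>\<^bsub>N\<^esub> x \<in> carrier N"
      using g[of x] left_hom_smult[OF assms(2), of r "?g x"] left_hom_closed[OF assms(2)]
      by (metis M.smult_closed)
    with rx show "?g (r \<odot>\<^bsub>N\<^esub> x) = r \<odot>\<^bsub>M\<^esub> ?g x"
      by (intro inj) (simp_all add: g left_hom_smult[OF assms(2)])
  qed (use g in auto)
qed

lemma module_iso_sym:
  assumes "left_module R M" "module_iso R M N"
  shows "module_iso R N M"
  using assms left_hom_inv_into bij_betw_inv_into unfolding module_iso_def by blast

lemma module_iso_trans:
  "\<lbrakk>module_iso R M N; module_iso R N P\<rbrakk> \<Longrightarrow> module_iso R M P"
  unfolding module_iso_def
proof (elim bexE)
  fix f g assume "f \<in> left_hom R M N" "g \<in> left_hom R N P"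
    "bij_betw f (carrier M) (carrier N)" "bij_betw g (carrier N) (carrier P)"
  then show "\<exists>f\<in>left_hom R M P. bij_betw f (carrier M) (carrier P)"
    using left_hom_compose[of f R M N g P] bij_betw_trans[of f "carrier M" "carrier N" g "carrier P"]
    by (auto simp: o_def intro!: bexI[where x = "\<lambda>x. g (f x)"])
qed

section \<open>Direct sums and opposite rings\<close>

lemma direct_sum_simps [simp]:
  "carrier (direct_sum M N) = carrier M \<times> carrier N"
  "\<zero>\<^bsub>direct_sum M N\<^esub> = (\<zero>\<^bsub>M\<^esub>, \<zero>\<^bsub>N\<^esub>)"
  "(x, y) \<oplus>\<^bsub>direct_sum M N\<^esub> (x', y') = (x \<oplus>\<^bsub>M\<^esub> x', y \<oplus>\<^bsub>N\<^esub> y')"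
  "r \<odot>\<^bsub>direct_sum M N\<^esub> (x, y) = (r \<odot>\<^bsub>M\<^esub> x, r \<odot>\<^bsub>N\<^esub> y)"
  by (simp_all add: direct_sum_def)

lemma left_module_direct_sum:
  assumes "left_module R M" "left_module R N"
  shows "left_module R (direct_sum M N)"
proof -
  interpret M: left_module R M by fact
  interpret N: left_module R N by fact
  have "\<exists>y\<in>carrier (direct_sum M N). y \<oplus>\<^bsub>direct_sum M N\<^esub> x = \<zero>\<^bsub>direct_sum M N\<^esub>"
    if "x \<in> carrier (direct_sum M N)" for x
    using that by (intro bexI[where x = "(\<ominus>\<^bsub>M\<^esub> fst x, \<ominus>\<^bsub>N\<^esub> snd x)"]) (auto simp: M.M.l_neg N.M.l_neg)
  then show ?thesis
    by (intro left_moduleI)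
      (auto simp: M.M.a_ac N.M.a_ac M.smult_l_distr N.smult_l_distr
        M.smult_r_distr N.smult_r_distr M.smult_assoc1 N.smult_assoc1 left_module_ring[OF assms(1)])
qed

lemma direct_sum_fst: "fst \<in> left_hom R (direct_sum M N) M"
  and direct_sum_snd: "snd \<in> left_hom R (direct_sum M N) N"
  by (auto intro!: left_homI)

lemma direct_sum_inl: "left_module R N \<Longrightarrow> (\<lambda>x. (x, \<zero>\<^bsub>N\<^esub>)) \<in> left_hom R M (direct_sum M N)"
  and direct_sum_inr: "left_module R M \<Longrightarrow> (\<lambda>y. (\<zero>\<^bsub>M\<^esub>, y)) \<in> left_hom R N (direct_sum M N)"
proof -
  assume "left_module R N"
  then interpret N: left_module R N .
  show "(\<lambda>x. (x, \<zero>\<^bsub>N\<^esub>)) \<in> left_hom R M (direct_sum M N)" by (auto intro!: left_homI)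
next
  assume "left_module R M"
  then interpret M: left_module R M .
  show "(\<lambda>y. (\<zero>\<^bsub>M\<^esub>, y)) \<in> left_hom R N (direct_sum M N)" by (auto intro!: left_homI)
qed

lemma left_hom_pair:
  "\<lbrakk>f \<in> left_hom R M N; g \<in> left_hom R M P\<rbrakk> \<Longrightarrow> (\<lambda>x. (f x, g x)) \<in> left_hom R M (direct_sum N P)"
  by (intro left_homI) (auto simp: left_hom_closed left_hom_add left_hom_smult)

lemma op_ring_simps [simp]:
  "carrier (op_ring R) = carrier R" "x \<otimes>\<^bsub>op_ring R\<^esub> y = y \<otimes>\<^bsub>R\<^esub> x" "\<one>\<^bsub>op_ring R\<^esub> = \<one>\<^bsub>R\<^esub>"
  "\<zero>\<^bsub>op_ring R\<^esub> = \<zero>\<^bsub>R\<^esub>" "ring.add (op_ring R) = ring.add R"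
  by (simp_all add: op_ring_def)

lemma op_op_ring [simp]: "op_ring (op_ring R) = R"
  by (simp add: op_ring_def)

section \<open>Free and projective modules\<close>

definition unit_vec :: "('r, 'e) ring_scheme \<Rightarrow> 'b \<Rightarrow> 'b \<Rightarrow> 'r" where
  "unit_vec R b = (\<lambda>x. if x = b then \<one>\<^bsub>R\<^esub> else \<zero>\<^bsub>R\<^esub>)"

lemma free_module_simps [simp]:
  "\<zero>\<^bsub>free_module R B\<^esub> = (\<lambda>_. \<zero>\<^bsub>R\<^esub>)"
  "f \<oplus>\<^bsub>free_module R B\<^esub> g = (\<lambda>b. f b \<oplus>\<^bsub>R\<^esub> g b)"
  "r \<odot>\<^bsub>free_module R B\<^esub> f = (\<lambda>b. r \<otimes>\<^bsub>R\<^esub> f b)"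
  by (simp_all add: free_module_def)

lemma free_module_carrier:
  "f \<in> carrier (free_module R B) \<longleftrightarrow>
    (\<forall>b. f b \<in> carrier R) \<and> finite {b. f b \<noteq> \<zero>\<^bsub>R\<^esub>} \<and> (\<forall>b. b \<notin> B \<longrightarrow> f b = \<zero>\<^bsub>R\<^esub>)"
  by (auto simp: free_module_def)

lemma left_module_free:
  fixes R :: "('r, 'e) ring_scheme" (structure)
  assumes "ring R"
  shows "left_module R (free_module R B)"
proof -
  interpret ring R by fact
  have fin: "finite {b. f b \<oplus> g b \<noteq> \<zero>}"
    if "finite {b. f b \<noteq> \<zero>}" "finite {b. g b \<noteq> \<zero>}" for f g :: "'b \<Rightarrow> 'r"
    by (rule finite_subset[OF _ finite_UnI[OF that]]) auto
  have fin': "finite {b. r \<otimes> f b \<noteq> \<zero>}"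
    if "finite {b. f b \<noteq> \<zero>}" "r \<in> carrier R" for f :: "'b \<Rightarrow> 'r" and r
    by (rule finite_subset[OF _ that(1)]) (use that(2) in auto)
  have neg: "\<exists>g\<in>carrier (free_module R B). g \<oplus>\<^bsub>free_module R B\<^esub> f = \<zero>\<^bsub>free_module R B\<^esub>"
    if "f \<in> carrier (free_module R B)" for f
  proof (rule bexI[where x = "\<lambda>b. (\<ominus> \<one>) \<otimes> f b"])
    show "(\<lambda>b. (\<ominus> \<one>) \<otimes> f b) \<in> carrier (free_module R B)"
      using that by (auto simp: free_module_carrier fin')
    show "(\<lambda>b. \<ominus> \<one> \<otimes> f b) \<oplus>\<^bsub>free_module R B\<^esub> f = \<zero>\<^bsub>free_module R B\<^esub>"
      using that by (auto simp: free_module_carrier l_minus l_neg)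
  qed
  show ?thesis
    by (intro left_moduleI assms neg)
      (auto simp: free_module_carrier fin fin' a_ac l_distr r_distr m_assoc)
qed

lemma unit_vec_closed:
  assumes "ring R" "b \<in> B"
  shows "unit_vec R b \<in> carrier (free_module R B)"
proof -
  interpret ring R by fact
  show ?thesis
    using assms(2) by (auto simp: free_module_carrier unit_vec_def intro: finite_subset[of _ "{b}"])
qed

text \<open>Erasing one coordinate of \<open>f\<close> splits off a multiple of a
  \<open>unit_vec\<close>, and after finitely many erasures nothing is left.\<close>

lemma free_module_induct [consumes 2, case_names zero add]:
  fixes R :: "('r, 'e) ring_scheme" (structure)
  assumes "ring R" "f \<in> carrier (free_module R B)"
    and zero: "P (\<lambda>_. \<zero>\<^bsub>R\<^esub>)"
    and add: "\<And>f r b. \<lbrakk>f \<in> carrier (free_module R B); r \<in> carrier R; b \<in> B; P f\<rbrakk> \<Longrightarrow>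
        P (r \<odot>\<^bsub>free_module R B\<^esub> unit_vec R b \<oplus>\<^bsub>free_module R B\<^esub> f)"
  shows "P f"
proof -
  interpret ring R by fact
  \<comment> \<open>Bounding the support by \<open>A\<close>, instead of fixing it, lets the case
    \<open>f a = \<zero>\<close> pass straight to the induction hypothesis.\<close>
  have "\<forall>f\<in>carrier (free_module R B). {b. f b \<noteq> \<zero>} \<subseteq> A \<longrightarrow> P f" if "finite A" for A
    using that
  proof (induction A)
    case empty
    have "f = (\<lambda>_. \<zero>)" if "{b. f b \<noteq> \<zero>} \<subseteq> {}" for f :: "'b \<Rightarrow> 'r" using that by auto
    then show ?case using zero by blast
  next
    case (insert a A)
    show ?case
    proof (intro ballI impI)
      fix f assume f: "f \<in> carrier (free_module R B)" "{b. f b \<noteq> \<zero>} \<subseteq> insert a A"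
      show "P f"
      proof (cases "f a = \<zero>")
        case True
        then show ?thesis using insert.IH f by auto
      next
        case False
        let ?f = "f(a := \<zero>)"
        have "{b. ?f b \<noteq> \<zero>} \<subseteq> {b. f b \<noteq> \<zero>}" by auto
        then have f': "?f \<in> carrier (free_module R B)"
          using f(1) by (auto simp: free_module_carrier intro: finite_subset)
        have a: "a \<in> B" "f a \<in> carrier R" using f(1) False by (auto simp: free_module_carrier)
        have "{b. ?f b \<noteq> \<zero>} \<subseteq> A" using f(2) by auto
        with insert.IH f' have "P ?f" by blast
        moreover have "f = f a \<odot>\<^bsub>free_module R B\<^esub> unit_vec R a \<oplus>\<^bsub>free_module R B\<^esub> ?f"
          using f(1) by (auto simp: free_module_carrier unit_vec_def fun_eq_iff)
        ultimately show ?thesis using add[OF f' a(2,1)] by simp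
      qed
    qed
  qed
  with assms(2) show ?thesis by (auto simp: free_module_carrier)
qed

text \<open>Finite combinations reduce everything to the basis. Identities between maps built with
  \<open>linear_ext\<close> are checked on basis vectors through this lemma.\<close>

lemma free_hom_eq:
  assumes "left_module R M" "f \<in> left_hom R (free_module R B) M" "g \<in> left_hom R (free_module R B) M"
    and "\<And>b. b \<in> B \<Longrightarrow> f (unit_vec R b) = g (unit_vec R b)"
    and "x \<in> carrier (free_module R B)"
  shows "f x = g x"
  using left_module_ring[OF assms(1)] assms(5)
proof (induction x rule: free_module_induct)
  case zero
  have free: "left_module R (free_module R B)"
    by (intro left_module_free left_module_ring[OF assms(1)])
  show ?case
    using left_hom_zero[OF assms(2) free assms(1)] left_hom_zero[OF assms(3) free assms(1)] by simp
next
  case (add x r b)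
  interpret F: left_module R "free_module R B"
    by (intro left_module_free left_module_ring[OF assms(1)])
  have b: "unit_vec R b \<in> carrier (free_module R B)"
    using add by (intro unit_vec_closed left_module_ring[OF assms(1)])
  show ?case
    using add assms(4)[of b] b
    by (simp only: left_hom_add[OF assms(2)] left_hom_add[OF assms(3)]
        left_hom_smult[OF assms(2)] left_hom_smult[OF assms(3)] F.smult_closed)
qed

text \<open>\<open>linear_ext\<close> sums over the exact support, which changes under addition and
  scaling. Padding with zero terms puts several elements over one common finite index set.\<close>

lemma linear_ext_superset:
  assumes "left_module R M" "f \<in> carrier (free_module R B)" "h \<in> B \<rightarrow> carrier M"
    and "finite A" "{b. f b \<noteq> \<zero>\<^bsub>R\<^esub>} \<subseteq> A" "A \<subseteq> B"
  shows "linear_ext R M h f = (\<Oplus>\<^bsub>M\<^esub>b\<in>A. f b \<odot>\<^bsub>M\<^esub> h b)"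
proof -
  interpret left_module R M by fact
  show ?thesis
    unfolding linear_ext_def
    by (rule M.add.finprod_mono_neutral_cong_left) (use assms in \<open>auto simp: free_module_carrier Pi_iff subset_iff\<close>)
qed

lemma linear_ext_hom:
  assumes "left_module R M" "h \<in> B \<rightarrow> carrier M"
  shows "linear_ext R M h \<in> left_hom R (free_module R B) M"
proof -
  interpret left_module R M by fact
  interpret F: left_module R "free_module R B"
    by (intro left_module_free left_module_ring[OF assms(1)])
  note ext = linear_ext_superset[OF assms(1) _ assms(2)]
  have h: "f b \<odot>\<^bsub>M\<^esub> h b \<in> carrier M" if "f \<in> carrier (free_module R B)" "b \<in> B" for f b
    using that assms(2) by (auto simp: free_module_carrier)
  show ?thesis
  proof (rule left_homI)
    fix f assume f: "f \<in> carrier (free_module R B)"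
    then show "linear_ext R M h f \<in> carrier M"
      unfolding linear_ext_def using h by (intro M.finsum_closed) (auto simp: free_module_carrier)
  next
    fix f g assume f: "f \<in> carrier (free_module R B)" and g: "g \<in> carrier (free_module R B)"
    let ?A = "{b. f b \<noteq> \<zero>\<^bsub>R\<^esub>} \<union> {b. g b \<noteq> \<zero>\<^bsub>R\<^esub>}"
    have A: "finite ?A" "?A \<subseteq> B" using f g by (auto simp: free_module_carrier)
    have "linear_ext R M h (f \<oplus>\<^bsub>free_module R B\<^esub> g)
        = (\<Oplus>\<^bsub>M\<^esub>b\<in>?A. (f b \<oplus>\<^bsub>R\<^esub> g b) \<odot>\<^bsub>M\<^esub> h b)"
      by (subst ext[OF F.M.a_closed[OF f g] A(1) _ A(2)]) (auto)
    also have "\<dots> = (\<Oplus>\<^bsub>M\<^esub>b\<in>?A. f b \<odot>\<^bsub>M\<^esub> h b \<oplus>\<^bsub>M\<^esub> g b \<odot>\<^bsub>M\<^esub> h b)"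
      by (intro M.finsum_cong') (use A f g h assms(2) in \<open>auto simp: free_module_carrier Pi_iff subset_iff smult_l_distr\<close>)
    also have "\<dots> = linear_ext R M h f \<oplus>\<^bsub>M\<^esub> linear_ext R M h g"
      using A h[OF f] h[OF g]
      by (subst M.finsum_addf) (auto simp: ext[OF f A(1) _ A(2)] ext[OF g A(1) _ A(2)])
    finally show "linear_ext R M h (f \<oplus>\<^bsub>free_module R B\<^esub> g) = linear_ext R M h f \<oplus>\<^bsub>M\<^esub> linear_ext R M h g" .
  next
    fix r f assume r: "r \<in> carrier R" and f: "f \<in> carrier (free_module R B)"
    let ?A = "{b. f b \<noteq> \<zero>\<^bsub>R\<^esub>}"
    have A: "finite ?A" "?A \<subseteq> B" using f by (auto simp: free_module_carrier)
    have "linear_ext R M h (r \<odot>\<^bsub>free_module R B\<^esub> f) = (\<Oplus>\<^bsub>M\<^esub>b\<in>?A. (r \<otimes>\<^bsub>R\<^esub> f b) \<odot>\<^bsub>M\<^esub> h b)"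
      by (subst ext[OF F.smult_closed[OF r f] A(1) _ A(2)]) (use r in auto)
    also have "\<dots> = (\<Oplus>\<^bsub>M\<^esub>b\<in>?A. r \<odot>\<^bsub>M\<^esub> (f b \<odot>\<^bsub>M\<^esub> h b))"
      by (intro M.finsum_cong') (use A r f h assms(2) in \<open>auto simp: free_module_carrier Pi_iff subset_iff smult_assoc1\<close>)
    also have "\<dots> = r \<odot>\<^bsub>M\<^esub> linear_ext R M h f"
      using A h[OF f] r
      by (subst finsum_smult[OF r, symmetric]) (auto simp: ext[OF f A(1) _ A(2)])
    finally show "linear_ext R M h (r \<odot>\<^bsub>free_module R B\<^esub> f) = r \<odot>\<^bsub>M\<^esub> linear_ext R M h f" .
  qed
qed

lemma linear_ext_unit_vec:
  assumes "left_module R M" "h \<in> B \<rightarrow> carrier M" "b \<in> B"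
  shows "linear_ext R M h (unit_vec R b) = h b"
proof -
  interpret left_module R M by fact
  have "linear_ext R M h (unit_vec R b) = (\<Oplus>\<^bsub>M\<^esub>b'\<in>{b}. unit_vec R b b' \<odot>\<^bsub>M\<^esub> h b')"
    by (rule linear_ext_superset[OF assms(1) unit_vec_closed assms(2)])
      (use assms in \<open>auto simp: unit_vec_def left_module_ring\<close>)
  also have "\<dots> = h b"
    using assms funcset_mem[OF assms(2,3)] by (subst M.finsum_insert) (auto simp: unit_vec_def)
  finally show ?thesis .
qed

text \<open>A submodule containing the images of the basis contains all their combinations. This
  keeps \<open>std_diff\<close>, which is computed in the free module on all generators, inside the
  module on the right ones.\<close>

lemma linear_ext_closed_under:
  assumes "left_module R M" "f \<in> carrier (free_module R B)"
    and "A \<subseteq> carrier M" "\<zero>\<^bsub>M\<^esub> \<in> A" "\<And>x y. \<lbrakk>x \<in> A; y \<in> A\<rbrakk> \<Longrightarrow> x \<oplus>\<^bsub>M\<^esub> y \<in> A"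
    and "\<And>r x. \<lbrakk>r \<in> carrier R; x \<in> A\<rbrakk> \<Longrightarrow> r \<odot>\<^bsub>M\<^esub> x \<in> A"
    and "\<And>b. b \<in> B \<Longrightarrow> h b \<in> A"
  shows "linear_ext R M h f \<in> A"
proof -
  have h: "h \<in> B \<rightarrow> carrier M" using assms(3,7) by auto
  note ext = linear_ext_hom[OF assms(1) h]
  interpret F: left_module R "free_module R B"
    by (intro left_module_free left_module_ring[OF assms(1)])
  show ?thesis
    using left_module_ring[OF assms(1)] assms(2)
  proof (induction f rule: free_module_induct)
    case zero
    show ?case using left_hom_zero[OF ext F.left_module_axioms assms(1)] assms(4) by simp
  next
    case (add f r b)
    then have b: "unit_vec R b \<in> carrier (free_module R B)"
      by (intro unit_vec_closed left_module_ring[OF assms(1)])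
    show ?case
      using add b by (simp only: left_hom_add[OF ext] left_hom_smult[OF ext] F.smult_closed
          linear_ext_unit_vec[OF assms(1) h] assms(5-7))
  qed
qed

text \<open>Projectivity is tested on the canonical presentation of \<open>P\<close> by its own elements, so that
  the definition does not quantify over types.\<close>

definition projective :: "('r, 'e) ring_scheme \<Rightarrow> ('r, 'm, 'x) module_scheme \<Rightarrow> bool" where
  "projective R P \<longleftrightarrow> left_module R P \<and>
     (\<exists>s\<in>left_hom R P (free_module R (carrier P)).
        \<forall>x\<in>carrier P. linear_ext R P (\<lambda>x. x) (s x) = x)"

text \<open>Choose preimages under \<open>g\<close> of the values of \<open>f\<close> at all
  elements of \<open>P\<close>, extend them linearly to the free module on these elements, and
  precompose with the section. Only the image of \<open>f\<close> has to lie in the image of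
  \<open>g\<close>, so \<open>g\<close> may be a differential.\<close>

lemma projective_lift:
  assumes "projective R P" "left_module R X" "left_module R Y"
    and f: "f \<in> left_hom R P Y" and g: "g \<in> left_hom R X Y"
    and sub: "\<And>x. x \<in> carrier P \<Longrightarrow> f x \<in> g ` carrier X"
  shows "\<exists>h\<in>left_hom R P X. \<forall>x\<in>carrier P. g (h x) = f x"
proof -
  have P: "left_module R P" using assms(1) by (simp add: projective_def)
  obtain s where s: "s \<in> left_hom R P (free_module R (carrier P))"
    and s': "\<And>x. x \<in> carrier P \<Longrightarrow> linear_ext R P (\<lambda>x. x) (s x) = x"
    using assms(1) by (auto simp: projective_def)
  have "\<forall>x\<in>carrier P. \<exists>y. y \<in> carrier X \<and> g y = f x" using sub by force
  then obtain h where h: "\<And>x. x \<in> carrier P \<Longrightarrow> h x \<in> carrier X \<and> g (h x) = f x"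
    by (elim bchoice[elim_format] exE) blast
  have hX: "h \<in> carrier P \<rightarrow> carrier X" using h by auto
  note ext = linear_ext_hom[OF assms(2) hX]
  have id: "(\<lambda>x. x) \<in> carrier P \<rightarrow> carrier P" by auto
  have eq: "g (linear_ext R X h y) = f (linear_ext R P (\<lambda>x. x) y)"
    if "y \<in> carrier (free_module R (carrier P))" for y
    by (rule free_hom_eq[OF assms(3) left_hom_compose[OF ext g]
          left_hom_compose[OF linear_ext_hom[OF P id] f] _ that])
      (simp add: linear_ext_unit_vec[OF assms(2) hX] linear_ext_unit_vec[OF P id] h)
  show ?thesis
    using left_hom_compose[OF s ext] eq s' left_hom_closed[OF s]
    by (intro bexI[where x = "\<lambda>x. linear_ext R X h (s x)"]) auto
qed

text \<open>The section sends the basis vector of \<open>b\<close> to the basis vector indexed by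
  that very element; evaluating it gives the identity on the basis.\<close>

lemma projective_free:
  assumes "ring R"
  shows "projective R (free_module R B)"
proof -
  let ?F = "free_module R B"
  note F = left_module_free[OF assms, of B]
  note F' = left_module_free[OF assms, of "carrier ?F"]
  have u: "(\<lambda>b. unit_vec R (unit_vec R b)) \<in> B \<rightarrow> carrier (free_module R (carrier ?F))"
    by (intro funcsetI unit_vec_closed[OF assms])
  have id: "(\<lambda>x. x) \<in> carrier ?F \<rightarrow> carrier ?F" by auto
  have "linear_ext R ?F (\<lambda>x. x) (linear_ext R (free_module R (carrier ?F)) (\<lambda>b. unit_vec R (unit_vec R b)) x) = x"
    if "x \<in> carrier ?F" for x
    by (rule free_hom_eq[OF F left_hom_compose[OF linear_ext_hom[OF F' u] linear_ext_hom[OF F id]] left_hom_id _ that])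
      (simp add: linear_ext_unit_vec[OF F' u] linear_ext_unit_vec[OF F id] unit_vec_closed[OF assms])
  with F linear_ext_hom[OF F' u] show ?thesis by (auto simp: projective_def)
qed

text \<open>Lift \<open>p\<close> through the canonical presentation of \<open>Q\<close>. The lift
  after \<open>i\<close> is a section because \<open>p\<close> after \<open>i\<close> is the
  identity.\<close>

lemma projective_retract:
  assumes "projective R P" "left_module R Q"
    and i: "i \<in> left_hom R Q P" and p: "p \<in> left_hom R P Q" and pi: "\<And>x. x \<in> carrier Q \<Longrightarrow> p (i x) = x"
  shows "projective R Q"
proof -
  have P: "left_module R P" using assms(1) by (simp add: projective_def)
  note F = left_module_free[OF left_module_ring[OF P], of "carrier Q"]
  have id: "(\<lambda>x. x) \<in> carrier Q \<rightarrow> carrier Q" by auto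
  note ext = linear_ext_hom[OF assms(2) id]
  have "\<exists>h\<in>left_hom R P (free_module R (carrier Q)). \<forall>x\<in>carrier P. linear_ext R Q (\<lambda>x. x) (h x) = p x"
  proof (rule projective_lift[OF assms(1) F assms(2) p ext])
    fix x assume "x \<in> carrier P"
    then have "p x \<in> carrier Q" using p by (rule left_hom_closed[rotated])
    then show "p x \<in> linear_ext R Q (\<lambda>x. x) ` carrier (free_module R (carrier Q))"
      using linear_ext_unit_vec[OF assms(2) id] unit_vec_closed[OF left_module_ring[OF P]]
      by (metis imageI)
  qed
  then obtain h where h: "h \<in> left_hom R P (free_module R (carrier Q))"
    "\<And>x. x \<in> carrier P \<Longrightarrow> linear_ext R Q (\<lambda>x. x) (h x) = p x" by auto
  show ?thesis
    using assms(2) left_hom_compose[OF i h(1)] h(2)[OF left_hom_closed[OF i]] pi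
    by (auto simp: projective_def intro!: bexI[where x = "\<lambda>x. h (i x)"])
qed

lemma fg_free_projective:
  assumes "fg_free R P"
  shows "projective R P"
proof -
  obtain k f where P: "left_module R P" and f: "f \<in> left_hom R P (free_module R {..<k::nat})"
    and b: "bij_betw f (carrier P) (carrier (free_module R {..<k}))"
    using assms by (auto simp: fg_free_def module_iso_def)
  show ?thesis
    by (rule projective_retract[OF projective_free[OF left_module_ring[OF P]] P f left_hom_inv_into[OF P f b]])
      (use b in \<open>simp add: bij_betw_def\<close>)
qed

text \<open>Only exactness is fixed here. Projectivity and freeness of the terms stay separate
  hypotheses, since transported, shifted and cone resolutions are first shown exact and get their
  freeness elsewhere.\<close>

locale resolution =
  fixes R :: "('r, 'e) ring_scheme" and P :: "nat \<Rightarrow> ('r, 'p, 'x) module_scheme"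
    and \<delta> :: "nat \<Rightarrow> 'p \<Rightarrow> 'p" and \<epsilon> :: "'p \<Rightarrow> 'u" and U :: "('r, 'u, 'y) module_scheme"
  assumes exact: "exact_resolution R \<infinity> P \<delta> \<epsilon> U"
begin

lemma target: "left_module R U"
  and modules: "left_module R (P i)"
  and aug: "\<epsilon> \<in> left_hom R (P 0) U"
  and aug_surj: "\<epsilon> ` carrier (P 0) = carrier U"
  and diff: "\<delta> i \<in> left_hom R (P (Suc i)) (P i)"
  and diff_image: "\<delta> i ` carrier (P (Suc i)) = syzygy P \<delta> \<epsilon> U i"
  using exact by (auto simp: exact_resolution_def)

lemma aug_diff: "x \<in> carrier (P (Suc 0)) \<Longrightarrow> \<epsilon> (\<delta> 0 x) = \<zero>\<^bsub>U\<^esub>"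
  and diff_diff: "x \<in> carrier (P (Suc (Suc i))) \<Longrightarrow> \<delta> i (\<delta> (Suc i) x) = \<zero>\<^bsub>P i\<^esub>"
  using diff_image[of 0] diff_image[of "Suc i"] by (auto simp: syzygy_def kernel_def)

lemma exact_0: "\<lbrakk>x \<in> carrier (P 0); \<epsilon> x = \<zero>\<^bsub>U\<^esub>\<rbrakk> \<Longrightarrow> \<exists>y\<in>carrier (P (Suc 0)). \<delta> 0 y = x"
  and exact_Suc: "\<lbrakk>x \<in> carrier (P (Suc i)); \<delta> i x = \<zero>\<^bsub>P i\<^esub>\<rbrakk> \<Longrightarrow>
    \<exists>y\<in>carrier (P (Suc (Suc i))). \<delta> (Suc i) y = x"
proof -
  assume "x \<in> carrier (P 0)" "\<epsilon> x = \<zero>\<^bsub>U\<^esub>"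
  then have "x \<in> \<delta> 0 ` carrier (P (Suc 0))" unfolding diff_image by (auto simp: syzygy_def kernel_def)
  then show "\<exists>y\<in>carrier (P (Suc 0)). \<delta> 0 y = x" by auto
next
  assume "x \<in> carrier (P (Suc i))" "\<delta> i x = \<zero>\<^bsub>P i\<^esub>"
  then have "x \<in> \<delta> (Suc i) ` carrier (P (Suc (Suc i)))" unfolding diff_image by (auto simp: syzygy_def kernel_def)
  then show "\<exists>y\<in>carrier (P (Suc (Suc i))). \<delta> (Suc i) y = x" by auto
qed

lemma syzygy_subset: "syzygy P \<delta> \<epsilon> U i \<subseteq> carrier (P i)"
  by (auto simp: syzygy_def kernel_def split: nat.split)

end

lemma resolutionI:
  assumes "left_module R U" "\<And>i. left_module R (P i)"
    and "\<epsilon> \<in> left_hom R (P 0) U" "\<And>u. u \<in> carrier U \<Longrightarrow> \<exists>x\<in>carrier (P 0). \<epsilon> x = u"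
    and "\<And>i. \<delta> i \<in> left_hom R (P (Suc i)) (P i)"
    and "\<And>x. x \<in> carrier (P (Suc 0)) \<Longrightarrow> \<epsilon> (\<delta> 0 x) = \<zero>\<^bsub>U\<^esub>"
    and "\<And>i x. x \<in> carrier (P (Suc (Suc i))) \<Longrightarrow> \<delta> i (\<delta> (Suc i) x) = \<zero>\<^bsub>P i\<^esub>"
    and "\<And>x. \<lbrakk>x \<in> carrier (P 0); \<epsilon> x = \<zero>\<^bsub>U\<^esub>\<rbrakk> \<Longrightarrow> \<exists>y\<in>carrier (P (Suc 0)). \<delta> 0 y = x"
    and "\<And>i x. \<lbrakk>x \<in> carrier (P (Suc i)); \<delta> i x = \<zero>\<^bsub>P i\<^esub>\<rbrakk> \<Longrightarrow>
      \<exists>y\<in>carrier (P (Suc (Suc i))). \<delta> (Suc i) y = x"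
  shows "resolution R P \<delta> \<epsilon> U"
proof
  have "\<delta> i ` carrier (P (Suc i)) = syzygy P \<delta> \<epsilon> U i" for i
  proof (cases i)
    case 0
    then show ?thesis
      using assms(6,8) left_hom_closed[OF assms(5)]
      by (auto simp: syzygy_def kernel_def image_iff; metis)
  next
    case (Suc j)
    then show ?thesis
      using assms(7,9) left_hom_closed[OF assms(5)]
      by (auto simp: syzygy_def kernel_def image_iff; metis)
  qed
  moreover have "\<epsilon> ` carrier (P 0) = carrier U"
    using assms(4) left_hom_closed[OF assms(3)] by (auto simp: image_iff; metis)
  ultimately show "exact_resolution R \<infinity> P \<delta> \<epsilon> U"
    using assms(1,2,3,5) by (simp add: exact_resolution_def)
qed

section \<open>Comparison of projective resolutions\<close>

text \<open>Projectivity of \<open>P i\<close> provides each \<open>f i\<close>; the next lift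
  exists because \<open>f i\<close> carries boundaries of \<open>P\<close> to boundaries of
  \<open>Q\<close>.\<close>

lemma lift_chain_map:
  assumes "resolution R P \<delta> \<epsilon> U" "resolution R Q \<delta>' \<eta> V" "\<And>i. projective R (P i)"
    and u: "u \<in> left_hom R U V"
  shows "\<exists>f. (\<forall>i. f i \<in> left_hom R (P i) (Q i)) \<and>
    (\<forall>x\<in>carrier (P 0). \<eta> (f 0 x) = u (\<epsilon> x)) \<and>
    (\<forall>i. \<forall>x\<in>carrier (P (Suc i)). f i (\<delta> i x) = \<delta>' i (f (Suc i) x))"
proof -
  interpret P: resolution R P \<delta> \<epsilon> U by fact
  interpret Q: resolution R Q \<delta>' \<eta> V by fact
  \<comment> \<open>The invariant is exactly what the next lift needs: the image of
    \<open>\<delta> i\<close> goes into the image of \<open>\<delta>' i\<close>. Commutation with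
    the differentials is the link between consecutive choices.\<close>
  let ?K = "\<lambda>i f. f \<in> left_hom R (P i) (Q i) \<and> (i = 0 \<longrightarrow> (\<forall>x\<in>carrier (P 0). \<eta> (f x) = u (\<epsilon> x)))
    \<and> (\<forall>x\<in>carrier (P (Suc i)). f (\<delta> i x) \<in> \<delta>' i ` carrier (Q (Suc i)))"
  have "\<exists>f. \<forall>i. ?K i (f i) \<and> (\<forall>x\<in>carrier (P (Suc i)). f i (\<delta> i x) = \<delta>' i (f (Suc i) x))"
  proof (rule dependent_nat_choice)
    have "\<exists>f\<in>left_hom R (P 0) (Q 0). \<forall>x\<in>carrier (P 0). \<eta> (f x) = u (\<epsilon> x)"
    proof (rule projective_lift[OF assms(3) Q.modules Q.target left_hom_compose[OF P.aug u] Q.aug])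
      show "u (\<epsilon> x) \<in> \<eta> ` carrier (Q 0)" if "x \<in> carrier (P 0)" for x
        using that by (simp add: Q.aug_surj left_hom_closed[OF u] left_hom_closed[OF P.aug])
    qed
    then obtain f where f: "f \<in> left_hom R (P 0) (Q 0)" "\<And>x. x \<in> carrier (P 0) \<Longrightarrow> \<eta> (f x) = u (\<epsilon> x)"
      by auto
    have "f (\<delta> 0 x) \<in> \<delta>' 0 ` carrier (Q (Suc 0))" if x: "x \<in> carrier (P (Suc 0))" for x
    proof -
      have d: "\<delta> 0 x \<in> carrier (P 0)" using left_hom_closed[OF P.diff x] .
      have "\<eta> (f (\<delta> 0 x)) = \<zero>\<^bsub>V\<^esub>"
        using f(2)[OF d] P.aug_diff[OF x] left_hom_zero[OF u P.target Q.target] by simp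
      with Q.exact_0[OF left_hom_closed[OF f(1) d]] show ?thesis by (metis imageI)
    qed
    with f show "\<exists>f. ?K 0 f" by blast
  next
    fix f i assume K: "?K i f"
    have "\<exists>g\<in>left_hom R (P (Suc i)) (Q (Suc i)). \<forall>x\<in>carrier (P (Suc i)). \<delta>' i (g x) = f (\<delta> i x)"
      using K by (intro projective_lift[OF assms(3) Q.modules Q.modules left_hom_compose[OF P.diff] Q.diff]) auto
    then obtain g where g: "g \<in> left_hom R (P (Suc i)) (Q (Suc i))"
      "\<And>x. x \<in> carrier (P (Suc i)) \<Longrightarrow> \<delta>' i (g x) = f (\<delta> i x)" by auto
    have "g (\<delta> (Suc i) x) \<in> \<delta>' (Suc i) ` carrier (Q (Suc (Suc i)))"
      if x: "x \<in> carrier (P (Suc (Suc i)))" for x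
    proof -
      have d: "\<delta> (Suc i) x \<in> carrier (P (Suc i))" using left_hom_closed[OF P.diff x] .
      have "\<delta>' i (g (\<delta> (Suc i) x)) = \<zero>\<^bsub>Q i\<^esub>"
        using g(2)[OF d] P.diff_diff[OF x] K left_hom_zero[OF _ P.modules Q.modules] by simp
      with Q.exact_Suc[OF left_hom_closed[OF g(1) d]] show ?thesis by (metis imageI)
    qed
    with g show "\<exists>g. ?K (Suc i) g \<and> (\<forall>x\<in>carrier (P (Suc i)). f (\<delta> i x) = \<delta>' i (g x))"
      by (intro exI[of _ g]) auto
  qed
  then obtain f where f: "\<forall>i. ?K i (f i) \<and> (\<forall>x\<in>carrier (P (Suc i)). f i (\<delta> i x) = \<delta>' i (f (Suc i) x))" ..
  show ?thesis
  proof (intro exI[of _ f] conjI allI)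
    show "\<forall>x\<in>carrier (P 0). \<eta> (f 0 x) = u (\<epsilon> x)" using f[THEN spec, of 0] by simp
  qed (use f in simp_all)
qed

text \<open>Each new map lifts the difference of \<open>f\<close> and the previous part
  \<open>h \<delta>\<close> through \<open>\<delta>'\<close>, which is possible because this
  difference is a cycle. The identity is recorded in positive degrees, the ones measured by
  \<open>ext_van\<close> and \<open>tor_van\<close>.\<close>

lemma null_homotopy:
  assumes "resolution R P \<delta> \<epsilon> U" "resolution R Q \<delta>' \<eta> V" "\<And>i. projective R (P i)"
    and f: "\<And>i. f i \<in> left_hom R (P i) (Q i)"
    and f0: "\<And>x. x \<in> carrier (P 0) \<Longrightarrow> \<eta> (f 0 x) = \<zero>\<^bsub>V\<^esub>"
    and fS: "\<And>i x. x \<in> carrier (P (Suc i)) \<Longrightarrow> f i (\<delta> i x) = \<delta>' i (f (Suc i) x)"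
  shows "\<exists>h. (\<forall>i. h i \<in> left_hom R (P i) (Q (Suc i))) \<and>
    (\<forall>i. \<forall>x\<in>carrier (P (Suc i)). f (Suc i) x = \<delta>' (Suc i) (h (Suc i) x) \<oplus>\<^bsub>Q (Suc i)\<^esub> h i (\<delta> i x))"
proof -
  interpret P: resolution R P \<delta> \<epsilon> U by fact
  interpret Q: resolution R Q \<delta>' \<eta> V by fact
  \<comment> \<open>The invariant says that \<open>f\<close> and \<open>\<delta>' h\<close> agree on
    boundaries; hence the difference formed in the next degree is a cycle.\<close>
  let ?K = "\<lambda>i h. h \<in> left_hom R (P i) (Q (Suc i)) \<and>
    (\<forall>x\<in>carrier (P (Suc i)). \<delta>' i (h (\<delta> i x)) = f i (\<delta> i x))"
  have "\<exists>h. \<forall>i. ?K i (h i) \<and> (\<forall>x\<in>carrier (P (Suc i)).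
      f (Suc i) x = \<delta>' (Suc i) (h (Suc i) x) \<oplus>\<^bsub>Q (Suc i)\<^esub> h i (\<delta> i x))"
  proof (rule dependent_nat_choice)
    have "\<exists>h\<in>left_hom R (P 0) (Q (Suc 0)). \<forall>x\<in>carrier (P 0). \<delta>' 0 (h x) = f 0 x"
    proof (rule projective_lift[OF assms(3) Q.modules Q.modules f Q.diff])
      show "f 0 x \<in> \<delta>' 0 ` carrier (Q (Suc 0))" if "x \<in> carrier (P 0)" for x
        using Q.exact_0[OF left_hom_closed[OF f that] f0[OF that]] by (metis imageI)
    qed
    then show "\<exists>h. ?K 0 h" using left_hom_closed[OF P.diff] by blast
  next
    fix h i assume K: "?K i h"
    interpret Qi: left_module R "Q i" by (rule Q.modules)
    interpret Qs: left_module R "Q (Suc i)" by (rule Q.modules)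
    have h: "h \<in> left_hom R (P i) (Q (Suc i))" using K by simp
    note hd = left_hom_compose[OF P.diff h]
    note g = left_hom_minus[OF Q.modules f hd]
    have "\<exists>h'\<in>left_hom R (P (Suc i)) (Q (Suc (Suc i))). \<forall>x\<in>carrier (P (Suc i)).
        \<delta>' (Suc i) (h' x) = f (Suc i) x \<ominus>\<^bsub>Q (Suc i)\<^esub> h (\<delta> i x)"
    proof (rule projective_lift[OF assms(3) Q.modules Q.modules g Q.diff])
      fix x assume x: "x \<in> carrier (P (Suc i))"
      have "\<delta>' i (f (Suc i) x \<ominus>\<^bsub>Q (Suc i)\<^esub> h (\<delta> i x)) = f i (\<delta> i x) \<ominus>\<^bsub>Q i\<^esub> f i (\<delta> i x)"
        using K x by (simp add: left_hom_diff[OF Q.diff Q.modules Q.modules] left_hom_closed[OF f]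
            left_hom_closed[OF hd] fS)
      also have "\<dots> = \<zero>\<^bsub>Q i\<^esub>"
        using left_hom_closed[OF f left_hom_closed[OF P.diff x]] by (simp add: Qi.minus_eq_zero_iff)
      finally show "f (Suc i) x \<ominus>\<^bsub>Q (Suc i)\<^esub> h (\<delta> i x) \<in> \<delta>' (Suc i) ` carrier (Q (Suc (Suc i)))"
        using Q.exact_Suc[OF left_hom_closed[OF g x]] by (metis imageI)
    qed
    then obtain h' where h': "h' \<in> left_hom R (P (Suc i)) (Q (Suc (Suc i)))"
      and h'': "\<And>x. x \<in> carrier (P (Suc i)) \<Longrightarrow> \<delta>' (Suc i) (h' x) = f (Suc i) x \<ominus>\<^bsub>Q (Suc i)\<^esub> h (\<delta> i x)" by auto
    have eq: "f (Suc i) x = \<delta>' (Suc i) (h' x) \<oplus>\<^bsub>Q (Suc i)\<^esub> h (\<delta> i x)" if x: "x \<in> carrier (P (Suc i))" for x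
      using h''[OF x] Qs.add_minus_cancel[OF left_hom_closed[OF f x] left_hom_closed[OF hd x]]
      by (simp add: Qs.M.a_comm left_hom_closed[OF f x] left_hom_closed[OF hd x])
    have "\<delta>' (Suc i) (h' (\<delta> (Suc i) x)) = f (Suc i) (\<delta> (Suc i) x)" if x: "x \<in> carrier (P (Suc (Suc i)))" for x
      using eq[OF left_hom_closed[OF P.diff x]] P.diff_diff[OF x] left_hom_zero[OF h P.modules Q.modules]
        left_hom_closed[OF Q.diff left_hom_closed[OF h' left_hom_closed[OF P.diff x]]]
      by simp
    with h' eq show "\<exists>h'. ?K (Suc i) h' \<and> (\<forall>x\<in>carrier (P (Suc i)).
        f (Suc i) x = \<delta>' (Suc i) (h' x) \<oplus>\<^bsub>Q (Suc i)\<^esub> h (\<delta> i x))"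
      by (intro exI[of _ h']) auto
  qed
  then obtain h where h: "\<forall>i. ?K i (h i) \<and> (\<forall>x\<in>carrier (P (Suc i)).
      f (Suc i) x = \<delta>' (Suc i) (h (Suc i) x) \<oplus>\<^bsub>Q (Suc i)\<^esub> h i (\<delta> i x))" ..
  show ?thesis
    by (intro exI[of _ h] conjI allI) (use h in simp_all)
qed

text \<open>Apply \<open>null_homotopy\<close> to the identity minus \<open>g f\<close>, which
  induces zero on \<open>U\<close>. A homotopy on the side of \<open>P\<close> carries vanishing
  from \<open>Q\<close> to \<open>P\<close>; the other direction is the same lemma with the roles
  exchanged.\<close>

lemma homotopy_equivalence:
  assumes "resolution R P \<delta> \<epsilon> U" "resolution R Q \<delta>' \<eta> U"
    and "\<And>i. projective R (P i)" "\<And>i. projective R (Q i)"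
  shows "\<exists>f g h. (\<forall>i. f i \<in> left_hom R (P i) (Q i)) \<and> (\<forall>i. g i \<in> left_hom R (Q i) (P i)) \<and>
    (\<forall>i. h i \<in> left_hom R (P i) (P (Suc i))) \<and>
    (\<forall>i. \<forall>x\<in>carrier (P (Suc i)). f i (\<delta> i x) = \<delta>' i (f (Suc i) x)) \<and>
    (\<forall>i. \<forall>x\<in>carrier (Q (Suc i)). g i (\<delta>' i x) = \<delta> i (g (Suc i) x)) \<and>
    (\<forall>i. \<forall>x\<in>carrier (P (Suc i)). x = g (Suc i) (f (Suc i) x) \<oplus>\<^bsub>P (Suc i)\<^esub>
      (\<delta> (Suc i) (h (Suc i) x) \<oplus>\<^bsub>P (Suc i)\<^esub> h i (\<delta> i x)))"
proof -
  interpret P: resolution R P \<delta> \<epsilon> U by fact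
  interpret Q: resolution R Q \<delta>' \<eta> U by fact
  obtain f where f: "\<And>i. f i \<in> left_hom R (P i) (Q i)"
    and f0: "\<And>x. x \<in> carrier (P 0) \<Longrightarrow> \<eta> (f 0 x) = \<epsilon> x"
    and fS: "\<And>i x. x \<in> carrier (P (Suc i)) \<Longrightarrow> f i (\<delta> i x) = \<delta>' i (f (Suc i) x)"
    using lift_chain_map[OF assms(1,2,3) left_hom_id] by blast
  obtain g where g: "\<And>i. g i \<in> left_hom R (Q i) (P i)"
    and g0: "\<And>x. x \<in> carrier (Q 0) \<Longrightarrow> \<epsilon> (g 0 x) = \<eta> x"
    and gS: "\<And>i x. x \<in> carrier (Q (Suc i)) \<Longrightarrow> g i (\<delta>' i x) = \<delta> i (g (Suc i) x)"
    using lift_chain_map[OF assms(2,1,4) left_hom_id] by blast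
  note gf = left_hom_compose[OF f g]
  let ?k = "\<lambda>i x. x \<ominus>\<^bsub>P i\<^esub> g i (f i x)"
  interpret U: left_module R U by (rule P.target)
  have "\<exists>h. (\<forall>i. h i \<in> left_hom R (P i) (P (Suc i))) \<and>
    (\<forall>i. \<forall>x\<in>carrier (P (Suc i)). ?k (Suc i) x = \<delta> (Suc i) (h (Suc i) x) \<oplus>\<^bsub>P (Suc i)\<^esub> h i (\<delta> i x))"
  proof (rule null_homotopy[OF assms(1,1,3)])
    show "?k i \<in> left_hom R (P i) (P i)" for i
      by (rule left_hom_minus[OF P.modules left_hom_id gf])
    show "\<epsilon> (?k 0 x) = \<zero>\<^bsub>U\<^esub>" if x: "x \<in> carrier (P 0)" for x
      using x by (simp add: left_hom_diff[OF P.aug P.modules P.target] left_hom_closed[OF gf] g0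
          left_hom_closed[OF f] f0 U.minus_eq_zero_iff left_hom_closed[OF P.aug])
    show "?k i (\<delta> i x) = \<delta> i (?k (Suc i) x)" if x: "x \<in> carrier (P (Suc i))" for i x
      using x by (simp add: left_hom_diff[OF P.diff P.modules P.modules] left_hom_closed[OF gf] fS gS
          left_hom_closed[OF f])
  qed
  then obtain h where h: "\<And>i. h i \<in> left_hom R (P i) (P (Suc i))"
    and hS: "\<And>i x. x \<in> carrier (P (Suc i)) \<Longrightarrow>
      ?k (Suc i) x = \<delta> (Suc i) (h (Suc i) x) \<oplus>\<^bsub>P (Suc i)\<^esub> h i (\<delta> i x)" by blast
  have "x = g (Suc i) (f (Suc i) x) \<oplus>\<^bsub>P (Suc i)\<^esub>
      (\<delta> (Suc i) (h (Suc i) x) \<oplus>\<^bsub>P (Suc i)\<^esub> h i (\<delta> i x))" if x: "x \<in> carrier (P (Suc i))" for i x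
    using left_module.add_minus_cancel[OF P.modules x left_hom_closed[OF gf x]] hS[OF x] by simp
  with f fS g gS h show ?thesis by (intro exI[of _ f] exI[of _ g] exI[of _ h]) blast
qed

text \<open>\<open>ext_van R P \<delta> M t\<close> says that the cohomology of \<open>Hom(P, M)\<close> vanishes in degree \<open>t + 1\<close>.\<close>

definition ext_van ::
  "('r, 'e) ring_scheme \<Rightarrow> (nat \<Rightarrow> ('r, 'p, 'x) module_scheme) \<Rightarrow> (nat \<Rightarrow> 'p \<Rightarrow> 'p)
    \<Rightarrow> ('r, 'm, 'y) module_scheme \<Rightarrow> nat \<Rightarrow> bool" where
  "ext_van R P \<delta> M t \<longleftrightarrow> (\<forall>\<phi>\<in>left_hom R (P (Suc t)) M.
     (\<forall>x\<in>carrier (P (Suc (Suc t))). \<phi> (\<delta> (Suc t) x) = \<zero>\<^bsub>M\<^esub>) \<longrightarrow>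
     (\<exists>\<psi>\<in>left_hom R (P t) M. \<forall>x\<in>carrier (P (Suc t)). \<phi> x = \<psi> (\<delta> t x)))"

text \<open>Compose the cocycle with the decomposition \<open>g f + \<delta> h + h \<delta>\<close>
  of the identity. The middle term dies on a cocycle, and the first is a coboundary because
  \<open>\<phi>\<close> after \<open>g\<close> is a cocycle on \<open>Q\<close>.\<close>

lemma ext_van_compare:
  assumes "resolution R P \<delta> \<epsilon> U" "resolution R Q \<delta>' \<eta> U"
    and "\<And>i. projective R (P i)" "\<And>i. projective R (Q i)"
    and M: "left_module R M" and van: "ext_van R Q \<delta>' M t"
  shows "ext_van R P \<delta> M t"
  unfolding ext_van_def
proof (intro ballI impI)
  interpret P: resolution R P \<delta> \<epsilon> U by fact
  interpret Q: resolution R Q \<delta>' \<eta> U by fact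
  interpret M: left_module R M by fact
  fix \<phi> assume \<phi>: "\<phi> \<in> left_hom R (P (Suc t)) M"
    and cocycle: "\<forall>x\<in>carrier (P (Suc (Suc t))). \<phi> (\<delta> (Suc t) x) = \<zero>\<^bsub>M\<^esub>"
  obtain f g h where f: "\<And>i. f i \<in> left_hom R (P i) (Q i)" and g: "\<And>i. g i \<in> left_hom R (Q i) (P i)"
    and h: "\<And>i. h i \<in> left_hom R (P i) (P (Suc i))"
    and fS: "\<And>i x. x \<in> carrier (P (Suc i)) \<Longrightarrow> f i (\<delta> i x) = \<delta>' i (f (Suc i) x)"
    and gS: "\<And>i x. x \<in> carrier (Q (Suc i)) \<Longrightarrow> g i (\<delta>' i x) = \<delta> i (g (Suc i) x)"
    and hS: "\<And>i x. x \<in> carrier (P (Suc i)) \<Longrightarrow> x = g (Suc i) (f (Suc i) x) \<oplus>\<^bsub>P (Suc i)\<^esub>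
      (\<delta> (Suc i) (h (Suc i) x) \<oplus>\<^bsub>P (Suc i)\<^esub> h i (\<delta> i x))"
    using homotopy_equivalence[OF assms(1-4)] by blast
  have "\<phi> (g (Suc t) (\<delta>' (Suc t) x)) = \<zero>\<^bsub>M\<^esub>" if "x \<in> carrier (Q (Suc (Suc t)))" for x
    using that cocycle by (simp add: gS left_hom_closed[OF g])
  then have "\<exists>\<psi>\<in>left_hom R (Q t) M. \<forall>x\<in>carrier (Q (Suc t)). \<phi> (g (Suc t) x) = \<psi> (\<delta>' t x)"
    using van[unfolded ext_van_def, THEN bspec, OF left_hom_compose[OF g \<phi>]] by simp
  then obtain \<psi> where \<psi>: "\<psi> \<in> left_hom R (Q t) M"
    and \<psi>\<delta>': "\<And>x. x \<in> carrier (Q (Suc t)) \<Longrightarrow> \<phi> (g (Suc t) x) = \<psi> (\<delta>' t x)" by blast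
  \<comment> \<open>The primitive of \<open>\<phi>\<close>: \<open>\<psi> f\<close> accounts for the
    summand \<open>g f\<close>, and \<open>\<phi> h\<close> for \<open>h \<delta>\<close>.\<close>
  let ?\<chi> = "\<lambda>x. \<psi> (f t x) \<oplus>\<^bsub>M\<^esub> \<phi> (h t x)"
  have "\<phi> x = ?\<chi> (\<delta> t x)" if x: "x \<in> carrier (P (Suc t))" for x
  proof -
    interpret Pt: left_module R "P (Suc t)" by (rule P.modules)
    note c = left_hom_closed[OF left_hom_compose[OF f g] x]
      left_hom_closed[OF P.diff left_hom_closed[OF h x]]
      left_hom_closed[OF h left_hom_closed[OF P.diff x]]
    have "\<phi> x = \<phi> (g (Suc t) (f (Suc t) x) \<oplus>\<^bsub>P (Suc t)\<^esub>
      (\<delta> (Suc t) (h (Suc t) x) \<oplus>\<^bsub>P (Suc t)\<^esub> h t (\<delta> t x)))"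
      using hS[OF x] by simp
    also have "\<dots> = \<psi> (f t (\<delta> t x)) \<oplus>\<^bsub>M\<^esub> (\<zero>\<^bsub>M\<^esub> \<oplus>\<^bsub>M\<^esub> \<phi> (h t (\<delta> t x)))"
      using c x cocycle by (simp add: left_hom_add[OF \<phi>] \<psi>\<delta>' left_hom_closed[OF f] left_hom_closed[OF h] fS)
    finally show ?thesis using c left_hom_closed[OF \<phi>] by simp
  qed
  then show "\<exists>\<psi>\<in>left_hom R (P t) M. \<forall>x\<in>carrier (P (Suc t)). \<phi> x = \<psi> (\<delta> t x)"
    using left_hom_plus[OF M left_hom_compose[OF f \<psi>] left_hom_compose[OF h \<phi>]]
    by (intro bexI[where x = ?\<chi>]) auto
qed

section \<open>The functorial resolution\<close>

text \<open>Free modules on different bases share their operations and differ in the carrier only.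
  So an extension computed over \<open>UNIV\<close>, as in \<open>std_diff\<close>, is a
  homomorphism into any smaller free module that receives the basis.\<close>

lemma linear_ext_free_hom:
  assumes "ring R" "h \<in> B \<rightarrow> carrier (free_module R B')"
  shows "linear_ext R (free_module R UNIV) h \<in> left_hom R (free_module R B) (free_module R B')"
    and "b \<in> B \<Longrightarrow> linear_ext R (free_module R UNIV) h (unit_vec R b) = h b"
proof -
  interpret F: left_module R "free_module R B'" by (rule left_module_free[OF assms(1)])
  note U = left_module_free[OF assms(1), of UNIV]
  have sub: "carrier (free_module R B') \<subseteq> carrier (free_module R UNIV)" by (auto simp: free_module_carrier)
  have h: "h \<in> B \<rightarrow> carrier (free_module R UNIV)" using assms(2) sub by auto
  note ext = linear_ext_hom[OF U h]
  have plus: "x \<oplus>\<^bsub>free_module R UNIV\<^esub> y = x \<oplus>\<^bsub>free_module R B'\<^esub> y"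
    "r \<odot>\<^bsub>free_module R UNIV\<^esub> x = r \<odot>\<^bsub>free_module R B'\<^esub> x"
    "\<zero>\<^bsub>free_module R UNIV\<^esub> = \<zero>\<^bsub>free_module R B'\<^esub>" for x y r by simp_all
  show "linear_ext R (free_module R UNIV) h \<in> left_hom R (free_module R B) (free_module R B')"
  proof (rule left_homI)
    show "linear_ext R (free_module R UNIV) h x \<in> carrier (free_module R B')"
      if "x \<in> carrier (free_module R B)" for x
      by (rule linear_ext_closed_under[OF U that sub])
        (use assms(2) in \<open>auto simp only: plus intro: F.M.zero_closed F.M.a_closed F.smult_closed\<close>)
  qed (simp_all only: left_hom_add[OF ext] left_hom_smult[OF ext] plus)
  show "linear_ext R (free_module R UNIV) h (unit_vec R b) = h b" if "b \<in> B"
    by (rule linear_ext_unit_vec[OF U h that])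
qed

lemma comb_value_simps:
  "comb_value R [] = (\<lambda>_. \<zero>\<^bsub>R\<^esub>)"
  "comb_value R ((r, b) # l) = (comb_value R l)(b := r \<oplus>\<^bsub>R\<^esub> comb_value R l b)"
  by (simp_all add: comb_value_def)

lemma comb_value_Cons:
  assumes "ring R" "r \<in> carrier R" "comb_value R l \<in> carrier (free_module R B)"
  shows "comb_value R ((r, b) # l) =
    r \<odot>\<^bsub>free_module R B\<^esub> unit_vec R b \<oplus>\<^bsub>free_module R B\<^esub> comb_value R l"
proof -
  interpret ring R by fact
  show ?thesis
    using assms(2,3) by (auto simp: comb_value_simps unit_vec_def fun_eq_iff free_module_carrier)
qed

lemma comb_value_closed:
  assumes "ring R" "set l \<subseteq> carrier R \<times> B"
  shows "comb_value R l \<in> carrier (free_module R B)"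
  using assms(2)
proof (induction l)
  case Nil
  interpret ring R by fact
  show ?case by (simp add: comb_value_simps free_module_carrier)
next
  case (Cons a l)
  interpret left_module R "free_module R B" by (rule left_module_free[OF assms(1)])
  obtain r b where a: "a = (r, b)" "r \<in> carrier R" "b \<in> B" using Cons.prems by (cases a) auto
  have "comb_value R l \<in> carrier (free_module R B)" using Cons by simp
  with a show ?case
    by (simp only: comb_value_Cons[OF assms(1)] M.a_closed smult_closed unit_vec_closed[OF assms(1)])
qed

text \<open>This makes the functorial resolution exact: every cycle is the value of some list
  \<open>l\<close>, and the next degree has a generator \<open>Rel l\<close> over it.\<close>

lemma comb_value_surj:
  assumes "ring R" "x \<in> carrier (free_module R B)"
  shows "\<exists>l. set l \<subseteq> carrier R \<times> B \<and> comb_value R l = x"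
  using assms
proof (induction x rule: free_module_induct)
  case zero
  show ?case by (intro exI[of _ "[]"]) (simp add: comb_value_simps)
next
  case (add f r b)
  then obtain l where "set l \<subseteq> carrier R \<times> B" "comb_value R l = f" by blast
  with add show ?case
    by (intro exI[of _ "(r, b) # l"]) (simp add: comb_value_Cons[OF assms(1)])
qed

lemma resolution_std:
  assumes U: "left_module R U"
  shows "resolution R (std_res R U) (\<lambda>_. std_diff R) (std_aug R U) U"
proof -
  interpret U: left_module R U by fact
  have R: "ring R" by (rule left_module_ring[OF U])
  note F = left_module_free[OF R]
  let ?a = "\<lambda>g. case g of Gen u \<Rightarrow> u | Rel l \<Rightarrow> \<zero>\<^bsub>U\<^esub>"
  let ?h = "\<lambda>g. case g of Gen u \<Rightarrow> (\<lambda>_. \<zero>\<^bsub>R\<^esub>) | Rel l \<Rightarrow> comb_value R l"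
  have a0: "?a \<in> std_basis R U 0 \<rightarrow> carrier U" by auto
  have h: "?h \<in> std_basis R U (Suc i) \<rightarrow> carrier (free_module R (std_basis R U i))" for i
    using comb_value_closed[OF R] by (auto split: if_splits)
  note aug = linear_ext_hom[OF U a0, folded std_aug_def std_res_def]
  note aug_unit = linear_ext_unit_vec[OF U a0, folded std_aug_def]
  note diff = linear_ext_free_hom(1)[OF R h, folded std_diff_def, folded std_res_def]
  note diff_unit = linear_ext_free_hom(2)[OF R h, folded std_diff_def]
  have M: "left_module R (std_res R U i)" for i unfolding std_res_def by (rule F)
  have zero: "\<zero>\<^bsub>std_res R U i\<^esub> = (\<lambda>_. \<zero>\<^bsub>R\<^esub>)" for i by (simp add: std_res_def)
  \<comment> \<open>The basis vector of \<open>Rel l\<close> is the preimage. The case distinction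
    mirrors the one in \<open>std_basis\<close>, where degree 0 is tested by the
    augmentation.\<close>
  have hit: "\<exists>y\<in>carrier (std_res R U (Suc i)). std_diff R y = x"
    if x: "x \<in> carrier (std_res R U i)"
      and z: "if i = 0 then std_aug R U x = \<zero>\<^bsub>U\<^esub> else std_diff R x = (\<lambda>_. \<zero>\<^bsub>R\<^esub>)" for x i
  proof -
    obtain l where l: "set l \<subseteq> carrier R \<times> std_basis R U i" "comb_value R l = x"
      using comb_value_surj[OF R x[unfolded std_res_def]] by blast
    have b: "Rel l \<in> std_basis R U (Suc i)" using l z by simp
    have "std_diff R (unit_vec R (Rel l)) = x" using diff_unit[OF b] l by simp
    then show ?thesis
      using unit_vec_closed[OF R b] unfolding std_res_def by blast
  qed
  show ?thesis
  proof (rule resolutionI[OF U M aug _ diff])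
    show "\<exists>x\<in>carrier (std_res R U 0). std_aug R U x = u" if "u \<in> carrier U" for u
    proof (rule bexI)
      have b: "Gen u \<in> std_basis R U 0" using that by simp
      show "std_aug R U (unit_vec R (Gen u)) = u" using aug_unit[OF b] by simp
      show "unit_vec R (Gen u) \<in> carrier (std_res R U 0)"
        unfolding std_res_def by (rule unit_vec_closed[OF R b])
    qed
  next
    fix x assume x: "x \<in> carrier (std_res R U (Suc 0))"
    show "std_aug R U (std_diff R x) = \<zero>\<^bsub>U\<^esub>"
    proof (rule free_hom_eq[OF U left_hom_compose[OF diff aug, unfolded std_res_def]
          left_hom_const_zero[OF U] _ x[unfolded std_res_def]])
      fix b assume b: "b \<in> std_basis R U (Suc 0)"
      then show "std_aug R U (std_diff R (unit_vec R b)) = \<zero>\<^bsub>U\<^esub>"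
        using diff_unit[OF b] by auto
    qed
  next
    fix i x assume x: "x \<in> carrier (std_res R U (Suc (Suc i)))"
    show "std_diff R (std_diff R x) = \<zero>\<^bsub>std_res R U i\<^esub>"
    proof (rule free_hom_eq[OF M _ left_hom_const_zero[OF M] _ x[unfolded std_res_def]])
      show "(\<lambda>x. std_diff R (std_diff R x)) \<in>
          left_hom R (free_module R (std_basis R U (Suc (Suc i)))) (std_res R U i)"
        using left_hom_compose[OF diff diff] by (simp only: std_res_def[of R U "Suc (Suc i)", symmetric])
    next
      fix b assume b: "b \<in> std_basis R U (Suc (Suc i))"
      then show "std_diff R (std_diff R (unit_vec R b)) = \<zero>\<^bsub>std_res R U i\<^esub>"
        using diff_unit[OF b] by (auto simp: zero)
    qed
  next
    show "\<exists>y\<in>carrier (std_res R U (Suc 0)). std_diff R y = x"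
      if "x \<in> carrier (std_res R U 0)" "std_aug R U x = \<zero>\<^bsub>U\<^esub>" for x
      using hit[of x 0] that by simp
    show "\<exists>y\<in>carrier (std_res R U (Suc (Suc i))). std_diff R y = x"
      if "x \<in> carrier (std_res R U (Suc i))" "std_diff R x = \<zero>\<^bsub>std_res R U i\<^esub>" for x i
      using hit[of x "Suc i"] that by (simp add: zero)
  qed
qed

lemma projective_std: "left_module R U \<Longrightarrow> projective R (std_res R U i)"
  unfolding std_res_def by (intro projective_free left_module_ring)

section \<open>Vanishing of Ext\<close>

lemma trivial_quotient_iff:
  fixes G (structure)
  assumes "comm_group G" "subgroup H G"
  shows "trivial_group (G Mod H) \<longleftrightarrow> carrier G \<subseteq> H"
proof -
  interpret comm_group G by fact
  interpret H: subgroup H G by fact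
  interpret Q: comm_group "G Mod H" by (rule abelian_FactGroup[OF assms(2)])
  show ?thesis
  proof
    assume "trivial_group (G Mod H)"
    then have "H #> x = H" if "x \<in> carrier G" for x
      using that by (auto simp: trivial_group_def carrier_FactGroup)
    then show "carrier G \<subseteq> H" using rcos_self[OF _ assms(2)] by blast
  next
    assume "carrier G \<subseteq> H"
    then show "trivial_group (G Mod H)"
      by (auto simp: Q.trivial_group_subset carrier_FactGroup H.rcos_const)
  qed
qed

text \<open>The common bridge for \<open>Ext\<close> and \<open>Tor\<close> from a quotient of the
  kernel by the image to exactness in terms of elements.\<close>

lemma trivial_homology_iff:
  assumes "comm_group A" "comm_group B" "comm_group C" "f \<in> hom A B" "g \<in> hom B C"
    and gf: "\<And>x. x \<in> carrier A \<Longrightarrow> g (f x) = \<one>\<^bsub>C\<^esub>"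
  shows "trivial_group (B\<lparr>carrier := kernel B C g\<rparr> Mod f ` carrier A) \<longleftrightarrow>
    (\<forall>y\<in>carrier B. g y = \<one>\<^bsub>C\<^esub> \<longrightarrow> y \<in> f ` carrier A)"
proof -
  interpret A: comm_group A by fact
  interpret B: comm_group B by fact
  interpret C: comm_group C by fact
  interpret f: group_hom A B f by unfold_locales fact
  interpret g: group_hom B C g by unfold_locales fact
  have "comm_group (B\<lparr>carrier := kernel B C g\<rparr>)"
    by (rule group.group_comm_groupI[OF B.subgroup_imp_group[OF g.subgroup_kernel]])
      (auto simp: kernel_def B.m_comm)
  moreover have "f ` carrier A \<subseteq> kernel B C g" using gf f.hom_closed by (auto simp: kernel_def)
  then have "subgroup (f ` carrier A) (B\<lparr>carrier := kernel B C g\<rparr>)"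
    by (intro B.subgroup_incl f.img_is_subgroup g.subgroup_kernel)
  ultimately show ?thesis by (subst trivial_quotient_iff) (auto simp: kernel_def)
qed

lemma comm_group_hom_group:
  assumes "left_module R M" "left_module R N"
  shows "comm_group (hom_group R M N)"
proof -
  interpret M: left_module R M by fact
  interpret N: left_module R N by fact
  have closed: "(\<lambda>x\<in>carrier M. f x) \<in> left_hom R M N \<inter> extensional (carrier M)"
    if "f \<in> left_hom R M N" for f
    using left_hom_cong[OF assms(1) that, of "restrict f (carrier M)"] by auto
  show ?thesis
  proof (rule comm_groupI)
    fix f assume f: "f \<in> carrier (hom_group R M N)"
    have f': "f \<in> left_hom R M N" using f by (simp add: hom_group_def)
    show "\<exists>g\<in>carrier (hom_group R M N). g \<otimes>\<^bsub>hom_group R M N\<^esub> f = \<one>\<^bsub>hom_group R M N\<^esub>"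
      using closed[OF left_hom_uminus[OF assms(2) f']] left_hom_closed[OF f']
      by (intro bexI[where x = "\<lambda>x\<in>carrier M. \<ominus>\<^bsub>N\<^esub> f x"])
        (auto simp: hom_group_def N.M.l_neg restrict_def fun_eq_iff)
    show "\<one>\<^bsub>hom_group R M N\<^esub> \<otimes>\<^bsub>hom_group R M N\<^esub> f = f"
      using f left_hom_closed[OF f'] by (auto simp: hom_group_def fun_eq_iff extensional_def)
    fix g assume g: "g \<in> carrier (hom_group R M N)"
    have g': "g \<in> left_hom R M N" using g by (simp add: hom_group_def)
    show "f \<otimes>\<^bsub>hom_group R M N\<^esub> g \<in> carrier (hom_group R M N)"
      using closed[OF left_hom_plus[OF assms(2) f' g']] by (simp add: hom_group_def)
    show "f \<otimes>\<^bsub>hom_group R M N\<^esub> g = g \<otimes>\<^bsub>hom_group R M N\<^esub> f"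
      using left_hom_closed[OF f'] left_hom_closed[OF g'] by (auto simp: hom_group_def fun_eq_iff N.M.a_comm)
    fix h assume h: "h \<in> carrier (hom_group R M N)"
    have h': "h \<in> left_hom R M N" using h by (simp add: hom_group_def)
    show "f \<otimes>\<^bsub>hom_group R M N\<^esub> g \<otimes>\<^bsub>hom_group R M N\<^esub> h
        = f \<otimes>\<^bsub>hom_group R M N\<^esub> (g \<otimes>\<^bsub>hom_group R M N\<^esub> h)"
      using left_hom_closed[OF f'] left_hom_closed[OF g'] left_hom_closed[OF h']
      by (auto simp: hom_group_def fun_eq_iff N.M.a_assoc)
  next
    show "\<one>\<^bsub>hom_group R M N\<^esub> \<in> carrier (hom_group R M N)"
      using closed[OF left_hom_const_zero[OF assms(2)]] by (simp add: hom_group_def)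
  qed
qed

text \<open>\<open>ext_van\<close> speaks of arbitrary functions that are linear on the carrier,
  \<open>hom_group\<close> of extensional ones; restriction to the carrier translates between them.
  In degree \<open>Suc t\<close> the boundary group in \<open>Ext\<close> is an image, so the
  degree-0 clause never arises.\<close>

lemma trivial_Ext_iff:
  assumes U: "left_module R U" and M: "left_module R M"
  shows "trivial_group (Ext R (Suc t) U M) \<longleftrightarrow> ext_van R (std_res R U) (\<lambda>_. std_diff R) M t"
proof -
  interpret S: resolution R "std_res R U" "\<lambda>_. std_diff R" "std_aug R U" U by (rule resolution_std[OF U])
  interpret M: left_module R M by fact
  let ?C = "\<lambda>j. hom_group R (std_res R U j) M"
  let ?D = "\<lambda>j \<phi>. compose (carrier (std_res R U (Suc j))) \<phi> (std_diff R)"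
  have D: "?D j \<in> hom (?C j) (?C (Suc j))" for j
  proof (rule homI)
    fix \<phi> assume \<phi>: "\<phi> \<in> carrier (?C j)"
    have "(\<lambda>x. \<phi> (std_diff R x)) \<in> left_hom R (std_res R U (Suc j)) M"
      using \<phi> by (intro left_hom_compose[OF S.diff]) (simp add: hom_group_def)
    from left_hom_cong[OF S.modules this, of "?D j \<phi>"] show "?D j \<phi> \<in> carrier (?C (Suc j))"
      by (auto simp: hom_group_def compose_def)
  next
    fix \<phi> \<psi> assume "\<phi> \<in> carrier (?C j)" "\<psi> \<in> carrier (?C j)"
    then show "?D j (\<phi> \<otimes>\<^bsub>?C j\<^esub> \<psi>) = ?D j \<phi> \<otimes>\<^bsub>?C (Suc j)\<^esub> ?D j \<psi>"
      using left_hom_closed[OF S.diff] by (auto simp: hom_group_def compose_def fun_eq_iff)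
  qed
  have "trivial_group (Ext R (Suc t) U M) \<longleftrightarrow>
      (\<forall>\<phi>\<in>carrier (?C (Suc t)). ?D (Suc t) \<phi> = \<one>\<^bsub>?C (Suc (Suc t))\<^esub> \<longrightarrow> \<phi> \<in> ?D t ` carrier (?C t))"
    unfolding Ext_def Let_def nat.case
  proof (rule trivial_homology_iff)
    fix \<phi> assume \<phi>: "\<phi> \<in> carrier (?C t)"
    then have "\<phi> \<zero>\<^bsub>std_res R U t\<^esub> = \<zero>\<^bsub>M\<^esub>"
      by (intro left_hom_zero[OF _ S.modules M]) (simp add: hom_group_def)
    then have "\<phi> (std_diff R (std_diff R x)) = \<zero>\<^bsub>M\<^esub>" if "x \<in> carrier (std_res R U (Suc (Suc t)))" for x
      using that by (simp add: S.diff_diff)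
    then show "?D (Suc t) (?D t \<phi>) = \<one>\<^bsub>?C (Suc (Suc t))\<^esub>"
      using left_hom_closed[OF S.diff] by (auto simp: hom_group_def compose_def fun_eq_iff)
  qed (use comm_group_hom_group[OF S.modules M] D in auto)
  also have "\<dots> \<longleftrightarrow> ext_van R (std_res R U) (\<lambda>_. std_diff R) M t"
  proof
    assume L: "\<forall>\<phi>\<in>carrier (?C (Suc t)). ?D (Suc t) \<phi> = \<one>\<^bsub>?C (Suc (Suc t))\<^esub> \<longrightarrow> \<phi> \<in> ?D t ` carrier (?C t)"
    show "ext_van R (std_res R U) (\<lambda>_. std_diff R) M t"
      unfolding ext_van_def
    proof (intro ballI impI)
      fix \<phi> assume \<phi>: "\<phi> \<in> left_hom R (std_res R U (Suc t)) M"
        and z: "\<forall>x\<in>carrier (std_res R U (Suc (Suc t))). \<phi> (std_diff R x) = \<zero>\<^bsub>M\<^esub>"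
      let ?\<phi> = "restrict \<phi> (carrier (std_res R U (Suc t)))"
      have "?\<phi> \<in> carrier (?C (Suc t))"
        using left_hom_cong[OF S.modules \<phi>, of ?\<phi>] by (auto simp: hom_group_def)
      moreover have "?D (Suc t) ?\<phi> = \<one>\<^bsub>?C (Suc (Suc t))\<^esub>"
        using z left_hom_closed[OF S.diff] by (auto simp: hom_group_def compose_def fun_eq_iff)
      ultimately have "?\<phi> \<in> ?D t ` carrier (?C t)" using L by blast
      then obtain \<psi> where \<psi>: "\<psi> \<in> carrier (?C t)" "?\<phi> = ?D t \<psi>" by blast
      have "\<phi> x = \<psi> (std_diff R x)" if "x \<in> carrier (std_res R U (Suc t))" for x
        using that fun_cong[OF \<psi>(2), of x] by (simp add: compose_def)
      with \<psi>(1) show "\<exists>\<psi>\<in>left_hom R (std_res R U t) M. \<forall>x\<in>carrier (std_res R U (Suc t)). \<phi> x = \<psi> (std_diff R x)"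
        by (auto simp: hom_group_def)
    qed
  next
    assume V: "ext_van R (std_res R U) (\<lambda>_. std_diff R) M t"
    show "\<forall>\<phi>\<in>carrier (?C (Suc t)). ?D (Suc t) \<phi> = \<one>\<^bsub>?C (Suc (Suc t))\<^esub> \<longrightarrow> \<phi> \<in> ?D t ` carrier (?C t)"
    proof (intro ballI impI)
      fix \<phi> assume \<phi>: "\<phi> \<in> carrier (?C (Suc t))" and z: "?D (Suc t) \<phi> = \<one>\<^bsub>?C (Suc (Suc t))\<^esub>"
      have "\<phi> (std_diff R x) = \<zero>\<^bsub>M\<^esub>" if "x \<in> carrier (std_res R U (Suc (Suc t)))" for x
        using that fun_cong[OF z, of x] by (simp add: compose_def hom_group_def)
      then obtain \<psi> where \<psi>: "\<psi> \<in> left_hom R (std_res R U t) M"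
        "\<And>x. x \<in> carrier (std_res R U (Suc t)) \<Longrightarrow> \<phi> x = \<psi> (std_diff R x)"
        using V[unfolded ext_van_def, THEN bspec, of \<phi>] \<phi> by (auto simp: hom_group_def)
      let ?\<psi> = "restrict \<psi> (carrier (std_res R U t))"
      have "?\<psi> \<in> carrier (?C t)"
        using left_hom_cong[OF S.modules \<psi>(1), of ?\<psi>] by (auto simp: hom_group_def)
      moreover have "\<phi> = ?D t ?\<psi>"
        using \<phi> \<psi>(2) left_hom_closed[OF S.diff] by (auto simp: hom_group_def compose_def fun_eq_iff extensional_def)
      ultimately show "\<phi> \<in> ?D t ` carrier (?C t)" by blast
    qed
  qed
  finally show ?thesis .
qed

section \<open>Finitely generated free resolutions\<close>

text \<open>The differentials are conjugated by isomorphisms of the terms. This serves to change the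
  element type of a resolution.\<close>

lemma resolution_transport:
  assumes "resolution R P \<delta> \<epsilon> U" and Q: "\<And>i. left_module R (Q i)"
    and \<theta>: "\<And>i. \<theta> i \<in> left_hom R (P i) (Q i)" and bij: "\<And>i. bij_betw (\<theta> i) (carrier (P i)) (carrier (Q i))"
  shows "resolution R Q (\<lambda>i y. \<theta> i (\<delta> i (inv_into (carrier (P (Suc i))) (\<theta> (Suc i)) y)))
    (\<lambda>y. \<epsilon> (inv_into (carrier (P 0)) (\<theta> 0) y)) U"
proof -
  interpret P: resolution R P \<delta> \<epsilon> U by fact
  define \<kappa> where "\<kappa> i = inv_into (carrier (P i)) (\<theta> i)" for i
  have \<kappa>: "\<kappa> i \<in> left_hom R (Q i) (P i)" for i
    unfolding \<kappa>_def by (rule left_hom_inv_into[OF P.modules \<theta> bij])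
  have \<kappa>\<theta>: "\<kappa> i (\<theta> i x) = x" if "x \<in> carrier (P i)" for i x
    unfolding \<kappa>_def using bij[of i] that by (simp add: bij_betw_def)
  have \<theta>\<kappa>: "\<theta> i (\<kappa> i y) = y" if "y \<in> carrier (Q i)" for i y
    unfolding \<kappa>_def using bij[of i] that by (simp add: bij_betw_def f_inv_into_f)
  note c = left_hom_closed[OF \<theta>] left_hom_closed[OF \<kappa>] left_hom_closed[OF P.diff]
  have ze: "\<delta> i (\<kappa> (Suc i) x) = \<zero>\<^bsub>P i\<^esub>"
    if "\<theta> i (\<delta> i (\<kappa> (Suc i) x)) = \<zero>\<^bsub>Q i\<^esub>" "x \<in> carrier (Q (Suc i))" for i x
    using arg_cong[OF that(1), of "\<kappa> i"] that(2) c by (simp add: \<kappa>\<theta> left_hom_zero[OF \<kappa> Q P.modules])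
  show ?thesis
    unfolding \<kappa>_def[symmetric]
  proof (rule resolutionI[OF P.target Q])
    show "\<exists>x\<in>carrier (Q 0). \<epsilon> (\<kappa> 0 x) = u" if u: "u \<in> carrier U" for u
    proof -
      obtain x where "x \<in> carrier (P 0)" "\<epsilon> x = u" using u P.aug_surj by (metis imageE)
      then show ?thesis by (intro bexI[where x = "\<theta> 0 x"]) (simp_all add: c \<kappa>\<theta>)
    qed
    show "\<epsilon> (\<kappa> 0 (\<theta> 0 (\<delta> 0 (\<kappa> (Suc 0) x)))) = \<zero>\<^bsub>U\<^esub>" if "x \<in> carrier (Q (Suc 0))" for x
      using that c by (simp add: \<kappa>\<theta> P.aug_diff)
    show "\<theta> i (\<delta> i (\<kappa> (Suc i) (\<theta> (Suc i) (\<delta> (Suc i) (\<kappa> (Suc (Suc i)) x))))) = \<zero>\<^bsub>Q i\<^esub>"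
      if "x \<in> carrier (Q (Suc (Suc i)))" for i x
      using that c by (simp add: \<kappa>\<theta> P.diff_diff left_hom_zero[OF \<theta> P.modules Q])
    show "\<exists>y\<in>carrier (Q (Suc 0)). \<theta> 0 (\<delta> 0 (\<kappa> (Suc 0) y)) = x"
      if x: "x \<in> carrier (Q 0)" "\<epsilon> (\<kappa> 0 x) = \<zero>\<^bsub>U\<^esub>" for x
    proof -
      obtain y where "y \<in> carrier (P (Suc 0))" "\<delta> 0 y = \<kappa> 0 x" using P.exact_0 x c by metis
      with x show ?thesis by (intro bexI[where x = "\<theta> (Suc 0) y"]) (simp_all add: c \<kappa>\<theta> \<theta>\<kappa>)
    qed
    show "\<exists>y\<in>carrier (Q (Suc (Suc i))). \<theta> (Suc i) (\<delta> (Suc i) (\<kappa> (Suc (Suc i)) y)) = x"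
      if x: "x \<in> carrier (Q (Suc i))" "\<theta> i (\<delta> i (\<kappa> (Suc i) x)) = \<zero>\<^bsub>Q i\<^esub>" for i x
    proof -
      obtain y where "y \<in> carrier (P (Suc (Suc i)))" "\<delta> (Suc i) y = \<kappa> (Suc i) x"
        using P.exact_Suc ze[OF x(2,1)] x c by metis
      with x show ?thesis by (intro bexI[where x = "\<theta> (Suc (Suc i)) y"]) (simp_all add: c \<kappa>\<theta> \<theta>\<kappa>)
    qed
  qed (intro left_hom_compose[OF \<kappa>] P.aug left_hom_compose[OF P.diff \<theta>])+
qed

lemma resolution_iso:
  assumes "resolution R P \<delta> \<epsilon> U" "left_module R V" "u \<in> left_hom R U V" "bij_betw u (carrier U) (carrier V)"
  shows "resolution R P \<delta> (\<lambda>x. u (\<epsilon> x)) V"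
proof -
  interpret P: resolution R P \<delta> \<epsilon> U by fact
  have u0: "u \<zero>\<^bsub>U\<^esub> = \<zero>\<^bsub>V\<^esub>" using left_hom_zero[OF assms(3) P.target assms(2)] .
  interpret U: left_module R U by (rule P.target)
  have inj: "x = \<zero>\<^bsub>U\<^esub>" if "x \<in> carrier U" "u x = \<zero>\<^bsub>V\<^esub>" for x
    using assms(4) that u0 by (auto simp: bij_betw_def inj_on_def)
  show ?thesis
  proof (rule resolutionI[OF assms(2) P.modules left_hom_compose[OF P.aug assms(3)] _ P.diff])
    show "\<exists>x\<in>carrier (P 0). u (\<epsilon> x) = v" if "v \<in> carrier V" for v
    proof -
      have "v \<in> u ` \<epsilon> ` carrier (P 0)" using assms(4) that by (simp add: bij_betw_def P.aug_surj)
      then show ?thesis by auto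
    qed
  qed (use P.aug_diff P.diff_diff P.exact_0 P.exact_Suc inj u0 left_hom_closed[OF P.aug] in auto)
qed

text \<open>Cutting at degree \<open>e\<close> leaves a resolution of the image of
  \<open>\<delta> e\<close>, which is the syzygy by exactness. The new degree \<open>i\<close> is
  the old degree \<open>Suc e + i\<close>, so degrees of \<open>Ext\<close> and \<open>Tor\<close>
  drop by \<open>Suc e\<close>.\<close>

lemma resolution_shift:
  assumes "resolution R P \<delta> \<epsilon> U"
  shows "resolution R (\<lambda>i. P (Suc e + i)) (\<lambda>i. \<delta> (Suc e + i)) (\<delta> e)
    (P e\<lparr>carrier := syzygy P \<delta> \<epsilon> U e\<rparr>)"
proof -
  interpret P: resolution R P \<delta> \<epsilon> U by fact
  interpret Pe: left_module R "P e" by (rule P.modules)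
  interpret Ps: left_module R "P (Suc e)" by (rule P.modules)
  have im: "syzygy P \<delta> \<epsilon> U e = \<delta> e ` carrier (P (Suc e))" by (simp add: P.diff_image)
  have zero: "\<delta> e \<zero>\<^bsub>P (Suc e)\<^esub> = \<zero>\<^bsub>P e\<^esub>" by (rule left_hom_zero[OF P.diff P.modules P.modules])
  have U: "left_module R (P e\<lparr>carrier := syzygy P \<delta> \<epsilon> U e\<rparr>)"
  proof (rule submodule[OF P.modules])
    show "\<zero>\<^bsub>P e\<^esub> \<in> syzygy P \<delta> \<epsilon> U e" unfolding im zero[symmetric] by blast
    show "x \<oplus>\<^bsub>P e\<^esub> y \<in> syzygy P \<delta> \<epsilon> U e" if "x \<in> syzygy P \<delta> \<epsilon> U e" "y \<in> syzygy P \<delta> \<epsilon> U e" for x y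
      using that unfolding im by (auto simp: left_hom_add[OF P.diff, symmetric])
    show "r \<odot>\<^bsub>P e\<^esub> x \<in> syzygy P \<delta> \<epsilon> U e" if "r \<in> carrier R" "x \<in> syzygy P \<delta> \<epsilon> U e" for r x
      using that unfolding im by (auto simp: left_hom_smult[OF P.diff, symmetric])
  qed (rule P.syzygy_subset)
  show ?thesis
  proof (rule resolutionI[OF U P.modules])
    show "\<delta> e \<in> left_hom R (P (Suc e + 0)) (P e\<lparr>carrier := syzygy P \<delta> \<epsilon> U e\<rparr>)"
      by (intro left_homI) (auto simp: im left_hom_add[OF P.diff] left_hom_smult[OF P.diff])
    show "\<exists>x\<in>carrier (P (Suc e + 0)). \<delta> e x = u" if "u \<in> carrier (P e\<lparr>carrier := syzygy P \<delta> \<epsilon> U e\<rparr>)" for u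
      using that by (auto simp: im)
    show "\<delta> (Suc e + i) \<in> left_hom R (P (Suc e + Suc i)) (P (Suc e + i))" for i
      using P.diff[of "Suc e + i"] by simp
  qed (use P.diff_diff[of _ "e"] P.diff_diff[of _ "Suc e + _"] P.exact_Suc[of _ e] P.exact_Suc[of _ "Suc e + _"] in auto)
qed

text \<open>Standard terms bring every finitely generated free resolution to the element type
  \<open>nat \<Rightarrow> 'r\<close> that \<open>finitely_presented\<close> demands, and they
  provide the ranks for \<open>dual_resolution\<close>.\<close>

lemma resolution_free:
  assumes "resolution R P \<delta> \<epsilon> U" "\<And>i. fg_free R (P i)"
  shows "\<exists>(k :: nat \<Rightarrow> nat) \<delta>' \<eta>. resolution R (\<lambda>i. free_module R {..<k i}) \<delta>' \<eta> U"
proof -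
  interpret P: resolution R P \<delta> \<epsilon> U by fact
  have R: "ring R" using left_module_ring[OF P.target] .
  have "\<forall>i. \<exists>k f. f \<in> left_hom R (P i) (free_module R {..<k::nat}) \<and>
      bij_betw f (carrier (P i)) (carrier (free_module R {..<k}))"
    using assms(2) unfolding fg_free_def module_iso_def by blast
  then obtain k \<theta> where \<theta>: "\<And>i. \<theta> i \<in> left_hom R (P i) (free_module R {..<k i::nat})"
    "\<And>i. bij_betw (\<theta> i) (carrier (P i)) (carrier (free_module R {..<k i}))" by metis
  from resolution_transport[OF assms(1) left_module_free[OF R] \<theta>] show ?thesis by blast
qed

lemma fg_free_free_module:
  assumes "ring R"
  shows "fg_free R (free_module R {..<k::nat})"
  unfolding fg_free_def module_iso_def
  using left_module_free[OF assms] left_hom_id bij_betw_id[unfolded id_def] by blast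

lemma finitely_presentedI:
  assumes "resolution R P \<delta> \<epsilon> U" "\<And>i. fg_free R (P i)"
  shows "finitely_presented R \<infinity> U"
proof -
  have "ring R" using left_module_ring[OF resolution.target[OF assms(1)]] .
  with resolution_free[OF assms] fg_free_free_module show ?thesis
    unfolding finitely_presented_def resolution_def by blast
qed

lemma finitely_presentedE:
  fixes R :: "('r, 'e) ring_scheme"
  assumes "finitely_presented R \<infinity> U"
  obtains F :: "nat \<Rightarrow> ('r, nat \<Rightarrow> 'r) module" and \<delta> \<epsilon>
  where "resolution R F \<delta> \<epsilon> U" "\<And>i. fg_free R (F i)"
  using assms that unfolding finitely_presented_def resolution_def by (simp, blast)

lemma finitely_presented_mono:
  fixes R :: "('r, 'e) ring_scheme"
  assumes "finitely_presented R \<infinity> U"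
  shows "finitely_presented R n U"
proof -
  obtain F :: "nat \<Rightarrow> ('r, nat \<Rightarrow> 'r) module" and \<delta> \<epsilon>
    where F: "resolution R F \<delta> \<epsilon> U" "\<And>i. fg_free R (F i)"
    using finitely_presentedE[OF assms] by blast
  then have "exact_resolution R n F \<delta> \<epsilon> U"
    unfolding resolution_def by (simp add: exact_resolution_def)
  with F(2) show ?thesis unfolding finitely_presented_def by blast
qed

text \<open>Transport of structure along an injection \<open>j\<close>: the operations go back
  through an inverse of \<open>j\<close>, and only the element type changes.\<close>

definition image_module ::
  "('u \<Rightarrow> 'v) \<Rightarrow> ('r, 'u, 'y) module_scheme \<Rightarrow> ('r, 'v) module" where
  "image_module j M = (let i = inv_into (carrier M) j in
     \<lparr>carrier = j ` carrier M, mult = undefined, one = undefined, ring.zero = j \<zero>\<^bsub>M\<^esub>,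
      add = (\<lambda>x y. j (i x \<oplus>\<^bsub>M\<^esub> i y)), smult = (\<lambda>r x. j (r \<odot>\<^bsub>M\<^esub> i x))\<rparr>)"

lemma image_module:
  assumes "left_module R M" "inj_on j (carrier M)"
  shows "left_module R (image_module j M)" "j \<in> left_hom R M (image_module j M)"
    "bij_betw j (carrier M) (carrier (image_module j M))"
proof -
  interpret M: left_module R M by fact
  have "\<exists>y\<in>carrier M. y \<oplus>\<^bsub>M\<^esub> x = \<zero>\<^bsub>M\<^esub>" if "x \<in> carrier M" for x
    using that by (intro bexI[of _ "\<ominus>\<^bsub>M\<^esub> x"]) (auto simp: M.M.l_neg)
  then have "\<exists>y\<in>carrier M. j (y \<oplus>\<^bsub>M\<^esub> x) = j \<zero>\<^bsub>M\<^esub>" if "x \<in> carrier M" for x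
    using that by metis
  then show "left_module R (image_module j M)"
    using assms(2)
    by (intro left_moduleI left_module_ring[OF assms(1)])
      (auto simp: image_module_def Let_def M.M.a_ac M.smult_l_distr M.smult_r_distr M.smult_assoc1)
  show "j \<in> left_hom R M (image_module j M)"
    by (intro left_homI) (use assms(2) in \<open>auto simp: image_module_def Let_def\<close>)
  show "bij_betw j (carrier M) (carrier (image_module j M))"
    using assms(2) by (auto simp: image_module_def bij_betw_def Let_def)
qed

text \<open>A finitely presented module is represented by the fibres of its augmentation, which have the
  element type over which \<open>nd_injective\<close> and \<open>nd_flat\<close> quantify.\<close>

lemma finitely_presented_fibre_module:
  fixes R :: "('r, 'e) ring_scheme"
  assumes "resolution R P \<delta> \<epsilon> U" "\<And>i. fg_free R (P i)"
  shows "\<exists>(V :: ('r, (nat \<Rightarrow> 'r) set) module) \<eta>. finitely_presented R n V \<and> resolution R P \<delta> \<eta> V"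
proof -
  interpret P: resolution R P \<delta> \<epsilon> U by fact
  obtain F :: "nat \<Rightarrow> ('r, nat \<Rightarrow> 'r) module" and \<delta>' \<epsilon>' where F: "resolution R F \<delta>' \<epsilon>' U"
    "\<And>i. fg_free R (F i)"
    using finitely_presentedE[OF finitely_presentedI[OF assms]] by blast
  define j where "j u = {x \<in> carrier (F 0). \<epsilon>' x = u}" for u
  have inj: "inj_on j (carrier U)"
  proof (rule inj_onI)
    fix u v assume "u \<in> carrier U" "v \<in> carrier U" "j u = j v"
    moreover obtain x where "x \<in> carrier (F 0)" "\<epsilon>' x = u"
      using resolution.aug_surj[OF F(1)] \<open>u \<in> carrier U\<close> by (metis imageE)
    ultimately show "u = v" by (auto simp: j_def)
  qed
  note V = image_module[OF P.target inj]
  have "finitely_presented R n (image_module j U)"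
    by (rule finitely_presented_mono[OF finitely_presentedI[OF resolution_iso[OF F(1) V] F(2)]])
  with resolution_iso[OF assms(1) V] show ?thesis by blast
qed

text \<open>Two replacements lead from the definition to the conclusion: \<open>U\<close> by a
  module of fibres with the same resolution, and the functorial resolution by the given one.\<close>

lemma nd_injective_ext_van_d:
  fixes R :: "('r, 'e) ring_scheme"
  assumes M: "nd_injective R n d M" and P: "resolution R P \<delta> \<epsilon> U" "\<And>i. fg_free R (P i)"
  shows "ext_van R P \<delta> M d"
proof -
  have M': "left_module R M" using M by (simp add: nd_injective_def)
  obtain V :: "('r, (nat \<Rightarrow> 'r) set) module" and \<eta>
    where V: "finitely_presented R n V" "resolution R P \<delta> \<eta> V"
    using finitely_presented_fibre_module[OF P] by blast
  have U: "left_module R V" using resolution.target[OF V(2)] .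
  have "trivial_group (Ext R (Suc d) V M)"
    using M V(1) by (auto simp: nd_injective_def)
  then show ?thesis
    unfolding trivial_Ext_iff[OF U M']
    by (rule ext_van_compare[OF V(2) resolution_std[OF U] fg_free_projective[OF P(2)] projective_std[OF U] M'])
qed

text \<open>Degrees above \<open>d\<close> reduce to degree \<open>d\<close> for a syzygy of
  \<open>U\<close>, which is again resolved by finitely generated free modules.\<close>

lemma nd_injective_ext_van:
  assumes M: "nd_injective R n d M" and P: "resolution R P \<delta> \<epsilon> U" "\<And>i. fg_free R (P i)" and "t \<ge> d"
  shows "ext_van R P \<delta> M t"
proof (cases "t = d")
  case True
  then show ?thesis using nd_injective_ext_van_d[OF M P] by simp
next
  case False
  \<comment> \<open>Shifting by \<open>Suc e\<close>, which equals \<open>t - d\<close>, moves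
    degree \<open>t\<close> to degree \<open>d\<close>.\<close>
  define e where "e = t - d - 1"
  have t: "t = Suc e + d" using False assms(4) by (simp add: e_def)
  show ?thesis
    using nd_injective_ext_van_d[OF M resolution_shift[OF P(1), of e] P(2)] by (simp add: ext_van_def t)
qed

section \<open>Direct sums of resolutions\<close>

lemma module_iso_direct_sum:
  assumes "module_iso R M M'" "module_iso R N N'"
  shows "module_iso R (direct_sum M N) (direct_sum M' N')"
proof -
  obtain f g where f: "f \<in> left_hom R M M'" "bij_betw f (carrier M) (carrier M')"
    and g: "g \<in> left_hom R N N'" "bij_betw g (carrier N) (carrier N')"
    using assms by (auto simp: module_iso_def)
  have "(\<lambda>z. (f (fst z), g (snd z))) \<in> left_hom R (direct_sum M N) (direct_sum M' N')"
    by (intro left_hom_pair left_hom_compose[OF direct_sum_fst] left_hom_compose[OF direct_sum_snd] f g)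
  moreover have "bij_betw (\<lambda>z. (f (fst z), g (snd z))) (carrier M \<times> carrier N) (carrier M' \<times> carrier N')"
    using bij_betw_map_prod[OF f(2) g(2)] by (simp add: map_prod_def case_prod_unfold)
  ultimately show ?thesis unfolding module_iso_def by auto
qed

lemma direct_sum_free_iso:
  assumes "ring R"
  shows "module_iso R (direct_sum (free_module R {..<k::nat}) (free_module R {..<l::nat})) (free_module R {..<k + l})"
proof -
  interpret ring R by fact
  let ?f = "\<lambda>(x, y) i. if i < k then x i else y (i - k)"
  have fin: "finite {i. x i \<noteq> \<zero>\<^bsub>R\<^esub>}" if "\<forall>i. \<not> i < m \<longrightarrow> x i = \<zero>\<^bsub>R\<^esub>" for x and m :: nat
    by (rule finite_subset[of _ "{..<m}"]) (use that in auto)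
  have carrier: "x \<in> carrier (free_module R {..<m}) \<longleftrightarrow>
      (\<forall>i. x i \<in> carrier R) \<and> (\<forall>i. \<not> i < m \<longrightarrow> x i = \<zero>\<^bsub>R\<^esub>)" for x and m :: nat
    using fin[of m x] by (auto simp: free_module_carrier)
  have hom: "?f \<in> left_hom R (direct_sum (free_module R {..<k}) (free_module R {..<l})) (free_module R {..<k + l})"
    by (intro left_homI) (auto simp: carrier)
  have "bij_betw ?f (carrier (free_module R {..<k}) \<times> carrier (free_module R {..<l})) (carrier (free_module R {..<k + l}))"
  proof (rule bij_betw_byWitness[where f' = "\<lambda>z. (\<lambda>i. if i < k then z i else \<zero>\<^bsub>R\<^esub>, \<lambda>i. z (i + k))"])
    show "\<forall>a\<in>carrier (free_module R {..<k}) \<times> carrier (free_module R {..<l}).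
        (\<lambda>i. if i < k then ?f a i else \<zero>\<^bsub>R\<^esub>, \<lambda>i. ?f a (i + k)) = a"
      by (auto simp: carrier fun_eq_iff)
  qed (auto simp: carrier fun_eq_iff)
  with hom show ?thesis unfolding module_iso_def by (intro bexI[of _ ?f]) simp_all
qed

lemma fg_free_direct_sum:
  assumes "fg_free R M" "fg_free R N"
  shows "fg_free R (direct_sum M N)"
proof -
  obtain k l :: nat where M: "left_module R M" "module_iso R M (free_module R {..<k})"
    and N: "left_module R N" "module_iso R N (free_module R {..<l})"
    using assms by (auto simp: fg_free_def)
  then show ?thesis
    unfolding fg_free_def
    using left_module_direct_sum module_iso_trans[OF module_iso_direct_sum
        direct_sum_free_iso[OF left_module_ring[OF M(1)]]] by blast
qed

lemma resolution_direct_sum: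
  assumes "resolution R P \<delta> \<epsilon> U" "resolution R Q \<delta>' \<eta> V"
  shows "resolution R (\<lambda>i. direct_sum (P i) (Q i)) (\<lambda>i z. (\<delta> i (fst z), \<delta>' i (snd z)))
    (\<lambda>z. (\<epsilon> (fst z), \<eta> (snd z))) (direct_sum U V)"
proof -
  interpret P: resolution R P \<delta> \<epsilon> U by fact
  interpret Q: resolution R Q \<delta>' \<eta> V by fact
  note c = left_hom_compose[OF direct_sum_fst] left_hom_compose[OF direct_sum_snd]
  show ?thesis
  proof (rule resolutionI)
    show "\<exists>x\<in>carrier (direct_sum (P 0) (Q 0)). (\<epsilon> (fst x), \<eta> (snd x)) = u"
      if "u \<in> carrier (direct_sum U V)" for u
      using that by (cases u) (auto simp: P.aug_surj[symmetric] Q.aug_surj[symmetric] image_iff)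
    show "\<exists>y\<in>carrier (direct_sum (P (Suc 0)) (Q (Suc 0))). (\<delta> 0 (fst y), \<delta>' 0 (snd y)) = x"
      if "x \<in> carrier (direct_sum (P 0) (Q 0))" "(\<epsilon> (fst x), \<eta> (snd x)) = \<zero>\<^bsub>direct_sum U V\<^esub>" for x
      using that P.exact_0[of "fst x"] Q.exact_0[of "snd x"] by (cases x) auto
    show "\<exists>y\<in>carrier (direct_sum (P (Suc (Suc i))) (Q (Suc (Suc i)))). (\<delta> (Suc i) (fst y), \<delta>' (Suc i) (snd y)) = x"
      if "x \<in> carrier (direct_sum (P (Suc i)) (Q (Suc i)))"
        "(\<delta> i (fst x), \<delta>' i (snd x)) = \<zero>\<^bsub>direct_sum (P i) (Q i)\<^esub>" for x i
      using that P.exact_Suc[of "fst x" i] Q.exact_Suc[of "snd x" i] by (cases x) auto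
  qed (auto intro!: left_module_direct_sum left_hom_pair c P.target Q.target P.modules Q.modules
      P.aug Q.aug P.diff Q.diff P.aug_diff Q.aug_diff P.diff_diff Q.diff_diff)
qed

lemma finitely_presented_direct_sum:
  assumes "finitely_presented R \<infinity> U" "finitely_presented R \<infinity> V"
  shows "finitely_presented R \<infinity> (direct_sum U V)"
proof -
  obtain F :: "nat \<Rightarrow> ('a, nat \<Rightarrow> 'a) module" and \<delta> \<epsilon> where F: "resolution R F \<delta> \<epsilon> U" "\<And>i. fg_free R (F i)"
    using finitely_presentedE[OF assms(1)] by blast
  obtain G :: "nat \<Rightarrow> ('a, nat \<Rightarrow> 'a) module" and \<delta>' \<eta> where G: "resolution R G \<delta>' \<eta> V" "\<And>i. fg_free R (G i)"
    using finitely_presentedE[OF assms(2)] by blast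
  show ?thesis
    by (rule finitely_presentedI[OF resolution_direct_sum[OF F(1) G(1)] fg_free_direct_sum[OF F(2) G(2)]])
qed

lemma finitely_presented_iso:
  fixes R :: "('r, 'e) ring_scheme"
  assumes "finitely_presented R \<infinity> U" "left_module R V" "module_iso R U V"
  shows "finitely_presented R \<infinity> V"
proof -
  obtain F :: "nat \<Rightarrow> ('r, nat \<Rightarrow> 'r) module" and \<delta> \<epsilon> where F: "resolution R F \<delta> \<epsilon> U" "\<And>i. fg_free R (F i)"
    using finitely_presentedE[OF assms(1)] by blast
  obtain u where "u \<in> left_hom R U V" "bij_betw u (carrier U) (carrier V)"
    using assms(3) by (auto simp: module_iso_def)
  from finitely_presentedI[OF resolution_iso[OF F(1) assms(2) this] F(2)] show ?thesis .
qed

text \<open>A cocycle on a direct sum is the sum of its restrictions to the two summands, and each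
  restriction has its own primitive.\<close>

lemma ext_van_direct_sum:
  assumes M: "left_module R M" and P: "left_module R (P t)" "left_module R (P (Suc t))" "left_module R (P (Suc (Suc t)))"
    and Q: "left_module R (Q t)" "left_module R (Q (Suc t))" "left_module R (Q (Suc (Suc t)))"
    and \<delta>: "\<And>i. \<delta> i \<in> left_hom R (P (Suc i)) (P i)" and \<delta>': "\<And>i. \<delta>' i \<in> left_hom R (Q (Suc i)) (Q i)"
    and "ext_van R P \<delta> M t" "ext_van R Q \<delta>' M t"
  shows "ext_van R (\<lambda>i. direct_sum (P i) (Q i)) (\<lambda>i z. (\<delta> i (fst z), \<delta>' i (snd z))) M t"
  unfolding ext_van_def
proof (intro ballI impI)
  interpret M: left_module R M by fact
  interpret P: left_module R "P (Suc t)" by fact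
  interpret Q: left_module R "Q (Suc t)" by fact
  interpret P2: left_module R "P (Suc (Suc t))" by fact
  interpret Q2: left_module R "Q (Suc (Suc t))" by fact
  fix \<phi> assume \<phi>: "\<phi> \<in> left_hom R (direct_sum (P (Suc t)) (Q (Suc t))) M"
    and z: "\<forall>x\<in>carrier (direct_sum (P (Suc (Suc t))) (Q (Suc (Suc t)))). \<phi> (\<delta> (Suc t) (fst x), \<delta>' (Suc t) (snd x)) = \<zero>\<^bsub>M\<^esub>"
  note l = left_hom_compose[OF direct_sum_inl[OF Q(2)] \<phi>]
  note r = left_hom_compose[OF direct_sum_inr[OF P(2)] \<phi>]
  have "\<phi> (\<delta> (Suc t) x, \<zero>\<^bsub>Q (Suc t)\<^esub>) = \<zero>\<^bsub>M\<^esub>" if "x \<in> carrier (P (Suc (Suc t)))" for x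
    using z[THEN bspec, of "(x, \<zero>\<^bsub>Q (Suc (Suc t))\<^esub>)"] that left_hom_zero[OF \<delta>' Q(3,2)] by simp
  then obtain \<alpha> where \<alpha>: "\<alpha> \<in> left_hom R (P t) M"
    "\<And>x. x \<in> carrier (P (Suc t)) \<Longrightarrow> \<phi> (x, \<zero>\<^bsub>Q (Suc t)\<^esub>) = \<alpha> (\<delta> t x)"
    using assms(10)[unfolded ext_van_def, THEN bspec, OF l] by auto
  have "\<phi> (\<zero>\<^bsub>P (Suc t)\<^esub>, \<delta>' (Suc t) x) = \<zero>\<^bsub>M\<^esub>" if "x \<in> carrier (Q (Suc (Suc t)))" for x
    using z[THEN bspec, of "(\<zero>\<^bsub>P (Suc (Suc t))\<^esub>, x)"] that left_hom_zero[OF \<delta> P(3,2)] by simp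
  then obtain \<beta> where \<beta>: "\<beta> \<in> left_hom R (Q t) M"
    "\<And>x. x \<in> carrier (Q (Suc t)) \<Longrightarrow> \<phi> (\<zero>\<^bsub>P (Suc t)\<^esub>, x) = \<beta> (\<delta>' t x)"
    using assms(11)[unfolded ext_van_def, THEN bspec, OF r] by auto
  show "\<exists>\<psi>\<in>left_hom R (direct_sum (P t) (Q t)) M. \<forall>x\<in>carrier (direct_sum (P (Suc t)) (Q (Suc t))).
      \<phi> x = \<psi> (\<delta> t (fst x), \<delta>' t (snd x))"
  proof (intro bexI ballI)
    show "(\<lambda>z. \<alpha> (fst z) \<oplus>\<^bsub>M\<^esub> \<beta> (snd z)) \<in> left_hom R (direct_sum (P t) (Q t)) M"
      by (intro left_hom_plus M left_hom_compose[OF direct_sum_fst \<alpha>(1)] left_hom_compose[OF direct_sum_snd \<beta>(1)])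
    fix z assume "z \<in> carrier (direct_sum (P (Suc t)) (Q (Suc t)))"
    then obtain x y where z: "z = (x, y)" "x \<in> carrier (P (Suc t))" "y \<in> carrier (Q (Suc t))" by auto
    have "\<phi> z = \<phi> ((x, \<zero>\<^bsub>Q (Suc t)\<^esub>) \<oplus>\<^bsub>direct_sum (P (Suc t)) (Q (Suc t))\<^esub> (\<zero>\<^bsub>P (Suc t)\<^esub>, y))"
      using z by simp
    also have "\<dots> = \<alpha> (\<delta> t x) \<oplus>\<^bsub>M\<^esub> \<beta> (\<delta>' t y)"
      using z by (subst left_hom_add[OF \<phi>]) (simp_all add: \<alpha>(2) \<beta>(2))
    finally show "\<phi> z = \<alpha> (fst (\<delta> t (fst z), \<delta>' t (snd z))) \<oplus>\<^bsub>M\<^esub> \<beta> (snd (\<delta> t (fst z), \<delta>' t (snd z)))"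
      using z by simp
  qed
qed

section \<open>Mapping cones\<close>

text \<open>The mapping cone of a chain map \<open>P \<rightarrow> Q\<close> has \<open>Q\<^sub>i \<oplus> P\<^sub>i\<^sub>-\<^sub>1\<close> in degree \<open>i\<close>, where \<open>P\<^sub>-\<^sub>1 = 0\<close>.\<close>

definition cone ::
  "('r, 'e) ring_scheme \<Rightarrow> (nat \<Rightarrow> ('r, 'p, 'x) module_scheme) \<Rightarrow> (nat \<Rightarrow> ('r, 'q, 'y) module_scheme)
    \<Rightarrow> nat \<Rightarrow> ('r, 'q \<times> 'p) module" where
  "cone R P Q i = (case i of
     0 \<Rightarrow> direct_sum (Q 0) (P 0\<lparr>carrier := {\<zero>\<^bsub>P 0\<^esub>}\<rparr>)
   | Suc j \<Rightarrow> direct_sum (Q (Suc j)) (P j))"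

text \<open>The minus sign makes the square zero, because \<open>\<delta>' f\<close> and
  \<open>f \<delta>\<close> cancel. For \<open>i = 0\<close> the second coordinate can only be the
  zero of the dummy summand of \<open>cone\<close>.\<close>

definition cone_diff ::
  "(nat \<Rightarrow> ('r, 'p, 'x) module_scheme) \<Rightarrow> (nat \<Rightarrow> ('r, 'q, 'y) module_scheme)
    \<Rightarrow> (nat \<Rightarrow> 'p \<Rightarrow> 'p) \<Rightarrow> (nat \<Rightarrow> 'q \<Rightarrow> 'q) \<Rightarrow> (nat \<Rightarrow> 'p \<Rightarrow> 'q) \<Rightarrow> nat \<Rightarrow> 'q \<times> 'p \<Rightarrow> 'q \<times> 'p" where
  "cone_diff P Q \<delta> \<delta>' f i z = (\<delta>' i (fst z) \<oplus>\<^bsub>Q i\<^esub> f i (snd z),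
     case i of 0 \<Rightarrow> \<zero>\<^bsub>P 0\<^esub> | Suc j \<Rightarrow> \<ominus>\<^bsub>P j\<^esub> \<delta> j (snd z))"

text \<open>The data are a short exact sequence \<open>0 -> A -> B -> C -> 0\<close>, resolutions of
  \<open>A\<close> and \<open>B\<close>, and a chain map over the inclusion. The cone of this chain
  map will resolve \<open>C\<close>.\<close>

locale cone_data =
  P: resolution R P \<delta> \<epsilon> A + Q: resolution R Q \<delta>' \<eta> B
  for R :: "('r, 'e) ring_scheme" and P :: "nat \<Rightarrow> ('r, 'p, 'x) module_scheme" and \<delta> \<epsilon>
    and A :: "('r, 'a, 'y) module_scheme"
    and Q :: "nat \<Rightarrow> ('r, 'q, 'z) module_scheme" and \<delta>' \<eta> and B :: "('r, 'b, 'w) module_scheme" +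
  fixes \<iota> \<pi> f and C :: "('r, 'c, 'v) module_scheme"
  assumes incl: "\<iota> \<in> left_hom R A B" and incl_inj: "inj_on \<iota> (carrier A)"
    and C: "left_module R C" and proj: "\<pi> \<in> left_hom R B C" and proj_surj: "\<pi> ` carrier B = carrier C"
    and ker: "\<And>b. b \<in> carrier B \<Longrightarrow> \<pi> b = \<zero>\<^bsub>C\<^esub> \<longleftrightarrow> b \<in> \<iota> ` carrier A"
    and f: "\<And>i. f i \<in> left_hom R (P i) (Q i)"
    and f_aug: "\<And>x. x \<in> carrier (P 0) \<Longrightarrow> \<eta> (f 0 x) = \<iota> (\<epsilon> x)"
    and f_diff: "\<And>i x. x \<in> carrier (P (Suc i)) \<Longrightarrow> f i (\<delta> i x) = \<delta>' i (f (Suc i) x)"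
begin

abbreviation "G \<equiv> cone R P Q"
abbreviation "D \<equiv> cone_diff P Q \<delta> \<delta>' f"

lemma zero_module: "left_module R (P 0\<lparr>carrier := {\<zero>\<^bsub>P 0\<^esub>}\<rparr>)"
proof -
  interpret left_module R "P 0" by (rule P.modules)
  show ?thesis by (rule submodule[OF P.modules]) auto
qed

lemma cone_modules: "left_module R (G i)"
  by (cases i) (auto simp: cone_def intro!: left_module_direct_sum zero_module P.modules Q.modules)

lemma cone_diff_hom: "D i \<in> left_hom R (G (Suc i)) (G i)"
proof (cases i)
  case 0
  have "D 0 \<in> left_hom R (direct_sum (Q (Suc 0)) (P 0)) (direct_sum (Q 0) (P 0\<lparr>carrier := {\<zero>\<^bsub>P 0\<^esub>}\<rparr>))"
    unfolding cone_diff_def nat.case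
    using left_hom_const_zero[OF zero_module]
    by (intro left_hom_pair left_hom_plus Q.modules left_hom_compose[OF direct_sum_fst Q.diff]
        left_hom_compose[OF direct_sum_snd f]) simp
  then show ?thesis by (simp add: cone_def 0)
next
  case (Suc j)
  have "D (Suc j) \<in> left_hom R (direct_sum (Q (Suc (Suc j))) (P (Suc j))) (direct_sum (Q (Suc j)) (P j))"
    unfolding cone_diff_def nat.case
    by (intro left_hom_pair left_hom_plus Q.modules left_hom_uminus P.modules
        left_hom_compose[OF direct_sum_fst Q.diff] left_hom_compose[OF direct_sum_snd f]
        left_hom_compose[OF direct_sum_snd P.diff])
  then show ?thesis by (simp add: cone_def Suc)
qed

text \<open>If \<open>p\<close> is the boundary of \<open>p'\<close>, then \<open>q + f p'\<close>
  is a cycle and lifts to some \<open>q'\<close>; the boundary of \<open>(q', - p')\<close> is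
  \<open>(q, p)\<close>. Why \<open>p\<close> is a boundary depends on the degree and is left to the
  caller.\<close>

lemma cone_exact_aux:
  assumes q: "q \<in> carrier (Q (Suc i))" and p: "p \<in> carrier (P i)"
    and eq: "\<delta>' i q \<oplus>\<^bsub>Q i\<^esub> f i p = \<zero>\<^bsub>Q i\<^esub>"
    and cyc: "\<exists>p'\<in>carrier (P (Suc i)). \<delta> i p' = p"
  shows "\<exists>z\<in>carrier (Q (Suc (Suc i))) \<times> carrier (P (Suc i)). \<delta>' (Suc i) (fst z) \<oplus>\<^bsub>Q (Suc i)\<^esub> f (Suc i) (snd z) = q \<and>
    \<ominus>\<^bsub>P i\<^esub> \<delta> i (snd z) = p"
proof -
  interpret Pi: left_module R "P i" by (rule P.modules)
  interpret Ps: left_module R "P (Suc i)" by (rule P.modules)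
  interpret Qi: left_module R "Q i" by (rule Q.modules)
  interpret Qs: left_module R "Q (Suc i)" by (rule Q.modules)
  obtain p' where p': "p' \<in> carrier (P (Suc i))" "\<delta> i p' = p" using cyc by blast
  have fp': "f (Suc i) p' \<in> carrier (Q (Suc i))" by (rule left_hom_closed[OF f p'(1)])
  have "\<delta>' i (q \<oplus>\<^bsub>Q (Suc i)\<^esub> f (Suc i) p') = \<zero>\<^bsub>Q i\<^esub>"
    using eq f_diff[OF p'(1)] p' by (simp add: left_hom_add[OF Q.diff q fp'])
  then obtain q' where q': "q' \<in> carrier (Q (Suc (Suc i)))" "\<delta>' (Suc i) q' = q \<oplus>\<^bsub>Q (Suc i)\<^esub> f (Suc i) p'"
    using Q.exact_Suc[of "q \<oplus>\<^bsub>Q (Suc i)\<^esub> f (Suc i) p'" i] q fp' by auto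
  have "\<delta>' (Suc i) q' \<oplus>\<^bsub>Q (Suc i)\<^esub> f (Suc i) (\<ominus>\<^bsub>P (Suc i)\<^esub> p') = q"
    using q fp' p' by (simp add: q' left_hom_neg[OF f P.modules Q.modules] Qs.M.a_assoc Qs.M.r_neg)
  moreover have "\<ominus>\<^bsub>P i\<^esub> \<delta> i (\<ominus>\<^bsub>P (Suc i)\<^esub> p') = p"
    using p p' by (simp add: left_hom_neg[OF P.diff P.modules P.modules])
  ultimately show ?thesis using p' q' by (intro bexI[where x = "(q', \<ominus>\<^bsub>P (Suc i)\<^esub> p')"]) auto
qed

text \<open>Exactness in degree 0 rests on the kernel of \<open>\<pi>\<close> being the image of
  \<open>\<iota>\<close>, in degree 1 on the injectivity of \<open>\<iota>\<close>, and beyond that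
  on the exactness of \<open>P\<close> and \<open>Q\<close> alone.\<close>

lemma resolution_cone: "resolution R G D (\<lambda>z. \<pi> (\<eta> (fst z))) C"
proof (rule resolutionI)
  show "left_module R C" "left_module R (G i)" "D i \<in> left_hom R (G (Suc i)) (G i)" for i
    by (rule C cone_modules cone_diff_hom)+
  interpret A: left_module R A by (rule P.target)
  interpret B: left_module R B by (rule Q.target)
  interpret C: left_module R C by (rule C)
  interpret Q0: left_module R "Q 0" by (rule Q.modules)
  interpret P0: left_module R "P 0" by (rule P.modules)
  have i0: "\<iota> \<zero>\<^bsub>A\<^esub> = \<zero>\<^bsub>B\<^esub>" by (rule left_hom_zero[OF incl P.target Q.target])
  have f0: "f i \<zero>\<^bsub>P i\<^esub> = \<zero>\<^bsub>Q i\<^esub>" for i by (rule left_hom_zero[OF f P.modules Q.modules])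
  show "(\<lambda>z. \<pi> (\<eta> (fst z))) \<in> left_hom R (G 0) C"
    by (auto simp: cone_def intro!: left_hom_compose[OF left_hom_compose[OF direct_sum_fst Q.aug] proj])
  show "\<exists>x\<in>carrier (G 0). \<pi> (\<eta> (fst x)) = c" if c: "c \<in> carrier C" for c
  proof -
    obtain b where b: "b \<in> carrier B" "\<pi> b = c" using preimage_ex[OF proj_surj c] by blast
    obtain q where "q \<in> carrier (Q 0)" "\<eta> q = b" using preimage_ex[OF Q.aug_surj b(1)] by blast
    with b show ?thesis by (intro bexI[of _ "(q, \<zero>\<^bsub>P 0\<^esub>)"]) (auto simp: cone_def)
  qed
  show "\<pi> (\<eta> (fst (D 0 x))) = \<zero>\<^bsub>C\<^esub>" if x: "x \<in> carrier (G (Suc 0))" for x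
  proof -
    obtain q p where z: "x = (q, p)" "q \<in> carrier (Q (Suc 0))" "p \<in> carrier (P 0)" using x by (auto simp: cone_def)
    have "\<eta> (\<delta>' 0 q \<oplus>\<^bsub>Q 0\<^esub> f 0 p) = \<iota> (\<epsilon> p)"
      using z left_hom_closed[OF P.aug z(3)] left_hom_closed[OF incl]
      by (subst left_hom_add[OF Q.aug]) (auto simp: left_hom_closed[OF Q.diff] left_hom_closed[OF f] Q.aug_diff f_aug)
    then show ?thesis
      using ker[of "\<iota> (\<epsilon> p)"] left_hom_closed[OF P.aug z(3)] left_hom_closed[OF incl] by (auto simp: cone_diff_def z)
  qed
  show "\<exists>y\<in>carrier (G (Suc 0)). D 0 y = x" if x: "x \<in> carrier (G 0)" "\<pi> (\<eta> (fst x)) = \<zero>\<^bsub>C\<^esub>" for x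
  proof -
    obtain q where z: "x = (q, \<zero>\<^bsub>P 0\<^esub>)" "q \<in> carrier (Q 0)" using x(1) by (auto simp: cone_def)
    obtain a where a: "a \<in> carrier A" "\<eta> q = \<iota> a"
      using x(2) z ker[OF left_hom_closed[OF Q.aug z(2)]] by auto
    obtain p where p: "p \<in> carrier (P 0)" "\<epsilon> p = a" using preimage_ex[OF P.aug_surj a(1)] by blast
    have fp: "f 0 p \<in> carrier (Q 0)" by (rule left_hom_closed[OF f p(1)])
    \<comment> \<open>\<open>\<eta> q\<close> comes from an element of \<open>A\<close>. Subtracting
      the image of a lift of that element makes the augmentation vanish.\<close>
    have "\<eta> (q \<ominus>\<^bsub>Q 0\<^esub> f 0 p) = \<zero>\<^bsub>B\<^esub>"
      using z fp p a by (simp add: left_hom_diff[OF Q.aug Q.modules Q.target] f_aug B.minus_eq_zero_iff left_hom_closed[OF incl])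
    then obtain q' where q': "q' \<in> carrier (Q (Suc 0))" "\<delta>' 0 q' = q \<ominus>\<^bsub>Q 0\<^esub> f 0 p"
      using Q.exact_0[of "q \<ominus>\<^bsub>Q 0\<^esub> f 0 p"] z fp by auto
    have "\<delta>' 0 q' \<oplus>\<^bsub>Q 0\<^esub> f 0 p = q"
      using z fp q' by (simp add: Q0.add_minus_cancel Q0.M.a_comm)
    with q' p show ?thesis by (intro bexI[of _ "(q', p)"]) (auto simp: cone_def cone_diff_def z)
  qed
  show "D i (D (Suc i) x) = \<zero>\<^bsub>G i\<^esub>" if x: "x \<in> carrier (G (Suc (Suc i)))" for i x
  proof -
    interpret Pi: left_module R "P i" by (rule P.modules)
    interpret Qi: left_module R "Q i" by (rule Q.modules)
    obtain q p where z: "x = (q, p)" "q \<in> carrier (Q (Suc (Suc i)))" "p \<in> carrier (P (Suc i))" using x by (auto simp: cone_def)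
    note cl = left_hom_closed[OF Q.diff z(2)] left_hom_closed[OF P.diff z(3)] left_hom_closed[OF f z(3)]
      left_hom_closed[OF f left_hom_closed[OF P.diff z(3)]]
    have "\<delta>' i (\<delta>' (Suc i) q \<oplus>\<^bsub>Q (Suc i)\<^esub> f (Suc i) p) \<oplus>\<^bsub>Q i\<^esub> f i (\<ominus>\<^bsub>P i\<^esub> \<delta> i p) = \<zero>\<^bsub>Q i\<^esub>"
      using z cl by (simp add: left_hom_add[OF Q.diff] Q.diff_diff left_hom_neg[OF f P.modules Q.modules] f_diff[symmetric] Qi.M.r_neg)
    moreover have "\<ominus>\<^bsub>P j\<^esub> \<delta> j (\<ominus>\<^bsub>P (Suc j)\<^esub> \<delta> (Suc j) p) = \<zero>\<^bsub>P j\<^esub>" if "i = Suc j" for j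
    proof -
      interpret Pj: left_module R "P j" by (rule P.modules)
      show ?thesis
        using z cl that by (simp add: left_hom_neg[OF P.diff P.modules P.modules] P.diff_diff)
    qed
    ultimately show ?thesis by (cases i) (auto simp: cone_diff_def cone_def z)
  qed
  show "\<exists>y\<in>carrier (G (Suc (Suc i))). D (Suc i) y = x"
    if x: "x \<in> carrier (G (Suc i))" "D i x = \<zero>\<^bsub>G i\<^esub>" for i x
  proof -
    interpret Qi: left_module R "Q i" by (rule Q.modules)
    obtain q p where z: "x = (q, p)" "q \<in> carrier (Q (Suc i))" "p \<in> carrier (P i)" using x(1) by (auto simp: cone_def)
    have eq: "\<delta>' i q \<oplus>\<^bsub>Q i\<^esub> f i p = \<zero>\<^bsub>Q i\<^esub>"
      using x(2) by (cases i) (auto simp: cone_def cone_diff_def z)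
    have "\<exists>p'\<in>carrier (P (Suc i)). \<delta> i p' = p"
    proof (cases i)
      case 0
      \<comment> \<open>The cycle condition yields that \<open>\<iota> (\<epsilon> p)\<close> is
        zero; injectivity of \<open>\<iota>\<close> then makes \<open>p\<close> a boundary.\<close>
      have "\<eta> (\<delta>' 0 q \<oplus>\<^bsub>Q 0\<^esub> f 0 p) = \<zero>\<^bsub>B\<^esub>" using eq left_hom_zero[OF Q.aug Q.modules Q.target] by (simp add: 0)
      then have "\<iota> (\<epsilon> p) = \<iota> \<zero>\<^bsub>A\<^esub>"
        using z left_hom_closed[OF Q.diff] left_hom_closed[OF f] left_hom_closed[OF incl] left_hom_closed[OF P.aug]
        by (simp add: 0 left_hom_add[OF Q.aug] Q.aug_diff f_aug i0)
      then have "\<epsilon> p = \<zero>\<^bsub>A\<^esub>" using incl_inj left_hom_closed[OF P.aug] z by (simp add: 0 inj_on_eq_iff)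
      then show ?thesis using P.exact_0 z by (simp add: 0)
    next
      case (Suc j)
      interpret Pj: left_module R "P j" by (rule P.modules)
      have "\<ominus>\<^bsub>P j\<^esub> \<delta> j p = \<zero>\<^bsub>P j\<^esub>" using x(2) by (simp add: Suc cone_def cone_diff_def z)
      then have "\<delta> j p = \<zero>\<^bsub>P j\<^esub>"
        using left_hom_closed[OF P.diff[of j], of p] z Suc by (metis Pj.M.minus_minus Pj.neg_zero)
      then show ?thesis using P.exact_Suc z by (simp add: Suc)
    qed
    from cone_exact_aux[OF z(2,3) eq this] show ?thesis
      by (auto simp: cone_def cone_diff_def z)
  qed
qed

lemma fg_free_cone:
  assumes "\<And>i. fg_free R (P i)" "\<And>i. fg_free R (Q i)"
  shows "fg_free R (G i)"
proof (cases i)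
  case 0
  interpret P0: left_module R "P 0" by (rule P.modules)
  interpret R: ring R by (rule left_module_ring[OF C])
  have "(\<lambda>_ _. \<zero>\<^bsub>R\<^esub>) \<in> left_hom R (P 0\<lparr>carrier := {\<zero>\<^bsub>P 0\<^esub>}\<rparr>) (free_module R {..<0::nat})"
    using left_hom_const_zero[OF left_module_free[OF left_module_ring[OF C]]] by simp
  moreover have "carrier (free_module R {..<0::nat}) = {\<lambda>_. \<zero>\<^bsub>R\<^esub>}" by (auto simp: free_module_carrier)
  ultimately have "fg_free R (P 0\<lparr>carrier := {\<zero>\<^bsub>P 0\<^esub>}\<rparr>)"
    unfolding fg_free_def module_iso_def using zero_module
    by (intro conjI exI[of _ "0::nat"] bexI[where x = "\<lambda>_ _. \<zero>\<^bsub>R\<^esub>"]) (auto simp: bij_betw_def)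
  then show ?thesis by (simp add: 0 cone_def fg_free_direct_sum assms)
next
  case (Suc j)
  then show ?thesis by (simp add: cone_def fg_free_direct_sum assms)
qed

text \<open>This is the exact piece \<open>Ext^(t+1)(B) -> Ext^(t+1)(A) -> Ext^(t+2)(C)\<close> with
  vanishing ends. Read on the cone, \<open>\<phi>\<close> has a primitive \<open>\<psi>\<close>. The
  part of \<open>\<psi>\<close> on \<open>Q\<close> is a cocycle with a primitive
  \<open>\<chi>\<close>, and \<open>\<chi> f\<close> minus the part of \<open>\<psi>\<close> on
  \<open>P\<close> is a primitive of \<open>\<phi>\<close>.\<close>

lemma ext_van_cone_Suc:
  assumes M: "left_module R M" and "ext_van R G D M (Suc t)" "ext_van R Q \<delta>' M t"
  shows "ext_van R P \<delta> M t"
  unfolding ext_van_def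
proof (intro ballI impI)
  interpret M: left_module R M by fact
  interpret P1: left_module R "P (Suc t)" by (rule P.modules)
  interpret Pt: left_module R "P t" by (rule P.modules)
  interpret Q2: left_module R "Q (Suc (Suc t))" by (rule Q.modules)
  interpret Q1: left_module R "Q (Suc t)" by (rule Q.modules)
  fix \<phi> assume \<phi>: "\<phi> \<in> left_hom R (P (Suc t)) M" and z: "\<forall>x\<in>carrier (P (Suc (Suc t))). \<phi> (\<delta> (Suc t) x) = \<zero>\<^bsub>M\<^esub>"
  have "(\<lambda>z. \<phi> (snd z)) \<in> left_hom R (G (Suc (Suc t))) M"
    by (simp add: cone_def left_hom_compose[OF direct_sum_snd \<phi>])
  moreover have "\<phi> (snd (D (Suc (Suc t)) x)) = \<zero>\<^bsub>M\<^esub>" if "x \<in> carrier (G (Suc (Suc (Suc t))))" for x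
    using that z left_hom_closed[OF P.diff]
    by (auto simp: cone_def cone_diff_def left_hom_neg[OF \<phi> P.modules M])
  ultimately obtain \<psi> where \<psi>: "\<psi> \<in> left_hom R (direct_sum (Q (Suc t)) (P t)) M"
    and eq: "\<And>x. x \<in> carrier (Q (Suc (Suc t))) \<times> carrier (P (Suc t)) \<Longrightarrow> \<phi> (snd x) = \<psi> (D (Suc t) x)"
    using assms(2)[unfolded ext_van_def, THEN bspec, of "\<lambda>z. \<phi> (snd z)"] by (auto simp: cone_def)
  note \<psi>Q = left_hom_compose[OF direct_sum_inl[OF P.modules] \<psi>]
  note \<psi>P = left_hom_compose[OF direct_sum_inr[OF Q.modules] \<psi>]
  have "\<psi> (\<delta>' (Suc t) q, \<zero>\<^bsub>P t\<^esub>) = \<zero>\<^bsub>M\<^esub>" if "q \<in> carrier (Q (Suc (Suc t)))" for q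
    using eq[of "(q, \<zero>\<^bsub>P (Suc t)\<^esub>)"] that left_hom_closed[OF Q.diff that]
    by (simp add: cone_diff_def left_hom_zero[OF P.diff P.modules P.modules] left_hom_zero[OF f P.modules Q.modules]
        left_hom_zero[OF \<phi> P.modules M])
  then obtain \<chi> where \<chi>: "\<chi> \<in> left_hom R (Q t) M"
    and \<chi>': "\<And>q. q \<in> carrier (Q (Suc t)) \<Longrightarrow> \<psi> (q, \<zero>\<^bsub>P t\<^esub>) = \<chi> (\<delta>' t q)"
    using assms(3)[unfolded ext_van_def, THEN bspec, OF \<psi>Q] by auto
  have "\<phi> p = \<chi> (f t (\<delta> t p)) \<ominus>\<^bsub>M\<^esub> \<psi> (\<zero>\<^bsub>Q (Suc t)\<^esub>, \<delta> t p)" if p: "p \<in> carrier (P (Suc t))" for p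
  proof -
    note cl = left_hom_closed[OF f p] left_hom_closed[OF P.diff p]
    have "\<phi> p = \<psi> (f (Suc t) p, \<ominus>\<^bsub>P t\<^esub> \<delta> t p)"
      using eq[of "(\<zero>\<^bsub>Q (Suc (Suc t))\<^esub>, p)"] p cl
      by (simp add: cone_diff_def left_hom_zero[OF Q.diff Q.modules Q.modules])
    also have "\<dots> = \<psi> ((f (Suc t) p, \<zero>\<^bsub>P t\<^esub>) \<oplus>\<^bsub>direct_sum (Q (Suc t)) (P t)\<^esub> (\<zero>\<^bsub>Q (Suc t)\<^esub>, \<ominus>\<^bsub>P t\<^esub> \<delta> t p))"
      using cl by simp
    also have "\<dots> = \<psi> (f (Suc t) p, \<zero>\<^bsub>P t\<^esub>) \<oplus>\<^bsub>M\<^esub> \<psi> (\<zero>\<^bsub>Q (Suc t)\<^esub>, \<ominus>\<^bsub>P t\<^esub> \<delta> t p)"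
      using cl by (subst left_hom_add[OF \<psi>]) simp_all
    also have "\<dots> = \<chi> (f t (\<delta> t p)) \<ominus>\<^bsub>M\<^esub> \<psi> (\<zero>\<^bsub>Q (Suc t)\<^esub>, \<delta> t p)"
      using cl by (simp add: \<chi>' f_diff p left_hom_neg[OF \<psi>P P.modules M] a_minus_def)
    finally show ?thesis .
  qed
  then show "\<exists>\<psi>\<in>left_hom R (P t) M. \<forall>x\<in>carrier (P (Suc t)). \<phi> x = \<psi> (\<delta> t x)"
    using left_hom_minus[OF M left_hom_compose[OF f \<chi>] \<psi>P]
    by (intro bexI[where x = "\<lambda>x. \<chi> (f t x) \<ominus>\<^bsub>M\<^esub> \<psi> (\<zero>\<^bsub>Q (Suc t)\<^esub>, x)"]) auto
qed

text \<open>Vanishing of \<open>Ext^1(C, M)\<close> makes \<open>Hom(B, M) -> Hom(A, M)\<close>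
  surjective: \<open>\<phi> \<epsilon>\<close> is a cocycle on the cone, and its primitive on
  \<open>Q 0\<close> kills boundaries, so it descends to \<open>B\<close>.\<close>

lemma ext_van_cone_0:
  assumes M: "left_module R M" and "ext_van R G D M 0" and \<phi>: "\<phi> \<in> left_hom R A M"
  shows "\<exists>\<chi>\<in>left_hom R B M. \<forall>a\<in>carrier A. \<chi> (\<iota> a) = \<phi> a"
proof -
  interpret M: left_module R M by fact
  interpret A: left_module R A by (rule P.target)
  interpret P0: left_module R "P 0" by (rule P.modules)
  interpret Q1: left_module R "Q (Suc 0)" by (rule Q.modules)
  interpret Q0: left_module R "Q 0" by (rule Q.modules)
  let ?\<phi> = "\<lambda>z. \<phi> (\<epsilon> (snd z))"
  note \<phi>\<epsilon> = left_hom_compose[OF P.aug \<phi>]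
  have "?\<phi> \<in> left_hom R (G (Suc 0)) M"
    using left_hom_compose[OF direct_sum_snd \<phi>\<epsilon>] by (simp add: cone_def)
  moreover have "?\<phi> (D (Suc 0) x) = \<zero>\<^bsub>M\<^esub>" if "x \<in> carrier (G (Suc (Suc 0)))" for x
    using that left_hom_closed[OF P.diff] left_hom_zero[OF \<phi> P.target M]
    by (auto simp: cone_def cone_diff_def left_hom_neg[OF P.aug P.modules P.target] P.aug_diff)
  ultimately obtain \<psi> where \<psi>: "\<psi> \<in> left_hom R (direct_sum (Q 0) (P 0\<lparr>carrier := {\<zero>\<^bsub>P 0\<^esub>}\<rparr>)) M"
    and eq: "\<And>x. x \<in> carrier (Q (Suc 0)) \<times> carrier (P 0) \<Longrightarrow> \<phi> (\<epsilon> (snd x)) = \<psi> (D 0 x)"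
    using assms(2)[unfolded ext_van_def, THEN bspec, of ?\<phi>] by (auto simp: cone_def)
  have \<psi>Q: "(\<lambda>q. \<psi> (q, \<zero>\<^bsub>P 0\<^esub>)) \<in> left_hom R (Q 0) M"
    using left_hom_compose[OF direct_sum_inl[OF zero_module] \<psi>] by simp
  have \<psi>0: "\<psi> (\<delta>' 0 q, \<zero>\<^bsub>P 0\<^esub>) = \<zero>\<^bsub>M\<^esub>" if "q \<in> carrier (Q (Suc 0))" for q
    using eq[of "(q, \<zero>\<^bsub>P 0\<^esub>)"] that left_hom_closed[OF Q.diff that]
    by (simp add: cone_diff_def left_hom_zero[OF f P.modules Q.modules] left_hom_zero[OF \<phi>\<epsilon> P.modules M])
  have \<psi>f: "\<psi> (f 0 p, \<zero>\<^bsub>P 0\<^esub>) = \<phi> (\<epsilon> p)" if "p \<in> carrier (P 0)" for p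
    using eq[of "(\<zero>\<^bsub>Q (Suc 0)\<^esub>, p)"] that left_hom_closed[OF f that]
    by (simp add: cone_diff_def left_hom_zero[OF Q.diff Q.modules Q.modules])
  have well: "\<psi> (q, \<zero>\<^bsub>P 0\<^esub>) = \<psi> (q', \<zero>\<^bsub>P 0\<^esub>)"
    if qq: "q \<in> carrier (Q 0)" "q' \<in> carrier (Q 0)" "\<eta> q = \<eta> q'" for q q'
  proof -
    interpret B: left_module R B by (rule Q.target)
    have "\<eta> (q \<ominus>\<^bsub>Q 0\<^esub> q') = \<zero>\<^bsub>B\<^esub>"
      using that by (simp add: left_hom_diff[OF Q.aug Q.modules Q.target] B.minus_eq_zero_iff left_hom_closed[OF Q.aug])
    then obtain r where "r \<in> carrier (Q (Suc 0))" "\<delta>' 0 r = q \<ominus>\<^bsub>Q 0\<^esub> q'"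
      using Q.exact_0[of "q \<ominus>\<^bsub>Q 0\<^esub> q'"] qq by auto
    with \<psi>0[of r] that have "\<psi> (q, \<zero>\<^bsub>P 0\<^esub>) \<ominus>\<^bsub>M\<^esub> \<psi> (q', \<zero>\<^bsub>P 0\<^esub>) = \<zero>\<^bsub>M\<^esub>"
      by (simp add: left_hom_diff[OF \<psi>Q Q.modules M])
    then show ?thesis using that by (simp add: M.minus_eq_zero_iff left_hom_closed[OF \<psi>Q])
  qed
  \<comment> \<open>An arbitrary section of the augmentation. By \<open>well\<close> the values of
    \<open>\<psi>\<close> do not depend on it, which makes the descended map linear.\<close>
  define s where "s = inv_into (carrier (Q 0)) \<eta>"
  have s: "s b \<in> carrier (Q 0)" "\<eta> (s b) = b" if "b \<in> carrier B" for b
    unfolding s_def using that by (simp_all add: inv_into_into f_inv_into_f Q.aug_surj)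
  interpret B: left_module R B by (rule Q.target)
  show ?thesis
  proof (intro bexI ballI)
    show "(\<lambda>b. \<psi> (s b, \<zero>\<^bsub>P 0\<^esub>)) \<in> left_hom R B M"
    proof (rule left_homI)
      fix b b' assume b: "b \<in> carrier B" "b' \<in> carrier B"
      have "\<psi> (s (b \<oplus>\<^bsub>B\<^esub> b'), \<zero>\<^bsub>P 0\<^esub>) = \<psi> (s b \<oplus>\<^bsub>Q 0\<^esub> s b', \<zero>\<^bsub>P 0\<^esub>)"
        using b s by (intro well) (simp_all add: left_hom_add[OF Q.aug])
      then show "\<psi> (s (b \<oplus>\<^bsub>B\<^esub> b'), \<zero>\<^bsub>P 0\<^esub>) = \<psi> (s b, \<zero>\<^bsub>P 0\<^esub>) \<oplus>\<^bsub>M\<^esub> \<psi> (s b', \<zero>\<^bsub>P 0\<^esub>)"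
        using b s by (simp add: left_hom_add[OF \<psi>Q])
    next
      fix r b assume b: "r \<in> carrier R" "b \<in> carrier B"
      have "\<psi> (s (r \<odot>\<^bsub>B\<^esub> b), \<zero>\<^bsub>P 0\<^esub>) = \<psi> (r \<odot>\<^bsub>Q 0\<^esub> s b, \<zero>\<^bsub>P 0\<^esub>)"
        using b s by (intro well) (simp_all add: left_hom_smult[OF Q.aug])
      then show "\<psi> (s (r \<odot>\<^bsub>B\<^esub> b), \<zero>\<^bsub>P 0\<^esub>) = r \<odot>\<^bsub>M\<^esub> \<psi> (s b, \<zero>\<^bsub>P 0\<^esub>)"
        using b s by (simp add: left_hom_smult[OF \<psi>Q])
    qed (simp add: left_hom_closed[OF \<psi>Q] s)
    fix a assume a: "a \<in> carrier A"
    obtain p where p: "p \<in> carrier (P 0)" "\<epsilon> p = a" using preimage_ex[OF P.aug_surj a] by blast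
    have "\<psi> (s (\<iota> a), \<zero>\<^bsub>P 0\<^esub>) = \<psi> (f 0 p, \<zero>\<^bsub>P 0\<^esub>)"
      using a p s[OF left_hom_closed[OF incl a]] by (intro well) (simp_all add: left_hom_closed[OF f] f_aug)
    then show "\<psi> (s (\<iota> a), \<zero>\<^bsub>P 0\<^esub>) = \<phi> a" using \<psi>f p by simp
  qed
qed

end

section \<open>Finite powers\<close>

text \<open>All powers share one element type, since tuples vanish from index \<open>m\<close> on.
  The index set matches \<open>free_module\<close> on \<open>{..<m}\<close>, so a tuple can be read
  as values at basis vectors.\<close>

definition pow_module :: "('r, 'm, 'x) module_scheme \<Rightarrow> nat \<Rightarrow> ('r, nat \<Rightarrow> 'm) module" where
  "pow_module M m =
     \<lparr>carrier = {x. (\<forall>i. x i \<in> carrier M) \<and> (\<forall>i. \<not> i < m \<longrightarrow> x i = \<zero>\<^bsub>M\<^esub>)},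
      mult = undefined, one = undefined, ring.zero = (\<lambda>_. \<zero>\<^bsub>M\<^esub>),
      add = (\<lambda>x y i. x i \<oplus>\<^bsub>M\<^esub> y i), smult = (\<lambda>r x i. r \<odot>\<^bsub>M\<^esub> x i)\<rparr>"

lemma pow_module_simps [simp]:
  "x \<in> carrier (pow_module M m) \<longleftrightarrow> (\<forall>i. x i \<in> carrier M) \<and> (\<forall>i. \<not> i < m \<longrightarrow> x i = \<zero>\<^bsub>M\<^esub>)"
  "\<zero>\<^bsub>pow_module M m\<^esub> = (\<lambda>_. \<zero>\<^bsub>M\<^esub>)"
  "x \<oplus>\<^bsub>pow_module M m\<^esub> y = (\<lambda>i. x i \<oplus>\<^bsub>M\<^esub> y i)"
  "r \<odot>\<^bsub>pow_module M m\<^esub> x = (\<lambda>i. r \<odot>\<^bsub>M\<^esub> x i)"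
  by (simp_all add: pow_module_def)

lemma left_module_pow:
  assumes "left_module R M"
  shows "left_module R (pow_module M m)"
proof -
  interpret M: left_module R M by fact
  have "\<exists>y\<in>carrier (pow_module M m). y \<oplus>\<^bsub>pow_module M m\<^esub> x = \<zero>\<^bsub>pow_module M m\<^esub>"
    if "x \<in> carrier (pow_module M m)" for x
    using that by (intro bexI[where x = "\<lambda>i. \<ominus>\<^bsub>M\<^esub> x i"]) (auto simp: M.M.l_neg)
  then show ?thesis
    by (intro left_moduleI left_module_ring[OF assms])
      (auto simp: M.M.a_ac M.smult_l_distr M.smult_r_distr M.smult_assoc1)
qed

lemma pow_module_Suc_iso:
  assumes "left_module R M"
  shows "module_iso R (direct_sum (pow_module M m) M) (pow_module M (Suc m))"
proof -
  interpret M: left_module R M by fact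
  let ?f = "\<lambda>(x, y) i. if i = m then y else x i"
  have "?f \<in> left_hom R (direct_sum (pow_module M m) M) (pow_module M (Suc m))"
    by (intro left_homI) auto
  moreover have "bij_betw ?f (carrier (direct_sum (pow_module M m) M)) (carrier (pow_module M (Suc m)))"
    by (rule bij_betw_byWitness[where f' = "\<lambda>z. (\<lambda>i. if i = m then \<zero>\<^bsub>M\<^esub> else z i, z m)"])
      (auto simp: fun_eq_iff)
  ultimately show ?thesis unfolding module_iso_def by blast
qed

definition pow_incl :: "('r, 'm, 'x) module_scheme \<Rightarrow> nat \<Rightarrow> 'm \<Rightarrow> nat \<Rightarrow> 'm" where
  "pow_incl M j x = (\<lambda>i. if i = j then x else \<zero>\<^bsub>M\<^esub>)"

lemma pow_incl_hom: "left_module R M \<Longrightarrow> j < m \<Longrightarrow> pow_incl M j \<in> left_hom R M (pow_module M m)"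
proof -
  assume "left_module R M"
  then interpret M: left_module R M .
  show "j < m \<Longrightarrow> pow_incl M j \<in> left_hom R M (pow_module M m)"
    by (intro left_homI) (auto simp: pow_incl_def)
qed

lemma pow_proj_hom: "(\<lambda>x. x j) \<in> left_hom R (pow_module M m) M"
  by (intro left_homI) auto

lemma pow_module_decompose:
  assumes "left_module R M" "x \<in> carrier (pow_module M m)"
  shows "x = (\<Oplus>\<^bsub>pow_module M m\<^esub>j\<in>{..<m}. pow_incl M j (x j))"
proof -
  interpret M: left_module R M by fact
  interpret P: left_module R "pow_module M m" by (rule left_module_pow[OF assms(1)])
  have "(\<Oplus>\<^bsub>pow_module M m\<^esub>j\<in>{..<k}. pow_incl M j (x j)) = (\<lambda>i. if i < k then x i else \<zero>\<^bsub>M\<^esub>)"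
    if "k \<le> m" for k
    using that
  proof (induction k)
    case (Suc k)
    have "(\<Oplus>\<^bsub>pow_module M m\<^esub>j\<in>insert k {..<k}. pow_incl M j (x j))
      = pow_incl M k (x k) \<oplus>\<^bsub>pow_module M m\<^esub> (\<Oplus>\<^bsub>pow_module M m\<^esub>j\<in>{..<k}. pow_incl M j (x j))"
      using Suc.prems assms(2) left_hom_closed[OF pow_incl_hom[OF assms(1)], of _ m]
      by (intro P.M.finsum_insert) (auto simp: Pi_iff simp del: pow_module_simps(1) dest: pow_module_simps(1)[THEN iffD1])
    then show ?case
      using Suc assms(2) by (auto simp: lessThan_Suc pow_incl_def fun_eq_iff less_Suc_eq)
  qed simp
  from this[of m] show ?thesis using assms(2) by (auto simp: fun_eq_iff)
qed

lemma pow_hom_sum: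
  assumes M: "left_module R M" and N: "left_module R N" and \<Phi>: "\<Phi> \<in> left_hom R (pow_module M m) N"
    and x: "x \<in> carrier (pow_module M m)"
  shows "\<Phi> x = (\<Oplus>\<^bsub>N\<^esub>j\<in>{..<m}. \<Phi> (pow_incl M j (x j)))"
proof -
  have "\<Phi> x = \<Phi> (\<Oplus>\<^bsub>pow_module M m\<^esub>j\<in>{..<m}. pow_incl M j (x j))"
    using pow_module_decompose[OF M x] by simp
  also have "\<dots> = (\<Oplus>\<^bsub>N\<^esub>j\<in>{..<m}. \<Phi> (pow_incl M j (x j)))"
    using x by (intro left_hom_finsum[OF \<Phi> left_module_pow[OF M] N])
      (auto intro!: left_hom_closed[OF pow_incl_hom[OF M]])
  finally show ?thesis .
qed

lemma pow_hom_eq: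
  assumes M: "left_module R M" and N: "left_module R N"
    and \<Phi>: "\<Phi> \<in> left_hom R (pow_module M m) N" and \<Psi>: "\<Psi> \<in> left_hom R (pow_module M m) N"
    and eq: "\<And>j x. \<lbrakk>j < m; x \<in> carrier M\<rbrakk> \<Longrightarrow> \<Phi> (pow_incl M j x) = \<Psi> (pow_incl M j x)"
    and x: "x \<in> carrier (pow_module M m)"
  shows "\<Phi> x = \<Psi> x"
proof -
  interpret N: left_module R N by fact
  show ?thesis
    unfolding pow_hom_sum[OF M N \<Phi> x] pow_hom_sum[OF M N \<Psi> x]
    using x eq left_hom_closed[OF \<Psi>] left_hom_closed[OF pow_incl_hom[OF M]]
    by (intro N.M.finsum_cong') (auto simp del: pow_module_simps(1) dest: pow_module_simps(1)[THEN iffD1])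
qed

text \<open>The map is the sum of the \<open>g k\<close> after the coordinate projections,
  accumulated one \<open>k\<close> at a time.\<close>

lemma pow_hom_of_components:
  assumes M: "left_module R M" and N: "left_module R N"
    and g: "\<And>j. j < m \<Longrightarrow> g j \<in> left_hom R M N"
  shows "\<exists>\<Phi>\<in>left_hom R (pow_module M m) N. \<forall>j<m. \<forall>x\<in>carrier M. \<Phi> (pow_incl M j x) = g j x"
proof -
  interpret M: left_module R M by fact
  interpret N: left_module R N by fact
  have 0: "g j \<zero>\<^bsub>M\<^esub> = \<zero>\<^bsub>N\<^esub>" if "j < m" for j using left_hom_zero[OF g[OF that] M N] .
  have "\<exists>\<Phi>\<in>left_hom R (pow_module M m) N. \<forall>j<m. \<forall>x\<in>carrier M.
      \<Phi> (pow_incl M j x) = (if j < k then g j x else \<zero>\<^bsub>N\<^esub>)" if "k \<le> m" for k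
    using that
  proof (induction k)
    case 0
    then show ?case using left_hom_const_zero[OF N] by (intro bexI[where x = "\<lambda>_. \<zero>\<^bsub>N\<^esub>"]) auto
  next
    case (Suc k)
    then have k: "k < m" by simp
    then obtain \<Phi> where \<Phi>: "\<Phi> \<in> left_hom R (pow_module M m) N"
      "\<And>j x. \<lbrakk>j < m; x \<in> carrier M\<rbrakk> \<Longrightarrow> \<Phi> (pow_incl M j x) = (if j < k then g j x else \<zero>\<^bsub>N\<^esub>)"
      using Suc.IH by auto
    have "(\<lambda>x. \<Phi> x \<oplus>\<^bsub>N\<^esub> g k (x k)) \<in> left_hom R (pow_module M m) N"
      by (intro left_hom_plus N \<Phi> left_hom_compose[OF pow_proj_hom g[OF k]])
    moreover have "\<Phi> (pow_incl M j x) \<oplus>\<^bsub>N\<^esub> g k (pow_incl M j x k) = (if j < Suc k then g j x else \<zero>\<^bsub>N\<^esub>)"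
      if "j < m" "x \<in> carrier M" for j x
      using that k \<Phi>(2)[OF that] 0 left_hom_closed[OF g that(2)] by (auto simp: pow_incl_def less_Suc_eq)
    ultimately show ?case by (intro bexI[where x = "\<lambda>x. \<Phi> x \<oplus>\<^bsub>N\<^esub> g k (x k)"]) auto
  qed
  from this[of m] show ?thesis by auto
qed

section \<open>Acyclicity\<close>

text \<open>One resolution by finitely generated free modules witnesses vanishing in all positive
  degrees; by \<open>ext_van_compare\<close> any other one does too. The existence of such a
  resolution is part of the notion.\<close>

definition ext_acyclic ::
  "('r, 'e) ring_scheme \<Rightarrow> ('r, 'u, 'x) module_scheme \<Rightarrow> ('r, 'm, 'y) module_scheme \<Rightarrow> bool" where
  "ext_acyclic R U M \<longleftrightarrow> (\<exists>(F :: nat \<Rightarrow> ('r, nat \<Rightarrow> 'r) module) \<delta> \<epsilon>.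
     resolution R F \<delta> \<epsilon> U \<and> (\<forall>i. fg_free R (F i)) \<and> (\<forall>t. ext_van R F \<delta> M t))"

lemma ext_acyclicI:
  fixes R :: "('r, 'e) ring_scheme"
  assumes "resolution R P \<delta> \<epsilon> U" "\<And>i. fg_free R (P i)" "left_module R M" "\<And>t. ext_van R P \<delta> M t"
  shows "ext_acyclic R U M"
proof -
  obtain F :: "nat \<Rightarrow> ('r, nat \<Rightarrow> 'r) module" and \<delta>' \<eta> where F: "resolution R F \<delta>' \<eta> U" "\<And>i. fg_free R (F i)"
    using finitely_presentedE[OF finitely_presentedI[OF assms(1,2)]] by blast
  have "ext_van R F \<delta>' M t" for t
    by (rule ext_van_compare[OF F(1) assms(1) fg_free_projective[OF F(2)] fg_free_projective[OF assms(2)] assms(3,4)])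
  with F show ?thesis unfolding ext_acyclic_def by blast
qed

lemma ext_acyclicE:
  fixes R :: "('r, 'e) ring_scheme"
  assumes "ext_acyclic R U M"
  obtains F :: "nat \<Rightarrow> ('r, nat \<Rightarrow> 'r) module" and \<delta> \<epsilon>
  where "resolution R F \<delta> \<epsilon> U" "\<And>i. fg_free R (F i)" "\<And>t. ext_van R F \<delta> M t"
  using assms unfolding ext_acyclic_def by blast

lemma ext_acyclic_iso:
  fixes R :: "('r, 'e) ring_scheme"
  assumes "ext_acyclic R U M" "left_module R M" "left_module R V" "module_iso R U V"
  shows "ext_acyclic R V M"
proof -
  obtain u where u: "u \<in> left_hom R U V" "bij_betw u (carrier U) (carrier V)"
    using assms(4) by (auto simp: module_iso_def)
  obtain F :: "nat \<Rightarrow> ('r, nat \<Rightarrow> 'r) module" and \<delta> \<epsilon>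
    where "resolution R F \<delta> \<epsilon> U" "\<And>i. fg_free R (F i)" "\<And>t. ext_van R F \<delta> M t"
    using ext_acyclicE[OF assms(1)] by blast
  then show ?thesis by (intro ext_acyclicI[OF resolution_iso[OF _ assms(3) u]] assms(2))
qed

lemma ext_acyclic_direct_sum:
  fixes R :: "('r, 'e) ring_scheme"
  assumes "ext_acyclic R U M" "ext_acyclic R V M" "left_module R M"
  shows "ext_acyclic R (direct_sum U V) M"
proof -
  obtain F :: "nat \<Rightarrow> ('r, nat \<Rightarrow> 'r) module" and \<delta> \<epsilon>
    where F: "resolution R F \<delta> \<epsilon> U" "\<And>i. fg_free R (F i)" "\<And>t. ext_van R F \<delta> M t"
    using ext_acyclicE[OF assms(1)] by blast
  obtain G :: "nat \<Rightarrow> ('r, nat \<Rightarrow> 'r) module" and \<delta>' \<eta>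
    where G: "resolution R G \<delta>' \<eta> V" "\<And>i. fg_free R (G i)" "\<And>t. ext_van R G \<delta>' M t"
    using ext_acyclicE[OF assms(2)] by blast
  interpret F: resolution R F \<delta> \<epsilon> U by fact
  interpret G: resolution R G \<delta>' \<eta> V by fact
  show ?thesis
    by (rule ext_acyclicI[OF resolution_direct_sum[OF F(1) G(1)] fg_free_direct_sum[OF F(2) G(2)] assms(3)
        ext_van_direct_sum[OF assms(3) F.modules F.modules F.modules G.modules G.modules G.modules
          F.diff G.diff F(3) G(3)]])
qed

lemma resolution_zero:
  assumes "left_module R U" "carrier U = {\<zero>\<^bsub>U\<^esub>}"
  shows "resolution R (\<lambda>i. free_module R {..<0::nat}) (\<lambda>_ x. x) (\<lambda>_. \<zero>\<^bsub>U\<^esub>) U"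
proof -
  have R: "ring R" by (rule left_module_ring[OF assms(1)])
  interpret ring R by fact
  have c: "carrier (free_module R ({} :: nat set)) = {\<lambda>_. \<zero>\<^bsub>R\<^esub>}" by (auto simp: free_module_carrier)
  show ?thesis
    by (rule resolutionI) (auto simp: assms(2) c intro!: assms(1) left_module_free R left_hom_const_zero left_hom_id)
qed

lemma ext_acyclic_pow:
  assumes M: "left_module R M" and N: "left_module R N" and "ext_acyclic R M N"
  shows "ext_acyclic R (pow_module M m) N"
proof (induction m)
  case 0
  interpret N: left_module R N by fact
  have R: "ring R" by (rule left_module_ring[OF M])
  interpret R: ring R by (rule R)
  interpret M: left_module R M by fact
  have "carrier (pow_module M 0) = {\<zero>\<^bsub>pow_module M 0\<^esub>}"
    by (auto simp: set_eq_iff fun_eq_iff)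
  note res = resolution_zero[OF left_module_pow[OF M] this]
  have c: "carrier (free_module R ({} :: nat set)) = {\<lambda>_. \<zero>\<^bsub>R\<^esub>}"
    by (auto simp: free_module_carrier)
  have "ext_van R (\<lambda>i. free_module R {..<0::nat}) (\<lambda>_ x. x) N t" for t
    unfolding ext_van_def using left_hom_const_zero[OF N]
    by (auto simp: c intro!: bexI[where x = "\<lambda>_. \<zero>\<^bsub>N\<^esub>"])
  then show ?case by (rule ext_acyclicI[OF res fg_free_free_module[OF R] N])
next
  case (Suc m)
  show ?case
    by (rule ext_acyclic_iso[OF ext_acyclic_direct_sum[OF Suc assms(3) N] N left_module_pow[OF M]
        pow_module_Suc_iso[OF M]])
qed

lemma finitely_presented_pow:
  assumes M: "left_module R M" and "finitely_presented R \<infinity> M"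
  shows "finitely_presented R \<infinity> (pow_module M m)"
proof (induction m)
  case 0
  interpret M: left_module R M by fact
  have "carrier (pow_module M 0) = {\<zero>\<^bsub>pow_module M 0\<^esub>}"
    by (auto simp: set_eq_iff fun_eq_iff)
  from resolution_zero[OF left_module_pow[OF M] this] show ?case
    by (rule finitely_presentedI) (intro fg_free_free_module left_module_ring[OF M])
next
  case (Suc m)
  show ?case
    by (rule finitely_presented_iso[OF finitely_presented_direct_sum[OF Suc assms(2)] left_module_pow[OF M]
        pow_module_Suc_iso[OF M]])
qed

section \<open>The dual of a resolution of a bimodule\<close>

text \<open>Both sides of a bimodule are treated alike: it is given as a left module \<open>K\<close> over \<open>T\<close> and a left
  module \<open>K'\<close> over \<open>L\<close> with the same underlying group and commuting actions. The module \<open>X i\<close> is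
  \<open>Hom\<^sub>L(L\<^sup>m\<^sup>i, K') = K\<^sup>m\<^sup>i\<close>, and \<open>Z i\<close> is the \<open>i\<close>-th module of cocycles, so that \<open>Z 0\<close> is \<open>T\<close>.\<close>

locale dual_resolution =
  K: left_module T K + res: resolution L "\<lambda>i. free_module L {..<m i}" \<delta> \<epsilon> K'
  for T :: "('t, 'e) ring_scheme" and K :: "('t, 'k, 'x) module_scheme"
    and L :: "('l, 'f) ring_scheme" and m :: "nat \<Rightarrow> nat" and \<delta> \<epsilon> and K' :: "('l, 'k, 'y) module_scheme" +
  assumes carrier_eq: "carrier K' = carrier K" and add_eq: "ring.add K' = ring.add K"
    and zero_eq: "\<zero>\<^bsub>K'\<^esub> = \<zero>\<^bsub>K\<^esub>"
    and comm: "\<And>t l x. \<lbrakk>t \<in> carrier T; l \<in> carrier L; x \<in> carrier K\<rbrakk> \<Longrightarrow>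
      t \<odot>\<^bsub>K\<^esub> (l \<odot>\<^bsub>K'\<^esub> x) = l \<odot>\<^bsub>K'\<^esub> (t \<odot>\<^bsub>K\<^esub> x)"
    and homothety_surj: "\<And>f. f \<in> left_hom L K' K' \<Longrightarrow> \<exists>t\<in>carrier T. \<forall>x\<in>carrier K. f x = t \<odot>\<^bsub>K\<^esub> x"
    and homothety_inj: "\<And>t. \<lbrakk>t \<in> carrier T; \<forall>x\<in>carrier K. t \<odot>\<^bsub>K\<^esub> x = \<zero>\<^bsub>K\<^esub>\<rbrakk> \<Longrightarrow> t = \<zero>\<^bsub>T\<^esub>"
    and self_van: "\<And>t. ext_van L (\<lambda>i. free_module L {..<m i}) \<delta> K' t"
    and K_fp: "finitely_presented T \<infinity> K"
begin

lemma L_ring: "ring L" by (rule left_module_ring[OF res.target])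

lemma T_ring: "ring T" by (rule left_module_ring[OF K.left_module_axioms])

definition X :: "nat \<Rightarrow> ('t, nat \<Rightarrow> 'k) module" where
  "X i = pow_module K (m i)"

text \<open>A tuple \<open>x\<close> stands for the homomorphism \<open>linear_ext L K' x\<close>.
  In these terms \<open>d i\<close> is precomposition with \<open>\<delta> i\<close>, read off at
  the basis vectors.\<close>

definition d :: "nat \<Rightarrow> (nat \<Rightarrow> 'k) \<Rightarrow> nat \<Rightarrow> 'k" where
  "d i x = (\<lambda>l. if l < m (Suc i) then linear_ext L K' x (\<delta> i (unit_vec L l)) else \<zero>\<^bsub>K\<^esub>)"

text \<open>The tuple that corresponds to the augmentation: a finite generating tuple of
  \<open>K'\<close> over \<open>L\<close>. It becomes the image of \<open>1\<close> under the
  isomorphism of \<open>T\<close> with \<open>Z 0\<close>.\<close>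

definition kk :: "nat \<Rightarrow> 'k" where
  "kk = (\<lambda>l. if l < m 0 then \<epsilon> (unit_vec L l) else \<zero>\<^bsub>K\<^esub>)"

definition Z :: "nat \<Rightarrow> ('t, nat \<Rightarrow> 'k) module" where
  "Z i = X i\<lparr>carrier := {x \<in> carrier (X i). d i x = \<zero>\<^bsub>X (Suc i)\<^esub>}\<rparr>"

section \<open>Exactness of the dual complex\<close>

lemma X_module: "left_module T (X i)"
  unfolding X_def by (rule left_module_pow[OF K.left_module_axioms])

lemma tuple: "x \<in> carrier (X i) \<Longrightarrow> x \<in> {..<m i} \<rightarrow> carrier K'"
  by (auto simp: X_def carrier_eq)

lemma tuple_hom: "x \<in> carrier (X i) \<Longrightarrow> linear_ext L K' x \<in> left_hom L (free_module L {..<m i}) K'"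
  by (rule linear_ext_hom[OF res.target tuple])

lemma tuple_unit: "\<lbrakk>x \<in> carrier (X i); l < m i\<rbrakk> \<Longrightarrow> linear_ext L K' x (unit_vec L l) = x l"
  by (rule linear_ext_unit_vec[OF res.target tuple]) simp_all

lemma unit_free: "l < k \<Longrightarrow> unit_vec L l \<in> carrier (free_module L {..<k})"
  by (rule unit_vec_closed[OF L_ring]) simp

lemma tuple_add:
  assumes "x \<in> carrier (X i)" "y \<in> carrier (X i)" "p \<in> carrier (free_module L {..<m i})"
  shows "linear_ext L K' (x \<oplus>\<^bsub>X i\<^esub> y) p = linear_ext L K' x p \<oplus>\<^bsub>K\<^esub> linear_ext L K' y p"
proof -
  interpret X: left_module T "X i" by (rule X_module)
  have "linear_ext L K' (x \<oplus>\<^bsub>X i\<^esub> y) p = linear_ext L K' x p \<oplus>\<^bsub>K'\<^esub> linear_ext L K' y p"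
    by (rule free_hom_eq[OF res.target tuple_hom[OF X.M.a_closed[OF assms(1,2)]]
          left_hom_plus[OF res.target tuple_hom[OF assms(1)] tuple_hom[OF assms(2)]] _ assms(3)])
      (use assms in \<open>simp add: tuple_unit tuple_unit[OF X.M.a_closed[OF assms(1,2)]], simp add: X_def add_eq\<close>)
  then show ?thesis by (simp add: add_eq)
qed

lemma act_hom: "t \<in> carrier T \<Longrightarrow> (\<lambda>x. t \<odot>\<^bsub>K\<^esub> x) \<in> left_hom L K' K'"
  by (intro left_homI) (auto simp: carrier_eq add_eq K.smult_r_distr comm)

lemma act_hom': "l \<in> carrier L \<Longrightarrow> (\<lambda>x. l \<odot>\<^bsub>K'\<^esub> x) \<in> left_hom T K K"
proof -
  interpret K': left_module L K' by (rule res.target)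
  show "l \<in> carrier L \<Longrightarrow> (\<lambda>x. l \<odot>\<^bsub>K'\<^esub> x) \<in> left_hom T K K"
    using K'.smult_closed K'.smult_r_distr by (intro left_homI) (auto simp: carrier_eq add_eq comm)
qed

lemma tuple_smult:
  assumes "t \<in> carrier T" "x \<in> carrier (X i)" "p \<in> carrier (free_module L {..<m i})"
  shows "linear_ext L K' (t \<odot>\<^bsub>X i\<^esub> x) p = t \<odot>\<^bsub>K\<^esub> linear_ext L K' x p"
proof -
  interpret X: left_module T "X i" by (rule X_module)
  show ?thesis
    by (rule free_hom_eq[OF res.target tuple_hom[OF X.smult_closed[OF assms(1,2)]]
          left_hom_compose[OF tuple_hom[OF assms(2)] act_hom[OF assms(1)]] _ assms(3)])
      (use assms in \<open>simp add: tuple_unit tuple_unit[OF X.smult_closed[OF assms(1,2)]], simp add: X_def\<close>)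
qed

lemma tuple_closed:
  "\<lbrakk>x \<in> carrier (X i); p \<in> carrier (free_module L {..<m i})\<rbrakk> \<Longrightarrow> linear_ext L K' x p \<in> carrier K"
  using left_hom_closed[OF tuple_hom] by (simp add: carrier_eq)

lemma diff_unit_closed: "l < m (Suc i) \<Longrightarrow> \<delta> i (unit_vec L l) \<in> carrier (free_module L {..<m i})"
  by (rule left_hom_closed[OF res.diff unit_free])

lemma d_hom: "d i \<in> left_hom T (X i) (X (Suc i))"
proof (rule left_homI)
  fix x y assume x: "x \<in> carrier (X i)" and y: "y \<in> carrier (X i)"
  show "d i x \<in> carrier (X (Suc i))"
    using tuple_closed[OF x diff_unit_closed] by (auto simp: d_def X_def)
  show "d i (x \<oplus>\<^bsub>X i\<^esub> y) = d i x \<oplus>\<^bsub>X (Suc i)\<^esub> d i y"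
    unfolding d_def using tuple_add[OF x y diff_unit_closed] by (auto simp: X_def fun_eq_iff)
next
  fix t x assume t: "t \<in> carrier T" and x: "x \<in> carrier (X i)"
  show "d i (t \<odot>\<^bsub>X i\<^esub> x) = t \<odot>\<^bsub>X (Suc i)\<^esub> d i x"
    unfolding d_def using tuple_smult[OF t x diff_unit_closed] t by (auto simp: X_def fun_eq_iff)
qed

lemma d_tuple:
  assumes x: "x \<in> carrier (X i)" and "p \<in> carrier (free_module L {..<m (Suc i)})"
  shows "linear_ext L K' (d i x) p = linear_ext L K' x (\<delta> i p)"
proof (rule free_hom_eq[OF res.target tuple_hom[OF left_hom_closed[OF d_hom x]]
      left_hom_compose[OF res.diff tuple_hom[OF x]] _ assms(2)])
  fix l assume "l \<in> {..<m (Suc i)}"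
  then show "linear_ext L K' (d i x) (unit_vec L l) = linear_ext L K' x (\<delta> i (unit_vec L l))"
    using tuple_unit[OF left_hom_closed[OF d_hom x]] by (simp add: d_def)
qed

lemma d_eq_zero_iff:
  assumes x: "x \<in> carrier (X i)"
  shows "d i x = \<zero>\<^bsub>X (Suc i)\<^esub> \<longleftrightarrow> (\<forall>p\<in>carrier (free_module L {..<m (Suc i)}). linear_ext L K' x (\<delta> i p) = \<zero>\<^bsub>K\<^esub>)"
proof
  interpret K': left_module L K' by (rule res.target)
  assume *: "d i x = \<zero>\<^bsub>X (Suc i)\<^esub>"
  show "\<forall>p\<in>carrier (free_module L {..<m (Suc i)}). linear_ext L K' x (\<delta> i p) = \<zero>\<^bsub>K\<^esub>"
  proof
    fix p assume p: "p \<in> carrier (free_module L {..<m (Suc i)})"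
    have "linear_ext L K' x (\<delta> i p) = \<zero>\<^bsub>K'\<^esub>"
    proof (rule free_hom_eq[OF res.target left_hom_compose[OF res.diff tuple_hom[OF x]] left_hom_const_zero[OF res.target] _ p])
      fix l assume "l \<in> {..<m (Suc i)}"
      then show "linear_ext L K' x (\<delta> i (unit_vec L l)) = \<zero>\<^bsub>K'\<^esub>"
        using fun_cong[OF *, of l] by (simp add: d_def X_def zero_eq)
    qed
    then show "linear_ext L K' x (\<delta> i p) = \<zero>\<^bsub>K\<^esub>" by (simp add: zero_eq)
  qed
next
  assume "\<forall>p\<in>carrier (free_module L {..<m (Suc i)}). linear_ext L K' x (\<delta> i p) = \<zero>\<^bsub>K\<^esub>"
  then show "d i x = \<zero>\<^bsub>X (Suc i)\<^esub>"
    using unit_free by (auto simp: d_def X_def fun_eq_iff)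
qed

lemma d_d: "x \<in> carrier (X i) \<Longrightarrow> d (Suc i) (d i x) = \<zero>\<^bsub>X (Suc (Suc i))\<^esub>"
  using d_eq_zero_iff[OF left_hom_closed[OF d_hom]] left_hom_closed[OF res.diff]
    left_hom_zero[OF tuple_hom left_module_free[OF L_ring] res.target]
  by (simp add: d_tuple res.diff_diff zero_eq)

lemma hom_tuple:
  assumes "\<phi> \<in> left_hom L (free_module L {..<m i}) K'"
  shows "\<exists>x\<in>carrier (X i). \<forall>p\<in>carrier (free_module L {..<m i}). \<phi> p = linear_ext L K' x p"
proof -
  let ?x = "\<lambda>l. if l < m i then \<phi> (unit_vec L l) else \<zero>\<^bsub>K\<^esub>"
  have x: "?x \<in> carrier (X i)"
    using left_hom_closed[OF assms unit_free] by (auto simp: X_def carrier_eq)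
  have "\<phi> p = linear_ext L K' ?x p" if "p \<in> carrier (free_module L {..<m i})" for p
    by (rule free_hom_eq[OF res.target assms tuple_hom[OF x] _ that]) (simp add: tuple_unit[OF x])
  with x show ?thesis by blast
qed

lemma tuple_eqI:
  assumes "x \<in> carrier (X i)" "y \<in> carrier (X i)"
    and "\<And>p. p \<in> carrier (free_module L {..<m i}) \<Longrightarrow> linear_ext L K' x p = linear_ext L K' y p"
  shows "x = y"
proof
  fix l
  show "x l = y l"
    using assms(1,2) assms(3)[OF unit_free, of l]
    by (cases "l < m i") (simp_all add: tuple_unit[OF assms(1)] tuple_unit[OF assms(2)], simp add: X_def)
qed

text \<open>For tuples read as homomorphisms, this is the vanishing of \<open>Ext(K', K')\<close> in
  positive degrees, as given by \<open>self_van\<close>.\<close>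

lemma d_exact:
  assumes x: "x \<in> carrier (X (Suc i))" "d (Suc i) x = \<zero>\<^bsub>X (Suc (Suc i))\<^esub>"
  shows "\<exists>y\<in>carrier (X i). d i y = x"
proof -
  have "\<forall>p\<in>carrier (free_module L {..<m (Suc (Suc i))}). linear_ext L K' x (\<delta> (Suc i) p) = \<zero>\<^bsub>K'\<^esub>"
    using x by (simp add: d_eq_zero_iff zero_eq)
  then obtain \<psi> where \<psi>: "\<psi> \<in> left_hom L (free_module L {..<m i}) K'"
    "\<And>p. p \<in> carrier (free_module L {..<m (Suc i)}) \<Longrightarrow> linear_ext L K' x p = \<psi> (\<delta> i p)"
    using self_van[of i, unfolded ext_van_def, THEN bspec, OF tuple_hom[OF x(1)]] by blast
  obtain y where y: "y \<in> carrier (X i)" "\<And>p. p \<in> carrier (free_module L {..<m i}) \<Longrightarrow> \<psi> p = linear_ext L K' y p"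
    using hom_tuple[OF \<psi>(1)] by blast
  have "d i y = x"
    by (rule tuple_eqI[OF left_hom_closed[OF d_hom y(1)] x(1)])
      (simp add: d_tuple[OF y(1)] \<psi>(2) y(2) left_hom_closed[OF res.diff])
  with y(1) show ?thesis by blast
qed

lemma kk_closed: "kk \<in> carrier (X 0)"
  using left_hom_closed[OF res.aug unit_free] by (auto simp: kk_def X_def carrier_eq)

lemma kk_tuple: "p \<in> carrier (free_module L {..<m 0}) \<Longrightarrow> linear_ext L K' kk p = \<epsilon> p"
  by (rule free_hom_eq[OF res.target tuple_hom[OF kk_closed] res.aug])
    (simp_all add: tuple_unit[OF kk_closed], simp add: kk_def)

lemma kk_generates: "x \<in> carrier K \<Longrightarrow> \<exists>p\<in>carrier (free_module L {..<m 0}). x = linear_ext L K' kk p"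
  using res.aug_surj kk_tuple by (auto simp: carrier_eq image_iff set_eq_iff; metis)

lemma d_kk: "t \<in> carrier T \<Longrightarrow> d 0 (t \<odot>\<^bsub>X 0\<^esub> kk) = \<zero>\<^bsub>X (Suc 0)\<^esub>"
  using left_module.smult_closed[OF X_module _ kk_closed] left_hom_closed[OF res.diff]
  by (simp add: d_eq_zero_iff tuple_smult[OF _ kk_closed] kk_tuple res.aug_diff zero_eq)

text \<open>A tuple killed by \<open>d 0\<close> is a homomorphism that vanishes on the relations
  between the generators. It descends to an endomorphism of \<open>K'\<close>, and surjectivity of
  the homothety map makes this multiplication by some \<open>t\<close>.\<close>

lemma d_0_exact:
  assumes x: "x \<in> carrier (X 0)" "d 0 x = \<zero>\<^bsub>X (Suc 0)\<^esub>"
  shows "\<exists>t\<in>carrier T. x = t \<odot>\<^bsub>X 0\<^esub> kk"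
proof -
  interpret K': left_module L K' by (rule res.target)
  interpret F: left_module L "free_module L {..<m 0}" by (rule left_module_free[OF L_ring])
  have xd: "linear_ext L K' x (\<delta> 0 p) = \<zero>\<^bsub>K'\<^esub>" if "p \<in> carrier (free_module L {..<m (Suc 0)})" for p
    using x that by (simp add: d_eq_zero_iff zero_eq)
  have well: "linear_ext L K' x p = linear_ext L K' x q"
    if pq: "p \<in> carrier (free_module L {..<m 0})" "q \<in> carrier (free_module L {..<m 0})" "\<epsilon> p = \<epsilon> q" for p q
  proof -
    have "\<epsilon> (p \<ominus>\<^bsub>free_module L {..<m 0}\<^esub> q) = \<zero>\<^bsub>K'\<^esub>"
      using pq by (simp add: left_hom_diff[OF res.aug res.modules res.target] K'.minus_eq_zero_iff left_hom_closed[OF res.aug])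
    then obtain r where "r \<in> carrier (free_module L {..<m (Suc 0)})" "\<delta> 0 r = p \<ominus>\<^bsub>free_module L {..<m 0}\<^esub> q"
      using res.exact_0[of "p \<ominus>\<^bsub>free_module L {..<m 0}\<^esub> q"] pq by auto
    with xd[of r] have "linear_ext L K' x p \<ominus>\<^bsub>K'\<^esub> linear_ext L K' x q = \<zero>\<^bsub>K'\<^esub>"
      using pq by (simp add: left_hom_diff[OF tuple_hom[OF x(1)] res.modules res.target])
    then show ?thesis using pq by (simp add: K'.minus_eq_zero_iff left_hom_closed[OF tuple_hom[OF x(1)]])
  qed
  define s where "s = inv_into (carrier (free_module L {..<m 0})) \<epsilon>"
  have s: "s y \<in> carrier (free_module L {..<m 0})" "\<epsilon> (s y) = y" if "y \<in> carrier K'" for y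
    unfolding s_def using that by (simp_all add: inv_into_into f_inv_into_f res.aug_surj)
  have "(\<lambda>y. linear_ext L K' x (s y)) \<in> left_hom L K' K'"
  proof (rule left_homI)
    fix y z assume yz: "y \<in> carrier K'" "z \<in> carrier K'"
    have "linear_ext L K' x (s (y \<oplus>\<^bsub>K'\<^esub> z)) = linear_ext L K' x (s y \<oplus>\<^bsub>free_module L {..<m 0}\<^esub> s z)"
      using yz s by (intro well F.M.a_closed) (simp_all only: left_hom_add[OF res.aug] K'.M.a_closed)
    then show "linear_ext L K' x (s (y \<oplus>\<^bsub>K'\<^esub> z)) = linear_ext L K' x (s y) \<oplus>\<^bsub>K'\<^esub> linear_ext L K' x (s z)"
      using yz s by (simp only: left_hom_add[OF tuple_hom[OF x(1)]])
  next
    fix r y assume ry: "r \<in> carrier L" "y \<in> carrier K'"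
    have "linear_ext L K' x (s (r \<odot>\<^bsub>K'\<^esub> y)) = linear_ext L K' x (r \<odot>\<^bsub>free_module L {..<m 0}\<^esub> s y)"
      using ry s by (intro well F.smult_closed) (simp_all only: left_hom_smult[OF res.aug] K'.smult_closed)
    then show "linear_ext L K' x (s (r \<odot>\<^bsub>K'\<^esub> y)) = r \<odot>\<^bsub>K'\<^esub> linear_ext L K' x (s y)"
      using ry s by (simp only: left_hom_smult[OF tuple_hom[OF x(1)]])
  qed (simp add: s left_hom_closed[OF tuple_hom[OF x(1)]])
  from homothety_surj[OF this] obtain t where t: "t \<in> carrier T"
    "\<And>y. y \<in> carrier K \<Longrightarrow> linear_ext L K' x (s y) = t \<odot>\<^bsub>K\<^esub> y" by blast
  have "x = t \<odot>\<^bsub>X 0\<^esub> kk"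
  proof (rule tuple_eqI[OF x(1) left_module.smult_closed[OF X_module t(1) kk_closed]])
    fix p assume p: "p \<in> carrier (free_module L {..<m 0})"
    have e: "\<epsilon> p \<in> carrier K'" by (rule left_hom_closed[OF res.aug p])
    have "linear_ext L K' x p = linear_ext L K' x (s (\<epsilon> p))"
      using p s[OF e] by (intro well) simp_all
    then show "linear_ext L K' x p = linear_ext L K' (t \<odot>\<^bsub>X 0\<^esub> kk) p"
      using e by (simp add: t tuple_smult[OF t(1) kk_closed p] kk_tuple p carrier_eq)
  qed
  with t(1) show ?thesis by blast
qed

text \<open>The entries of \<open>kk\<close> generate \<open>K'\<close> over \<open>L\<close>, whose
  action commutes with \<open>t\<close>. So \<open>t\<close> annihilates all of \<open>K\<close>,
  and the homothety map is injective.\<close>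

lemma kk_inj:
  assumes t: "t \<in> carrier T" "t \<odot>\<^bsub>X 0\<^esub> kk = \<zero>\<^bsub>X 0\<^esub>"
  shows "t = \<zero>\<^bsub>T\<^esub>"
proof (rule homothety_inj[OF t(1)])
  show "\<forall>x\<in>carrier K. t \<odot>\<^bsub>K\<^esub> x = \<zero>\<^bsub>K\<^esub>"
  proof
    fix x assume "x \<in> carrier K"
    then obtain p where p: "p \<in> carrier (free_module L {..<m 0})" "x = linear_ext L K' kk p"
      using kk_generates by blast
    interpret X: left_module T "X 0" by (rule X_module)
    have "t \<odot>\<^bsub>K\<^esub> x = linear_ext L K' \<zero>\<^bsub>X 0\<^esub> p"
      using p tuple_smult[OF t(1) kk_closed p(1)] t(2) by simp
    also have "\<dots> = \<zero>\<^bsub>K'\<^esub>"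
      by (rule free_hom_eq[OF res.target tuple_hom[OF X.M.zero_closed] left_hom_const_zero[OF res.target] _ p(1)])
        (simp add: tuple_unit[OF X.M.zero_closed], simp add: X_def zero_eq)
    finally show "t \<odot>\<^bsub>K\<^esub> x = \<zero>\<^bsub>K\<^esub>" by (simp add: zero_eq)
  qed
qed

section \<open>Modules of cocycles and their presentations\<close>

lemma Z_simps: "carrier (Z i) = {x \<in> carrier (X i). d i x = \<zero>\<^bsub>X (Suc i)\<^esub>}"
  "\<zero>\<^bsub>Z i\<^esub> = \<zero>\<^bsub>X i\<^esub>" "ring.add (Z i) = ring.add (X i)" "smult (Z i) = smult (X i)"
  by (simp_all add: Z_def)

lemma Z_module: "left_module T (Z i)"
proof -
  interpret X: left_module T "X i" by (rule X_module)
  interpret X': left_module T "X (Suc i)" by (rule X_module)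
  show ?thesis
    unfolding Z_def
    by (rule submodule[OF X_module])
      (auto simp: left_hom_zero[OF d_hom X_module X_module] left_hom_add[OF d_hom] left_hom_smult[OF d_hom])
qed

lemma Z_incl: "(\<lambda>x. x) \<in> left_hom T (Z i) (X i)"
  by (intro left_homI) (simp_all add: Z_simps)

lemma d_Z_hom: "d i \<in> left_hom T (X i) (Z (Suc i))"
  by (intro left_homI) (simp_all add: Z_simps left_hom_closed[OF d_hom] d_d left_hom_add[OF d_hom] left_hom_smult[OF d_hom])

lemma d_Z_surj: "d i ` carrier (X i) = carrier (Z (Suc i))"
  using left_hom_closed[OF d_Z_hom] d_exact by (fastforce simp: Z_simps)

lemma Z_0_iso: "(\<lambda>t. t \<odot>\<^bsub>X 0\<^esub> kk) ` carrier T = carrier (Z 0)"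
  "inj_on (\<lambda>t. t \<odot>\<^bsub>X 0\<^esub> kk) (carrier T)"
proof -
  interpret X: left_module T "X 0" by (rule X_module)
  interpret R: ring T by (rule T_ring)
  show "(\<lambda>t. t \<odot>\<^bsub>X 0\<^esub> kk) ` carrier T = carrier (Z 0)"
    using d_0_exact d_kk kk_closed by (auto simp: Z_simps)
  show "inj_on (\<lambda>t. t \<odot>\<^bsub>X 0\<^esub> kk) (carrier T)"
  proof (rule inj_onI)
    fix s t assume st: "s \<in> carrier T" "t \<in> carrier T" "s \<odot>\<^bsub>X 0\<^esub> kk = t \<odot>\<^bsub>X 0\<^esub> kk"
    have "(s \<ominus>\<^bsub>T\<^esub> t) \<odot>\<^bsub>X 0\<^esub> kk = \<zero>\<^bsub>X 0\<^esub>"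
      using st kk_closed by (simp add: a_minus_def X.smult_l_distr X.smult_l_minus X.M.r_neg)
    then have "s \<ominus>\<^bsub>T\<^esub> t = \<zero>\<^bsub>T\<^esub>" using st by (intro kk_inj) simp_all
    then show "s = t" by (rule abelian_group.eq_of_diff_eq_zero[OF ring.is_abelian_group[OF T_ring] st(1,2)])
  qed
qed

text \<open>\<open>Z 0\<close> is free of rank one on \<open>kk\<close>, so \<open>T\<close> in
  degree 0 and zero elsewhere is a resolution.\<close>

lemma Z_0_fp: "finitely_presented T \<infinity> (Z 0)"
proof -
  interpret R: ring T by (rule T_ring)
  interpret X: left_module T "X 0" by (rule X_module)
  let ?P = "\<lambda>i. free_module T {..<if i = 0 then 1 else 0 :: nat}"
  have c0: "p \<in> carrier (free_module T {..<Suc 0}) \<longleftrightarrow> (\<exists>t\<in>carrier T. p = (\<lambda>i. if i = 0 then t else \<zero>\<^bsub>T\<^esub>))" for p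
  proof
    assume p: "p \<in> carrier (free_module T {..<Suc 0})"
    then have "p = (\<lambda>i. if i = 0 then p 0 else \<zero>\<^bsub>T\<^esub>)" "p 0 \<in> carrier T"
      by (auto simp: free_module_carrier fun_eq_iff)
    then show "\<exists>t\<in>carrier T. p = (\<lambda>i. if i = 0 then t else \<zero>\<^bsub>T\<^esub>)" by blast
  qed (auto simp: free_module_carrier intro: finite_subset[of _ "{0}"])
  have c1: "carrier (free_module T ({} :: nat set)) = {\<lambda>_. \<zero>\<^bsub>T\<^esub>}" by (auto simp: free_module_carrier)
  have "resolution T ?P (\<lambda>_ x. x) (\<lambda>p. p 0 \<odot>\<^bsub>X 0\<^esub> kk) (Z 0)"
  proof (rule resolutionI[OF Z_module left_module_free[OF T_ring]])
    show "(\<lambda>p. p 0 \<odot>\<^bsub>X 0\<^esub> kk) \<in> left_hom T (?P 0) (Z 0)"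
      using kk_closed by (intro left_homI)
        (auto simp: Z_simps c0 d_kk X.smult_l_distr X.smult_assoc1)
    show "(\<lambda>x. x) \<in> left_hom T (?P (Suc i)) (?P i)" for i
      by (intro left_homI) (auto simp: c1 free_module_carrier)
    show "\<exists>p\<in>carrier (?P 0). p 0 \<odot>\<^bsub>X 0\<^esub> kk = z" if z: "z \<in> carrier (Z 0)" for z
    proof -
      obtain t where "t \<in> carrier T" "z = t \<odot>\<^bsub>X 0\<^esub> kk" using z unfolding Z_0_iso(1)[symmetric] by blast
      then show ?thesis by (intro bexI[where x = "\<lambda>i. if i = 0 then t else \<zero>\<^bsub>T\<^esub>"]) (auto simp: c0)
    qed
    show "\<exists>y\<in>carrier (?P (Suc 0)). y = p" if "p \<in> carrier (?P 0)" "p 0 \<odot>\<^bsub>X 0\<^esub> kk = \<zero>\<^bsub>Z 0\<^esub>" for p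
      using that kk_inj[of "p 0"] by (auto simp: c0 c1 Z_simps)
  qed (auto simp: c1 Z_simps kk_closed)
  then show ?thesis by (rule finitely_presentedI) (rule fg_free_free_module[OF T_ring])
qed

lemma X_fp: "finitely_presented T \<infinity> (X i)"
  unfolding X_def by (rule finitely_presented_pow[OF K.left_module_axioms K_fp])

text \<open>The sequence \<open>0 -> Z i -> X i -> Z (Suc i) -> 0\<close> is exact with
  \<open>d i\<close> as its projection; the chain map over the inclusion comes from
  \<open>lift_chain_map\<close>.\<close>

lemma Z_cone:
  assumes "resolution T P \<alpha> \<eta> (Z i)" "\<And>j. fg_free T (P j)"
    and "resolution T Q \<beta> \<theta> (X i)"
  shows "\<exists>f. cone_data T P \<alpha> \<eta> (Z i) Q \<beta> \<theta> (X i) (\<lambda>x. x) (d i) f (Z (Suc i))"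
proof -
  obtain f where f: "\<And>j. f j \<in> left_hom T (P j) (Q j)"
    "\<And>x. x \<in> carrier (P 0) \<Longrightarrow> \<theta> (f 0 x) = \<eta> x"
    "\<And>j x. x \<in> carrier (P (Suc j)) \<Longrightarrow> f j (\<alpha> j x) = \<beta> j (f (Suc j) x)"
    using lift_chain_map[OF assms(1,3) fg_free_projective[OF assms(2)] Z_incl] by blast
  have "cone_data T P \<alpha> \<eta> (Z i) Q \<beta> \<theta> (X i) (\<lambda>x. x) (d i) f (Z (Suc i))"
    by (intro cone_data.intro cone_data_axioms.intro assms Z_incl Z_module d_Z_hom d_Z_surj f)
      (auto simp: Z_simps)
  then show ?thesis by blast
qed

text \<open>The cone of finitely generated free resolutions of \<open>Z i\<close> and
  \<open>X i\<close> is such a resolution of \<open>Z (Suc i)\<close>.\<close>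

lemma Z_fp: "finitely_presented T \<infinity> (Z i)"
proof (induction i)
  case 0
  show ?case by (rule Z_0_fp)
next
  case (Suc i)
  obtain P :: "nat \<Rightarrow> ('t, nat \<Rightarrow> 't) module" and \<alpha> \<eta> where P: "resolution T P \<alpha> \<eta> (Z i)" "\<And>j. fg_free T (P j)"
    using finitely_presentedE[OF Suc] by blast
  obtain Q :: "nat \<Rightarrow> ('t, nat \<Rightarrow> 't) module" and \<beta> \<theta> where Q: "resolution T Q \<beta> \<theta> (X i)" "\<And>j. fg_free T (Q j)"
    using finitely_presentedE[OF X_fp] by blast
  obtain f where "cone_data T P \<alpha> \<eta> (Z i) Q \<beta> \<theta> (X i) (\<lambda>x. x) (d i) f (Z (Suc i))"
    using Z_cone[OF P Q(1)] by blast
  then interpret C: cone_data T P \<alpha> \<eta> "Z i" Q \<beta> \<theta> "X i" "\<lambda>x. x" "d i" f "Z (Suc i)" .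
  show ?case by (rule finitely_presentedI[OF C.resolution_cone C.fg_free_cone[OF P(2) Q(2)]])
qed

end

section \<open>Extending homomorphisms from cocycles\<close>

context dual_resolution
begin

text \<open>\<open>Ext\<close> of the powers \<open>X i\<close> into \<open>I\<close> vanishes in
  positive degrees, so vanishing for \<open>Z (Suc i)\<close> one degree higher gives vanishing for
  \<open>Z i\<close>. After enough passages the degree reaches \<open>D\<close>, where vanishing is
  assumed for every \<open>Z i\<close>.\<close>

lemma Z_ext_van:
  fixes P :: "nat \<Rightarrow> ('t, nat \<Rightarrow> 't) module"
  assumes I: "left_module T I" and acyclic: "ext_acyclic T K I"
    and van: "\<And>(P :: nat \<Rightarrow> ('t, nat \<Rightarrow> 't) module) \<alpha> \<eta> i t.
      \<lbrakk>resolution T P \<alpha> \<eta> (Z i); \<And>j. fg_free T (P j); t \<ge> D\<rbrakk> \<Longrightarrow> ext_van T P \<alpha> I t"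
    and "resolution T P \<alpha> \<eta> (Z i)" "\<And>j. fg_free T (P j)"
  shows "ext_van T P \<alpha> I t"
proof -
  \<comment> \<open>\<open>s\<close> bounds how far \<open>t\<close> lies below \<open>D\<close>.
    The quantifiers over \<open>i\<close> and over resolutions are inside the induction because the
    step changes both.\<close>
  have "\<forall>(P :: nat \<Rightarrow> ('t, nat \<Rightarrow> 't) module) \<alpha> \<eta> i t. resolution T P \<alpha> \<eta> (Z i) \<longrightarrow> (\<forall>j. fg_free T (P j)) \<longrightarrow>
      t + s \<ge> D \<longrightarrow> ext_van T P \<alpha> I t" for s
  proof (induction s)
    case 0
    then show ?case using van by simp
  next
    case (Suc s)
    show ?case
    proof (intro allI impI)
      fix P :: "nat \<Rightarrow> ('t, nat \<Rightarrow> 't) module" and \<alpha> \<eta> i t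
      assume P: "resolution T P \<alpha> \<eta> (Z i)" and fgP: "\<forall>j. fg_free T (P j)" and t: "D \<le> t + Suc s"
      obtain Q :: "nat \<Rightarrow> ('t, nat \<Rightarrow> 't) module" and \<beta> \<theta>
        where Q: "resolution T Q \<beta> \<theta> (X i)" "\<And>j. fg_free T (Q j)" "\<And>t. ext_van T Q \<beta> I t"
        using ext_acyclicE[OF ext_acyclic_pow[OF K.left_module_axioms I acyclic, of "m i", folded X_def]] by blast
      obtain f where "cone_data T P \<alpha> \<eta> (Z i) Q \<beta> \<theta> (X i) (\<lambda>x. x) (d i) f (Z (Suc i))"
        using Z_cone[OF P _ Q(1)] fgP by blast
      then interpret C: cone_data T P \<alpha> \<eta> "Z i" Q \<beta> \<theta> "X i" "\<lambda>x. x" "d i" f "Z (Suc i)" .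
      have fg: "fg_free T (C.G j)" for j using fgP Q(2) by (intro C.fg_free_cone) auto
      obtain P' :: "nat \<Rightarrow> ('t, nat \<Rightarrow> 't) module" and \<alpha>' \<eta>'
        where P': "resolution T P' \<alpha>' \<eta>' (Z (Suc i))" "\<And>j. fg_free T (P' j)"
        using finitely_presentedE[OF Z_fp] by blast
      have "ext_van T P' \<alpha>' I (Suc t)" using Suc[rule_format, of P' \<alpha>' \<eta>' "Suc i" "Suc t"] P' t by simp
      from ext_van_compare[OF C.resolution_cone P'(1) fg_free_projective[OF fg] fg_free_projective[OF P'(2)] I this]
      show "ext_van T P \<alpha> I t" by (rule C.ext_van_cone_Suc[OF I _ Q(3)])
    qed
  qed
  from this[of D] assms(4,5) show ?thesis by auto
qed

text \<open>The obstruction to extending lies in \<open>Ext^1(Z (Suc i), I)\<close>, which vanishes;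
  it is read off the cone resolving \<open>Z (Suc i)\<close>.\<close>

lemma Z_hom_extends:
  assumes I: "left_module T I" and acyclic: "ext_acyclic T K I"
    and van: "\<And>(P :: nat \<Rightarrow> ('t, nat \<Rightarrow> 't) module) \<alpha> \<eta> i t.
      \<lbrakk>resolution T P \<alpha> \<eta> (Z i); \<And>j. fg_free T (P j); t \<ge> D\<rbrakk> \<Longrightarrow> ext_van T P \<alpha> I t"
    and \<phi>: "\<phi> \<in> left_hom T (Z i) I"
  shows "\<exists>\<chi>\<in>left_hom T (X i) I. \<forall>x\<in>carrier (Z i). \<chi> x = \<phi> x"
proof -
  obtain P :: "nat \<Rightarrow> ('t, nat \<Rightarrow> 't) module" and \<alpha> \<eta> where P: "resolution T P \<alpha> \<eta> (Z i)" "\<And>j. fg_free T (P j)"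
    using finitely_presentedE[OF Z_fp] by blast
  obtain Q :: "nat \<Rightarrow> ('t, nat \<Rightarrow> 't) module" and \<beta> \<theta> where Q: "resolution T Q \<beta> \<theta> (X i)" "\<And>j. fg_free T (Q j)"
    using finitely_presentedE[OF X_fp] by blast
  obtain f where "cone_data T P \<alpha> \<eta> (Z i) Q \<beta> \<theta> (X i) (\<lambda>x. x) (d i) f (Z (Suc i))"
    using Z_cone[OF P Q(1)] by blast
  then interpret C: cone_data T P \<alpha> \<eta> "Z i" Q \<beta> \<theta> "X i" "\<lambda>x. x" "d i" f "Z (Suc i)" .
  obtain P' :: "nat \<Rightarrow> ('t, nat \<Rightarrow> 't) module" and \<alpha>' \<eta>'
    where P': "resolution T P' \<alpha>' \<eta>' (Z (Suc i))" "\<And>j. fg_free T (P' j)"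
    using finitely_presentedE[OF Z_fp] by blast
  have "ext_van T P' \<alpha>' I 0" by (rule Z_ext_van[OF I acyclic van P'])
  from ext_van_compare[OF C.resolution_cone P'(1) fg_free_projective[OF C.fg_free_cone[OF P(2) Q(2)]]
      fg_free_projective[OF P'(2)] I this]
  show ?thesis using C.ext_van_cone_0[OF I _ \<phi>] by blast
qed

end

text \<open>\<open>extend\<close> is all that is retained of the homological hypotheses on
  \<open>I\<close>. From here on the argument is linear algebra with tuples.\<close>

locale dual_injective = dual_resolution T K L m \<delta> \<epsilon> K' + I: left_module T I
  for T :: "('t, 'e) ring_scheme" and K :: "('t, 'k, 'x) module_scheme"
    and L :: "('l, 'f) ring_scheme" and m \<delta> \<epsilon> and K' :: "('l, 'k, 'y) module_scheme"
    and I :: "('t, 'i, 'z) module_scheme" +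
  assumes extend: "\<And>i \<phi>. \<phi> \<in> left_hom T (Z i) I \<Longrightarrow> \<exists>\<chi>\<in>left_hom T (X i) I. \<forall>x\<in>carrier (Z i). \<chi> x = \<phi> x"
begin

text \<open>The submodules of \<open>Hom\<^sub>T(K, I)\<close> over \<open>L\<close>, with functions identified if they agree on \<open>K\<close>.\<close>

definition hom_submodule :: "('k \<Rightarrow> 'i) set \<Rightarrow> bool" where
  "hom_submodule A \<longleftrightarrow> A \<subseteq> left_hom T K I \<and> (\<lambda>_. \<zero>\<^bsub>I\<^esub>) \<in> A \<and>
     (\<forall>f\<in>A. \<forall>g\<in>A. (\<lambda>x. f x \<oplus>\<^bsub>I\<^esub> g x) \<in> A) \<and>
     (\<forall>f\<in>A. \<forall>l\<in>carrier L. (\<lambda>x. f (l \<odot>\<^bsub>K'\<^esub> x)) \<in> A) \<and>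
     (\<forall>f\<in>A. \<forall>g. (\<forall>x\<in>carrier K. g x = f x) \<longrightarrow> g \<in> A)"

lemma hom_submoduleD:
  assumes "hom_submodule A"
  shows "f \<in> A \<Longrightarrow> f \<in> left_hom T K I" "(\<lambda>_. \<zero>\<^bsub>I\<^esub>) \<in> A"
    "\<lbrakk>f \<in> A; g \<in> A\<rbrakk> \<Longrightarrow> (\<lambda>x. f x \<oplus>\<^bsub>I\<^esub> g x) \<in> A"
    "\<lbrakk>f \<in> A; l \<in> carrier L\<rbrakk> \<Longrightarrow> (\<lambda>x. f (l \<odot>\<^bsub>K'\<^esub> x)) \<in> A"
    "\<lbrakk>f \<in> A; \<And>x. x \<in> carrier K \<Longrightarrow> g x = f x\<rbrakk> \<Longrightarrow> g \<in> A"
  using assms by (auto simp: hom_submodule_def)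

text \<open>The scalar \<open>- 1\<close> of \<open>L\<close>, acting on the argument of
  \<open>f\<close>, provides the negative, since \<open>f\<close> is additive.\<close>

lemma hom_submodule_uminus:
  assumes A: "hom_submodule A" and f: "f \<in> A"
  shows "(\<lambda>x. \<ominus>\<^bsub>I\<^esub> f x) \<in> A"
proof -
  interpret K': left_module L K' by (rule res.target)
  interpret L: ring L by (rule L_ring)
  have fh: "f \<in> left_hom T K I" by (rule hom_submoduleD(1)[OF A f])
  have neg: "(\<ominus>\<^bsub>L\<^esub> \<one>\<^bsub>L\<^esub>) \<odot>\<^bsub>K'\<^esub> x = \<ominus>\<^bsub>K\<^esub> x" if x: "x \<in> carrier K" for x
  proof -
    have "\<ominus>\<^bsub>K\<^esub> x = (\<ominus>\<^bsub>L\<^esub> \<one>\<^bsub>L\<^esub>) \<odot>\<^bsub>K'\<^esub> x"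
    proof (rule K.M.minus_equality)
      show "(\<ominus>\<^bsub>L\<^esub> \<one>\<^bsub>L\<^esub>) \<odot>\<^bsub>K'\<^esub> x \<oplus>\<^bsub>K\<^esub> x = \<zero>\<^bsub>K\<^esub>"
        using x K'.M.l_neg[of x] by (simp add: K'.smult_l_minus carrier_eq add_eq zero_eq)
      show "(\<ominus>\<^bsub>L\<^esub> \<one>\<^bsub>L\<^esub>) \<odot>\<^bsub>K'\<^esub> x \<in> carrier K"
        using x K'.smult_closed[of "\<ominus>\<^bsub>L\<^esub> \<one>\<^bsub>L\<^esub>" x] by (simp add: carrier_eq)
    qed (use x in simp)
    then show ?thesis by simp
  qed
  show ?thesis
    by (rule hom_submoduleD(5)[OF A hom_submoduleD(4)[OF A f, of "\<ominus>\<^bsub>L\<^esub> \<one>\<^bsub>L\<^esub>"]])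
      (simp_all add: neg left_hom_neg[OF fh K.left_module_axioms I.left_module_axioms])
qed

lemma hom_submodule_minus:
  assumes A: "hom_submodule A" and "f \<in> A" "g \<in> A"
  shows "(\<lambda>x. f x \<ominus>\<^bsub>I\<^esub> g x) \<in> A"
  unfolding a_minus_def by (intro hom_submoduleD(3)[OF A] hom_submodule_uminus[OF A] assms)

lemma hom_submodule_sum:
  assumes A: "hom_submodule A" and g: "\<And>l. l < k \<Longrightarrow> g l \<in> A"
  shows "(\<lambda>x. \<Oplus>\<^bsub>I\<^esub>l\<in>{..<k::nat}. g l x) \<in> A"
  using g
proof (induction k)
  case 0
  then show ?case using hom_submoduleD(2)[OF A] by simp
next
  case (Suc k)
  have "(\<lambda>x. g k x \<oplus>\<^bsub>I\<^esub> (\<Oplus>\<^bsub>I\<^esub>l\<in>{..<k}. g l x)) \<in> A"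
    using Suc by (intro hom_submoduleD(3)[OF A]) auto
  then show ?case
  proof (rule hom_submoduleD(5)[OF A])
    fix x assume x: "x \<in> carrier K"
    have "g l x \<in> carrier I" if "l < Suc k" for l
      using left_hom_closed[OF hom_submoduleD(1)[OF A Suc.prems[OF that]] x] .
    then show "(\<Oplus>\<^bsub>I\<^esub>l\<in>{..<Suc k}. g l x) = g k x \<oplus>\<^bsub>I\<^esub> (\<Oplus>\<^bsub>I\<^esub>l\<in>{..<k}. g l x)"
      unfolding lessThan_Suc by (intro I.M.finsum_insert) auto
  qed
qed

text \<open>
  A homomorphism \<open>\<Phi>: X 0 \<rightarrow> I\<close> is a tuple of homomorphisms \<open>K \<rightarrow> I\<close>. So \<open>value_span A\<close> is the submodule of \<open>I\<close>
  generated by the values of the elements of \<open>A\<close> at the components of \<open>kk\<close>.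
\<close>

definition components_in :: "('k \<Rightarrow> 'i) set \<Rightarrow> nat \<Rightarrow> ((nat \<Rightarrow> 'k) \<Rightarrow> 'i) \<Rightarrow> bool" where
  "components_in A i \<Phi> \<longleftrightarrow> \<Phi> \<in> left_hom T (X i) I \<and> (\<forall>j<m i. (\<lambda>y. \<Phi> (pow_incl K j y)) \<in> A)"

definition value_span :: "('k \<Rightarrow> 'i) set \<Rightarrow> 'i set" where
  "value_span A = {\<Phi> kk | \<Phi>. components_in A 0 \<Phi>}"

lemma incl_hom: "j < m i \<Longrightarrow> pow_incl K j \<in> left_hom T K (X i)"
  unfolding X_def by (rule pow_incl_hom[OF K.left_module_axioms])

lemma tuple_incl:
  assumes y: "y \<in> carrier K" and j: "j < m i" and p: "p \<in> carrier (free_module L {..<m i})"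
  shows "linear_ext L K' (pow_incl K j y) p = p j \<odot>\<^bsub>K'\<^esub> y"
proof (rule free_hom_eq[OF res.target tuple_hom[OF left_hom_closed[OF incl_hom[OF j] y]] _ _ p])
  interpret K': left_module L K' by (rule res.target)
  have y': "y \<in> carrier K'" using y by (simp add: carrier_eq)
  then show "(\<lambda>p. p j \<odot>\<^bsub>K'\<^esub> y) \<in> left_hom L (free_module L {..<m i}) K'"
    by (intro left_homI) (auto simp: free_module_carrier K'.smult_l_distr K'.smult_assoc1)
  fix b assume "b \<in> {..<m i}"
  then show "linear_ext L K' (pow_incl K j y) (unit_vec L b) = unit_vec L b j \<odot>\<^bsub>K'\<^esub> y"
    using y' by (simp add: tuple_unit[OF left_hom_closed[OF incl_hom[OF j] y]])
      (auto simp: pow_incl_def unit_vec_def zero_eq)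
qed

text \<open>Write \<open>x\<close> as a combination of the entries of \<open>kk\<close> with
  coefficients \<open>p\<close>. Forming this combination is a homomorphism from \<open>X 0\<close>
  to \<open>K\<close>; following it by \<open>f\<close> gives components that are \<open>f\<close>
  with its argument scaled by \<open>p j\<close>, and \<open>A\<close> is closed under such
  scaling.\<close>

lemma apply_in_span:
  assumes A: "hom_submodule A" and f: "f \<in> A" and x: "x \<in> carrier K"
  shows "f x \<in> value_span A"
proof -
  have fh: "f \<in> left_hom T K I" by (rule hom_submoduleD(1)[OF A f])
  obtain p where p: "p \<in> carrier (free_module L {..<m 0})" "x = linear_ext L K' kk p"
    using kk_generates[OF x] by blast
  have "(\<lambda>z. linear_ext L K' z p) \<in> left_hom T (X 0) K"
    by (intro left_homI) (simp_all add: tuple_closed tuple_add tuple_smult p)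
  note h = left_hom_compose[OF this fh]
  have "components_in A 0 (\<lambda>z. f (linear_ext L K' z p))"
    unfolding components_in_def
  proof (intro conjI h allI impI)
    fix j assume j: "j < m 0"
    have "p j \<in> carrier L" using p by (simp add: free_module_carrier)
    then show "(\<lambda>y. f (linear_ext L K' (pow_incl K j y) p)) \<in> A"
      by (intro hom_submoduleD(5)[OF A hom_submoduleD(4)[OF A f, of "p j"]]) (simp_all add: tuple_incl[OF _ j p(1)])
  qed
  then show ?thesis
    unfolding value_span_def by (intro CollectI exI[where x = "\<lambda>z. f (linear_ext L K' z p)"]) (simp add: p(2))
qed

lemma components_in_add:
  assumes A: "hom_submodule A" and "components_in A i \<Phi>" "components_in A i \<Psi>"
  shows "components_in A i (\<lambda>x. \<Phi> x \<oplus>\<^bsub>I\<^esub> \<Psi> x)"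
  using assms left_hom_plus[OF I.left_module_axioms] hom_submoduleD(3)[OF A] by (auto simp: components_in_def)

lemma value_span_add: "hom_submodule A \<Longrightarrow> x \<in> value_span A \<Longrightarrow> y \<in> value_span A \<Longrightarrow> x \<oplus>\<^bsub>I\<^esub> y \<in> value_span A"
  by (auto simp: value_span_def dest: components_in_add)

lemma value_span_zero: "hom_submodule A \<Longrightarrow> \<zero>\<^bsub>I\<^esub> \<in> value_span A"
  unfolding value_span_def components_in_def
  by (rule CollectI, rule exI[where x = "\<lambda>_. \<zero>\<^bsub>I\<^esub>"])
    (simp add: left_hom_const_zero[OF I.left_module_axioms] hom_submoduleD(2))

lemma value_span_closed: "hom_submodule A \<Longrightarrow> value_span A \<subseteq> carrier I"
  by (auto simp: value_span_def components_in_def intro: left_hom_closed[OF _ kk_closed])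

lemma value_span_sum:
  assumes A: "hom_submodule A" and "\<And>j. j < k \<Longrightarrow> g j \<in> value_span A"
  shows "(\<Oplus>\<^bsub>I\<^esub>j\<in>{..<k::nat}. g j) \<in> value_span A"
  using assms(2)
proof (induction k)
  case (Suc k)
  have "(\<Oplus>\<^bsub>I\<^esub>j\<in>{..<Suc k}. g j) = g k \<oplus>\<^bsub>I\<^esub> (\<Oplus>\<^bsub>I\<^esub>j\<in>{..<k}. g j)"
    unfolding lessThan_Suc using Suc.prems value_span_closed[OF A] by (intro I.M.finsum_insert) auto
  then show ?case using Suc value_span_add[OF A] by simp
qed (simp add: value_span_zero[OF A])

text \<open>Over a noncommutative \<open>T\<close> a multiple of a homomorphism need not be a
  homomorphism, so the scalar is moved inside: \<open>\<Phi>\<close> at \<open>t kk\<close> is a sum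
  of values of its components, each in the span by \<open>apply_in_span\<close>.\<close>

lemma value_span_smult:
  assumes A: "hom_submodule A" and t: "t \<in> carrier T" and x: "x \<in> value_span A"
  shows "t \<odot>\<^bsub>I\<^esub> x \<in> value_span A"
proof -
  interpret X: left_module T "X 0" by (rule X_module)
  obtain \<Phi> where \<Phi>: "components_in A 0 \<Phi>" "x = \<Phi> kk" using x by (auto simp: value_span_def)
  have \<Phi>h: "\<Phi> \<in> left_hom T (X 0) I" using \<Phi> by (simp add: components_in_def)
  have c: "t \<odot>\<^bsub>X 0\<^esub> kk \<in> carrier (X 0)" using t kk_closed by simp
  have "t \<odot>\<^bsub>I\<^esub> x = \<Phi> (t \<odot>\<^bsub>X 0\<^esub> kk)" using \<Phi> t kk_closed by (simp add: left_hom_smult[OF \<Phi>h])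
  also have "\<dots> = (\<Oplus>\<^bsub>I\<^esub>j\<in>{..<m 0}. \<Phi> (pow_incl K j ((t \<odot>\<^bsub>X 0\<^esub> kk) j)))"
    by (rule pow_hom_sum[OF K.left_module_axioms I.left_module_axioms \<Phi>h[unfolded X_def] c[unfolded X_def], folded X_def])
  also have "\<dots> \<in> value_span A"
    using c \<Phi> by (intro value_span_sum[OF A] apply_in_span[OF A]) (auto simp: components_in_def X_def)
  finally show ?thesis .
qed

lemma from_components:
  assumes "hom_submodule A" "\<And>j. j < m i \<Longrightarrow> g j \<in> A"
  shows "\<exists>\<Phi>. components_in A i \<Phi> \<and> (\<forall>j<m i. \<forall>y\<in>carrier K. \<Phi> (pow_incl K j y) = g j y)"
proof -
  obtain \<Phi> where \<Phi>: "\<Phi> \<in> left_hom T (X i) I" "\<And>j y. \<lbrakk>j < m i; y \<in> carrier K\<rbrakk> \<Longrightarrow> \<Phi> (pow_incl K j y) = g j y"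
    using pow_hom_of_components[OF K.left_module_axioms I.left_module_axioms, of "m i" g]
      hom_submoduleD(1)[OF assms] unfolding X_def by blast
  have "(\<lambda>y. \<Phi> (pow_incl K j y)) \<in> A" if "j < m i" for j
    by (rule hom_submoduleD(5)[OF assms(1) assms(2)[OF that] \<Phi>(2)[OF that]])
  with \<Phi> show ?thesis by (intro exI[of _ \<Phi>]) (simp add: components_in_def)
qed

lemma hom_X_eqI:
  assumes "\<Phi> \<in> left_hom T (X i) I" "\<Psi> \<in> left_hom T (X i) I" "x \<in> carrier (X i)"
    and "\<And>j y. \<lbrakk>j < m i; y \<in> carrier K\<rbrakk> \<Longrightarrow> \<Phi> (pow_incl K j y) = \<Psi> (pow_incl K j y)"
  shows "\<Phi> x = \<Psi> x"
  by (rule pow_hom_eq[OF K.left_module_axioms I.left_module_axioms assms(1,2)[unfolded X_def] _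
      assms(3)[unfolded X_def]]) (rule assms(4))

section \<open>Splitting \<open>I\<close> along a decomposition of \<open>Hom(K, I)\<close>\<close>

context
  fixes A B :: "('k \<Rightarrow> 'i) set"
  assumes A: "hom_submodule A" and B: "hom_submodule B"
    and decompose: "\<And>f. f \<in> left_hom T K I \<Longrightarrow> \<exists>a\<in>A. \<exists>b\<in>B. \<forall>x\<in>carrier K. f x = a x \<oplus>\<^bsub>I\<^esub> b x"
    and disjoint: "\<And>f x. \<lbrakk>f \<in> A; f \<in> B; x \<in> carrier K\<rbrakk> \<Longrightarrow> f x = \<zero>\<^bsub>I\<^esub>"
begin

lemma decompose_hom:
  assumes \<Phi>: "\<Phi> \<in> left_hom T (X i) I"
  shows "\<exists>\<Phi>A \<Phi>B. components_in A i \<Phi>A \<and> components_in B i \<Phi>B \<and>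
    (\<forall>x\<in>carrier (X i). \<Phi> x = \<Phi>A x \<oplus>\<^bsub>I\<^esub> \<Phi>B x)"
proof -
  have "\<forall>j. \<exists>a b. j < m i \<longrightarrow> a \<in> A \<and> b \<in> B \<and> (\<forall>y\<in>carrier K. \<Phi> (pow_incl K j y) = a y \<oplus>\<^bsub>I\<^esub> b y)"
    using decompose[OF left_hom_compose[OF incl_hom \<Phi>]] by blast
  then obtain a b where ab: "\<And>j. j < m i \<Longrightarrow> a j \<in> A" "\<And>j. j < m i \<Longrightarrow> b j \<in> B"
    "\<And>j y. \<lbrakk>j < m i; y \<in> carrier K\<rbrakk> \<Longrightarrow> \<Phi> (pow_incl K j y) = a j y \<oplus>\<^bsub>I\<^esub> b j y" by metis
  obtain \<Phi>A where \<Phi>A: "components_in A i \<Phi>A" "\<And>j y. \<lbrakk>j < m i; y \<in> carrier K\<rbrakk> \<Longrightarrow> \<Phi>A (pow_incl K j y) = a j y"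
    using from_components[OF A, of i a] ab(1) by blast
  obtain \<Phi>B where \<Phi>B: "components_in B i \<Phi>B" "\<And>j y. \<lbrakk>j < m i; y \<in> carrier K\<rbrakk> \<Longrightarrow> \<Phi>B (pow_incl K j y) = b j y"
    using from_components[OF B, of i b] ab(2) by blast
  have "\<Phi> x = \<Phi>A x \<oplus>\<^bsub>I\<^esub> \<Phi>B x" if x: "x \<in> carrier (X i)" for x
    using \<Phi>A \<Phi>B ab(3) by (intro hom_X_eqI[OF \<Phi> left_hom_plus[OF I.left_module_axioms] x])
      (auto simp: components_in_def)
  with \<Phi>A \<Phi>B show ?thesis by blast
qed

text \<open>\<open>Z 0\<close> is free on \<open>kk\<close>, so some homomorphism to
  \<open>I\<close> takes \<open>kk\<close> to \<open>i\<close>. It extends to \<open>X 0\<close>,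
  and splitting its components into parts from \<open>A\<close> and \<open>B\<close> splits
  \<open>i\<close>.\<close>

lemma value_span_sum_all:
  assumes i: "i \<in> carrier I"
  shows "\<exists>a\<in>value_span A. \<exists>b\<in>value_span B. i = a \<oplus>\<^bsub>I\<^esub> b"
proof -
  interpret X: left_module T "X 0" by (rule X_module)
  \<comment> \<open>The coordinate on \<open>Z 0\<close>: \<open>s z\<close> is the unique
    \<open>t\<close> for which \<open>z\<close> is \<open>t\<close> times \<open>kk\<close>.\<close>
  define s where "s = inv_into (carrier T) (\<lambda>t. t \<odot>\<^bsub>X 0\<^esub> kk)"
  have s: "s (t \<odot>\<^bsub>X 0\<^esub> kk) = t" if "t \<in> carrier T" for t
    unfolding s_def by (rule inv_into_f_f[OF Z_0_iso(2) that])
  have z: "\<exists>t\<in>carrier T. z = t \<odot>\<^bsub>X 0\<^esub> kk" if "z \<in> carrier (Z 0)" for z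
    using that unfolding Z_0_iso(1)[symmetric] by blast
  have "(\<lambda>z. s z \<odot>\<^bsub>I\<^esub> i) \<in> left_hom T (Z 0) I"
  proof (rule left_homI)
    fix z assume "z \<in> carrier (Z 0)"
    then obtain t where t: "t \<in> carrier T" "z = t \<odot>\<^bsub>X 0\<^esub> kk" using z by blast
    then show "s z \<odot>\<^bsub>I\<^esub> i \<in> carrier I" using i by (simp add: s)
    fix w assume "w \<in> carrier (Z 0)"
    then obtain u where u: "u \<in> carrier T" "w = u \<odot>\<^bsub>X 0\<^esub> kk" using z by blast
    have "z \<oplus>\<^bsub>Z 0\<^esub> w = (t \<oplus>\<^bsub>T\<^esub> u) \<odot>\<^bsub>X 0\<^esub> kk"
      using t u kk_closed by (simp add: Z_simps X.smult_l_distr)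
    then show "s (z \<oplus>\<^bsub>Z 0\<^esub> w) \<odot>\<^bsub>I\<^esub> i = s z \<odot>\<^bsub>I\<^esub> i \<oplus>\<^bsub>I\<^esub> s w \<odot>\<^bsub>I\<^esub> i"
      using t u i by (simp add: s I.smult_l_distr)
  next
    fix r z assume r: "r \<in> carrier T" and "z \<in> carrier (Z 0)"
    then obtain t where t: "t \<in> carrier T" "z = t \<odot>\<^bsub>X 0\<^esub> kk" using z by blast
    have "r \<odot>\<^bsub>Z 0\<^esub> z = (r \<otimes>\<^bsub>T\<^esub> t) \<odot>\<^bsub>X 0\<^esub> kk"
      using r t kk_closed by (simp add: Z_simps X.smult_assoc1)
    then show "s (r \<odot>\<^bsub>Z 0\<^esub> z) \<odot>\<^bsub>I\<^esub> i = r \<odot>\<^bsub>I\<^esub> (s z \<odot>\<^bsub>I\<^esub> i)"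
      using r t i by (simp add: s I.smult_assoc1)
  qed
  then obtain \<chi> where \<chi>: "\<chi> \<in> left_hom T (X 0) I" "\<And>z. z \<in> carrier (Z 0) \<Longrightarrow> \<chi> z = s z \<odot>\<^bsub>I\<^esub> i"
    using extend by blast
  interpret R: ring T by (rule T_ring)
  have "\<one>\<^bsub>T\<^esub> \<odot>\<^bsub>X 0\<^esub> kk \<in> carrier (Z 0)" unfolding Z_0_iso(1)[symmetric] by blast
  then have "\<chi> kk = i" using \<chi>(2)[of "\<one>\<^bsub>T\<^esub> \<odot>\<^bsub>X 0\<^esub> kk"] s[of "\<one>\<^bsub>T\<^esub>"] i kk_closed by simp
  moreover obtain \<Phi>A \<Phi>B where "components_in A 0 \<Phi>A" "components_in B 0 \<Phi>B"
    "\<And>x. x \<in> carrier (X 0) \<Longrightarrow> \<chi> x = \<Phi>A x \<oplus>\<^bsub>I\<^esub> \<Phi>B x"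
    using decompose_hom[OF \<chi>(1)] by blast
  ultimately show ?thesis using kk_closed unfolding value_span_def by blast
qed

text \<open>Each component of \<open>\<Psi>\<close> after \<open>d i\<close> is a finite sum of
  components of \<open>\<Psi>\<close>, their arguments scaled by matrix entries of
  \<open>\<delta> i\<close>; \<open>C\<close> is closed under both operations.\<close>

lemma components_in_d:
  assumes C: "hom_submodule C" and \<Psi>: "components_in C (Suc i) \<Psi>"
  shows "components_in C i (\<lambda>x. \<Psi> (d i x))"
  unfolding components_in_def
proof (intro conjI allI impI)
  have \<Psi>h: "\<Psi> \<in> left_hom T (X (Suc i)) I" using \<Psi> by (simp add: components_in_def)
  show "(\<lambda>x. \<Psi> (d i x)) \<in> left_hom T (X i) I" by (rule left_hom_compose[OF d_hom \<Psi>h])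
  fix j assume j: "j < m i"
  have "(\<lambda>y. \<Oplus>\<^bsub>I\<^esub>l\<in>{..<m (Suc i)}. \<Psi> (pow_incl K l (\<delta> i (unit_vec L l) j \<odot>\<^bsub>K'\<^esub> y))) \<in> C"
    using \<Psi> diff_unit_closed
    by (intro hom_submodule_sum[OF C] hom_submoduleD(4)[OF C, of "\<lambda>y. \<Psi> (pow_incl K _ y)"])
      (auto simp: components_in_def free_module_carrier)
  then show "(\<lambda>y. \<Psi> (d i (pow_incl K j y))) \<in> C"
  proof (rule hom_submoduleD(5)[OF C])
    fix y assume y: "y \<in> carrier K"
    have c: "d i (pow_incl K j y) \<in> carrier (X (Suc i))"
      by (rule left_hom_closed[OF d_hom left_hom_closed[OF incl_hom[OF j] y]])
    have "\<Psi> (d i (pow_incl K j y)) = (\<Oplus>\<^bsub>I\<^esub>l\<in>{..<m (Suc i)}. \<Psi> (pow_incl K l (d i (pow_incl K j y) l)))"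
      by (rule pow_hom_sum[OF K.left_module_axioms I.left_module_axioms \<Psi>h[unfolded X_def] c[unfolded X_def]])
    also have "\<dots> = (\<Oplus>\<^bsub>I\<^esub>l\<in>{..<m (Suc i)}. \<Psi> (pow_incl K l (\<delta> i (unit_vec L l) j \<odot>\<^bsub>K'\<^esub> y)))"
    proof (rule I.M.finsum_cong'[OF refl])
      have e: "d i (pow_incl K j y) l = \<delta> i (unit_vec L l) j \<odot>\<^bsub>K'\<^esub> y" if "l < m (Suc i)" for l
        using that by (simp add: d_def tuple_incl[OF y j diff_unit_closed])
      then show "\<Psi> (pow_incl K l (d i (pow_incl K j y) l)) = \<Psi> (pow_incl K l (\<delta> i (unit_vec L l) j \<odot>\<^bsub>K'\<^esub> y))"
        if "l \<in> {..<m (Suc i)}" for l using that by simp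
      have "\<delta> i (unit_vec L l) j \<odot>\<^bsub>K'\<^esub> y \<in> carrier K" if "l < m (Suc i)" for l
        using c e[OF that] by (metis X_def pow_module_simps(1))
      then show "(\<lambda>l. \<Psi> (pow_incl K l (\<delta> i (unit_vec L l) j \<odot>\<^bsub>K'\<^esub> y))) \<in> {..<m (Suc i)} \<rightarrow> carrier I"
        using left_hom_closed[OF left_hom_compose[OF incl_hom \<Psi>h]] by auto
    qed
    finally show "\<Psi> (d i (pow_incl K j y)) = (\<Oplus>\<^bsub>I\<^esub>l\<in>{..<m (Suc i)}. \<Psi> (pow_incl K l (\<delta> i (unit_vec L l) j \<odot>\<^bsub>K'\<^esub> y)))" .
  qed
qed

text \<open>The kernel of \<open>d 0\<close> consists of the multiples of \<open>kk\<close>, which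
  \<open>\<Phi>\<close> kills. So \<open>\<Phi>\<close> descends to \<open>Z (Suc 0)\<close>, the
  image of \<open>d 0\<close>, and extends from there to \<open>X (Suc 0)\<close>.\<close>

lemma factor_through_d:
  assumes \<Phi>: "\<Phi> \<in> left_hom T (X 0) I" and 0: "\<Phi> kk = \<zero>\<^bsub>I\<^esub>"
  shows "\<exists>\<Psi>\<in>left_hom T (X (Suc 0)) I. \<forall>x\<in>carrier (X 0). \<Phi> x = \<Psi> (d 0 x)"
proof -
  interpret X: left_module T "X 0" by (rule X_module)
  interpret X1: left_module T "X (Suc 0)" by (rule X_module)
  have ker: "\<Phi> x = \<zero>\<^bsub>I\<^esub>" if x: "x \<in> carrier (X 0)" "d 0 x = \<zero>\<^bsub>X (Suc 0)\<^esub>" for x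
  proof -
    obtain t where "t \<in> carrier T" "x = t \<odot>\<^bsub>X 0\<^esub> kk" using d_0_exact[OF x] by blast
    then show ?thesis using 0 kk_closed by (simp add: left_hom_smult[OF \<Phi>])
  qed
  have well: "\<Phi> x = \<Phi> y" if xy: "x \<in> carrier (X 0)" "y \<in> carrier (X 0)" "d 0 x = d 0 y" for x y
  proof -
    have "d 0 (x \<ominus>\<^bsub>X 0\<^esub> y) = \<zero>\<^bsub>X (Suc 0)\<^esub>"
      using xy by (simp add: left_hom_diff[OF d_hom X_module X_module] X1.minus_eq_zero_iff left_hom_closed[OF d_hom])
    then have "\<Phi> x \<ominus>\<^bsub>I\<^esub> \<Phi> y = \<zero>\<^bsub>I\<^esub>"
      using ker[of "x \<ominus>\<^bsub>X 0\<^esub> y"] xy by (simp add: left_hom_diff[OF \<Phi> X_module I.left_module_axioms])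
    then show ?thesis using xy by (simp add: I.minus_eq_zero_iff left_hom_closed[OF \<Phi>])
  qed
  define s where "s = inv_into (carrier (X 0)) (d 0)"
  have s: "s z \<in> carrier (X 0)" "d 0 (s z) = z" if "z \<in> carrier (Z (Suc 0))" for z
    unfolding s_def using that by (simp_all add: inv_into_into f_inv_into_f d_Z_surj)
  interpret Z1: left_module T "Z (Suc 0)" by (rule Z_module)
  have "(\<lambda>z. \<Phi> (s z)) \<in> left_hom T (Z (Suc 0)) I"
  proof (rule left_homI)
    fix z w assume zw: "z \<in> carrier (Z (Suc 0))" "w \<in> carrier (Z (Suc 0))"
    have "\<Phi> (s (z \<oplus>\<^bsub>Z (Suc 0)\<^esub> w)) = \<Phi> (s z \<oplus>\<^bsub>X 0\<^esub> s w)"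
      using zw s by (intro well) (simp_all add: left_hom_add[OF d_Z_hom])
    then show "\<Phi> (s (z \<oplus>\<^bsub>Z (Suc 0)\<^esub> w)) = \<Phi> (s z) \<oplus>\<^bsub>I\<^esub> \<Phi> (s w)"
      using zw s by (simp add: left_hom_add[OF \<Phi>])
  next
    fix r z assume rz: "r \<in> carrier T" "z \<in> carrier (Z (Suc 0))"
    have "\<Phi> (s (r \<odot>\<^bsub>Z (Suc 0)\<^esub> z)) = \<Phi> (r \<odot>\<^bsub>X 0\<^esub> s z)"
      using rz s by (intro well) (simp_all add: left_hom_smult[OF d_Z_hom])
    then show "\<Phi> (s (r \<odot>\<^bsub>Z (Suc 0)\<^esub> z)) = r \<odot>\<^bsub>I\<^esub> \<Phi> (s z)"
      using rz s by (simp add: left_hom_smult[OF \<Phi>])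
  qed (simp add: s left_hom_closed[OF \<Phi>])
  from extend[OF this] obtain \<Psi> where \<Psi>: "\<Psi> \<in> left_hom T (X (Suc 0)) I"
    "\<And>z. z \<in> carrier (Z (Suc 0)) \<Longrightarrow> \<Psi> z = \<Phi> (s z)" by blast
  have "\<Phi> x = \<Psi> (d 0 x)" if x: "x \<in> carrier (X 0)" for x
  proof -
    have "d 0 x \<in> carrier (Z (Suc 0))" by (rule left_hom_closed[OF d_Z_hom x])
    then show ?thesis using \<Psi>(2) s x well[of x "s (d 0 x)"] by simp
  qed
  with \<Psi>(1) show ?thesis by blast
qed

text \<open>
  Write \<open>i\<close> as \<open>\<Phi> kk\<close> and as \<open>\<Phi>' kk\<close> with components in \<open>A\<close> and in \<open>B\<close>. Then \<open>\<Phi> - \<Phi>'\<close> factors through \<open>d 0\<close>; splitting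
  the other factor into its parts in \<open>A\<close> and \<open>B\<close> shows that \<open>\<Phi>\<close> alone factors through \<open>d 0\<close>, which kills \<open>kk\<close>.
\<close>

lemma value_span_disjoint:
  assumes "i \<in> value_span A" "i \<in> value_span B"
  shows "i = \<zero>\<^bsub>I\<^esub>"
proof -
  obtain \<Phi> where \<Phi>: "components_in A 0 \<Phi>" "i = \<Phi> kk" using assms(1) by (auto simp: value_span_def)
  obtain \<Phi>' where \<Phi>': "components_in B 0 \<Phi>'" "i = \<Phi>' kk" using assms(2) by (auto simp: value_span_def)
  have h: "\<Phi> \<in> left_hom T (X 0) I" "\<Phi>' \<in> left_hom T (X 0) I" using \<Phi> \<Phi>' by (auto simp: components_in_def)
  note cl = left_hom_closed[OF h(1)] left_hom_closed[OF h(2)]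
  have "\<Phi> kk \<ominus>\<^bsub>I\<^esub> \<Phi>' kk = \<zero>\<^bsub>I\<^esub>"
    using \<Phi>(2) \<Phi>'(2) cl kk_closed by (simp add: I.minus_eq_zero_iff)
  from factor_through_d[OF left_hom_minus[OF I.left_module_axioms h] this]
  obtain \<Psi> where \<Psi>: "\<Psi> \<in> left_hom T (X (Suc 0)) I"
    "\<And>x. x \<in> carrier (X 0) \<Longrightarrow> \<Phi> x \<ominus>\<^bsub>I\<^esub> \<Phi>' x = \<Psi> (d 0 x)" by blast
  obtain \<Psi>A \<Psi>B where \<Psi>AB: "components_in A (Suc 0) \<Psi>A" "components_in B (Suc 0) \<Psi>B"
    "\<And>x. x \<in> carrier (X (Suc 0)) \<Longrightarrow> \<Psi> x = \<Psi>A x \<oplus>\<^bsub>I\<^esub> \<Psi>B x"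
    using decompose_hom[OF \<Psi>(1)] by blast
  note dA = components_in_d[OF A \<Psi>AB(1)] and dB = components_in_d[OF B \<Psi>AB(2)]
  have hA: "\<Psi>A \<in> left_hom T (X (Suc 0)) I" and hB: "\<Psi>B \<in> left_hom T (X (Suc 0)) I"
    using \<Psi>AB by (auto simp: components_in_def)
  have "\<Phi> x = \<Psi>A (d 0 x)" if x: "x \<in> carrier (X 0)" for x
  proof (rule hom_X_eqI[OF h(1) left_hom_compose[OF d_hom hA] x])
    fix j y assume j: "j < m 0" and y: "y \<in> carrier K"
    \<comment> \<open>Rearranging \<open>\<Phi> - \<Phi>' = \<Psi>A d + \<Psi>B d\<close> puts a
      member of \<open>A\<close> on one side and a member of \<open>B\<close> on the other, so both
      sides vanish in each component.\<close>
    let ?a = "\<lambda>y. \<Phi> (pow_incl K j y) \<ominus>\<^bsub>I\<^esub> \<Psi>A (d 0 (pow_incl K j y))"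
    let ?b = "\<lambda>y. \<Phi>' (pow_incl K j y) \<oplus>\<^bsub>I\<^esub> \<Psi>B (d 0 (pow_incl K j y))"
    have a: "?a \<in> A"
      using \<Phi>(1) dA j by (intro hom_submodule_minus[OF A]) (auto simp: components_in_def)
    have b: "?b \<in> B"
      using \<Phi>'(1) dB j by (intro hom_submoduleD(3)[OF B]) (auto simp: components_in_def)
    have eq: "?a z = ?b z" if z: "z \<in> carrier K" for z
    proof -
      have c: "pow_incl K j z \<in> carrier (X 0)" by (rule left_hom_closed[OF incl_hom[OF j] z])
      note c' = left_hom_closed[OF d_hom c]
      have e: "\<Phi> (pow_incl K j z) \<ominus>\<^bsub>I\<^esub> \<Phi>' (pow_incl K j z)
          = \<Psi>A (d 0 (pow_incl K j z)) \<oplus>\<^bsub>I\<^esub> \<Psi>B (d 0 (pow_incl K j z))"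
        using \<Psi>(2)[OF c] \<Psi>AB(3)[OF c'] by simp
      have "\<Phi> (pow_incl K j z) = \<Phi>' (pow_incl K j z) \<oplus>\<^bsub>I\<^esub> (\<Psi>A (d 0 (pow_incl K j z)) \<oplus>\<^bsub>I\<^esub> \<Psi>B (d 0 (pow_incl K j z)))"
        unfolding e[symmetric] using cl c by (simp add: I.add_minus_cancel)
      then show ?thesis
        using cl[OF c] left_hom_closed[OF hA c'] left_hom_closed[OF hB c']
        by (simp add: I.M.a_lcomm[of "\<Phi>' _"] I.M.add_diff_cancel_left)
    qed
    have "?a \<in> B" by (rule hom_submoduleD(5)[OF B b eq])
    from disjoint[OF a this y]
    show "\<Phi> (pow_incl K j y) = \<Psi>A (d 0 (pow_incl K j y))"
      using left_hom_closed[OF incl_hom[OF j] y] cl left_hom_closed[OF left_hom_compose[OF d_hom hA]]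
      by (simp add: I.minus_eq_zero_iff)
  qed
  from this[OF kk_closed] have "i = \<Psi>A (d 0 kk)" using \<Phi>(2) by simp
  moreover have "d 0 kk = \<zero>\<^bsub>X (Suc 0)\<^esub>"
    using d_kk[OF monoid.one_closed[OF ring.is_monoid[OF T_ring]]] left_module.smult_one[OF X_module kk_closed] by simp
  ultimately show ?thesis by (simp add: left_hom_zero[OF hA X_module I.left_module_axioms])
qed

text \<open>If \<open>f = a + b\<close> has its values in the span of \<open>A\<close>, so has
  \<open>b\<close>, whose values also lie in the span of \<open>B\<close>; disjointness leaves
  \<open>f = a\<close>. This identifies \<open>A\<close> with the homomorphisms from
  \<open>K\<close> into its span.\<close>

lemma in_A_iff: "f \<in> left_hom T K I \<Longrightarrow> f \<in> A \<longleftrightarrow> (\<forall>x\<in>carrier K. f x \<in> value_span A)"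
proof
  assume "f \<in> A" then show "\<forall>x\<in>carrier K. f x \<in> value_span A" using apply_in_span[OF A] by blast
next
  assume f: "f \<in> left_hom T K I" and sp: "\<forall>x\<in>carrier K. f x \<in> value_span A"
  obtain a b where ab: "a \<in> A" "b \<in> B" "\<And>x. x \<in> carrier K \<Longrightarrow> f x = a x \<oplus>\<^bsub>I\<^esub> b x"
    using decompose[OF f] by blast
  have "f x = a x" if x: "x \<in> carrier K" for x
  proof -
    have c: "a x \<in> carrier I" "b x \<in> carrier I"
      using left_hom_closed[OF hom_submoduleD(1)[OF A ab(1)] x] left_hom_closed[OF hom_submoduleD(1)[OF B ab(2)] x] by auto
    have "\<ominus>\<^bsub>I\<^esub> a x \<in> value_span A" using apply_in_span[OF A hom_submodule_uminus[OF A ab(1)] x] .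
    then have "\<ominus>\<^bsub>I\<^esub> a x \<oplus>\<^bsub>I\<^esub> f x \<in> value_span A" using sp x value_span_add[OF A] by blast
    moreover have "\<ominus>\<^bsub>I\<^esub> a x \<oplus>\<^bsub>I\<^esub> f x = b x"
      using c ab(3)[OF x] by (simp add: I.M.a_assoc[symmetric] I.M.l_neg)
    ultimately have "b x = \<zero>\<^bsub>I\<^esub>" using value_span_disjoint apply_in_span[OF B ab(2) x] by simp
    then show ?thesis using c ab(3)[OF x] by simp
  qed
  then show "f \<in> A" by (rule hom_submoduleD(5)[OF A ab(1)])
qed

lemma value_span_module: "left_module T (I\<lparr>carrier := value_span A\<rparr>)"
  by (intro submodule[OF I.left_module_axioms value_span_closed[OF A] value_span_zero[OF A] value_span_add[OF A] value_span_smult[OF A]])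

lemma value_span_retract:
  "\<exists>p\<in>left_hom T I (I\<lparr>carrier := value_span A\<rparr>). \<forall>x\<in>value_span A. p x = x"
  using value_span_sum_all
  by (intro internal_sum_projection[OF I.left_module_axioms value_span_closed[OF A] value_span_closed[OF B]
      value_span_zero[OF A] value_span_zero[OF B] value_span_add[OF A] value_span_add[OF B]
      value_span_smult[OF A] value_span_smult[OF B] _ value_span_disjoint]) blast

end

end

section \<open>Retracts\<close>

text \<open>Push a cocycle into \<open>I\<close> by \<open>i\<close>, take a primitive there, and
  bring it back by \<open>p\<close>.\<close>

lemma nd_injective_retract:
  fixes R :: "('r, 'e) ring_scheme"
  assumes I: "nd_injective R n d I" and J: "left_module R J"
    and i: "i \<in> left_hom R J I" and p: "p \<in> left_hom R I J" and pi: "\<And>x. x \<in> carrier J \<Longrightarrow> p (i x) = x"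
  shows "nd_injective R n d J"
  unfolding nd_injective_def
proof (intro conjI allI impI J)
  fix U :: "('r, (nat \<Rightarrow> 'r) set) module"
  assume fp: "finitely_presented R n U"
  have I': "left_module R I" using I by (simp add: nd_injective_def)
  have U: "left_module R U" using fp by (auto simp: finitely_presented_def exact_resolution_def)
  interpret S: resolution R "std_res R U" "\<lambda>_. std_diff R" "std_aug R U" U by (rule resolution_std[OF U])
  have "ext_van R (std_res R U) (\<lambda>_. std_diff R) I d"
    using I[unfolded nd_injective_def, THEN conjunct2, rule_format, OF fp] trivial_Ext_iff[OF U I', of d] by simp
  have "ext_van R (std_res R U) (\<lambda>_. std_diff R) J d"
    unfolding ext_van_def
  proof (intro ballI impI)
    fix \<phi> assume \<phi>: "\<phi> \<in> left_hom R (std_res R U (Suc d)) J"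
      and z: "\<forall>x\<in>carrier (std_res R U (Suc (Suc d))). \<phi> (std_diff R x) = \<zero>\<^bsub>J\<^esub>"
    have "\<exists>\<psi>\<in>left_hom R (std_res R U d) I. \<forall>x\<in>carrier (std_res R U (Suc d)). i (\<phi> x) = \<psi> (std_diff R x)"
      using \<open>ext_van R (std_res R U) (\<lambda>_. std_diff R) I d\<close>[unfolded ext_van_def, THEN bspec, OF left_hom_compose[OF \<phi> i]]
        z by (simp add: left_hom_zero[OF i J I'])
    then obtain \<psi> where \<psi>: "\<psi> \<in> left_hom R (std_res R U d) I"
      "\<And>x. x \<in> carrier (std_res R U (Suc d)) \<Longrightarrow> i (\<phi> x) = \<psi> (std_diff R x)" by blast
    have "\<phi> x = p (\<psi> (std_diff R x))" if "x \<in> carrier (std_res R U (Suc d))" for x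
      using \<psi>(2)[OF that, symmetric] pi left_hom_closed[OF \<phi> that] by simp
    then show "\<exists>\<psi>\<in>left_hom R (std_res R U d) J. \<forall>x\<in>carrier (std_res R U (Suc d)). \<phi> x = \<psi> (std_diff R x)"
      using left_hom_compose[OF \<psi>(1) p] by (intro bexI[where x = "\<lambda>x. p (\<psi> x)"]) auto
  qed
  then show "trivial_group (Ext R (d + 1) U J)" using trivial_Ext_iff[OF U J] by simp
qed

section \<open>Tensor products\<close>

text \<open>The elementary tensor, as a coset. After the basic lemmas, cosets of
  \<open>tensor_rel\<close> are handled through these elements only.\<close>

definition tens ::
  "('r, 'e) ring_scheme \<Rightarrow> ('r, 'a, 'x) module_scheme \<Rightarrow> ('r, 'n, 'y) module_scheme \<Rightarrow> 'a \<Rightarrow> 'n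
    \<Rightarrow> ('a \<times> 'n \<Rightarrow>\<^sub>0 int) set" where
  "tens R A N a x = tensor_rel R A N #>\<^bsub>free_Abelian_group (carrier A \<times> carrier N)\<^esub> frag_of (a, x)"

locale tensor = A: left_module "op_ring R" A + N: left_module R N
  for R :: "('r, 'e) ring_scheme" and A :: "('r, 'a, 'x) module_scheme" and N :: "('r, 'n, 'y) module_scheme"
begin

abbreviation "F \<equiv> free_Abelian_group (carrier A \<times> carrier N)"
abbreviation "rel \<equiv> tensor_rel R A N"
abbreviation "G \<equiv> tensor_group R A N"

lemma F_group: "comm_group F"
  by (rule abelian_free_Abelian_group)

lemma A_smult: "\<lbrakk>r \<in> carrier R; a \<in> carrier A\<rbrakk> \<Longrightarrow> r \<odot>\<^bsub>A\<^esub> a \<in> carrier A"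
  using A.smult_closed[of r a] by simp

lemma rel_subgroup: "subgroup rel F"
  unfolding tensor_rel_def
  by (rule group.generate_is_subgroup)
    (auto simp: A_smult dest!: subsetD[OF keys_diff])

lemma group: "comm_group G"
  unfolding tensor_group_def by (rule comm_group.abelian_FactGroup[OF F_group rel_subgroup])

lemma rel_normal: "rel \<lhd> F"
  using comm_group.normal_iff_subgroup[OF F_group] rel_subgroup by simp

lemma coset_hom: "(\<lambda>c. rel #>\<^bsub>F\<^esub> c) \<in> hom F G"
  unfolding tensor_group_def by (rule normal.r_coset_hom_Mod[OF rel_normal])

lemma carrier_G: "carrier G = (\<lambda>c. rel #>\<^bsub>F\<^esub> c) ` carrier F"
  by (simp add: tensor_group_def carrier_FactGroup)

lemma tens_closed: "\<lbrakk>a \<in> carrier A; x \<in> carrier N\<rbrakk> \<Longrightarrow> tens R A N a x \<in> carrier G"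
  unfolding carrier_G tens_def by (rule imageI) simp

lemma coset_rel: "c \<in> rel \<Longrightarrow> rel #>\<^bsub>F\<^esub> c = \<one>\<^bsub>G\<^esub>"
  unfolding tensor_group_def
  by (simp add: subgroup.rcos_const[OF rel_subgroup comm_group.axioms(2)[OF F_group]])

text \<open>Each defining relation reads \<open>u = v + w\<close> modulo \<open>rel\<close>; the
  balanced relation is the case \<open>w = 0\<close>.\<close>

lemma coset_sum:
  assumes "u - v - w \<in> rel" "u \<in> carrier F" "v \<in> carrier F" "w \<in> carrier F"
  shows "rel #>\<^bsub>F\<^esub> u = (rel #>\<^bsub>F\<^esub> v) \<otimes>\<^bsub>G\<^esub> (rel #>\<^bsub>F\<^esub> w)"
proof -
  interpret F: comm_group F by (rule F_group)
  interpret G: comm_group G by (rule group)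
  interpret c: group_hom F G "\<lambda>c. rel #>\<^bsub>F\<^esub> c" by unfold_locales (rule coset_hom)
  have s: "u - v - w \<in> carrier F" using assms(1) rel_subgroup by (meson subgroup.mem_carrier)
  have "rel #>\<^bsub>F\<^esub> u = rel #>\<^bsub>F\<^esub> ((u - v - w) \<otimes>\<^bsub>F\<^esub> (v \<otimes>\<^bsub>F\<^esub> w))" by simp
  also have "\<dots> = (rel #>\<^bsub>F\<^esub> (u - v - w)) \<otimes>\<^bsub>G\<^esub> ((rel #>\<^bsub>F\<^esub> v) \<otimes>\<^bsub>G\<^esub> (rel #>\<^bsub>F\<^esub> w))"
    using c.hom_mult[OF s F.m_closed[OF assms(3,4)]] c.hom_mult[OF assms(3,4)] by simp
  also have "\<dots> = (rel #>\<^bsub>F\<^esub> v) \<otimes>\<^bsub>G\<^esub> (rel #>\<^bsub>F\<^esub> w)"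
    unfolding coset_rel[OF assms(1)] using c.hom_closed[OF assms(3)] c.hom_closed[OF assms(4)] by simp
  finally show ?thesis .
qed

lemma tens_add_left:
  assumes "a \<in> carrier A" "a' \<in> carrier A" "x \<in> carrier N"
  shows "tens R A N (a \<oplus>\<^bsub>A\<^esub> a') x = tens R A N a x \<otimes>\<^bsub>G\<^esub> tens R A N a' x"
  unfolding tens_def
proof (rule coset_sum)
  show "frag_of (a \<oplus>\<^bsub>A\<^esub> a', x) - frag_of (a, x) - frag_of (a', x) \<in> rel"
    unfolding tensor_rel_def by (rule generate.incl) (use assms in blast)
qed (use assms in simp_all)

lemma tens_add_right:
  assumes "a \<in> carrier A" "x \<in> carrier N" "x' \<in> carrier N"
  shows "tens R A N a (x \<oplus>\<^bsub>N\<^esub> x') = tens R A N a x \<otimes>\<^bsub>G\<^esub> tens R A N a x'"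
  unfolding tens_def
proof (rule coset_sum)
  show "frag_of (a, x \<oplus>\<^bsub>N\<^esub> x') - frag_of (a, x) - frag_of (a, x') \<in> rel"
    unfolding tensor_rel_def by (rule generate.incl) (use assms in blast)
qed (use assms in simp_all)

lemma tens_balanced:
  assumes "r \<in> carrier R" "a \<in> carrier A" "x \<in> carrier N"
  shows "tens R A N (r \<odot>\<^bsub>A\<^esub> a) x = tens R A N a (r \<odot>\<^bsub>N\<^esub> x)"
proof -
  interpret G: comm_group G by (rule group)
  have "tens R A N (r \<odot>\<^bsub>A\<^esub> a) x = tens R A N a (r \<odot>\<^bsub>N\<^esub> x) \<otimes>\<^bsub>G\<^esub> (rel #>\<^bsub>F\<^esub> 0)"
    unfolding tens_def
  proof (rule coset_sum)
    show "frag_of (r \<odot>\<^bsub>A\<^esub> a, x) - frag_of (a, r \<odot>\<^bsub>N\<^esub> x) - 0 \<in> rel"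
      unfolding tensor_rel_def diff_0_right by (rule generate.incl) (use assms in blast)
  qed (use assms A_smult in simp_all)
  moreover have "0 \<in> rel" using subgroup.one_closed[OF rel_subgroup] by simp
  ultimately show ?thesis using assms by (simp add: coset_rel tens_closed)
qed

lemma tens_zero_left: "x \<in> carrier N \<Longrightarrow> tens R A N \<zero>\<^bsub>A\<^esub> x = \<one>\<^bsub>G\<^esub>"
proof -
  interpret G: comm_group G by (rule group)
  assume x: "x \<in> carrier N"
  have "tens R A N \<zero>\<^bsub>A\<^esub> x = tens R A N \<zero>\<^bsub>A\<^esub> x \<otimes>\<^bsub>G\<^esub> tens R A N \<zero>\<^bsub>A\<^esub> x"
    using tens_add_left[of "\<zero>\<^bsub>A\<^esub>" "\<zero>\<^bsub>A\<^esub>" x] x by simp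
  then show ?thesis using x by (simp add: tens_closed G.l_cancel_one)
qed

lemma tens_zero_right: "a \<in> carrier A \<Longrightarrow> tens R A N a \<zero>\<^bsub>N\<^esub> = \<one>\<^bsub>G\<^esub>"
proof -
  interpret G: comm_group G by (rule group)
  assume a: "a \<in> carrier A"
  have "tens R A N a \<zero>\<^bsub>N\<^esub> = tens R A N a \<zero>\<^bsub>N\<^esub> \<otimes>\<^bsub>G\<^esub> tens R A N a \<zero>\<^bsub>N\<^esub>"
    using tens_add_right[of a "\<zero>\<^bsub>N\<^esub>" "\<zero>\<^bsub>N\<^esub>"] a by simp
  then show ?thesis using a by (simp add: tens_closed G.l_cancel_one)
qed

lemma tens_neg_left: "\<lbrakk>a \<in> carrier A; x \<in> carrier N\<rbrakk> \<Longrightarrow> tens R A N (\<ominus>\<^bsub>A\<^esub> a) x = inv\<^bsub>G\<^esub> tens R A N a x"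
proof -
  interpret G: comm_group G by (rule group)
  assume a: "a \<in> carrier A" "x \<in> carrier N"
  have "tens R A N (\<ominus>\<^bsub>A\<^esub> a) x \<otimes>\<^bsub>G\<^esub> tens R A N a x = \<one>\<^bsub>G\<^esub>"
    using a by (simp add: tens_add_left[symmetric] A.M.l_neg tens_zero_left)
  then show ?thesis using a by (intro G.inv_equality[symmetric]) (simp_all add: tens_closed)
qed

text \<open>Sums of elementary tensors exhaust the group, because the inverse of an elementary
  tensor is again elementary.\<close>

lemma induct [consumes 1, case_names one mult tens]:
  assumes X: "X \<in> carrier G" and one: "P \<one>\<^bsub>G\<^esub>"
    and mult: "\<And>X Y. \<lbrakk>X \<in> carrier G; Y \<in> carrier G; P X; P Y\<rbrakk> \<Longrightarrow> P (X \<otimes>\<^bsub>G\<^esub> Y)"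
    and tens: "\<And>a x. \<lbrakk>a \<in> carrier A; x \<in> carrier N\<rbrakk> \<Longrightarrow> P (tens R A N a x)"
  shows "P X"
proof -
  interpret F: comm_group F by (rule F_group)
  interpret G: comm_group G by (rule group)
  interpret c: group_hom F G "\<lambda>c. rel #>\<^bsub>F\<^esub> c" by unfold_locales (rule coset_hom)
  obtain c where c: "c \<in> carrier F" "X = rel #>\<^bsub>F\<^esub> c" using X unfolding carrier_G by blast
  \<comment> \<open>The induction principle for free abelian groups proceeds by differences, so the
    inverse is carried along.\<close>
  have "P (rel #>\<^bsub>F\<^esub> c) \<and> P (inv\<^bsub>G\<^esub> (rel #>\<^bsub>F\<^esub> c))"
  proof (rule free_Abelian_group_induct[of c "carrier A \<times> carrier N"])
    show "Poly_Mapping.keys c \<subseteq> carrier A \<times> carrier N" using c by simp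
    show "P (rel #>\<^bsub>F\<^esub> 0) \<and> P (inv\<^bsub>G\<^esub> (rel #>\<^bsub>F\<^esub> 0))" using one c.hom_one by simp
  next
    fix u v assume uv: "Poly_Mapping.keys u \<subseteq> carrier A \<times> carrier N" "Poly_Mapping.keys v \<subseteq> carrier A \<times> carrier N"
      and Pu: "P (rel #>\<^bsub>F\<^esub> u) \<and> P (inv\<^bsub>G\<^esub> (rel #>\<^bsub>F\<^esub> u))" and Pv: "P (rel #>\<^bsub>F\<^esub> v) \<and> P (inv\<^bsub>G\<^esub> (rel #>\<^bsub>F\<^esub> v))"
    have u: "u \<in> carrier F" and v: "v \<in> carrier F" using uv by simp_all
    note cl = c.hom_closed[OF u] c.hom_closed[OF v]
    have e: "rel #>\<^bsub>F\<^esub> (u - v) = (rel #>\<^bsub>F\<^esub> u) \<otimes>\<^bsub>G\<^esub> inv\<^bsub>G\<^esub> (rel #>\<^bsub>F\<^esub> v)"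
      using c.hom_mult[OF u F.inv_closed[OF v]] c.hom_inv[OF v] uv by simp
    show "P (rel #>\<^bsub>F\<^esub> (u - v)) \<and> P (inv\<^bsub>G\<^esub> (rel #>\<^bsub>F\<^esub> (u - v)))"
      unfolding e using cl Pu Pv by (simp add: mult G.inv_mult)
  next
    fix z assume "z \<in> carrier A \<times> carrier N"
    then obtain a x where z: "z = (a, x)" "a \<in> carrier A" "x \<in> carrier N" by blast
    show "P (rel #>\<^bsub>F\<^esub> frag_of z) \<and> P (inv\<^bsub>G\<^esub> (rel #>\<^bsub>F\<^esub> frag_of z))"
      using tens[OF z(2,3)] tens[OF A.M.a_inv_closed[OF z(2)] z(3)] tens_neg_left[OF z(2,3)]
      by (simp add: tens_def z(1))
  qed
  then show ?thesis using c by simp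
qed

lemma hom_eqI:
  assumes "comm_group H" "f \<in> hom G H" "g \<in> hom G H"
    and "\<And>a x. \<lbrakk>a \<in> carrier A; x \<in> carrier N\<rbrakk> \<Longrightarrow> f (tens R A N a x) = g (tens R A N a x)"
    and "X \<in> carrier G"
  shows "f X = g X"
proof -
  interpret G: comm_group G by (rule group)
  interpret H: comm_group H by fact
  interpret f: group_hom G H f by unfold_locales fact
  interpret g: group_hom G H g by unfold_locales fact
  show ?thesis using assms(5) by (induction X rule: induct) (simp_all add: assms(4))
qed

text \<open>The map extends to the free abelian group on pairs, kills the generators of
  \<open>tensor_rel\<close> by biadditivity and balance, and hence factors through the
  quotient.\<close>

lemma universal:
  assumes H: "comm_group H"
    and closed: "\<And>a x. \<lbrakk>a \<in> carrier A; x \<in> carrier N\<rbrakk> \<Longrightarrow> \<beta> a x \<in> carrier H"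
    and add_l: "\<And>a a' x. \<lbrakk>a \<in> carrier A; a' \<in> carrier A; x \<in> carrier N\<rbrakk> \<Longrightarrow> \<beta> (a \<oplus>\<^bsub>A\<^esub> a') x = \<beta> a x \<otimes>\<^bsub>H\<^esub> \<beta> a' x"
    and add_r: "\<And>a x x'. \<lbrakk>a \<in> carrier A; x \<in> carrier N; x' \<in> carrier N\<rbrakk> \<Longrightarrow> \<beta> a (x \<oplus>\<^bsub>N\<^esub> x') = \<beta> a x \<otimes>\<^bsub>H\<^esub> \<beta> a x'"
    and bal: "\<And>r a x. \<lbrakk>r \<in> carrier R; a \<in> carrier A; x \<in> carrier N\<rbrakk> \<Longrightarrow> \<beta> (r \<odot>\<^bsub>A\<^esub> a) x = \<beta> a (r \<odot>\<^bsub>N\<^esub> x)"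
  shows "\<exists>h\<in>hom G H. \<forall>a\<in>carrier A. \<forall>x\<in>carrier N. h (tens R A N a x) = \<beta> a x"
proof -
  interpret F: comm_group F by (rule F_group)
  interpret H: comm_group H by fact
  have im: "(\<lambda>(a, x). \<beta> a x) ` (carrier A \<times> carrier N) \<subseteq> carrier H" using closed by auto
  obtain g where g: "g \<in> hom F H" "\<And>z. z \<in> carrier A \<times> carrier N \<Longrightarrow> g (frag_of z) = (case z of (a, x) \<Rightarrow> \<beta> a x)"
    using H.free_Abelian_group_universal[OF im] by metis
  interpret g: group_hom F H g by unfold_locales (rule g)
  have gd: "g (u - v) = g u \<otimes>\<^bsub>H\<^esub> inv\<^bsub>H\<^esub> g v" if "u \<in> carrier F" "v \<in> carrier F" for u v
    using g.hom_mult[OF that(1) F.inv_closed[OF that(2)]] g.hom_inv[OF that(2)] that(2) by simp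
  have gens: "g c = \<one>\<^bsub>H\<^esub>"
    if c: "c \<in> {frag_of (a \<oplus>\<^bsub>A\<^esub> a', x) - frag_of (a, x) - frag_of (a', x) | a a' x.
         a \<in> carrier A \<and> a' \<in> carrier A \<and> x \<in> carrier N} \<union>
      {frag_of (a, x \<oplus>\<^bsub>N\<^esub> x') - frag_of (a, x) - frag_of (a, x') | a x x'.
         a \<in> carrier A \<and> x \<in> carrier N \<and> x' \<in> carrier N} \<union>
      {frag_of (r \<odot>\<^bsub>A\<^esub> a, x) - frag_of (a, r \<odot>\<^bsub>N\<^esub> x) | r a x.
         r \<in> carrier R \<and> a \<in> carrier A \<and> x \<in> carrier N}" for c
  proof -
    have 3: "g (u - v - w) = \<one>\<^bsub>H\<^esub>"
      if "u \<in> carrier F" "v \<in> carrier F" "w \<in> carrier F" "g u = g v \<otimes>\<^bsub>H\<^esub> g w" for u v w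
    proof -
      have "u - v \<in> carrier F" using F.m_closed[OF that(1) F.inv_closed[OF that(2)]] that(2) by simp
      then have "g (u - v - w) = (g v \<otimes>\<^bsub>H\<^esub> g w \<otimes>\<^bsub>H\<^esub> inv\<^bsub>H\<^esub> g v) \<otimes>\<^bsub>H\<^esub> inv\<^bsub>H\<^esub> g w"
        using that by (simp only: gd)
      also have "\<dots> = \<one>\<^bsub>H\<^esub>"
        using g.hom_closed[OF that(2)] g.hom_closed[OF that(3)]
        by (simp add: H.m_comm[of "g v" "g w"]) (simp add: H.m_assoc)
      finally show ?thesis .
    qed
    from c show ?thesis
    proof (elim UnE CollectE exE conjE)
      fix a a' x assume "c = frag_of (a \<oplus>\<^bsub>A\<^esub> a', x) - frag_of (a, x) - frag_of (a', x)"
        "a \<in> carrier A" "a' \<in> carrier A" "x \<in> carrier N"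
      then show ?thesis by (simp add: 3 g(2) add_l)
    next
      fix a x x' assume "c = frag_of (a, x \<oplus>\<^bsub>N\<^esub> x') - frag_of (a, x) - frag_of (a, x')"
        "a \<in> carrier A" "x \<in> carrier N" "x' \<in> carrier N"
      then show ?thesis by (simp add: 3 g(2) add_r)
    next
      fix r a x assume "c = frag_of (r \<odot>\<^bsub>A\<^esub> a, x) - frag_of (a, r \<odot>\<^bsub>N\<^esub> x)"
        "r \<in> carrier R" "a \<in> carrier A" "x \<in> carrier N"
      then show ?thesis using A_smult by (simp add: gd g(2) bal closed)
    qed
  qed
  have "g c = \<one>\<^bsub>H\<^esub>" if "c \<in> rel" for c
  proof -
    have "rel \<subseteq> kernel F H g"
      unfolding tensor_rel_def
    proof (rule F.generate_subgroup_incl[OF _ g.subgroup_kernel])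
      show "{frag_of (a \<oplus>\<^bsub>A\<^esub> a', x) - frag_of (a, x) - frag_of (a', x) | a a' x.
         a \<in> carrier A \<and> a' \<in> carrier A \<and> x \<in> carrier N} \<union>
      {frag_of (a, x \<oplus>\<^bsub>N\<^esub> x') - frag_of (a, x) - frag_of (a, x') | a x x'.
         a \<in> carrier A \<and> x \<in> carrier N \<and> x' \<in> carrier N} \<union>
      {frag_of (r \<odot>\<^bsub>A\<^esub> a, x) - frag_of (a, r \<odot>\<^bsub>N\<^esub> x) | r a x.
         r \<in> carrier R \<and> a \<in> carrier A \<and> x \<in> carrier N} \<subseteq> kernel F H g" (is "?E \<subseteq> _")
      proof
        fix c assume c: "c \<in> ?E"
        then have "c \<in> carrier F" by (auto simp: A_smult dest!: subsetD[OF keys_diff])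
        with gens[OF c] show "c \<in> kernel F H g" by (simp add: kernel_def)
      qed
    qed
    with that show ?thesis by (auto simp: kernel_def)
  qed
  then have sub: "rel \<subseteq> kernel F H g" using subgroup.mem_carrier[OF rel_subgroup] by (auto simp: kernel_def)
  obtain h where h: "h \<in> hom (F Mod rel) H" "\<And>c. c \<in> carrier F \<Longrightarrow> h (rel #>\<^bsub>F\<^esub> c) = g c"
    using g.FactGroup_universal_kernel[OF rel_normal sub] by metis
  show ?thesis
    using h g(2) by (intro bexI[of _ h]) (auto simp: tensor_group_def tens_def)
qed

end

text \<open>\<open>tensor_map\<close> is a union over coset representatives. The universal property
  provides a homomorphism \<open>h\<close> with the right values on elementary tensors; a comparison
  on the free abelian group shows that each representative contributes the same coset
  \<open>h X\<close>.\<close>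

lemma tensor_map_hom:
  assumes A: "tensor R A N" and B: "tensor R B N" and f: "f \<in> left_hom (op_ring R) A B"
  shows "tensor_map R B N f \<in> hom (tensor_group R A N) (tensor_group R B N)"
    and "\<And>a x. \<lbrakk>a \<in> carrier A; x \<in> carrier N\<rbrakk> \<Longrightarrow> tensor_map R B N f (tens R A N a x) = tens R B N (f a) x"
proof -
  interpret A: tensor R A N by fact
  interpret B: tensor R B N by fact
  interpret AG: comm_group A.G by (rule A.group)
  interpret BG: comm_group B.G by (rule B.group)
  interpret AF: comm_group A.F by (rule A.F_group)
  interpret BF: comm_group B.F by (rule B.F_group)
  note c = left_hom_closed[OF f]
  have smult: "f (r \<odot>\<^bsub>A\<^esub> a) = r \<odot>\<^bsub>B\<^esub> f a" if "r \<in> carrier R" "a \<in> carrier A" for r a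
    using left_hom_smult[OF f] that by simp
  have "\<exists>h\<in>hom A.G B.G. \<forall>a\<in>carrier A. \<forall>x\<in>carrier N. h (tens R A N a x) = tens R B N (f a) x"
    by (rule A.universal[OF B.group])
      (simp_all add: c B.tens_closed left_hom_add[OF f] smult B.tens_add_left B.tens_add_right B.tens_balanced)
  then obtain h where h: "h \<in> hom A.G B.G"
    "\<And>a x. \<lbrakk>a \<in> carrier A; x \<in> carrier N\<rbrakk> \<Longrightarrow> h (tens R A N a x) = tens R B N (f a) x" by blast
  interpret h: group_hom A.G B.G h by unfold_locales (rule h)
  interpret q: group_hom A.F A.G "\<lambda>c. A.rel #>\<^bsub>A.F\<^esub> c" by unfold_locales (rule A.coset_hom)
  interpret q': group_hom B.F B.G "\<lambda>c. B.rel #>\<^bsub>B.F\<^esub> c" by unfold_locales (rule B.coset_hom)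
  let ?e = "frag_extend (\<lambda>(b, x). frag_of (f b, x))"
  have key: "?e c \<in> carrier B.F \<and> h (A.rel #>\<^bsub>A.F\<^esub> c) = B.rel #>\<^bsub>B.F\<^esub> ?e c" if c': "c \<in> carrier A.F" for c
  proof (rule free_Abelian_group_induct[of c "carrier A \<times> carrier N"])
    show "Poly_Mapping.keys c \<subseteq> carrier A \<times> carrier N" using c' by simp
    show "?e 0 \<in> carrier B.F \<and> h (A.rel #>\<^bsub>A.F\<^esub> 0) = B.rel #>\<^bsub>B.F\<^esub> ?e 0"
      using q.hom_one q'.hom_one h.hom_one by simp
  next
    fix u v assume uv: "Poly_Mapping.keys u \<subseteq> carrier A \<times> carrier N" "Poly_Mapping.keys v \<subseteq> carrier A \<times> carrier N"
      and u: "?e u \<in> carrier B.F \<and> h (A.rel #>\<^bsub>A.F\<^esub> u) = B.rel #>\<^bsub>B.F\<^esub> ?e u"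
      and v: "?e v \<in> carrier B.F \<and> h (A.rel #>\<^bsub>A.F\<^esub> v) = B.rel #>\<^bsub>B.F\<^esub> ?e v"
    have u': "u \<in> carrier A.F" and v': "v \<in> carrier A.F" using uv by simp_all
    have eu: "?e u \<in> carrier B.F" and ev: "?e v \<in> carrier B.F" using u v by simp_all
    have m: "?e u - ?e v = ?e u \<otimes>\<^bsub>B.F\<^esub> inv\<^bsub>B.F\<^esub> ?e v" "u - v = u \<otimes>\<^bsub>A.F\<^esub> inv\<^bsub>A.F\<^esub> v" using uv ev by simp_all
    have "?e (u - v) = ?e u - ?e v" by (rule frag_extend_diff)
    moreover have "?e u - ?e v \<in> carrier B.F" unfolding m by (rule BF.m_closed[OF eu BF.inv_closed[OF ev]])
    moreover have "h (A.rel #>\<^bsub>A.F\<^esub> (u - v)) = B.rel #>\<^bsub>B.F\<^esub> (?e u - ?e v)"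
      unfolding m using u v
      by (simp only: q.hom_mult[OF u' AF.inv_closed[OF v']] q.hom_inv[OF v'] q'.hom_mult[OF eu BF.inv_closed[OF ev]]
          q'.hom_inv[OF ev] h.hom_mult[OF q.hom_closed[OF u'] AG.inv_closed[OF q.hom_closed[OF v']]] h.hom_inv[OF q.hom_closed[OF v']])
    ultimately show "?e (u - v) \<in> carrier B.F \<and> h (A.rel #>\<^bsub>A.F\<^esub> (u - v)) = B.rel #>\<^bsub>B.F\<^esub> ?e (u - v)" by simp
  next
    fix z assume "z \<in> carrier A \<times> carrier N"
    then show "?e (frag_of z) \<in> carrier B.F \<and> h (A.rel #>\<^bsub>A.F\<^esub> frag_of z) = B.rel #>\<^bsub>B.F\<^esub> ?e (frag_of z)"
      using h(2) c by (auto simp: tens_def)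
  qed
  have eq: "tensor_map R B N f X = h X" if X: "X \<in> carrier A.G" for X
  proof -
    obtain c0 where c0: "c0 \<in> carrier A.F" "X = A.rel #>\<^bsub>A.F\<^esub> c0" using X unfolding A.carrier_G by blast
    have "B.rel #>\<^bsub>B.F\<^esub> ?e c = h X" if "c \<in> X" for c
    proof -
      have "c \<in> carrier A.F" using that c0 AF.r_coset_subset_G[OF subgroup.subset[OF A.rel_subgroup] c0(1)] by blast
      moreover have "A.rel #>\<^bsub>A.F\<^esub> c = X" using AF.repr_independence[OF _ c0(1) A.rel_subgroup] that c0 by simp
      ultimately show ?thesis using key by metis
    qed
    moreover have "c0 \<in> X" using AF.rcos_self[OF c0(1) A.rel_subgroup] c0(2) by simp
    ultimately show ?thesis unfolding tensor_map_def by blast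
  qed
  show "tensor_map R B N f \<in> hom A.G B.G"
    using h.hom_closed h.hom_mult by (auto simp: hom_def eq)
  show "tensor_map R B N f (tens R A N a x) = tens R B N (f a) x" if "a \<in> carrier A" "x \<in> carrier N" for a x
    using that by (simp add: eq A.tens_closed h)
qed

section \<open>Additivity and right exactness of the tensor product\<close>

lemma tensor_map_closed:
  "\<lbrakk>tensor R A N; tensor R B N; f \<in> left_hom (op_ring R) A B; X \<in> carrier (tensor_group R A N)\<rbrakk> \<Longrightarrow>
    tensor_map R B N f X \<in> carrier (tensor_group R B N)"
  by (rule hom_in_carrier[OF tensor_map_hom(1)])

lemma tensor_map_mult:
  "\<lbrakk>tensor R A N; tensor R B N; f \<in> left_hom (op_ring R) A B;
    X \<in> carrier (tensor_group R A N); Y \<in> carrier (tensor_group R A N)\<rbrakk> \<Longrightarrow>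
    tensor_map R B N f (X \<otimes>\<^bsub>tensor_group R A N\<^esub> Y) =
    tensor_map R B N f X \<otimes>\<^bsub>tensor_group R B N\<^esub> tensor_map R B N f Y"
  by (rule hom_mult[OF tensor_map_hom(1)])

lemma tensor_map_one:
  assumes "tensor R A N" "tensor R B N" "f \<in> left_hom (op_ring R) A B"
  shows "tensor_map R B N f \<one>\<^bsub>tensor_group R A N\<^esub> = \<one>\<^bsub>tensor_group R B N\<^esub>"
  using hom_one[OF tensor_map_hom(1)[OF assms]] tensor.group[OF assms(1)] tensor.group[OF assms(2)]
  by (simp add: comm_group.axioms(2))

lemma tensor_map_inv:
  assumes "tensor R A N" "tensor R B N" "f \<in> left_hom (op_ring R) A B" "X \<in> carrier (tensor_group R A N)"
  shows "tensor_map R B N f (inv\<^bsub>tensor_group R A N\<^esub> X) = inv\<^bsub>tensor_group R B N\<^esub> tensor_map R B N f X"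
proof -
  interpret A: comm_group "tensor_group R A N" by (rule tensor.group[OF assms(1)])
  interpret B: comm_group "tensor_group R B N" by (rule tensor.group[OF assms(2)])
  interpret group_hom "tensor_group R A N" "tensor_group R B N" "tensor_map R B N f"
    by unfold_locales (rule tensor_map_hom(1)[OF assms(1-3)])
  show ?thesis by (rule hom_inv[OF assms(4)])
qed

lemma tensor_map_compose:
  assumes "tensor R A N" "tensor R B N" "tensor R C N"
    and f: "f \<in> left_hom (op_ring R) A B" and g: "g \<in> left_hom (op_ring R) B C"
    and "X \<in> carrier (tensor_group R A N)"
  shows "tensor_map R C N g (tensor_map R B N f X) = tensor_map R C N (\<lambda>x. g (f x)) X"
proof (rule tensor.hom_eqI[OF assms(1) tensor.group[OF assms(3)] _ tensor_map_hom(1)[OF assms(1,3) left_hom_compose[OF f g]] _ assms(6)])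
  show "(\<lambda>X. tensor_map R C N g (tensor_map R B N f X)) \<in> hom (tensor_group R A N) (tensor_group R C N)"
    using hom_compose[OF tensor_map_hom(1)[OF assms(1,2) f] tensor_map_hom(1)[OF assms(2,3) g]]
    by (simp add: o_def)
qed (simp add: tensor_map_hom(2)[OF assms(1,2) f] tensor_map_hom(2)[OF assms(2,3) g]
    tensor_map_hom(2)[OF assms(1,3) left_hom_compose[OF f g]] left_hom_closed[OF f])

lemma tensor_map_add:
  assumes A: "tensor R A N" and B: "tensor R B N"
    and f: "f \<in> left_hom (op_ring R) A B" and g: "g \<in> left_hom (op_ring R) A B"
    and "X \<in> carrier (tensor_group R A N)"
  shows "tensor_map R B N (\<lambda>x. f x \<oplus>\<^bsub>B\<^esub> g x) X = tensor_map R B N f X \<otimes>\<^bsub>tensor_group R B N\<^esub> tensor_map R B N g X"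
proof -
  interpret B: tensor R B N by fact
  interpret G: comm_group B.G by (rule B.group)
  note fg = left_hom_plus[OF B.A.left_module_axioms f g]
  show ?thesis
  proof (rule tensor.hom_eqI[OF A B.group tensor_map_hom(1)[OF A B fg] _ _ assms(5)])
    show "(\<lambda>X. tensor_map R B N f X \<otimes>\<^bsub>B.G\<^esub> tensor_map R B N g X) \<in> hom (tensor_group R A N) B.G"
      by (rule homI) (simp_all add: tensor_map_closed[OF A B f] tensor_map_closed[OF A B g] tensor_map_mult[OF A B f]
          tensor_map_mult[OF A B g] G.m_ac)
  qed (simp add: tensor_map_hom(2)[OF A B fg] tensor_map_hom(2)[OF A B f] tensor_map_hom(2)[OF A B g]
      B.tens_add_left left_hom_closed[OF f] left_hom_closed[OF g])
qed

lemma tensor_map_cong: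
  assumes A: "tensor R A N" and B: "tensor R B N" and f: "f \<in> left_hom (op_ring R) A B"
    and "\<And>x. x \<in> carrier A \<Longrightarrow> g x = f x" and "X \<in> carrier (tensor_group R A N)"
  shows "tensor_map R B N g X = tensor_map R B N f X"
proof -
  interpret A: tensor R A N by fact
  have g: "g \<in> left_hom (op_ring R) A B" by (rule left_hom_cong[OF A.A.left_module_axioms f assms(4)])
  show ?thesis
    by (rule tensor.hom_eqI[OF A tensor.group[OF B] tensor_map_hom(1)[OF A B g] tensor_map_hom(1)[OF A B f] _ assms(5)])
      (simp add: tensor_map_hom(2)[OF A B g] tensor_map_hom(2)[OF A B f] assms(4))
qed

lemma tensor_map_id:
  assumes A: "tensor R A N" and "X \<in> carrier (tensor_group R A N)"
  shows "tensor_map R A N (\<lambda>x. x) X = X"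
  by (rule tensor.hom_eqI[OF A tensor.group[OF A] tensor_map_hom(1)[OF A A left_hom_id] _ _ assms(2)])
    (auto simp: hom_def tensor_map_hom(2)[OF A A left_hom_id])

lemma tensor_map_zero:
  assumes A: "tensor R A N" and B: "tensor R B N" and "\<And>x. x \<in> carrier A \<Longrightarrow> f x = \<zero>\<^bsub>B\<^esub>"
    and "X \<in> carrier (tensor_group R A N)"
  shows "tensor_map R B N f X = \<one>\<^bsub>tensor_group R B N\<^esub>"
proof -
  interpret A: tensor R A N by fact
  interpret B: tensor R B N by fact
  interpret G: comm_group B.G by (rule B.group)
  have f: "f \<in> left_hom (op_ring R) A B"
    by (rule left_hom_cong[OF A.A.left_module_axioms left_hom_const_zero[OF B.A.left_module_axioms] assms(3)])
  show ?thesis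
    by (rule A.hom_eqI[OF B.group tensor_map_hom(1)[OF A B f] _ _ assms(4)])
      (auto simp: hom_def tensor_map_hom(2)[OF A B f] assms(3) B.tens_zero_left)
qed

lemma tensor_map_surj:
  assumes A: "tensor R A N" and B: "tensor R B N" and f: "f \<in> left_hom (op_ring R) A B"
    and surj: "f ` carrier A = carrier B" and Y: "Y \<in> carrier (tensor_group R B N)"
  shows "\<exists>X\<in>carrier (tensor_group R A N). tensor_map R B N f X = Y"
proof -
  interpret A: tensor R A N by fact
  interpret AG: comm_group A.G by (rule A.group)
  show ?thesis
    using Y
  proof (induction Y rule: tensor.induct[OF B, consumes 1])
    case 1
    then show ?case using tensor_map_one[OF A B f] by (intro bexI[of _ "\<one>\<^bsub>A.G\<^esub>"]) simp_all
  next
    case (2 Y Y')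
    then obtain X X' where "X \<in> carrier A.G" "X' \<in> carrier A.G" "tensor_map R B N f X = Y" "tensor_map R B N f X' = Y'"
      by blast
    then show ?case using tensor_map_mult[OF A B f] by (intro bexI[of _ "X \<otimes>\<^bsub>A.G\<^esub> X'"]) simp_all
  next
    case (3 b x)
    obtain a where "a \<in> carrier A" "f a = b" using preimage_ex[OF surj 3(1)] by blast
    then show ?case
      using 3 tensor_map_hom(2)[OF A B f] A.tens_closed by (intro bexI[of _ "tens R A N a x"]) simp_all
  qed
qed

text \<open>Right exactness: a section of \<open>g\<close> induces an inverse of \<open>(B \<otimes> N) / im (f \<otimes> N) \<rightarrow> C \<otimes> N\<close>.\<close>

lemma tensor_map_exact:
  assumes A: "tensor R A N" and B: "tensor R B N" and C: "tensor R C N"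
    and f: "f \<in> left_hom (op_ring R) A B" and g: "g \<in> left_hom (op_ring R) B C"
    and surj: "g ` carrier B = carrier C"
    and exact: "\<And>b. \<lbrakk>b \<in> carrier B; g b = \<zero>\<^bsub>C\<^esub>\<rbrakk> \<Longrightarrow> \<exists>a\<in>carrier A. f a = b"
    and gf: "\<And>a. a \<in> carrier A \<Longrightarrow> g (f a) = \<zero>\<^bsub>C\<^esub>"
    and X: "X \<in> carrier (tensor_group R B N)" and 1: "tensor_map R C N g X = \<one>\<^bsub>tensor_group R C N\<^esub>"
  shows "\<exists>W\<in>carrier (tensor_group R A N). tensor_map R B N f W = X"
proof -
  interpret A: tensor R A N by fact
  interpret B: tensor R B N by fact
  interpret C: tensor R C N by fact
  interpret AG: comm_group A.G by (rule A.group)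
  interpret BG: comm_group B.G by (rule B.group)
  interpret t: group_hom A.G B.G "tensor_map R B N f" by unfold_locales (rule tensor_map_hom(1)[OF A B f])
  define I where "I = tensor_map R B N f ` carrier A.G"
  have I: "subgroup I B.G" unfolding I_def by (rule t.img_is_subgroup)
  have IN: "I \<lhd> B.G" using I BG.normal_iff_subgroup by simp
  define Q where "Q = B.G Mod I"
  have Q: "comm_group Q" unfolding Q_def by (rule BG.abelian_FactGroup[OF I])
  interpret Q: comm_group Q by (rule Q)
  have qh: "(\<lambda>Y. I #>\<^bsub>B.G\<^esub> Y) \<in> hom B.G Q" unfolding Q_def by (rule normal.r_coset_hom_Mod[OF IN])
  interpret q: group_hom B.G Q "\<lambda>Y. I #>\<^bsub>B.G\<^esub> Y" by unfold_locales (rule qh)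
  have qI: "I #>\<^bsub>B.G\<^esub> Y = \<one>\<^bsub>Q\<^esub>" if "Y \<in> I" for Y
    unfolding Q_def using subgroup.rcos_const[OF I BG.is_group that] by simp
  have q_eq: "I #>\<^bsub>B.G\<^esub> tens R B N b x = I #>\<^bsub>B.G\<^esub> tens R B N b' x"
    if b: "b \<in> carrier B" "b' \<in> carrier B" "x \<in> carrier N" "g b = g b'" for b b' x
  proof -
    have "g (b \<ominus>\<^bsub>B\<^esub> b') = \<zero>\<^bsub>C\<^esub>"
      using b left_hom_closed[OF g] by (simp add: left_hom_diff[OF g B.A.left_module_axioms C.A.left_module_axioms] C.A.minus_eq_zero_iff)
    then obtain a where a: "a \<in> carrier A" "f a = b \<ominus>\<^bsub>B\<^esub> b'" using exact[of "b \<ominus>\<^bsub>B\<^esub> b'"] b by auto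
    have d: "b \<ominus>\<^bsub>B\<^esub> b' \<in> carrier B" using b by simp
    have "b = b' \<oplus>\<^bsub>B\<^esub> (b \<ominus>\<^bsub>B\<^esub> b')" using b by (simp add: B.A.add_minus_cancel)
    then have "tens R B N b x = tens R B N b' x \<otimes>\<^bsub>B.G\<^esub> tens R B N (b \<ominus>\<^bsub>B\<^esub> b') x"
      using B.tens_add_left[OF b(2) d b(3)] by simp
    moreover have "tens R B N (b \<ominus>\<^bsub>B\<^esub> b') x \<in> I"
      unfolding I_def using tensor_map_hom(2)[OF A B f a(1) b(3)] A.tens_closed[OF a(1) b(3)] a(2) by (metis imageI)
    ultimately show ?thesis
      using qI q.hom_mult[OF B.tens_closed[OF b(2,3)] B.tens_closed[OF d b(3)]] q.hom_closed[OF B.tens_closed[OF b(2,3)]] by simp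
  qed
  define s where "s = inv_into (carrier B) g"
  have s: "s c \<in> carrier B" "g (s c) = c" if "c \<in> carrier C" for c
    unfolding s_def using that surj by (simp_all add: inv_into_into f_inv_into_f)
  have "\<exists>h\<in>hom C.G Q. \<forall>c\<in>carrier C. \<forall>x\<in>carrier N. h (tens R C N c x) = I #>\<^bsub>B.G\<^esub> tens R B N (s c) x"
  proof (rule C.universal[OF Q])
    show "I #>\<^bsub>B.G\<^esub> tens R B N (s c) x \<in> carrier Q" if "c \<in> carrier C" "x \<in> carrier N" for c x
      using that by (intro q.hom_closed B.tens_closed s)
    show "I #>\<^bsub>B.G\<^esub> tens R B N (s (c \<oplus>\<^bsub>C\<^esub> c')) x = (I #>\<^bsub>B.G\<^esub> tens R B N (s c) x) \<otimes>\<^bsub>Q\<^esub> (I #>\<^bsub>B.G\<^esub> tens R B N (s c') x)"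
      if c: "c \<in> carrier C" "c' \<in> carrier C" "x \<in> carrier N" for c c' x
    proof -
      have "I #>\<^bsub>B.G\<^esub> tens R B N (s (c \<oplus>\<^bsub>C\<^esub> c')) x = I #>\<^bsub>B.G\<^esub> tens R B N (s c \<oplus>\<^bsub>B\<^esub> s c') x"
        using c s by (intro q_eq) (simp_all add: left_hom_add[OF g])
      then show ?thesis
        using c s q.hom_mult[OF B.tens_closed[of "s c" x] B.tens_closed[of "s c'" x]] by (simp add: B.tens_add_left)
    qed
    show "I #>\<^bsub>B.G\<^esub> tens R B N (s c) (x \<oplus>\<^bsub>N\<^esub> x') = (I #>\<^bsub>B.G\<^esub> tens R B N (s c) x) \<otimes>\<^bsub>Q\<^esub> (I #>\<^bsub>B.G\<^esub> tens R B N (s c) x')"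
      if c: "c \<in> carrier C" "x \<in> carrier N" "x' \<in> carrier N" for c x x'
      using c s q.hom_mult[OF B.tens_closed[of "s c" x] B.tens_closed[of "s c" x']] by (simp add: B.tens_add_right)
    show "I #>\<^bsub>B.G\<^esub> tens R B N (s (r \<odot>\<^bsub>C\<^esub> c)) x = I #>\<^bsub>B.G\<^esub> tens R B N (s c) (r \<odot>\<^bsub>N\<^esub> x)"
      if c: "r \<in> carrier R" "c \<in> carrier C" "x \<in> carrier N" for r c x
    proof -
      have "g (r \<odot>\<^bsub>B\<^esub> s c) = r \<odot>\<^bsub>C\<^esub> c" using c s left_hom_smult[OF g, of r "s c"] by simp
      then have "I #>\<^bsub>B.G\<^esub> tens R B N (s (r \<odot>\<^bsub>C\<^esub> c)) x = I #>\<^bsub>B.G\<^esub> tens R B N (r \<odot>\<^bsub>B\<^esub> s c) x"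
        using c s C.A_smult B.A_smult by (intro q_eq) simp_all
      then show ?thesis using c s by (simp add: B.tens_balanced)
    qed
  qed
  then obtain h where h: "h \<in> hom C.G Q"
    "\<And>c x. \<lbrakk>c \<in> carrier C; x \<in> carrier N\<rbrakk> \<Longrightarrow> h (tens R C N c x) = I #>\<^bsub>B.G\<^esub> tens R B N (s c) x" by blast
  interpret CG: comm_group C.G by (rule C.group)
  interpret h: group_hom C.G Q h by unfold_locales (rule h)
  \<comment> \<open>\<open>h\<close> after \<open>g \<otimes> N\<close> is the quotient map modulo
    the image of \<open>f \<otimes> N\<close>. What \<open>g \<otimes> N\<close> kills therefore
    lies in that image.\<close>
  have "h (tensor_map R C N g X) = I #>\<^bsub>B.G\<^esub> X"
  proof (rule B.hom_eqI[OF Q _ qh _ X])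
    show "(\<lambda>X. h (tensor_map R C N g X)) \<in> hom B.G Q"
      using hom_compose[OF tensor_map_hom(1)[OF B C g] h(1)] by (simp add: o_def)
    fix b x assume b: "b \<in> carrier B" "x \<in> carrier N"
    have "I #>\<^bsub>B.G\<^esub> tens R B N (s (g b)) x = I #>\<^bsub>B.G\<^esub> tens R B N b x"
      using b s left_hom_closed[OF g] by (intro q_eq) simp_all
    then show "h (tensor_map R C N g (tens R B N b x)) = I #>\<^bsub>B.G\<^esub> tens R B N b x"
      using b left_hom_closed[OF g] by (simp add: tensor_map_hom(2)[OF B C g] h(2))
  qed
  then have "I #>\<^bsub>B.G\<^esub> X = I" using 1 h.hom_one by (simp add: Q_def)
  then have "X \<in> I" using BG.rcos_self[OF X I] by simp
  then show ?thesis unfolding I_def by blast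
qed

section \<open>Vanishing of Tor\<close>

text \<open>\<open>tor_van R P \<delta> N t\<close> says that the homology of \<open>P \<otimes> N\<close> vanishes in degree \<open>t + 1\<close>.\<close>

definition tor_van ::
  "('r, 'e) ring_scheme \<Rightarrow> (nat \<Rightarrow> ('r, 'p, 'x) module_scheme) \<Rightarrow> (nat \<Rightarrow> 'p \<Rightarrow> 'p)
    \<Rightarrow> ('r, 'n, 'y) module_scheme \<Rightarrow> nat \<Rightarrow> bool" where
  "tor_van R P \<delta> N t \<longleftrightarrow> (\<forall>z\<in>carrier (tensor_group R (P (Suc t)) N).
     tensor_map R (P t) N (\<delta> t) z = \<one>\<^bsub>tensor_group R (P t) N\<^esub> \<longrightarrow>
     (\<exists>w\<in>carrier (tensor_group R (P (Suc (Suc t))) N). tensor_map R (P (Suc t)) N (\<delta> (Suc t)) w = z))"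

lemma tensorI: "left_module (op_ring R) A \<Longrightarrow> left_module R N \<Longrightarrow> tensor R A N"
  by (simp add: tensor_def)

lemma trivial_Tor_iff:
  assumes U: "left_module (op_ring R) U" and N: "left_module R N"
  shows "trivial_group (Tor R (Suc t) U N) \<longleftrightarrow>
    tor_van R (std_res (op_ring R) U) (\<lambda>_. std_diff (op_ring R)) N t"
proof -
  interpret S: resolution "op_ring R" "std_res (op_ring R) U" "\<lambda>_. std_diff (op_ring R)" "std_aug (op_ring R) U" U
    by (rule resolution_std[OF U])
  let ?F = "std_res (op_ring R) U"
  have T: "tensor R (?F j) N" for j by (rule tensorI[OF S.modules N])
  have "trivial_group (Tor R (Suc t) U N) \<longleftrightarrow>
      (\<forall>y\<in>carrier (tensor_group R (?F (Suc t)) N).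
        tensor_map R (?F t) N (std_diff (op_ring R)) y = \<one>\<^bsub>tensor_group R (?F t) N\<^esub> \<longrightarrow>
        y \<in> tensor_map R (?F (Suc t)) N (std_diff (op_ring R)) ` carrier (tensor_group R (?F (Suc (Suc t))) N))"
    unfolding Tor_def Let_def nat.case
  proof (rule trivial_homology_iff)
    fix x assume x: "x \<in> carrier (tensor_group R (?F (Suc (Suc t))) N)"
    show "tensor_map R (?F t) N (std_diff (op_ring R)) (tensor_map R (?F (Suc t)) N (std_diff (op_ring R)) x)
        = \<one>\<^bsub>tensor_group R (?F t) N\<^esub>"
      unfolding tensor_map_compose[OF T T T S.diff S.diff x]
      by (rule tensor_map_zero[OF T T S.diff_diff x])
  qed (rule tensor.group[OF T] tensor_map_hom(1)[OF T T S.diff])+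
  also have "\<dots> \<longleftrightarrow> tor_van R ?F (\<lambda>_. std_diff (op_ring R)) N t"
    unfolding tor_van_def image_iff by (simp add: eq_commute)
  finally show ?thesis .
qed

text \<open>Apply the decomposition \<open>g f + \<delta> h + h \<delta>\<close> of the identity to
  a cycle \<open>z\<close>. The last part vanishes, the second is a boundary, and the first is the
  image under \<open>g\<close> of a boundary of \<open>Q\<close>.\<close>

lemma tor_van_compare:
  assumes "resolution (op_ring R) P \<delta> \<epsilon> U" "resolution (op_ring R) Q \<delta>' \<eta> U"
    and "\<And>i. projective (op_ring R) (P i)" "\<And>i. projective (op_ring R) (Q i)"
    and N: "left_module R N" and van: "tor_van R Q \<delta>' N t"
  shows "tor_van R P \<delta> N t"
  unfolding tor_van_def
proof (intro ballI impI)
  interpret P: resolution "op_ring R" P \<delta> \<epsilon> U by fact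
  interpret Q: resolution "op_ring R" Q \<delta>' \<eta> U by fact
  have TP: "tensor R (P i) N" and TQ: "tensor R (Q i) N" for i
    by (rule tensorI[OF P.modules N] tensorI[OF Q.modules N])+
  interpret G: comm_group "tensor_group R (P (Suc t)) N" by (rule tensor.group[OF TP])
  interpret G2: comm_group "tensor_group R (P (Suc (Suc t))) N" by (rule tensor.group[OF TP])
  fix z assume z: "z \<in> carrier (tensor_group R (P (Suc t)) N)"
    and cycle: "tensor_map R (P t) N (\<delta> t) z = \<one>\<^bsub>tensor_group R (P t) N\<^esub>"
  obtain f g h where f: "\<And>i. f i \<in> left_hom (op_ring R) (P i) (Q i)" and g: "\<And>i. g i \<in> left_hom (op_ring R) (Q i) (P i)"
    and h: "\<And>i. h i \<in> left_hom (op_ring R) (P i) (P (Suc i))"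
    and fS: "\<And>i x. x \<in> carrier (P (Suc i)) \<Longrightarrow> f i (\<delta> i x) = \<delta>' i (f (Suc i) x)"
    and gS: "\<And>i x. x \<in> carrier (Q (Suc i)) \<Longrightarrow> g i (\<delta>' i x) = \<delta> i (g (Suc i) x)"
    and hS: "\<And>i x. x \<in> carrier (P (Suc i)) \<Longrightarrow> x = g (Suc i) (f (Suc i) x) \<oplus>\<^bsub>P (Suc i)\<^esub>
      (\<delta> (Suc i) (h (Suc i) x) \<oplus>\<^bsub>P (Suc i)\<^esub> h i (\<delta> i x))"
    using homotopy_equivalence[OF assms(1-4)] by blast
  let ?fz = "tensor_map R (Q (Suc t)) N (f (Suc t)) z"
  let ?hz = "tensor_map R (P (Suc (Suc t))) N (h (Suc t)) z"
  note fz = tensor_map_closed[OF TP TQ f z] and hz = tensor_map_closed[OF TP TP h z]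
  have "tensor_map R (Q t) N (\<delta>' t) ?fz = tensor_map R (Q t) N (\<lambda>x. f t (\<delta> t x)) z"
    unfolding tensor_map_compose[OF TP TQ TQ f Q.diff z]
    by (rule tensor_map_cong[OF TP TQ left_hom_compose[OF P.diff f] _ z]) (simp add: fS)
  also have "\<dots> = tensor_map R (Q t) N (f t) (tensor_map R (P t) N (\<delta> t) z)"
    by (rule tensor_map_compose[OF TP TP TQ P.diff f z, symmetric])
  also have "\<dots> = \<one>\<^bsub>tensor_group R (Q t) N\<^esub>" unfolding cycle by (rule tensor_map_one[OF TP TQ f])
  finally obtain w where w: "w \<in> carrier (tensor_group R (Q (Suc (Suc t))) N)"
    "tensor_map R (Q (Suc t)) N (\<delta>' (Suc t)) w = ?fz"
    using van fz unfolding tor_van_def by blast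
  let ?gw = "tensor_map R (P (Suc (Suc t))) N (g (Suc (Suc t))) w"
  note gw = tensor_map_closed[OF TQ TP g w(1)]
  have 1: "tensor_map R (P (Suc t)) N (\<lambda>x. g (Suc t) (f (Suc t) x)) z = tensor_map R (P (Suc t)) N (\<delta> (Suc t)) ?gw"
  proof -
    have "tensor_map R (P (Suc t)) N (\<lambda>x. g (Suc t) (f (Suc t) x)) z
        = tensor_map R (P (Suc t)) N (g (Suc t)) (tensor_map R (Q (Suc t)) N (\<delta>' (Suc t)) w)"
      unfolding w(2) by (rule tensor_map_compose[OF TP TQ TP f g z, symmetric])
    also have "\<dots> = tensor_map R (P (Suc t)) N (\<lambda>x. g (Suc t) (\<delta>' (Suc t) x)) w"
      by (rule tensor_map_compose[OF TQ TQ TP Q.diff g w(1)])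
    also have "\<dots> = tensor_map R (P (Suc t)) N (\<lambda>x. \<delta> (Suc t) (g (Suc (Suc t)) x)) w"
      by (rule tensor_map_cong[OF TQ TP left_hom_compose[OF g P.diff] _ w(1)]) (simp add: gS)
    also have "\<dots> = tensor_map R (P (Suc t)) N (\<delta> (Suc t)) ?gw"
      by (rule tensor_map_compose[OF TQ TP TP g P.diff w(1), symmetric])
    finally show ?thesis .
  qed
  have 2: "tensor_map R (P (Suc t)) N (\<lambda>x. \<delta> (Suc t) (h (Suc t) x)) z = tensor_map R (P (Suc t)) N (\<delta> (Suc t)) ?hz"
    by (rule tensor_map_compose[OF TP TP TP h P.diff z, symmetric])
  have 3: "tensor_map R (P (Suc t)) N (\<lambda>x. h t (\<delta> t x)) z = \<one>\<^bsub>tensor_group R (P (Suc t)) N\<^esub>"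
    using tensor_map_compose[OF TP TP TP P.diff h z] unfolding cycle tensor_map_one[OF TP TP h] by simp
  note gf = left_hom_compose[OF f g] and \<delta>h = left_hom_compose[OF h P.diff] and h\<delta> = left_hom_compose[OF P.diff h]
  have "z = tensor_map R (P (Suc t)) N (\<lambda>x. x) z" by (rule tensor_map_id[OF TP z, symmetric])
  also have "\<dots> = tensor_map R (P (Suc t)) N (\<lambda>x. g (Suc t) (f (Suc t) x) \<oplus>\<^bsub>P (Suc t)\<^esub>
      (\<delta> (Suc t) (h (Suc t) x) \<oplus>\<^bsub>P (Suc t)\<^esub> h t (\<delta> t x))) z"
    by (rule tensor_map_cong[OF TP TP left_hom_plus[OF P.modules gf left_hom_plus[OF P.modules \<delta>h h\<delta>]] hS z])
  also have "\<dots> = tensor_map R (P (Suc t)) N (\<delta> (Suc t)) ?gw \<otimes>\<^bsub>tensor_group R (P (Suc t)) N\<^esub>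
      (tensor_map R (P (Suc t)) N (\<delta> (Suc t)) ?hz \<otimes>\<^bsub>tensor_group R (P (Suc t)) N\<^esub> \<one>\<^bsub>tensor_group R (P (Suc t)) N\<^esub>)"
    unfolding tensor_map_add[OF TP TP gf left_hom_plus[OF P.modules \<delta>h h\<delta>] z] tensor_map_add[OF TP TP \<delta>h h\<delta> z] 1 2 3 ..
  also have "\<dots> = tensor_map R (P (Suc t)) N (\<delta> (Suc t)) (?gw \<otimes>\<^bsub>tensor_group R (P (Suc (Suc t))) N\<^esub> ?hz)"
    using gw hz tensor_map_closed[OF TP TP P.diff hz] by (simp add: tensor_map_mult[OF TP TP P.diff])
  finally show "\<exists>w\<in>carrier (tensor_group R (P (Suc (Suc t))) N). tensor_map R (P (Suc t)) N (\<delta> (Suc t)) w = z"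
    using gw hz by (intro bexI[where x = "?gw \<otimes>\<^bsub>tensor_group R (P (Suc (Suc t))) N\<^esub> ?hz"]) simp_all
qed

lemma nd_flat_tor_van_d:
  fixes R :: "('r, 'e) ring_scheme"
  assumes N: "nd_flat R n d N" and P: "resolution (op_ring R) P \<delta> \<epsilon> U" "\<And>i. fg_free (op_ring R) (P i)"
  shows "tor_van R P \<delta> N d"
proof -
  have N': "left_module R N" using N by (simp add: nd_flat_def)
  obtain V :: "('r, (nat \<Rightarrow> 'r) set) module" and \<eta>
    where V: "finitely_presented (op_ring R) n V" "resolution (op_ring R) P \<delta> \<eta> V"
    using finitely_presented_fibre_module[OF P] by blast
  have U: "left_module (op_ring R) V" using resolution.target[OF V(2)] .
  have "trivial_group (Tor R (Suc d) V N)"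
    using N[unfolded nd_flat_def, THEN conjunct2, rule_format, OF V(1)] by simp
  then show ?thesis
    unfolding trivial_Tor_iff[OF U N']
    by (rule tor_van_compare[OF V(2) resolution_std[OF U] fg_free_projective[OF P(2)] projective_std[OF U] N'])
qed

lemma nd_flat_tor_van:
  assumes N: "nd_flat R n d N" and P: "resolution (op_ring R) P \<delta> \<epsilon> U" "\<And>i. fg_free (op_ring R) (P i)" and "t \<ge> d"
  shows "tor_van R P \<delta> N t"
proof (cases "t = d")
  case True
  then show ?thesis using nd_flat_tor_van_d[OF N P] by simp
next
  case False
  \<comment> \<open>\<open>Suc e\<close> equals \<open>t - d\<close>, so the old degree
    \<open>t\<close> is degree \<open>d\<close> of the shifted resolution.\<close>
  define e where "e = t - d - 1"
  have t: "t = Suc e + d" using False assms(4) by (simp add: e_def)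
  show ?thesis
    using nd_flat_tor_van_d[OF N resolution_shift[OF P(1), of e] P(2)] by (simp add: tor_van_def t)
qed

text \<open>Both projections of a cycle are cycles and hence boundaries. The inclusions reassemble
  their primitives, since the two maps inclusion after projection add up to the identity.\<close>

lemma tor_van_direct_sum:
  assumes N: "left_module R N" and P: "\<And>i. left_module (op_ring R) (P i)" and Q: "\<And>i. left_module (op_ring R) (Q i)"
    and \<delta>: "\<And>i. \<delta> i \<in> left_hom (op_ring R) (P (Suc i)) (P i)" and \<delta>': "\<And>i. \<delta>' i \<in> left_hom (op_ring R) (Q (Suc i)) (Q i)"
    and vP: "tor_van R P \<delta> N t" and vQ: "tor_van R Q \<delta>' N t"
  shows "tor_van R (\<lambda>i. direct_sum (P i) (Q i)) (\<lambda>i z. (\<delta> i (fst z), \<delta>' i (snd z))) N t"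
  unfolding tor_van_def
proof (intro ballI impI)
  let ?S = "\<lambda>i. direct_sum (P i) (Q i)"
  let ?D = "\<lambda>i z. (\<delta> i (fst z), \<delta>' i (snd z))"
  have S: "left_module (op_ring R) (?S i)" for i by (rule left_module_direct_sum[OF P Q])
  have TP: "tensor R (P i) N" and TQ: "tensor R (Q i) N" and TS: "tensor R (?S i) N" for i
    by (rule tensorI[OF P N] tensorI[OF Q N] tensorI[OF S N])+
  have D: "?D i \<in> left_hom (op_ring R) (?S (Suc i)) (?S i)" for i
    by (intro left_hom_pair left_hom_compose[OF direct_sum_fst \<delta>] left_hom_compose[OF direct_sum_snd \<delta>'])
  let ?l = "\<lambda>i x. (x, \<zero>\<^bsub>Q i\<^esub>)" and ?r = "\<lambda>i y. (\<zero>\<^bsub>P i\<^esub>, y)"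
  have l: "?l i \<in> left_hom (op_ring R) (P i) (?S i)" and r: "?r i \<in> left_hom (op_ring R) (Q i) (?S i)" for i
    by (rule direct_sum_inl[OF Q] direct_sum_inr[OF P])+
  fix z assume z: "z \<in> carrier (tensor_group R (?S (Suc t)) N)"
    and cycle: "tensor_map R (?S t) N (?D t) z = \<one>\<^bsub>tensor_group R (?S t) N\<^esub>"
  let ?z1 = "tensor_map R (P (Suc t)) N fst z" and ?z2 = "tensor_map R (Q (Suc t)) N snd z"
  note z1 = tensor_map_closed[OF TS TP direct_sum_fst z] and z2 = tensor_map_closed[OF TS TQ direct_sum_snd z]
  have "tensor_map R (P t) N (\<delta> t) ?z1 = tensor_map R (P t) N (\<lambda>x. fst (?D t x)) z"
    unfolding tensor_map_compose[OF TS TP TP direct_sum_fst \<delta> z] by simp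
  also have "\<dots> = tensor_map R (P t) N fst (tensor_map R (?S t) N (?D t) z)"
    by (rule tensor_map_compose[OF TS TS TP D direct_sum_fst z, symmetric])
  also have "\<dots> = \<one>\<^bsub>tensor_group R (P t) N\<^esub>" unfolding cycle by (rule tensor_map_one[OF TS TP direct_sum_fst])
  finally obtain w1 where w1: "w1 \<in> carrier (tensor_group R (P (Suc (Suc t))) N)" "tensor_map R (P (Suc t)) N (\<delta> (Suc t)) w1 = ?z1"
    using vP z1 unfolding tor_van_def by blast
  have "tensor_map R (Q t) N (\<delta>' t) ?z2 = tensor_map R (Q t) N (\<lambda>x. snd (?D t x)) z"
    unfolding tensor_map_compose[OF TS TQ TQ direct_sum_snd \<delta>' z] by simp
  also have "\<dots> = tensor_map R (Q t) N snd (tensor_map R (?S t) N (?D t) z)"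
    by (rule tensor_map_compose[OF TS TS TQ D direct_sum_snd z, symmetric])
  also have "\<dots> = \<one>\<^bsub>tensor_group R (Q t) N\<^esub>" unfolding cycle by (rule tensor_map_one[OF TS TQ direct_sum_snd])
  finally obtain w2 where w2: "w2 \<in> carrier (tensor_group R (Q (Suc (Suc t))) N)" "tensor_map R (Q (Suc t)) N (\<delta>' (Suc t)) w2 = ?z2"
    using vQ z2 unfolding tor_van_def by blast
  let ?w1 = "tensor_map R (?S (Suc (Suc t))) N (?l (Suc (Suc t))) w1"
  let ?w2 = "tensor_map R (?S (Suc (Suc t))) N (?r (Suc (Suc t))) w2"
  note w1' = tensor_map_closed[OF TP TS l w1(1)] and w2' = tensor_map_closed[OF TQ TS r w2(1)]
  interpret G: comm_group "tensor_group R (?S (Suc (Suc t))) N" by (rule tensor.group[OF TS])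
  have e1: "tensor_map R (?S (Suc t)) N (?D (Suc t)) ?w1 = tensor_map R (?S (Suc t)) N (\<lambda>x. ?l (Suc t) (fst x)) z"
  proof -
    have "tensor_map R (?S (Suc t)) N (?D (Suc t)) ?w1 = tensor_map R (?S (Suc t)) N (\<lambda>x. ?l (Suc t) (\<delta> (Suc t) x)) w1"
      unfolding tensor_map_compose[OF TP TS TS l D w1(1)]
      by (rule tensor_map_cong[OF TP TS left_hom_compose[OF \<delta> l] _ w1(1)]) (simp add: left_hom_zero[OF \<delta>' Q Q])
    also have "\<dots> = tensor_map R (?S (Suc t)) N (?l (Suc t)) ?z1"
      unfolding w1(2)[symmetric] by (rule tensor_map_compose[OF TP TP TS \<delta> l w1(1), symmetric])
    also have "\<dots> = tensor_map R (?S (Suc t)) N (\<lambda>x. ?l (Suc t) (fst x)) z"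
      by (rule tensor_map_compose[OF TS TP TS direct_sum_fst l z])
    finally show ?thesis .
  qed
  have e2: "tensor_map R (?S (Suc t)) N (?D (Suc t)) ?w2 = tensor_map R (?S (Suc t)) N (\<lambda>x. ?r (Suc t) (snd x)) z"
  proof -
    have "tensor_map R (?S (Suc t)) N (?D (Suc t)) ?w2 = tensor_map R (?S (Suc t)) N (\<lambda>x. ?r (Suc t) (\<delta>' (Suc t) x)) w2"
      unfolding tensor_map_compose[OF TQ TS TS r D w2(1)]
      by (rule tensor_map_cong[OF TQ TS left_hom_compose[OF \<delta>' r] _ w2(1)]) (simp add: left_hom_zero[OF \<delta> P P])
    also have "\<dots> = tensor_map R (?S (Suc t)) N (?r (Suc t)) ?z2"
      unfolding w2(2)[symmetric] by (rule tensor_map_compose[OF TQ TQ TS \<delta>' r w2(1), symmetric])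
    also have "\<dots> = tensor_map R (?S (Suc t)) N (\<lambda>x. ?r (Suc t) (snd x)) z"
      by (rule tensor_map_compose[OF TS TQ TS direct_sum_snd r z])
    finally show ?thesis .
  qed
  interpret Pt: left_module "op_ring R" "P (Suc t)" by (rule P)
  interpret Qt: left_module "op_ring R" "Q (Suc t)" by (rule Q)
  note lf = left_hom_compose[OF direct_sum_fst l] and rs = left_hom_compose[OF direct_sum_snd r]
  have "tensor_map R (?S (Suc t)) N (?D (Suc t)) (?w1 \<otimes>\<^bsub>tensor_group R (?S (Suc (Suc t))) N\<^esub> ?w2)
      = tensor_map R (?S (Suc t)) N (\<lambda>x. ?l (Suc t) (fst x) \<oplus>\<^bsub>?S (Suc t)\<^esub> ?r (Suc t) (snd x)) z"
    unfolding tensor_map_mult[OF TS TS D w1' w2'] e1 e2 tensor_map_add[OF TS TS lf rs z] ..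
  also have "\<dots> = tensor_map R (?S (Suc t)) N (\<lambda>x. x) z"
    by (rule tensor_map_cong[OF TS TS left_hom_id _ z]) auto
  also have "\<dots> = z" by (rule tensor_map_id[OF TS z])
  finally show "\<exists>w\<in>carrier (tensor_group R (?S (Suc (Suc t))) N). tensor_map R (?S (Suc t)) N (?D (Suc t)) w = z"
    using w1' w2' by (intro bexI[where x = "?w1 \<otimes>\<^bsub>tensor_group R (?S (Suc (Suc t))) N\<^esub> ?w2"]) simp_all
qed

text \<open>Lifting along the connecting map: if \<open>f z\<close> is the boundary of
  \<open>w\<close>, then \<open>(- w, z)\<close> is a cycle of the cone that projects to
  \<open>z\<close>. The assumption \<open>cycle\<close> concerns \<open>i = Suc j\<close> only,
  because in degree 0 every \<open>z\<close> is a cycle.\<close>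

lemma tor_van_cone_aux:
  assumes "cone_data (op_ring R) P \<delta> \<epsilon> A Q \<delta>' \<eta> B \<iota> \<pi> f C" and N: "left_module R N"
    and w: "w \<in> carrier (tensor_group R (Q (Suc i)) N)" and z: "z \<in> carrier (tensor_group R (P i) N)"
    and wz: "tensor_map R (Q i) N (\<delta>' i) w = tensor_map R (Q i) N (f i) z"
    and cycle: "\<And>j. i = Suc j \<Longrightarrow> tensor_map R (P j) N (\<delta> j) z = \<one>\<^bsub>tensor_group R (P j) N\<^esub>"
  shows "\<exists>y\<in>carrier (tensor_group R (cone (op_ring R) P Q (Suc i)) N).
    tensor_map R (cone (op_ring R) P Q i) N (cone_diff P Q \<delta> \<delta>' f i) y = \<one>\<^bsub>tensor_group R (cone (op_ring R) P Q i) N\<^esub> \<and>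
    tensor_map R (P i) N snd y = z"
proof -
  interpret C: cone_data "op_ring R" P \<delta> \<epsilon> A Q \<delta>' \<eta> B \<iota> \<pi> f C by fact
  let ?G = "cone (op_ring R) P Q" and ?D = "cone_diff P Q \<delta> \<delta>' f"
  have TP: "tensor R (P i) N" and TQ: "tensor R (Q i) N" and TG: "tensor R (?G i) N" for i
    by (rule tensorI[OF C.P.modules N] tensorI[OF C.Q.modules N] tensorI[OF C.cone_modules N])+
  let ?l = "\<lambda>q. (q, \<zero>\<^bsub>P i\<^esub>)" and ?r = "\<lambda>p. (\<zero>\<^bsub>Q (Suc i)\<^esub>, p)"
  have l: "?l \<in> left_hom (op_ring R) (Q (Suc i)) (?G (Suc i))" and r: "?r \<in> left_hom (op_ring R) (P i) (?G (Suc i))"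
    using direct_sum_inl[OF C.P.modules] direct_sum_inr[OF C.Q.modules] by (auto simp: cone_def)
  have s: "snd \<in> left_hom (op_ring R) (?G (Suc i)) (P i)" using direct_sum_snd by (simp add: cone_def)
  \<comment> \<open>The zero of the second summand of the cone in degree \<open>i\<close>: taken
    from the dummy summand in degree 0 and from \<open>P j\<close> in degree
    \<open>Suc j\<close>.\<close>
  define zz where "zz = (case i of 0 \<Rightarrow> \<zero>\<^bsub>P 0\<^esub> | Suc j \<Rightarrow> \<zero>\<^bsub>P j\<^esub>)"
  let ?l' = "\<lambda>q. (q, zz)"
  have l': "?l' \<in> left_hom (op_ring R) (Q i) (?G i)"
    using direct_sum_inl[OF C.zero_module] direct_sum_inl[OF C.P.modules] by (cases i) (simp_all add: cone_def zz_def)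
  \<comment> \<open>The part of the cone differential that goes from \<open>P\<close> to
    \<open>P\<close>; tensored with \<open>N\<close> it kills \<open>z\<close> by the cycle
    condition.\<close>
  define rr where "rr p = (\<zero>\<^bsub>Q i\<^esub>, case i of 0 \<Rightarrow> \<zero>\<^bsub>P 0\<^esub> | Suc j \<Rightarrow> \<ominus>\<^bsub>P j\<^esub> \<delta> j p)" for p
  have rr: "rr \<in> left_hom (op_ring R) (P i) (?G i) \<and> tensor_map R (?G i) N rr z = \<one>\<^bsub>tensor_group R (?G i) N\<^esub>"
  proof (cases i)
    case 0
    have e: "rr x = \<zero>\<^bsub>?G i\<^esub>" for x by (simp add: rr_def 0 cone_def)
    have "rr \<in> left_hom (op_ring R) (P i) (?G i)"
      by (rule left_hom_cong[OF C.P.modules left_hom_const_zero[OF C.cone_modules] e])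
    with tensor_map_zero[OF TP TG e z] show ?thesis by simp
  next
    case (Suc j)
    have neg: "(\<lambda>p. (\<zero>\<^bsub>Q (Suc j)\<^esub>, \<ominus>\<^bsub>P j\<^esub> p)) \<in> left_hom (op_ring R) (P j) (?G i)"
      using left_hom_compose[OF left_hom_uminus[OF C.P.modules left_hom_id] direct_sum_inr[OF C.Q.modules]]
      by (simp add: cone_def Suc)
    have z': "z \<in> carrier (tensor_group R (P (Suc j)) N)" using z Suc by simp
    have e: "rr = (\<lambda>p. (\<zero>\<^bsub>Q (Suc j)\<^esub>, \<ominus>\<^bsub>P j\<^esub> \<delta> j p))" by (simp add: rr_def Suc fun_eq_iff)
    have "tensor_map R (?G i) N rr z = \<one>\<^bsub>tensor_group R (?G i) N\<^esub>"
      unfolding e using tensor_map_compose[OF TP TP TG C.P.diff neg z'] cycle[OF Suc] tensor_map_one[OF TP TG neg] by simp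
    moreover have "rr \<in> left_hom (op_ring R) (P i) (?G i)"
      unfolding e using left_hom_compose[OF C.P.diff neg] Suc by simp
    ultimately show ?thesis by simp
  qed
  interpret GQ: comm_group "tensor_group R (Q (Suc i)) N" by (rule tensor.group[OF TQ])
  interpret GQ': comm_group "tensor_group R (Q i) N" by (rule tensor.group[OF TQ])
  interpret GS: comm_group "tensor_group R (?G (Suc i)) N" by (rule tensor.group[OF TG])
  interpret GG: comm_group "tensor_group R (?G i) N" by (rule tensor.group[OF TG])
  interpret GP: comm_group "tensor_group R (P i) N" by (rule tensor.group[OF TP])
  interpret Qi: left_module "op_ring R" "Q i" by (rule C.Q.modules)
  interpret Qs: left_module "op_ring R" "Q (Suc i)" by (rule C.Q.modules)
  interpret Pi: left_module "op_ring R" "P i" by (rule C.P.modules)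
  let ?w = "inv\<^bsub>tensor_group R (Q (Suc i)) N\<^esub> w"
  have w': "?w \<in> carrier (tensor_group R (Q (Suc i)) N)" using w by simp
  let ?a = "tensor_map R (?G (Suc i)) N ?l ?w" and ?b = "tensor_map R (?G (Suc i)) N ?r z"
  note a = tensor_map_closed[OF TQ TG l w'] and b = tensor_map_closed[OF TP TG r z]
  let ?fz = "tensor_map R (Q i) N (f i) z"
  note fz = tensor_map_closed[OF TP TQ C.f z]
  note l'\<delta> = left_hom_compose[OF C.Q.diff l'] and l'f = left_hom_compose[OF C.f l']
  have Da: "tensor_map R (?G i) N (?D i) ?a = tensor_map R (?G i) N ?l' (inv\<^bsub>tensor_group R (Q i) N\<^esub> ?fz)"
  proof -
    have "tensor_map R (?G i) N (?D i) ?a = tensor_map R (?G i) N (\<lambda>q. ?l' (\<delta>' i q)) ?w"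
      unfolding tensor_map_compose[OF TQ TG TG l C.cone_diff_hom w']
    proof (rule tensor_map_cong[OF TQ TG l'\<delta> _ w'])
      fix q assume q: "q \<in> carrier (Q (Suc i))"
      have "\<ominus>\<^bsub>P j\<^esub> \<delta> j \<zero>\<^bsub>P (Suc j)\<^esub> = \<zero>\<^bsub>P j\<^esub>" for j
        using left_hom_zero[OF C.P.diff C.P.modules C.P.modules] left_module.neg_zero[OF C.P.modules] by simp
      then show "?D i (q, \<zero>\<^bsub>P i\<^esub>) = (\<delta>' i q, zz)"
        using Qi.M.r_zero[OF left_hom_closed[OF C.Q.diff q]] left_hom_zero[OF C.f C.P.modules C.Q.modules]
        by (cases i) (simp_all add: cone_diff_def zz_def)
    qed
    also have "\<dots> = tensor_map R (?G i) N ?l' (tensor_map R (Q i) N (\<delta>' i) ?w)"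
      by (rule tensor_map_compose[OF TQ TQ TG C.Q.diff l' w', symmetric])
    finally show ?thesis unfolding tensor_map_inv[OF TQ TQ C.Q.diff w] wz .
  qed
  have Db: "tensor_map R (?G i) N (?D i) ?b = tensor_map R (?G i) N ?l' ?fz \<otimes>\<^bsub>tensor_group R (?G i) N\<^esub> \<one>\<^bsub>tensor_group R (?G i) N\<^esub>"
  proof -
    have "tensor_map R (?G i) N (?D i) ?b = tensor_map R (?G i) N (\<lambda>p. ?l' (f i p) \<oplus>\<^bsub>?G i\<^esub> rr p) z"
      unfolding tensor_map_compose[OF TP TG TG r C.cone_diff_hom z]
    proof (rule tensor_map_cong[OF TP TG left_hom_plus[OF C.cone_modules l'f conjunct1[OF rr]] _ z])
      fix p assume p: "p \<in> carrier (P i)"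
      have 0: "\<delta>' i \<zero>\<^bsub>Q (Suc i)\<^esub> = \<zero>\<^bsub>Q i\<^esub>" by (rule left_hom_zero[OF C.Q.diff C.Q.modules C.Q.modules])
      note fp = left_hom_closed[OF C.f p]
      show "?D i (\<zero>\<^bsub>Q (Suc i)\<^esub>, p) = (f i p, zz) \<oplus>\<^bsub>?G i\<^esub> rr p"
      proof (cases i)
        case i: 0
        interpret P0: left_module "op_ring R" "P 0" by (rule C.P.modules)
        show ?thesis using fp 0 Qi.M.l_zero Qi.M.r_zero by (simp add: i cone_diff_def zz_def rr_def cone_def direct_sum_def)
      next
        case (Suc j)
        interpret Pj: left_module "op_ring R" "P j" by (rule C.P.modules)
        have "\<delta> j p \<in> carrier (P j)" using left_hom_closed[OF C.P.diff] p Suc by blast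
        then show ?thesis using fp 0 Qi.M.l_zero Qi.M.r_zero by (simp add: Suc cone_diff_def zz_def rr_def cone_def direct_sum_def)
      qed
    qed
    also have "\<dots> = tensor_map R (?G i) N ?l' ?fz \<otimes>\<^bsub>tensor_group R (?G i) N\<^esub> \<one>\<^bsub>tensor_group R (?G i) N\<^esub>"
      unfolding tensor_map_add[OF TP TG l'f conjunct1[OF rr] z] conjunct2[OF rr] tensor_map_compose[OF TP TQ TG C.f l' z] ..
    finally show ?thesis .
  qed
  have "tensor_map R (?G i) N (?D i) (?a \<otimes>\<^bsub>tensor_group R (?G (Suc i)) N\<^esub> ?b) = \<one>\<^bsub>tensor_group R (?G i) N\<^esub>"
    unfolding tensor_map_mult[OF TG TG C.cone_diff_hom a b] Da Db tensor_map_inv[OF TQ TG l' fz]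
    using tensor_map_closed[OF TQ TG l' fz] by simp
  moreover have "tensor_map R (P i) N snd (?a \<otimes>\<^bsub>tensor_group R (?G (Suc i)) N\<^esub> ?b) = z"
  proof -
    have "tensor_map R (P i) N snd ?a = \<one>\<^bsub>tensor_group R (P i) N\<^esub>"
      unfolding tensor_map_compose[OF TQ TG TP l s w'] by (rule tensor_map_zero[OF TQ TP _ w']) simp
    moreover have "tensor_map R (P i) N snd ?b = z"
      unfolding tensor_map_compose[OF TP TG TP r s z] using tensor_map_id[OF TP z] by simp
    ultimately show ?thesis unfolding tensor_map_mult[OF TG TP s a b] using z by simp
  qed
  ultimately show ?thesis using a b by (intro bexI[where x = "?a \<otimes>\<^bsub>tensor_group R (?G (Suc i)) N\<^esub> ?b"]) simp_all
qed

text \<open>This is the exact piece \<open>Tor_(t+2)(C) -> Tor_(t+1)(A) -> Tor_(t+1)(B)\<close> with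
  vanishing ends. The image of \<open>z\<close> in \<open>Q\<close> is a boundary, so
  \<open>z\<close> lifts to a cycle of the cone; the second coordinate of a primitive there bounds
  \<open>z\<close> up to sign.\<close>

lemma tor_van_cone_Suc:
  assumes cd: "cone_data (op_ring R) P \<delta> \<epsilon> A Q \<delta>' \<eta> B \<iota> \<pi> f C" and N: "left_module R N"
    and vG: "tor_van R (cone (op_ring R) P Q) (cone_diff P Q \<delta> \<delta>' f) N (Suc t)" and vQ: "tor_van R Q \<delta>' N t"
  shows "tor_van R P \<delta> N t"
  unfolding tor_van_def
proof (intro ballI impI)
  interpret C: cone_data "op_ring R" P \<delta> \<epsilon> A Q \<delta>' \<eta> B \<iota> \<pi> f C by fact
  let ?G = "cone (op_ring R) P Q" and ?D = "cone_diff P Q \<delta> \<delta>' f"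
  have TP: "tensor R (P i) N" and TQ: "tensor R (Q i) N" and TG: "tensor R (?G i) N" for i
    by (rule tensorI[OF C.P.modules N] tensorI[OF C.Q.modules N] tensorI[OF C.cone_modules N])+
  have s: "snd \<in> left_hom (op_ring R) (?G (Suc i)) (P i)" for i using direct_sum_snd by (simp add: cone_def)
  fix z assume z: "z \<in> carrier (tensor_group R (P (Suc t)) N)"
    and cycle: "tensor_map R (P t) N (\<delta> t) z = \<one>\<^bsub>tensor_group R (P t) N\<^esub>"
  have "tensor_map R (Q t) N (\<delta>' t) (tensor_map R (Q (Suc t)) N (f (Suc t)) z) = tensor_map R (Q t) N (\<lambda>x. f t (\<delta> t x)) z"
    unfolding tensor_map_compose[OF TP TQ TQ C.f C.Q.diff z]
    by (rule tensor_map_cong[OF TP TQ left_hom_compose[OF C.P.diff C.f] _ z]) (simp add: C.f_diff)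
  also have "\<dots> = \<one>\<^bsub>tensor_group R (Q t) N\<^esub>"
    using tensor_map_compose[OF TP TP TQ C.P.diff C.f z] unfolding cycle tensor_map_one[OF TP TQ C.f] by simp
  finally obtain w where w: "w \<in> carrier (tensor_group R (Q (Suc (Suc t))) N)"
    "tensor_map R (Q (Suc t)) N (\<delta>' (Suc t)) w = tensor_map R (Q (Suc t)) N (f (Suc t)) z"
    using vQ tensor_map_closed[OF TP TQ C.f z] unfolding tor_van_def by blast
  obtain y where y: "y \<in> carrier (tensor_group R (?G (Suc (Suc t))) N)"
    "tensor_map R (?G (Suc t)) N (?D (Suc t)) y = \<one>\<^bsub>tensor_group R (?G (Suc t)) N\<^esub>" "tensor_map R (P (Suc t)) N snd y = z"
    using tor_van_cone_aux[OF cd N w(1) z w(2)] cycle by auto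
  then obtain u where u: "u \<in> carrier (tensor_group R (?G (Suc (Suc (Suc t)))) N)"
    "tensor_map R (?G (Suc (Suc t))) N (?D (Suc (Suc t))) u = y"
    using vG unfolding tor_van_def by blast
  note ns = left_hom_uminus[OF C.P.modules s[of "Suc (Suc t)"]]
  have "z = tensor_map R (P (Suc t)) N (\<lambda>x. snd (?D (Suc (Suc t)) x)) u"
    using tensor_map_compose[OF TG TG TP C.cone_diff_hom s u(1)] u(2) y(3) by simp
  also have "\<dots> = tensor_map R (P (Suc t)) N (\<lambda>x. \<delta> (Suc t) (\<ominus>\<^bsub>P (Suc (Suc t))\<^esub> snd x)) u"
    by (rule tensor_map_cong[OF TG TP left_hom_compose[OF ns C.P.diff] _ u(1)])
      (use left_hom_closed[OF s] in \<open>simp add: cone_diff_def left_hom_neg[OF C.P.diff C.P.modules C.P.modules]\<close>)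
  also have "\<dots> = tensor_map R (P (Suc t)) N (\<delta> (Suc t)) (tensor_map R (P (Suc (Suc t))) N (\<lambda>x. \<ominus>\<^bsub>P (Suc (Suc t))\<^esub> snd x) u)"
    by (rule tensor_map_compose[OF TG TP TP ns C.P.diff u(1), symmetric])
  finally show "\<exists>w\<in>carrier (tensor_group R (P (Suc (Suc t))) N). tensor_map R (P (Suc t)) N (\<delta> (Suc t)) w = z"
    using tensor_map_closed[OF TG TP ns u(1)] by metis
qed

text \<open>Vanishing of \<open>Tor_1(C, N)\<close> makes \<open>\<iota> \<otimes> N\<close>
  injective. An element of the kernel lifts to \<open>P 0 \<otimes> N\<close>, becomes a boundary in
  \<open>Q\<close> by right exactness, and so lifts to a cycle of the cone; a primitive of it shows
  that the augmentation is trivial.\<close>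

lemma tor_van_cone_0:
  assumes cd: "cone_data (op_ring R) P \<delta> \<epsilon> A Q \<delta>' \<eta> B \<iota> \<pi> f C" and N: "left_module R N"
    and vG: "tor_van R (cone (op_ring R) P Q) (cone_diff P Q \<delta> \<delta>' f) N 0"
    and z: "z \<in> carrier (tensor_group R A N)" "tensor_map R B N \<iota> z = \<one>\<^bsub>tensor_group R B N\<^esub>"
  shows "z = \<one>\<^bsub>tensor_group R A N\<^esub>"
proof -
  interpret C: cone_data "op_ring R" P \<delta> \<epsilon> A Q \<delta>' \<eta> B \<iota> \<pi> f C by fact
  let ?G = "cone (op_ring R) P Q" and ?D = "cone_diff P Q \<delta> \<delta>' f"
  have TP: "tensor R (P i) N" and TQ: "tensor R (Q i) N" and TG: "tensor R (?G i) N" for i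
    by (rule tensorI[OF C.P.modules N] tensorI[OF C.Q.modules N] tensorI[OF C.cone_modules N])+
  have TA: "tensor R A N" and TB: "tensor R B N"
    by (rule tensorI[OF C.P.target N] tensorI[OF C.Q.target N])+
  have s: "snd \<in> left_hom (op_ring R) (?G (Suc i)) (P i)" for i using direct_sum_snd by (simp add: cone_def)
  obtain z0 where z0: "z0 \<in> carrier (tensor_group R (P 0) N)" "tensor_map R A N \<epsilon> z0 = z"
    using tensor_map_surj[OF TP TA C.P.aug C.P.aug_surj z(1)] by blast
  have "tensor_map R B N \<eta> (tensor_map R (Q 0) N (f 0) z0) = tensor_map R B N (\<lambda>x. \<iota> (\<epsilon> x)) z0"
    unfolding tensor_map_compose[OF TP TQ TB C.f C.Q.aug z0(1)]
    by (rule tensor_map_cong[OF TP TB left_hom_compose[OF C.P.aug C.incl] C.f_aug z0(1)])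
  also have "\<dots> = \<one>\<^bsub>tensor_group R B N\<^esub>"
    using tensor_map_compose[OF TP TA TB C.P.aug C.incl z0(1)] z0(2) z(2) by simp
  finally have "\<exists>w\<in>carrier (tensor_group R (Q (Suc 0)) N). tensor_map R (Q 0) N (\<delta>' 0) w = tensor_map R (Q 0) N (f 0) z0"
    by (intro tensor_map_exact[OF TQ TQ TB C.Q.diff C.Q.aug C.Q.aug_surj C.Q.exact_0 C.Q.aug_diff
          tensor_map_closed[OF TP TQ C.f z0(1)]])
  then obtain w where w: "w \<in> carrier (tensor_group R (Q (Suc 0)) N)"
    "tensor_map R (Q 0) N (\<delta>' 0) w = tensor_map R (Q 0) N (f 0) z0" by blast
  obtain y where y: "y \<in> carrier (tensor_group R (?G (Suc 0)) N)"
    "tensor_map R (?G 0) N (?D 0) y = \<one>\<^bsub>tensor_group R (?G 0) N\<^esub>" "tensor_map R (P 0) N snd y = z0"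
    using tor_van_cone_aux[OF cd N w(1) z0(1) w(2)] by auto
  then obtain u where u: "u \<in> carrier (tensor_group R (?G (Suc (Suc 0))) N)"
    "tensor_map R (?G (Suc 0)) N (?D (Suc 0)) u = y"
    using vG unfolding tor_van_def by blast
  have "z = tensor_map R A N (\<lambda>x. \<epsilon> (snd (?D (Suc 0) x))) u"
    using tensor_map_compose[OF TG TP TA left_hom_compose[OF C.cone_diff_hom s] C.P.aug u(1)]
      tensor_map_compose[OF TG TG TP C.cone_diff_hom s u(1)] u(2) y(3) z0(2) by simp
  also have "\<dots> = \<one>\<^bsub>tensor_group R A N\<^esub>"
  proof (rule tensor_map_zero[OF TG TA _ u(1)])
    fix x assume "x \<in> carrier (?G (Suc (Suc 0)))"
    then have "snd x \<in> carrier (P (Suc 0))" by (auto simp: cone_def)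
    then show "\<epsilon> (snd (?D (Suc 0) x)) = \<zero>\<^bsub>A\<^esub>"
      using left_hom_closed[OF C.P.diff] left_module.neg_zero[OF C.P.target]
      by (simp add: cone_diff_def left_hom_neg[OF C.P.aug C.P.modules C.P.target] C.P.aug_diff)
  qed
  finally show ?thesis .
qed

text \<open>The counterpart of \<open>ext_acyclic\<close>. Here \<open>U\<close> is a right module
  and is resolved over \<open>op_ring R\<close>.\<close>

definition tor_acyclic ::
  "('r, 'e) ring_scheme \<Rightarrow> ('r, 'u, 'x) module_scheme \<Rightarrow> ('r, 'n, 'y) module_scheme \<Rightarrow> bool" where
  "tor_acyclic R U N \<longleftrightarrow> (\<exists>(F :: nat \<Rightarrow> ('r, nat \<Rightarrow> 'r) module) \<delta> \<epsilon>.
     resolution (op_ring R) F \<delta> \<epsilon> U \<and> (\<forall>i. fg_free (op_ring R) (F i)) \<and> (\<forall>t. tor_van R F \<delta> N t))"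

lemma tor_acyclicI:
  fixes R :: "('r, 'e) ring_scheme"
  assumes "resolution (op_ring R) P \<delta> \<epsilon> U" "\<And>i. fg_free (op_ring R) (P i)" "left_module R N" "\<And>t. tor_van R P \<delta> N t"
  shows "tor_acyclic R U N"
proof -
  obtain F :: "nat \<Rightarrow> ('r, nat \<Rightarrow> 'r) module" and \<delta>' \<eta> where F: "resolution (op_ring R) F \<delta>' \<eta> U" "\<And>i. fg_free (op_ring R) (F i)"
    using finitely_presentedE[OF finitely_presentedI[OF assms(1,2)]] by blast
  have "tor_van R F \<delta>' N t" for t
    by (rule tor_van_compare[OF F(1) assms(1) fg_free_projective[OF F(2)] fg_free_projective[OF assms(2)] assms(3,4)])
  with F show ?thesis unfolding tor_acyclic_def by blast
qed

lemma tor_acyclicE: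
  fixes R :: "('r, 'e) ring_scheme"
  assumes "tor_acyclic R U N"
  obtains F :: "nat \<Rightarrow> ('r, nat \<Rightarrow> 'r) module" and \<delta> \<epsilon>
  where "resolution (op_ring R) F \<delta> \<epsilon> U" "\<And>i. fg_free (op_ring R) (F i)" "\<And>t. tor_van R F \<delta> N t"
  using assms unfolding tor_acyclic_def by blast

lemma tor_acyclic_iso:
  fixes R :: "('r, 'e) ring_scheme"
  assumes "tor_acyclic R U N" "left_module R N" "left_module (op_ring R) V" "module_iso (op_ring R) U V"
  shows "tor_acyclic R V N"
proof -
  obtain u where u: "u \<in> left_hom (op_ring R) U V" "bij_betw u (carrier U) (carrier V)"
    using assms(4) by (auto simp: module_iso_def)
  obtain F :: "nat \<Rightarrow> ('r, nat \<Rightarrow> 'r) module" and \<delta> \<epsilon>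
    where "resolution (op_ring R) F \<delta> \<epsilon> U" "\<And>i. fg_free (op_ring R) (F i)" "\<And>t. tor_van R F \<delta> N t"
    using tor_acyclicE[OF assms(1)] by blast
  then show ?thesis by (intro tor_acyclicI[OF resolution_iso[OF _ assms(3) u]] assms(2))
qed

lemma tor_acyclic_direct_sum:
  fixes R :: "('r, 'e) ring_scheme"
  assumes "tor_acyclic R U N" "tor_acyclic R V N" "left_module R N"
  shows "tor_acyclic R (direct_sum U V) N"
proof -
  obtain F :: "nat \<Rightarrow> ('r, nat \<Rightarrow> 'r) module" and \<delta> \<epsilon>
    where F: "resolution (op_ring R) F \<delta> \<epsilon> U" "\<And>i. fg_free (op_ring R) (F i)" "\<And>t. tor_van R F \<delta> N t"
    using tor_acyclicE[OF assms(1)] by blast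
  obtain G :: "nat \<Rightarrow> ('r, nat \<Rightarrow> 'r) module" and \<delta>' \<eta>
    where G: "resolution (op_ring R) G \<delta>' \<eta> V" "\<And>i. fg_free (op_ring R) (G i)" "\<And>t. tor_van R G \<delta>' N t"
    using tor_acyclicE[OF assms(2)] by blast
  interpret F: resolution "op_ring R" F \<delta> \<epsilon> U by fact
  interpret G: resolution "op_ring R" G \<delta>' \<eta> V by fact
  show ?thesis
    by (rule tor_acyclicI[OF resolution_direct_sum[OF F(1) G(1)] fg_free_direct_sum[OF F(2) G(2)] assms(3)
        tor_van_direct_sum[OF assms(3) F.modules G.modules F.diff G.diff F(3) G(3)]])
qed

lemma tor_acyclic_pow:
  assumes M: "left_module (op_ring R) M" and N: "left_module R N" and "tor_acyclic R M N"
  shows "tor_acyclic R (pow_module M m) N"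
proof (induction m)
  case 0
  have R: "ring (op_ring R)" by (rule left_module_ring[OF M])
  interpret R: ring "op_ring R" by (rule R)
  interpret M: left_module "op_ring R" M by fact
  have "carrier (pow_module M 0) = {\<zero>\<^bsub>pow_module M 0\<^esub>}"
    by (auto simp: set_eq_iff fun_eq_iff)
  note res = resolution_zero[OF left_module_pow[OF M] this]
  let ?F = "free_module (op_ring R) {..<0::nat}"
  have T: "tensor R ?F N" by (rule tensorI[OF left_module_free[OF R] N])
  have c: "x = \<zero>\<^bsub>?F\<^esub>" if "x \<in> carrier ?F" for x using that by (auto simp: free_module_carrier)
  have "tor_van R (\<lambda>i. ?F) (\<lambda>_ x. x) N t" for t
    unfolding tor_van_def using tensor_map_id[OF T] by blast
  then show ?case by (rule tor_acyclicI[OF res fg_free_free_module[OF R] N])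
next
  case (Suc m)
  show ?case
    by (rule tor_acyclic_iso[OF tor_acyclic_direct_sum[OF Suc assms(3) N] N left_module_pow[OF M]
        pow_module_Suc_iso[OF M]])
qed

text \<open>Tensor products commute with finite powers. Surjectivity of the comparison map is
  obtained by adding the image of one \<open>u k\<close> under the \<open>k\<close>-th inclusion at
  a time.\<close>

lemma tensor_pow_tuple:
  assumes M: "tensor R M N" and u: "\<And>j. j < m \<Longrightarrow> u j \<in> carrier (tensor_group R M N)"
  shows "\<exists>x\<in>carrier (tensor_group R (pow_module M m) N). \<forall>j<m. tensor_map R M N (\<lambda>x. x j) x = u j"
proof -
  interpret M: tensor R M N by fact
  interpret G: comm_group M.G by (rule M.group)
  note P = left_module_pow[OF M.A.left_module_axioms, of m]
  have TP: "tensor R (pow_module M m) N" by (rule tensorI[OF P M.N.left_module_axioms])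
  interpret GP: comm_group "tensor_group R (pow_module M m) N" by (rule tensor.group[OF TP])
  have "\<exists>x\<in>carrier (tensor_group R (pow_module M m) N). \<forall>j<m.
      tensor_map R M N (\<lambda>x. x j) x = (if j < k then u j else \<one>\<^bsub>M.G\<^esub>)" if "k \<le> m" for k
    using that
  proof (induction k)
    case 0
    then show ?case using tensor_map_one[OF TP M pow_proj_hom] by (intro bexI[of _ "\<one>\<^bsub>tensor_group R (pow_module M m) N\<^esub>"]) auto
  next
    case (Suc k)
    then have k: "k < m" by simp
    obtain x where x: "x \<in> carrier (tensor_group R (pow_module M m) N)"
      "\<And>j. j < m \<Longrightarrow> tensor_map R M N (\<lambda>x. x j) x = (if j < k then u j else \<one>\<^bsub>M.G\<^esub>)"
      using Suc by auto
    note inc = pow_incl_hom[OF M.A.left_module_axioms k]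
    let ?y = "tensor_map R (pow_module M m) N (pow_incl M k) (u k)"
    note y = tensor_map_closed[OF M TP inc u[OF k]]
    have e: "tensor_map R M N (\<lambda>x. x j) ?y = (if j = k then u k else \<one>\<^bsub>M.G\<^esub>)" for j
    proof -
      have "tensor_map R M N (\<lambda>x. x j) ?y = tensor_map R M N (\<lambda>x. pow_incl M k x j) (u k)"
        by (rule tensor_map_compose[OF M TP M inc pow_proj_hom u[OF k]])
      also have "\<dots> = (if j = k then u k else \<one>\<^bsub>M.G\<^esub>)"
        using tensor_map_id[OF M u[OF k]] tensor_map_zero[OF M M _ u[OF k], of "\<lambda>x. \<zero>\<^bsub>M\<^esub>"] by (simp add: pow_incl_def)
      finally show ?thesis .
    qed
    show ?case
    proof (rule bexI)
      show "x \<otimes>\<^bsub>tensor_group R (pow_module M m) N\<^esub> ?y \<in> carrier (tensor_group R (pow_module M m) N)" using x y by simp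
      show "\<forall>j<m. tensor_map R M N (\<lambda>x. x j) (x \<otimes>\<^bsub>tensor_group R (pow_module M m) N\<^esub> ?y) = (if j < Suc k then u j else \<one>\<^bsub>M.G\<^esub>)"
        using x(2) u by (auto simp: tensor_map_mult[OF TP M pow_proj_hom x(1) y] e less_Suc_eq)
    qed
  qed
  from this[of m] show ?thesis by auto
qed

text \<open>Injectivity of the comparison map: the identity of the power is the sum of the
  inclusions after the projections, and each of these summands kills \<open>x\<close>.\<close>

lemma tensor_pow_eq_one:
  assumes M: "tensor R M N" and x: "x \<in> carrier (tensor_group R (pow_module M m) N)"
    and 1: "\<And>j. j < m \<Longrightarrow> tensor_map R M N (\<lambda>x. x j) x = \<one>\<^bsub>tensor_group R M N\<^esub>"
  shows "x = \<one>\<^bsub>tensor_group R (pow_module M m) N\<^esub>"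
proof -
  interpret M: tensor R M N by fact
  note P = left_module_pow[OF M.A.left_module_axioms, of m]
  have TP: "tensor R (pow_module M m) N" by (rule tensorI[OF P M.N.left_module_axioms])
  interpret GP: comm_group "tensor_group R (pow_module M m) N" by (rule tensor.group[OF TP])
  \<comment> \<open>Truncation to the first \<open>k\<close> coordinates, which runs from the zero
    map to the identity as \<open>k\<close> grows to \<open>m\<close>.\<close>
  let ?t = "\<lambda>k z i. if i < k then z i else \<zero>\<^bsub>M\<^esub>"
  have t: "?t k \<in> left_hom (op_ring R) (pow_module M m) (pow_module M m)" for k
    by (intro left_homI) auto
  have "tensor_map R (pow_module M m) N (?t k) x = \<one>\<^bsub>tensor_group R (pow_module M m) N\<^esub>" if "k \<le> m" for k
    using that
  proof (induction k)
    case 0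
    show ?case by (rule tensor_map_zero[OF TP TP _ x]) simp
  next
    case (Suc k)
    then have k: "k < m" by simp
    note inc = left_hom_compose[OF pow_proj_hom pow_incl_hom[OF M.A.left_module_axioms k]]
    have "tensor_map R (pow_module M m) N (?t (Suc k)) x
        = tensor_map R (pow_module M m) N (\<lambda>z. ?t k z \<oplus>\<^bsub>pow_module M m\<^esub> pow_incl M k (z k)) x"
      by (rule tensor_map_cong[OF TP TP left_hom_plus[OF P t inc] _ x])
        (auto simp: pow_incl_def fun_eq_iff less_Suc_eq)
    also have "\<dots> = \<one>\<^bsub>tensor_group R (pow_module M m) N\<^esub>"
    proof -
      have "tensor_map R (pow_module M m) N (\<lambda>z. pow_incl M k (z k)) x
          = tensor_map R (pow_module M m) N (pow_incl M k) (tensor_map R M N (\<lambda>z. z k) x)"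
        by (rule tensor_map_compose[OF TP M TP pow_proj_hom pow_incl_hom[OF M.A.left_module_axioms k] x, symmetric])
      then show ?thesis
        unfolding tensor_map_add[OF TP TP t inc x]
        using Suc k 1[OF k] tensor_map_one[OF M TP pow_incl_hom[OF M.A.left_module_axioms k]] by simp
    qed
    finally show ?case .
  qed
  then have "tensor_map R (pow_module M m) N (?t m) x = \<one>\<^bsub>tensor_group R (pow_module M m) N\<^esub>" by simp
  moreover have "tensor_map R (pow_module M m) N (?t m) x = tensor_map R (pow_module M m) N (\<lambda>z. z) x"
    by (rule tensor_map_cong[OF TP TP left_hom_id _ x]) (auto simp: fun_eq_iff)
  ultimately show ?thesis using tensor_map_id[OF TP x] by simp
qed

text \<open>\<open>tensor_inj\<close> is the vanishing of \<open>Tor_1(Z (Suc i), N)\<close> in the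
  only form used afterwards. The ring \<open>T\<close> of \<open>dual_resolution\<close> is
  \<open>op_ring R\<close>, so \<open>Z 0\<close> is \<open>R\<close> as a right module over
  itself.\<close>

locale dual_flat = dual_resolution "op_ring R" K L m \<delta> \<epsilon> K' + N: left_module R N
  for R :: "('r, 'e) ring_scheme" and K :: "('r, 'k, 'x) module_scheme"
    and L :: "('l, 'f) ring_scheme" and m \<delta> \<epsilon> and K' :: "('l, 'k, 'y) module_scheme"
    and N :: "('r, 'n, 'z) module_scheme" +
  assumes tensor_inj: "\<And>i z. \<lbrakk>z \<in> carrier (tensor_group R (Z i) N);
      tensor_map R (X i) N (\<lambda>x. x) z = \<one>\<^bsub>tensor_group R (X i) N\<^esub>\<rbrakk> \<Longrightarrow> z = \<one>\<^bsub>tensor_group R (Z i) N\<^esub>"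
begin

lemma TK: "tensor R K N" by (rule tensorI[OF K.left_module_axioms N.left_module_axioms])
lemma TX: "tensor R (X i) N" by (rule tensorI[OF X_module N.left_module_axioms])
lemma TZ: "tensor R (Z i) N" by (rule tensorI[OF Z_module N.left_module_axioms])

lemma kk_Z: "kk \<in> carrier (Z 0)"
proof -
  have "\<one>\<^bsub>op_ring R\<^esub> \<odot>\<^bsub>X 0\<^esub> kk \<in> carrier (Z 0)"
    unfolding Z_0_iso(1)[symmetric] using monoid.one_closed[OF ring.is_monoid[OF T_ring]] by blast
  then show ?thesis using left_module.smult_one[OF X_module kk_closed] by simp
qed

definition act :: "'l \<Rightarrow> ('k \<times> 'n \<Rightarrow>\<^sub>0 int) set \<Rightarrow> ('k \<times> 'n \<Rightarrow>\<^sub>0 int) set" where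
  "act l = tensor_map R K N (\<lambda>x. l \<odot>\<^bsub>K'\<^esub> x)"

lemma ev_hom: "p \<in> carrier (free_module L {..<m i}) \<Longrightarrow> (\<lambda>x. linear_ext L K' x p) \<in> left_hom (op_ring R) (X i) K"
  by (intro left_homI) (simp_all add: tuple_closed tuple_add tuple_smult)

text \<open>If all \<open>k \<otimes> y\<close> vanish, then \<open>kk \<otimes> y\<close> vanishes
  in \<open>X 0 \<otimes> N\<close> coordinate by coordinate, and by injectivity already in
  \<open>Z 0 \<otimes> N\<close>. Since \<open>Z 0\<close> is free on \<open>kk\<close>,
  \<open>y\<close> itself is zero.\<close>

lemma tens_kk_inj:
  assumes y: "y \<in> carrier N" and 1: "\<And>k. k \<in> carrier K \<Longrightarrow> tens R K N k y = \<one>\<^bsub>tensor_group R K N\<^esub>"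
  shows "y = \<zero>\<^bsub>N\<^esub>"
proof -
  interpret Z: tensor R "Z 0" N by (rule TZ)
  interpret XT: tensor R "X 0" N by (rule TX)
  interpret ZG: comm_group Z.G by (rule Z.group)
  have "tens R (X 0) N kk y = \<one>\<^bsub>tensor_group R (X 0) N\<^esub>"
    unfolding X_def
  proof (rule tensor_pow_eq_one[OF TK])
    show "tens R (pow_module K (m 0)) N kk y \<in> carrier (tensor_group R (pow_module K (m 0)) N)"
      using XT.tens_closed[OF kk_closed y] by (simp add: X_def)
    fix j assume "j < m 0"
    have "kk j \<in> carrier K" using kk_closed by (simp add: X_def)
    then show "tensor_map R K N (\<lambda>x. x j) (tens R (pow_module K (m 0)) N kk y) = \<one>\<^bsub>tensor_group R K N\<^esub>"
      using tensor_map_hom(2)[OF TX TK pow_proj_hom[of j "op_ring R" K "m 0", folded X_def] kk_closed y] 1 by (simp add: X_def)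
  qed
  then have "tensor_map R (X 0) N (\<lambda>x. x) (tens R (Z 0) N kk y) = \<one>\<^bsub>tensor_group R (X 0) N\<^esub>"
    using tensor_map_hom(2)[OF TZ TX Z_incl kk_Z y] by simp
  from tensor_inj[OF Z.tens_closed[OF kk_Z y] this]
  have tz: "tens R (Z 0) N kk y = \<one>\<^bsub>Z.G\<^esub>" .
  define s where "s = inv_into (carrier R) (\<lambda>t. t \<odot>\<^bsub>X 0\<^esub> kk)"
  have inj: "inj_on (\<lambda>t. t \<odot>\<^bsub>X 0\<^esub> kk) (carrier R)" using Z_0_iso(2) by simp
  have s: "s (t \<odot>\<^bsub>X 0\<^esub> kk) = t" if "t \<in> carrier R" for t
    unfolding s_def by (rule inv_into_f_f[OF inj that])
  have z: "\<exists>t\<in>carrier R. z = t \<odot>\<^bsub>X 0\<^esub> kk" if "z \<in> carrier (Z 0)" for z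
    using that unfolding Z_0_iso(1)[symmetric] by auto
  have ladd: "(r \<oplus>\<^bsub>R\<^esub> t) \<odot>\<^bsub>X 0\<^esub> kk = r \<odot>\<^bsub>X 0\<^esub> kk \<oplus>\<^bsub>X 0\<^esub> t \<odot>\<^bsub>X 0\<^esub> kk" if "r \<in> carrier R" "t \<in> carrier R" for r t
    using XT.A.smult_l_distr[of r t kk] that kk_closed by simp
  \<comment> \<open>The factors change places because \<open>X 0\<close> is a module over the
    opposite ring.\<close>
  have lmult: "(t \<otimes>\<^bsub>R\<^esub> r) \<odot>\<^bsub>X 0\<^esub> kk = r \<odot>\<^bsub>X 0\<^esub> (t \<odot>\<^bsub>X 0\<^esub> kk)" if "r \<in> carrier R" "t \<in> carrier R" for r t
    using XT.A.smult_assoc1[of r t kk] that kk_closed by simp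
  \<comment> \<open>This \<open>h\<close> recovers \<open>y\<close> from
    \<open>kk \<otimes> y\<close>: it multiplies the second factor by the coordinate
    \<open>s z\<close> of the first one.\<close>
  have "\<exists>h\<in>hom Z.G (add_monoid N). \<forall>z\<in>carrier (Z 0). \<forall>n\<in>carrier N. h (tens R (Z 0) N z n) = s z \<odot>\<^bsub>N\<^esub> n"
  proof (rule Z.universal[OF N.M.a_comm_group])
    fix z assume "z \<in> carrier (Z 0)"
    then obtain t where t: "t \<in> carrier R" "z = t \<odot>\<^bsub>X 0\<^esub> kk" using z by blast
    fix n assume n: "n \<in> carrier N"
    show "s z \<odot>\<^bsub>N\<^esub> n \<in> carrier (add_monoid N)" using t n by (simp add: s)
    show "s z \<odot>\<^bsub>N\<^esub> (n \<oplus>\<^bsub>N\<^esub> n') = (s z \<odot>\<^bsub>N\<^esub> n) \<otimes>\<^bsub>add_monoid N\<^esub> (s z \<odot>\<^bsub>N\<^esub> n')" if "n' \<in> carrier N" for n'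
      using t n that by (simp add: s N.smult_r_distr)
    show "s (r \<odot>\<^bsub>Z 0\<^esub> z) \<odot>\<^bsub>N\<^esub> n = s z \<odot>\<^bsub>N\<^esub> (r \<odot>\<^bsub>N\<^esub> n)" if r: "r \<in> carrier R" for r
    proof -
      have "s (r \<odot>\<^bsub>Z 0\<^esub> z) = t \<otimes>\<^bsub>R\<^esub> r" using r t by (simp add: Z_simps lmult[symmetric] s)
      then show ?thesis using r t n by (simp add: s N.smult_assoc1)
    qed
    fix z' assume "z' \<in> carrier (Z 0)"
    then obtain t' where t': "t' \<in> carrier R" "z' = t' \<odot>\<^bsub>X 0\<^esub> kk" using z by blast
    have "s (z \<oplus>\<^bsub>Z 0\<^esub> z') = t \<oplus>\<^bsub>R\<^esub> t'" using t t' by (simp add: Z_simps ladd[symmetric] s)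
    then show "s (z \<oplus>\<^bsub>Z 0\<^esub> z') \<odot>\<^bsub>N\<^esub> n = (s z \<odot>\<^bsub>N\<^esub> n) \<otimes>\<^bsub>add_monoid N\<^esub> (s z' \<odot>\<^bsub>N\<^esub> n)"
      using t t' n by (simp add: s N.smult_l_distr)
  qed
  then obtain h where h: "h \<in> hom Z.G (add_monoid N)" "h (tens R (Z 0) N kk y) = s kk \<odot>\<^bsub>N\<^esub> y"
    using kk_Z y by blast
  have "s kk = \<one>\<^bsub>R\<^esub>"
    using s[OF monoid.one_closed[OF ring.is_monoid[OF left_module_ring[OF N.left_module_axioms]]]] left_module.smult_one[OF X_module kk_closed] by simp
  moreover have "h \<one>\<^bsub>Z.G\<^esub> = \<zero>\<^bsub>N\<^esub>"
    using hom_one[OF h(1)] N.M.a_group by simp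
  ultimately show ?thesis using h(2) y by (simp add: tz)
qed

lemma tensor_Z_0:
  assumes "z \<in> carrier (tensor_group R (Z 0) N)"
  shows "\<exists>y\<in>carrier N. z = tens R (Z 0) N kk y"
proof -
  interpret Z: tensor R "Z 0" N by (rule TZ)
  interpret ZG: comm_group Z.G by (rule Z.group)
  show ?thesis
    using assms
  proof (induction z rule: Z.induct)
    case one
    show ?case using Z.tens_zero_right[OF kk_Z] by (intro bexI[of _ "\<zero>\<^bsub>N\<^esub>"]) simp_all
  next
    case (mult z z')
    then obtain y y' where "y \<in> carrier N" "z = tens R (Z 0) N kk y" "y' \<in> carrier N" "z' = tens R (Z 0) N kk y'" by blast
    then show ?case using Z.tens_add_right[OF kk_Z] by (intro bexI[of _ "y \<oplus>\<^bsub>N\<^esub> y'"]) simp_all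
  next
    case (tens z n)
    then have "z \<in> (\<lambda>t. t \<odot>\<^bsub>X 0\<^esub> kk) ` carrier R" using Z_0_iso(1) by simp
    then obtain t where t: "t \<in> carrier R" "z = t \<odot>\<^bsub>Z 0\<^esub> kk" by (auto simp: Z_simps)
    then show ?case using tens Z.tens_balanced[OF t(1) kk_Z, of n] by (intro bexI[of _ "t \<odot>\<^bsub>N\<^esub> n"]) simp_all
  qed
qed

text \<open>
  The values of \<open>g\<close> on the generators \<open>kk\<close> of \<open>K'\<close> form an element of \<open>X 0 \<otimes> N\<close>. The relations between these
  generators make it a cycle, so it comes from \<open>Z 0 \<otimes> N\<close>, which is \<open>N\<close>.
\<close>

lemma hom_to_tensor:
  assumes closed: "\<And>x. x \<in> carrier K \<Longrightarrow> g x \<in> carrier (tensor_group R K N)"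
    and add: "\<And>x y. \<lbrakk>x \<in> carrier K; y \<in> carrier K\<rbrakk> \<Longrightarrow> g (x \<oplus>\<^bsub>K\<^esub> y) = g x \<otimes>\<^bsub>tensor_group R K N\<^esub> g y"
    and smult: "\<And>l x. \<lbrakk>l \<in> carrier L; x \<in> carrier K\<rbrakk> \<Longrightarrow> g (l \<odot>\<^bsub>K'\<^esub> x) = act l (g x)"
  shows "\<exists>y\<in>carrier N. \<forall>x\<in>carrier K. g x = tens R K N x y"
proof -
  interpret TK: tensor R K N by (rule TK)
  interpret G: comm_group TK.G by (rule TK.group)
  interpret K': left_module L K' by (rule res.target)
  have g0: "g \<zero>\<^bsub>K\<^esub> = \<one>\<^bsub>TK.G\<^esub>"
  proof -
    have "g \<zero>\<^bsub>K\<^esub> = g \<zero>\<^bsub>K\<^esub> \<otimes>\<^bsub>TK.G\<^esub> g \<zero>\<^bsub>K\<^esub>" using add[of "\<zero>\<^bsub>K\<^esub>" "\<zero>\<^bsub>K\<^esub>"] by simp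
    then show ?thesis using closed[of "\<zero>\<^bsub>K\<^esub>"] by (simp add: G.l_cancel_one)
  qed
  have kkc: "kk j \<in> carrier K" for j using kk_closed by (simp add: X_def)
  obtain x0 where x0: "x0 \<in> carrier (tensor_group R (X 0) N)"
    "\<And>j. j < m 0 \<Longrightarrow> tensor_map R K N (\<lambda>x. x j) x0 = g (kk j)"
    using tensor_pow_tuple[OF TK, of "m 0" "\<lambda>j. g (kk j)"] closed kkc unfolding X_def by blast
  \<comment> \<open>Evaluating the tuple at a coefficient vector \<open>p\<close> gives
    \<open>g\<close> at the corresponding combination of generators. This is the place where the
    linearity of \<open>g\<close> over \<open>L\<close> enters.\<close>
  have ev: "tensor_map R K N (\<lambda>x. linear_ext L K' x p) x0 = g (linear_ext L K' kk p)"
    if "p \<in> carrier (free_module L {..<m 0})" for p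
    using L_ring that
  proof (induction p rule: free_module_induct)
    case zero
    have e: "linear_ext L K' x (\<lambda>_. \<zero>\<^bsub>L\<^esub>) = \<zero>\<^bsub>K\<^esub>" if "x \<in> carrier (X 0)" for x
      using left_hom_zero[OF tuple_hom[OF that] left_module_free[OF L_ring] res.target] by (simp add: zero_eq)
    show ?case using tensor_map_zero[OF TX TK e x0(1)] e[OF kk_closed] g0 by simp
  next
    case (add q r b)
    interpret F: left_module L "free_module L {..<m 0}" by (rule left_module_free[OF L_ring])
    have u: "unit_vec L b \<in> carrier (free_module L {..<m 0})" using add unit_free by simp
    have b: "b < m 0" using add by simp
    have split: "linear_ext L K' x (r \<odot>\<^bsub>free_module L {..<m 0}\<^esub> unit_vec L b \<oplus>\<^bsub>free_module L {..<m 0}\<^esub> q)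
        = r \<odot>\<^bsub>K'\<^esub> x b \<oplus>\<^bsub>K\<^esub> linear_ext L K' x q" if x: "x \<in> carrier (X 0)" for x
      using add(1,2) u by (simp only: left_hom_add[OF tuple_hom[OF x]] left_hom_smult[OF tuple_hom[OF x]] F.smult_closed
          tuple_unit[OF x b] add_eq)
    note pr = pow_proj_hom[of b "op_ring R" K "m 0", folded X_def]
    note h1 = left_hom_compose[OF pr act_hom'[OF add(2)]] and h2 = ev_hom[OF add(1)]
    have "tensor_map R K N (\<lambda>x. linear_ext L K' x (r \<odot>\<^bsub>free_module L {..<m 0}\<^esub> unit_vec L b \<oplus>\<^bsub>free_module L {..<m 0}\<^esub> q)) x0
        = tensor_map R K N (\<lambda>x. r \<odot>\<^bsub>K'\<^esub> x b \<oplus>\<^bsub>K\<^esub> linear_ext L K' x q) x0"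
      by (rule tensor_map_cong[OF TX TK left_hom_plus[OF K.left_module_axioms h1 h2] split x0(1)])
    also have "\<dots> = act r (g (kk b)) \<otimes>\<^bsub>TK.G\<^esub> g (linear_ext L K' kk q)"
      unfolding tensor_map_add[OF TX TK h1 h2 x0(1)] add(4) act_def x0(2)[OF b, symmetric]
        tensor_map_compose[OF TX TK TK pr act_hom'[OF add(2)] x0(1)] ..
    also have "\<dots> = g (r \<odot>\<^bsub>K'\<^esub> kk b \<oplus>\<^bsub>K\<^esub> linear_ext L K' kk q)"
      using smult[OF add(2) kkc] assms(2)[OF _ tuple_closed[OF kk_closed add(1)]] left_hom_closed[OF act_hom'[OF add(2)] kkc] by simp
    also have "\<dots> = g (linear_ext L K' kk (r \<odot>\<^bsub>free_module L {..<m 0}\<^esub> unit_vec L b \<oplus>\<^bsub>free_module L {..<m 0}\<^esub> q))"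
      unfolding split[OF kk_closed] ..
    finally show ?case .
  qed
  have "tensor_map R (X (Suc 0)) N (d 0) x0 = \<one>\<^bsub>tensor_group R (X (Suc 0)) N\<^esub>"
    unfolding X_def
  proof (rule tensor_pow_eq_one[OF TK])
    show "tensor_map R (pow_module K (m (Suc 0))) N (d 0) x0 \<in> carrier (tensor_group R (pow_module K (m (Suc 0))) N)"
      using tensor_map_closed[OF TX TX d_hom x0(1)] by (simp add: X_def)
    fix l assume l: "l < m (Suc 0)"
    note pr = pow_proj_hom[of l "op_ring R" K "m (Suc 0)", folded X_def]
    have "tensor_map R K N (\<lambda>x. x l) (tensor_map R (X (Suc 0)) N (d 0) x0) = tensor_map R K N (\<lambda>x. d 0 x l) x0"
      by (rule tensor_map_compose[OF TX TX TK d_hom pr x0(1)])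
    also have "\<dots> = tensor_map R K N (\<lambda>x. linear_ext L K' x (\<delta> 0 (unit_vec L l))) x0" using l by (simp add: d_def)
    also have "\<dots> = g (\<epsilon> (\<delta> 0 (unit_vec L l)))"
      using ev[OF diff_unit_closed[OF l]] kk_tuple[OF diff_unit_closed[OF l]] by simp
    also have "\<dots> = \<one>\<^bsub>TK.G\<^esub>" using res.aug_diff[OF unit_free[OF l]] g0 by (simp add: zero_eq)
    finally show "tensor_map R K N (\<lambda>x. x l) (tensor_map R (pow_module K (m (Suc 0))) N (d 0) x0) = \<one>\<^bsub>TK.G\<^esub>"
      by (simp add: X_def)
  qed
  moreover have "tensor_map R (X (Suc 0)) N (\<lambda>x. x) (tensor_map R (Z (Suc 0)) N (d 0) x0) = tensor_map R (X (Suc 0)) N (d 0) x0"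
    by (rule tensor_map_compose[OF TX TZ TX d_Z_hom Z_incl x0(1)])
  \<comment> \<open>Right exactness applies to \<open>Z 0\<close>, \<open>X 0\<close>,
    \<open>Z (Suc 0)\<close>. Injectivity from \<open>Z (Suc 0) \<otimes> N\<close> to
    \<open>X (Suc 0) \<otimes> N\<close> turns the cycle condition into one over
    \<open>Z (Suc 0)\<close>.\<close>
  ultimately have dz: "tensor_map R (Z (Suc 0)) N (d 0) x0 = \<one>\<^bsub>tensor_group R (Z (Suc 0)) N\<^esub>"
    by (intro tensor_inj tensor_map_closed[OF TX TZ d_Z_hom x0(1)]) simp
  have "\<exists>z\<in>carrier (tensor_group R (Z 0) N). tensor_map R (X 0) N (\<lambda>x. x) z = x0"
    by (rule tensor_map_exact[OF TZ TX TZ Z_incl d_Z_hom d_Z_surj _ _ x0(1) dz]) (auto simp: Z_simps)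
  then obtain y where y: "y \<in> carrier N" "x0 = tens R (X 0) N kk y"
    using tensor_Z_0 tensor_map_hom(2)[OF TZ TX Z_incl kk_Z] by metis
  have "g x = tens R K N x y" if x: "x \<in> carrier K" for x
  proof -
    obtain p where p: "p \<in> carrier (free_module L {..<m 0})" "x = linear_ext L K' kk p" using kk_generates[OF x] by blast
    then show ?thesis
      using ev[OF p(1)] tensor_map_hom(2)[OF TX TK ev_hom[OF p(1)] kk_closed y(1)] by (simp add: y(2))
  qed
  with y(1) show ?thesis by blast
qed

end

text \<open>The dimension shift for \<open>Tor\<close>: acyclicity of the powers of \<open>K\<close>
  permits raising \<open>i\<close> and the degree together until the degree reaches
  \<open>D\<close>. Vanishing of \<open>Tor_1\<close> for \<open>Z (Suc i)\<close> then gives the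
  injectivity required by \<open>tensor_inj\<close>.\<close>

lemma dual_flatI:
  fixes R :: "('r, 'e) ring_scheme"
  assumes "dual_resolution (op_ring R) K L m \<delta> \<epsilon> K'" and N: "left_module R N" and acyclic: "tor_acyclic R K N"
    and van: "\<And>(P :: nat \<Rightarrow> ('r, nat \<Rightarrow> 'r) module) \<alpha> \<eta> i t.
      \<lbrakk>resolution (op_ring R) P \<alpha> \<eta> (dual_resolution.Z K L m \<delta> K' i); \<And>j. fg_free (op_ring R) (P j); t \<ge> D\<rbrakk> \<Longrightarrow> tor_van R P \<alpha> N t"
  shows "dual_flat R K L m \<delta> \<epsilon> K' N"
proof -
  interpret dual_resolution "op_ring R" K L m \<delta> \<epsilon> K' by fact
  have vanish: "tor_van R P \<alpha> N t"
    if "resolution (op_ring R) P \<alpha> \<eta> (Z i)" "\<And>j. fg_free (op_ring R) (P j)" for P :: "nat \<Rightarrow> ('r, nat \<Rightarrow> 'r) module" and \<alpha> \<eta> i t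
  proof -
    have "\<forall>(P :: nat \<Rightarrow> ('r, nat \<Rightarrow> 'r) module) \<alpha> \<eta> i t. resolution (op_ring R) P \<alpha> \<eta> (Z i) \<longrightarrow> (\<forall>j. fg_free (op_ring R) (P j)) \<longrightarrow>
        t + s \<ge> D \<longrightarrow> tor_van R P \<alpha> N t" for s
    proof (induction s)
      case 0
      then show ?case using van by simp
    next
      case (Suc s)
      show ?case
      proof (intro allI impI)
        fix P :: "nat \<Rightarrow> ('r, nat \<Rightarrow> 'r) module" and \<alpha> \<eta> i t
        assume P: "resolution (op_ring R) P \<alpha> \<eta> (Z i)" and fgP: "\<forall>j. fg_free (op_ring R) (P j)" and t: "D \<le> t + Suc s"
        obtain Q :: "nat \<Rightarrow> ('r, nat \<Rightarrow> 'r) module" and \<beta> \<theta>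
          where Q: "resolution (op_ring R) Q \<beta> \<theta> (X i)" "\<And>j. fg_free (op_ring R) (Q j)" "\<And>t. tor_van R Q \<beta> N t"
          using tor_acyclicE[OF tor_acyclic_pow[OF K.left_module_axioms N acyclic, of "m i", folded X_def]] by blast
        obtain f where cd: "cone_data (op_ring R) P \<alpha> \<eta> (Z i) Q \<beta> \<theta> (X i) (\<lambda>x. x) (d i) f (Z (Suc i))"
          using Z_cone[OF P _ Q(1)] fgP by blast
        then interpret C: cone_data "op_ring R" P \<alpha> \<eta> "Z i" Q \<beta> \<theta> "X i" "\<lambda>x. x" "d i" f "Z (Suc i)" .
        have fg: "fg_free (op_ring R) (C.G j)" for j using fgP Q(2) by (intro C.fg_free_cone) auto
        obtain P' :: "nat \<Rightarrow> ('r, nat \<Rightarrow> 'r) module" and \<alpha>' \<eta>'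
          where P': "resolution (op_ring R) P' \<alpha>' \<eta>' (Z (Suc i))" "\<And>j. fg_free (op_ring R) (P' j)"
          using finitely_presentedE[OF Z_fp] by blast
        have "tor_van R P' \<alpha>' N (Suc t)" using Suc[rule_format, of P' \<alpha>' \<eta>' "Suc i" "Suc t"] P' t by simp
        from tor_van_compare[OF C.resolution_cone P'(1) fg_free_projective[OF fg] fg_free_projective[OF P'(2)] N this]
        show "tor_van R P \<alpha> N t" by (rule tor_van_cone_Suc[OF cd N _ Q(3)])
      qed
    qed
    from this[of D] that show ?thesis by auto
  qed
  show ?thesis
  proof (intro dual_flat.intro assms(1) N dual_flat_axioms.intro)
    fix i z assume z: "z \<in> carrier (tensor_group R (Z i) N)" "tensor_map R (X i) N (\<lambda>x. x) z = \<one>\<^bsub>tensor_group R (X i) N\<^esub>"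
    obtain P :: "nat \<Rightarrow> ('r, nat \<Rightarrow> 'r) module" and \<alpha> \<eta> where P: "resolution (op_ring R) P \<alpha> \<eta> (Z i)" "\<And>j. fg_free (op_ring R) (P j)"
      using finitely_presentedE[OF Z_fp] by blast
    obtain Q :: "nat \<Rightarrow> ('r, nat \<Rightarrow> 'r) module" and \<beta> \<theta> where Q: "resolution (op_ring R) Q \<beta> \<theta> (X i)" "\<And>j. fg_free (op_ring R) (Q j)"
      using finitely_presentedE[OF X_fp] by blast
    obtain f where cd: "cone_data (op_ring R) P \<alpha> \<eta> (Z i) Q \<beta> \<theta> (X i) (\<lambda>x. x) (d i) f (Z (Suc i))"
      using Z_cone[OF P Q(1)] by blast
    then interpret C: cone_data "op_ring R" P \<alpha> \<eta> "Z i" Q \<beta> \<theta> "X i" "\<lambda>x. x" "d i" f "Z (Suc i)" .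
    obtain P' :: "nat \<Rightarrow> ('r, nat \<Rightarrow> 'r) module" and \<alpha>' \<eta>'
      where P': "resolution (op_ring R) P' \<alpha>' \<eta>' (Z (Suc i))" "\<And>j. fg_free (op_ring R) (P' j)"
      using finitely_presentedE[OF Z_fp] by blast
    have "tor_van R P' \<alpha>' N 0" by (rule vanish[OF P'])
    from tor_van_compare[OF C.resolution_cone P'(1) fg_free_projective[OF C.fg_free_cone[OF P(2) Q(2)]]
        fg_free_projective[OF P'(2)] N this]
    show "z = \<one>\<^bsub>tensor_group R (Z i) N\<^esub>" by (rule tor_van_cone_0[OF cd N _ z])
  qed
qed

text \<open>Functoriality in the second factor, for which \<open>tensor_map\<close> has no formula.
  The universal property yields the map, and its values on elementary tensors determine it.\<close>

lemma tensor_map_right: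
  assumes A: "tensor R A N" and A': "tensor R A N'" and u: "u \<in> left_hom R N N'"
  shows "\<exists>h\<in>hom (tensor_group R A N) (tensor_group R A N').
    \<forall>a\<in>carrier A. \<forall>x\<in>carrier N. h (tens R A N a x) = tens R A N' a (u x)"
proof -
  interpret A: tensor R A N by fact
  interpret A': tensor R A N' by fact
  show ?thesis
    by (rule A.universal[OF A'.group])
      (simp_all add: left_hom_closed[OF u] A'.tens_closed left_hom_add[OF u] left_hom_smult[OF u]
        A'.tens_add_left A'.tens_add_right A'.tens_balanced)
qed

text \<open>Both composites send \<open>a \<otimes> x\<close> to the tensor of \<open>f a\<close>
  and \<open>u x\<close>.\<close>

lemma tensor_map_right_natural:
  assumes "tensor R A N" "tensor R B N" "tensor R A N'" "tensor R B N'" and u: "u \<in> left_hom R N N'"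
    and f: "f \<in> left_hom (op_ring R) A B"
    and hA: "hA \<in> hom (tensor_group R A N) (tensor_group R A N')"
      "\<And>a x. \<lbrakk>a \<in> carrier A; x \<in> carrier N\<rbrakk> \<Longrightarrow> hA (tens R A N a x) = tens R A N' a (u x)"
    and hB: "hB \<in> hom (tensor_group R B N) (tensor_group R B N')"
      "\<And>b x. \<lbrakk>b \<in> carrier B; x \<in> carrier N\<rbrakk> \<Longrightarrow> hB (tens R B N b x) = tens R B N' b (u x)"
    and X: "X \<in> carrier (tensor_group R A N)"
  shows "hB (tensor_map R B N f X) = tensor_map R B N' f (hA X)"
proof (rule tensor.hom_eqI[OF assms(1) tensor.group[OF assms(4)] _ _ _ X])
  show "(\<lambda>X. hB (tensor_map R B N f X)) \<in> hom (tensor_group R A N) (tensor_group R B N')"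
    using hom_compose[OF tensor_map_hom(1)[OF assms(1,2) f] hB(1)] by (simp add: o_def)
  show "(\<lambda>X. tensor_map R B N' f (hA X)) \<in> hom (tensor_group R A N) (tensor_group R B N')"
    using hom_compose[OF hA(1) tensor_map_hom(1)[OF assms(3,4) f]] by (simp add: o_def)
qed (simp add: tensor_map_hom(2)[OF assms(1,2) f] tensor_map_hom(2)[OF assms(3,4) f] hA(2) hB(2)
    left_hom_closed[OF f] left_hom_closed[OF u])

lemma tensor_map_right_retract:
  assumes "tensor R A J" "tensor R A N"
    and i: "i \<in> left_hom R J N" and p: "p \<in> left_hom R N J" and pi: "\<And>x. x \<in> carrier J \<Longrightarrow> p (i x) = x"
    and hi: "hi \<in> hom (tensor_group R A J) (tensor_group R A N)"
      "\<And>a x. \<lbrakk>a \<in> carrier A; x \<in> carrier J\<rbrakk> \<Longrightarrow> hi (tens R A J a x) = tens R A N a (i x)"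
    and hp: "hp \<in> hom (tensor_group R A N) (tensor_group R A J)"
      "\<And>a x. \<lbrakk>a \<in> carrier A; x \<in> carrier N\<rbrakk> \<Longrightarrow> hp (tens R A N a x) = tens R A J a (p x)"
    and X: "X \<in> carrier (tensor_group R A J)"
  shows "hp (hi X) = X"
proof (rule tensor.hom_eqI[OF assms(1) tensor.group[OF assms(1)] _ _ _ X])
  show "(\<lambda>X. hp (hi X)) \<in> hom (tensor_group R A J) (tensor_group R A J)"
    using hom_compose[OF hi(1) hp(1)] by (simp add: o_def)
  show "(\<lambda>X. X) \<in> hom (tensor_group R A J) (tensor_group R A J)" by (simp add: hom_def)
qed (simp add: hi(2) hp(2) pi left_hom_closed[OF i])

text \<open>A cycle with coefficients in \<open>J\<close> is pushed to \<open>N\<close>, bounded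
  there, and the primitive is brought back. Naturality in the first factor makes both passages
  commute with the differentials.\<close>

lemma nd_flat_retract:
  fixes R :: "('r, 'e) ring_scheme"
  assumes N: "nd_flat R n d N" and J: "left_module R J"
    and i: "i \<in> left_hom R J N" and p: "p \<in> left_hom R N J" and pi: "\<And>x. x \<in> carrier J \<Longrightarrow> p (i x) = x"
  shows "nd_flat R n d J"
  unfolding nd_flat_def
proof (intro conjI allI impI J)
  fix U :: "('r, (nat \<Rightarrow> 'r) set) module"
  assume fp: "finitely_presented (op_ring R) n U"
  have N': "left_module R N" using N by (simp add: nd_flat_def)
  have U: "left_module (op_ring R) U" using fp by (auto simp: finitely_presented_def exact_resolution_def)
  interpret S: resolution "op_ring R" "std_res (op_ring R) U" "\<lambda>_. std_diff (op_ring R)" "std_aug (op_ring R) U" U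
    by (rule resolution_std[OF U])
  let ?P = "std_res (op_ring R) U" and ?\<delta> = "std_diff (op_ring R)"
  have TJ: "tensor R (?P j) J" and TN: "tensor R (?P j) N" for j
    by (rule tensorI[OF S.modules J] tensorI[OF S.modules N'])+
  have van: "tor_van R ?P (\<lambda>_. ?\<delta>) N d"
    using N[unfolded nd_flat_def, THEN conjunct2, rule_format, OF fp] trivial_Tor_iff[OF U N', of d] by simp
  have "\<forall>j. \<exists>h\<in>hom (tensor_group R (?P j) J) (tensor_group R (?P j) N).
    \<forall>a\<in>carrier (?P j). \<forall>x\<in>carrier J. h (tens R (?P j) J a x) = tens R (?P j) N a (i x)"
    using tensor_map_right[OF TJ TN i] by blast
  then obtain hi where hi: "\<And>j. hi j \<in> hom (tensor_group R (?P j) J) (tensor_group R (?P j) N)"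
    "\<And>j a x. \<lbrakk>a \<in> carrier (?P j); x \<in> carrier J\<rbrakk> \<Longrightarrow> hi j (tens R (?P j) J a x) = tens R (?P j) N a (i x)" by metis
  have "\<forall>j. \<exists>h\<in>hom (tensor_group R (?P j) N) (tensor_group R (?P j) J).
    \<forall>a\<in>carrier (?P j). \<forall>x\<in>carrier N. h (tens R (?P j) N a x) = tens R (?P j) J a (p x)"
    using tensor_map_right[OF TN TJ p] by blast
  then obtain hp where hp: "\<And>j. hp j \<in> hom (tensor_group R (?P j) N) (tensor_group R (?P j) J)"
    "\<And>j a x. \<lbrakk>a \<in> carrier (?P j); x \<in> carrier N\<rbrakk> \<Longrightarrow> hp j (tens R (?P j) N a x) = tens R (?P j) J a (p x)" by metis
  have "tor_van R ?P (\<lambda>_. ?\<delta>) J d"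
    unfolding tor_van_def
  proof (intro ballI impI)
    fix z assume z: "z \<in> carrier (tensor_group R (?P (Suc d)) J)"
      and cycle: "tensor_map R (?P d) J ?\<delta> z = \<one>\<^bsub>tensor_group R (?P d) J\<^esub>"
    have "tensor_map R (?P d) N ?\<delta> (hi (Suc d) z) = hi d (tensor_map R (?P d) J ?\<delta> z)"
      by (rule tensor_map_right_natural[OF TJ TJ TN TN i S.diff hi hi z, symmetric])
    also have "\<dots> = \<one>\<^bsub>tensor_group R (?P d) N\<^esub>"
      unfolding cycle using hom_one[OF hi(1)] tensor.group[OF TJ] tensor.group[OF TN] by (simp add: comm_group.axioms(2))
    finally obtain w where w: "w \<in> carrier (tensor_group R (?P (Suc (Suc d))) N)"
      "tensor_map R (?P (Suc d)) N ?\<delta> w = hi (Suc d) z"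
      using van hom_in_carrier[OF hi(1) z] unfolding tor_van_def by blast
    have "z = hp (Suc d) (hi (Suc d) z)" by (rule tensor_map_right_retract[OF TJ TN i p pi hi hp z, symmetric])
    also have "\<dots> = tensor_map R (?P (Suc d)) J ?\<delta> (hp (Suc (Suc d)) w)"
      unfolding w(2)[symmetric] by (rule tensor_map_right_natural[OF TN TN TJ TJ p S.diff hp hp w(1)])
    finally show "\<exists>w\<in>carrier (tensor_group R (?P (Suc (Suc d))) J). tensor_map R (?P (Suc d)) J ?\<delta> w = z"
      using hom_in_carrier[OF hp(1) w(1)] by metis
  qed
  then show "trivial_group (Tor R (d + 1) U J)" using trivial_Tor_iff[OF U J] by simp
qed

section \<open>Splitting a flat module along a decomposition of its tensor product\<close>

context dual_flat
begin

context
  fixes A B :: "('k \<times> 'n \<Rightarrow>\<^sub>0 int) set set"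
  assumes A: "subgroup A (tensor_group R K N)" and B: "subgroup B (tensor_group R K N)"
    and A_act: "\<And>l a. \<lbrakk>l \<in> carrier L; a \<in> A\<rbrakk> \<Longrightarrow> act l a \<in> A" and B_act: "\<And>l b. \<lbrakk>l \<in> carrier L; b \<in> B\<rbrakk> \<Longrightarrow> act l b \<in> B"
    and decompose: "\<And>X. X \<in> carrier (tensor_group R K N) \<Longrightarrow> \<exists>a\<in>A. \<exists>b\<in>B. X = a \<otimes>\<^bsub>tensor_group R K N\<^esub> b"
    and disjoint: "\<And>X. \<lbrakk>X \<in> A; X \<in> B\<rbrakk> \<Longrightarrow> X = \<one>\<^bsub>tensor_group R K N\<^esub>"
begin

definition tens_part :: "('k \<times> 'n \<Rightarrow>\<^sub>0 int) set set \<Rightarrow> 'n set" where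
  "tens_part P = {y \<in> carrier N. \<forall>k\<in>carrier K. tens R K N k y \<in> P}"

lemma tens_part_submodule:
  assumes P: "subgroup P (tensor_group R K N)"
  shows "tens_part P \<subseteq> carrier N" "\<zero>\<^bsub>N\<^esub> \<in> tens_part P"
    "\<lbrakk>x \<in> tens_part P; y \<in> tens_part P\<rbrakk> \<Longrightarrow> x \<oplus>\<^bsub>N\<^esub> y \<in> tens_part P"
    "\<lbrakk>r \<in> carrier R; x \<in> tens_part P\<rbrakk> \<Longrightarrow> r \<odot>\<^bsub>N\<^esub> x \<in> tens_part P"
proof -
  interpret TK: tensor R K N by (rule TK)
  show "tens_part P \<subseteq> carrier N" by (auto simp: tens_part_def)
  show "\<zero>\<^bsub>N\<^esub> \<in> tens_part P"
    using subgroup.one_closed[OF P] by (simp add: tens_part_def TK.tens_zero_right)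
  show "x \<oplus>\<^bsub>N\<^esub> y \<in> tens_part P" if "x \<in> tens_part P" "y \<in> tens_part P"
    using that subgroup.m_closed[OF P] by (simp add: tens_part_def TK.tens_add_right)
  show "r \<odot>\<^bsub>N\<^esub> x \<in> tens_part P" if "r \<in> carrier R" "x \<in> tens_part P"
    using that TK.A_smult by (simp add: tens_part_def TK.tens_balanced[symmetric])
qed

lemma decomposition_unique:
  assumes ab: "a \<in> A" "a' \<in> A" "b \<in> B" "b' \<in> B"
    and eq: "a \<otimes>\<^bsub>tensor_group R K N\<^esub> b = a' \<otimes>\<^bsub>tensor_group R K N\<^esub> b'"
  shows "a = a'"
proof -
  interpret TK: tensor R K N by (rule TK)
  interpret G: comm_group TK.G by (rule TK.group)
  note c = subgroup.mem_carrier[OF A ab(1)] subgroup.mem_carrier[OF A ab(2)]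
    subgroup.mem_carrier[OF B ab(3)] subgroup.mem_carrier[OF B ab(4)]
  have e: "a = (a' \<otimes>\<^bsub>TK.G\<^esub> b') \<otimes>\<^bsub>TK.G\<^esub> inv\<^bsub>TK.G\<^esub> b" using c by (simp add: eq[symmetric] G.m_assoc)
  have "inv\<^bsub>TK.G\<^esub> a' \<otimes>\<^bsub>TK.G\<^esub> a = b' \<otimes>\<^bsub>TK.G\<^esub> inv\<^bsub>TK.G\<^esub> b"
    using c by (subst G.inv_solve_left') (simp_all add: e G.m_assoc)
  moreover have "inv\<^bsub>TK.G\<^esub> a' \<otimes>\<^bsub>TK.G\<^esub> a \<in> A"
    by (intro subgroup.m_closed[OF A] subgroup.m_inv_closed[OF A] ab)
  moreover have "b' \<otimes>\<^bsub>TK.G\<^esub> inv\<^bsub>TK.G\<^esub> b \<in> B"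
    by (intro subgroup.m_closed[OF B] subgroup.m_inv_closed[OF B] ab)
  ultimately have "inv\<^bsub>TK.G\<^esub> a' \<otimes>\<^bsub>TK.G\<^esub> a = \<one>\<^bsub>TK.G\<^esub>" using disjoint by simp
  then show ?thesis using c by (subst (asm) G.inv_solve_left') simp_all
qed

text \<open>The component of \<open>k \<otimes> y\<close> in \<open>A\<close> is linear in \<open>k\<close>, hence of the form \<open>k \<otimes> y'\<close>.\<close>

lemma tens_part_sum:
  assumes y: "y \<in> carrier N"
  shows "\<exists>a\<in>tens_part A. \<exists>b\<in>tens_part B. y = a \<oplus>\<^bsub>N\<^esub> b"
proof -
  interpret TK: tensor R K N by (rule TK)
  interpret G: comm_group TK.G by (rule TK.group)
  have cA: "x \<in> carrier TK.G" if "x \<in> A" for x using subgroup.mem_carrier[OF A that] .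
  have cB: "x \<in> carrier TK.G" if "x \<in> B" for x using subgroup.mem_carrier[OF B that] .
  have "\<forall>k. \<exists>a b. k \<in> carrier K \<longrightarrow> a \<in> A \<and> b \<in> B \<and> tens R K N k y = a \<otimes>\<^bsub>TK.G\<^esub> b"
    using decompose[OF TK.tens_closed[OF _ y]] by blast
  then obtain g h where gh: "\<And>k. k \<in> carrier K \<Longrightarrow> g k \<in> A" "\<And>k. k \<in> carrier K \<Longrightarrow> h k \<in> B"
    "\<And>k. k \<in> carrier K \<Longrightarrow> tens R K N k y = g k \<otimes>\<^bsub>TK.G\<^esub> h k" by metis
  have "\<exists>y'\<in>carrier N. \<forall>x\<in>carrier K. g x = tens R K N x y'"
  proof (rule hom_to_tensor)
    show "g x \<in> carrier TK.G" if "x \<in> carrier K" for x using cA gh(1)[OF that] by simp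
    fix x assume x: "x \<in> carrier K"
    show "g (x \<oplus>\<^bsub>K\<^esub> x') = g x \<otimes>\<^bsub>TK.G\<^esub> g x'" if x': "x' \<in> carrier K" for x'
    proof (rule decomposition_unique)
      show "g (x \<oplus>\<^bsub>K\<^esub> x') \<in> A" "h (x \<oplus>\<^bsub>K\<^esub> x') \<in> B" using gh x x' by simp_all
      show "g x \<otimes>\<^bsub>TK.G\<^esub> g x' \<in> A" "h x \<otimes>\<^bsub>TK.G\<^esub> h x' \<in> B"
        using gh x x' subgroup.m_closed[OF A] subgroup.m_closed[OF B] by simp_all
      have "g (x \<oplus>\<^bsub>K\<^esub> x') \<otimes>\<^bsub>TK.G\<^esub> h (x \<oplus>\<^bsub>K\<^esub> x') = tens R K N x y \<otimes>\<^bsub>TK.G\<^esub> tens R K N x' y"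
        using gh(3)[of "x \<oplus>\<^bsub>K\<^esub> x'"] x x' y by (simp add: TK.tens_add_left)
      also have "\<dots> = (g x \<otimes>\<^bsub>TK.G\<^esub> g x') \<otimes>\<^bsub>TK.G\<^esub> (h x \<otimes>\<^bsub>TK.G\<^esub> h x')"
        using gh x x' cA cB by (simp add: G.m_ac)
      finally show "g (x \<oplus>\<^bsub>K\<^esub> x') \<otimes>\<^bsub>TK.G\<^esub> h (x \<oplus>\<^bsub>K\<^esub> x') = (g x \<otimes>\<^bsub>TK.G\<^esub> g x') \<otimes>\<^bsub>TK.G\<^esub> (h x \<otimes>\<^bsub>TK.G\<^esub> h x')" .
    qed
    show "g (l \<odot>\<^bsub>K'\<^esub> x) = act l (g x)" if l: "l \<in> carrier L" for l
    proof (rule decomposition_unique)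
      have lx: "l \<odot>\<^bsub>K'\<^esub> x \<in> carrier K" by (rule left_hom_closed[OF act_hom'[OF l] x])
      show "g (l \<odot>\<^bsub>K'\<^esub> x) \<in> A" "h (l \<odot>\<^bsub>K'\<^esub> x) \<in> B" using gh lx by simp_all
      show "act l (g x) \<in> A" "act l (h x) \<in> B" using gh x l A_act B_act by simp_all
      have "g (l \<odot>\<^bsub>K'\<^esub> x) \<otimes>\<^bsub>TK.G\<^esub> h (l \<odot>\<^bsub>K'\<^esub> x) = act l (tens R K N x y)"
        unfolding act_def using gh(3)[OF lx] tensor_map_hom(2)[OF TK TK act_hom'[OF l] x y] by simp
      also have "\<dots> = act l (g x) \<otimes>\<^bsub>TK.G\<^esub> act l (h x)"
        unfolding act_def gh(3)[OF x] by (rule tensor_map_mult[OF TK TK act_hom'[OF l] cA[OF gh(1)[OF x]] cB[OF gh(2)[OF x]]])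
      finally show "g (l \<odot>\<^bsub>K'\<^esub> x) \<otimes>\<^bsub>TK.G\<^esub> h (l \<odot>\<^bsub>K'\<^esub> x) = act l (g x) \<otimes>\<^bsub>TK.G\<^esub> act l (h x)" .
    qed
  qed
  then obtain y' where y': "y' \<in> carrier N" "\<And>x. x \<in> carrier K \<Longrightarrow> g x = tens R K N x y'" by blast
  \<comment> \<open>Removing \<open>y'\<close> leaves an element whose tensors are exactly the
    \<open>B\<close>-parts \<open>h x\<close>; so it belongs to \<open>tens_part B\<close>.\<close>
  have "tens R K N x (y \<ominus>\<^bsub>N\<^esub> y') = h x" if x: "x \<in> carrier K" for x
  proof -
    have "tens R K N x y' \<otimes>\<^bsub>TK.G\<^esub> tens R K N x (y \<ominus>\<^bsub>N\<^esub> y') = tens R K N x y"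
      using x y y'(1) by (simp add: TK.tens_add_right[symmetric] N.add_minus_cancel)
    also have "\<dots> = tens R K N x y' \<otimes>\<^bsub>TK.G\<^esub> h x" using gh(3)[OF x] y'(2)[OF x] by simp
    finally show ?thesis
      using TK.tens_closed[OF x y'(1)] TK.tens_closed[OF x N.M.minus_closed[OF y y'(1)]] cB[OF gh(2)[OF x]] by simp
  qed
  then have "y \<ominus>\<^bsub>N\<^esub> y' \<in> tens_part B" using gh(2) y y'(1) by (simp add: tens_part_def)
  moreover have "y' \<in> tens_part A" using y' gh(1) by (simp add: tens_part_def)
  moreover have "y = y' \<oplus>\<^bsub>N\<^esub> (y \<ominus>\<^bsub>N\<^esub> y')" using y y'(1) by (simp add: N.add_minus_cancel)
  ultimately show ?thesis by blast
qed

lemma tens_part_disjoint: "\<lbrakk>y \<in> tens_part A; y \<in> tens_part B\<rbrakk> \<Longrightarrow> y = \<zero>\<^bsub>N\<^esub>"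
  using disjoint by (intro tens_kk_inj) (auto simp: tens_part_def)

lemma tens_part_module: "left_module R (N\<lparr>carrier := tens_part A\<rparr>)"
  by (rule submodule[OF N.left_module_axioms tens_part_submodule[OF A]])

lemma tens_part_retract:
  "\<exists>p\<in>left_hom R N (N\<lparr>carrier := tens_part A\<rparr>). \<forall>x\<in>tens_part A. p x = x"
  by (rule internal_sum_projection[OF N.left_module_axioms tens_part_submodule(1)[OF A] tens_part_submodule(1)[OF B]
      tens_part_submodule(2)[OF A] tens_part_submodule(2)[OF B] tens_part_submodule(3)[OF A] tens_part_submodule(3)[OF B]
      tens_part_submodule(4)[OF A] tens_part_submodule(4)[OF B] tens_part_sum tens_part_disjoint])

text \<open>The inclusion of \<open>tens_part A\<close> induces a map from its tensor product into
  \<open>A\<close>. It is injective because the inclusion has a retraction, and onto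
  \<open>A\<close> because its image together with \<open>B\<close> gives the whole group. The
  witness is the map induced by the retraction, which inverts it on \<open>A\<close>.\<close>

lemma tens_part_tensor:
  shows "\<exists>q\<in>hom (tensor_group R K N) (tensor_group R K (N\<lparr>carrier := tens_part A\<rparr>)).
    bij_betw q A (carrier (tensor_group R K (N\<lparr>carrier := tens_part A\<rparr>))) \<and>
    (\<forall>l\<in>carrier L. \<forall>X\<in>carrier (tensor_group R K N).
      q (act l X) = tensor_map R K (N\<lparr>carrier := tens_part A\<rparr>) (\<lambda>x. l \<odot>\<^bsub>K'\<^esub> x) (q X))"
proof -
  let ?J = "N\<lparr>carrier := tens_part A\<rparr>"
  have TJ: "tensor R K ?J" by (rule tensorI[OF K.left_module_axioms tens_part_module])
  interpret TK: tensor R K N by (rule TK)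
  interpret TJ: tensor R K ?J by (rule TJ)
  interpret G: comm_group TK.G by (rule TK.group)
  interpret GJ: comm_group TJ.G by (rule TJ.group)
  obtain p where p: "p \<in> left_hom R N ?J" "\<And>x. x \<in> tens_part A \<Longrightarrow> p x = x" using tens_part_retract by blast
  have i: "(\<lambda>x. x) \<in> left_hom R ?J N"
    using tens_part_submodule(1)[OF A] by (intro left_homI) auto
  have pi: "p x = x" if "x \<in> carrier ?J" for x using that p(2) by simp
  obtain hi where hi: "hi \<in> hom TJ.G TK.G"
    "\<And>a x. \<lbrakk>a \<in> carrier K; x \<in> carrier ?J\<rbrakk> \<Longrightarrow> hi (tens R K ?J a x) = tens R K N a x"
    using tensor_map_right[OF TJ TK i] by blast
  obtain hp where hp: "hp \<in> hom TK.G TJ.G"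
    "\<And>a x. \<lbrakk>a \<in> carrier K; x \<in> carrier N\<rbrakk> \<Longrightarrow> hp (tens R K N a x) = tens R K ?J a (p x)"
    using tensor_map_right[OF TK TJ p(1)] by blast
  interpret hi: group_hom TJ.G TK.G hi by unfold_locales (rule hi)
  have hphi: "hp (hi X) = X" if "X \<in> carrier TJ.G" for X
    by (rule tensor_map_right_retract[OF TJ TK i p(1) pi hi hp that])
  have hiA: "hi X \<in> A" if "X \<in> carrier TJ.G" for X
    using that
  proof (induction X rule: TJ.induct)
    case one
    show ?case using hi.hom_one subgroup.one_closed[OF A] by simp
  next
    case (mult X Y)
    then show ?case using subgroup.m_closed[OF A] by simp
  next
    case (tens a x)
    then show ?case using hi(2) by (simp add: tens_part_def)
  qed
  have split: "\<exists>X'\<in>carrier TJ.G. \<exists>b\<in>B. X = hi X' \<otimes>\<^bsub>TK.G\<^esub> b" if "X \<in> carrier TK.G" for X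
    using that
  proof (induction X rule: TK.induct)
    case one
    show ?case using hi.hom_one subgroup.one_closed[OF B] by (intro bexI[of _ "\<one>\<^bsub>TJ.G\<^esub>"] bexI[of _ "\<one>\<^bsub>TK.G\<^esub>"]) simp_all
  next
    case (mult X Y)
    then obtain X' b Y' c where X: "X' \<in> carrier TJ.G" "b \<in> B" "X = hi X' \<otimes>\<^bsub>TK.G\<^esub> b"
      and Y: "Y' \<in> carrier TJ.G" "c \<in> B" "Y = hi Y' \<otimes>\<^bsub>TK.G\<^esub> c" by blast
    have "X \<otimes>\<^bsub>TK.G\<^esub> Y = hi (X' \<otimes>\<^bsub>TJ.G\<^esub> Y') \<otimes>\<^bsub>TK.G\<^esub> (b \<otimes>\<^bsub>TK.G\<^esub> c)"
      using X Y subgroup.mem_carrier[OF B X(2)] subgroup.mem_carrier[OF B Y(2)] by (simp add: G.m_ac)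
    then show ?case using X(1) Y(1) subgroup.m_closed[OF B X(2) Y(2)]
      by (intro bexI[of _ "X' \<otimes>\<^bsub>TJ.G\<^esub> Y'"] bexI[of _ "b \<otimes>\<^bsub>TK.G\<^esub> c"]) simp_all
  next
    case (tens k y)
    obtain a b where ab: "a \<in> tens_part A" "b \<in> tens_part B" "y = a \<oplus>\<^bsub>N\<^esub> b" using tens_part_sum[OF tens(2)] by blast
    have "a \<in> carrier N" "b \<in> carrier N" "tens R K N k b \<in> B" using ab tens by (auto simp: tens_part_def)
    then have "tens R K N k y = hi (tens R K ?J k a) \<otimes>\<^bsub>TK.G\<^esub> tens R K N k b"
      using tens ab hi(2) by (simp add: TK.tens_add_right)
    then show ?case using \<open>tens R K N k b \<in> B\<close> TJ.tens_closed[of k a] tens ab(1)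
      by (intro bexI[of _ "tens R K ?J k a"] bexI[of _ "tens R K N k b"]) simp_all
  qed
  have onto: "\<exists>X'\<in>carrier TJ.G. X = hi X'" if X: "X \<in> A" for X
  proof -
    have Xc: "X \<in> carrier TK.G" by (rule subgroup.mem_carrier[OF A X])
    obtain X' b where b: "X' \<in> carrier TJ.G" "b \<in> B" "X = hi X' \<otimes>\<^bsub>TK.G\<^esub> b" using split[OF Xc] by blast
    \<comment> \<open>\<open>X\<close> and \<open>hi X'\<close> are both \<open>A\<close>-parts of
      the same element, once with trivial \<open>B\<close>-part and once with
      \<open>b\<close>.\<close>
    have "X = hi X'"
      by (rule decomposition_unique[OF X hiA[OF b(1)] subgroup.one_closed[OF B] b(2)]) (use b Xc in simp)
    with b(1) show ?thesis by blast
  qed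
  have "bij_betw hp A (carrier TJ.G)"
  proof (rule bij_betw_byWitness[where f' = hi])
    show "\<forall>X\<in>A. hi (hp X) = X" using onto hphi by metis
    show "\<forall>X\<in>carrier TJ.G. hp (hi X) = X" using hphi by blast
    show "hp ` A \<subseteq> carrier TJ.G" using hom_in_carrier[OF hp(1)] subgroup.mem_carrier[OF A] by blast
    show "hi ` carrier TJ.G \<subseteq> A" using hiA by blast
  qed
  moreover have "hp (act l X) = tensor_map R K ?J (\<lambda>x. l \<odot>\<^bsub>K'\<^esub> x) (hp X)" if "l \<in> carrier L" "X \<in> carrier TK.G" for l X
    unfolding act_def by (rule tensor_map_right_natural[OF TK TK TJ TJ p(1) act_hom'[OF that(1)] hp hp that(2)])
  ultimately show ?thesis using hp(1) by blast
qed

end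

end

section \<open>Special semidualizing bimodules\<close>

text \<open>Repackages the semidualizing conditions. It is applied with \<open>T = S\<close> for
  injective modules and, with the sides of the bimodule exchanged, with \<open>T = op_ring R\<close>
  for flat ones.\<close>

lemma dual_resolution_exists:
  fixes T :: "('t, 'e) ring_scheme" and L :: "('l, 'f) ring_scheme"
  assumes K: "left_module T K" and K': "left_module L K'"
    and eq: "carrier K' = carrier K" "ring.add K' = ring.add K" "\<zero>\<^bsub>K'\<^esub> = \<zero>\<^bsub>K\<^esub>"
    and comm: "\<And>t l x. \<lbrakk>t \<in> carrier T; l \<in> carrier L; x \<in> carrier K\<rbrakk> \<Longrightarrow>
      t \<odot>\<^bsub>K\<^esub> (l \<odot>\<^bsub>K'\<^esub> x) = l \<odot>\<^bsub>K'\<^esub> (t \<odot>\<^bsub>K\<^esub> x)"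
    and homothety: "(\<lambda>t. \<lambda>x\<in>carrier K. t \<odot>\<^bsub>K\<^esub> x) \<in> iso (add_monoid T) (hom_group L K' K')"
    and Ext: "\<And>i. i \<ge> 1 \<Longrightarrow> trivial_group (Ext L i K' K')"
    and fp: "finitely_presented T \<infinity> K" and fp': "finitely_presented L \<infinity> K'"
  shows "\<exists>m \<delta> \<epsilon>. dual_resolution T K L m \<delta> \<epsilon> K'"
proof -
  interpret K: left_module T K by fact
  obtain F :: "nat \<Rightarrow> ('l, nat \<Rightarrow> 'l) module" and \<alpha> \<beta> where F: "resolution L F \<alpha> \<beta> K'" "\<And>i. fg_free L (F i)"
    using finitely_presentedE[OF fp'] by blast
  obtain m :: "nat \<Rightarrow> nat" and \<delta> \<epsilon> where res: "resolution L (\<lambda>i. free_module L {..<m i}) \<delta> \<epsilon> K'"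
    using resolution_free[OF F] by blast
  have L: "ring L" by (rule left_module_ring[OF K'])
  have bij: "bij_betw (\<lambda>t. \<lambda>x\<in>carrier K. t \<odot>\<^bsub>K\<^esub> x) (carrier T) (carrier (hom_group L K' K'))"
    using homothety by (simp add: iso_def)
  have "dual_resolution T K L m \<delta> \<epsilon> K'"
  proof (intro dual_resolution.intro dual_resolution_axioms.intro K res eq comm fp)
    fix f assume f: "f \<in> left_hom L K' K'"
    have "restrict f (carrier K) \<in> carrier (hom_group L K' K')"
      using left_hom_cong[OF K' f, of "restrict f (carrier K)"] by (auto simp: hom_group_def eq)
    then obtain t where t: "t \<in> carrier T" "restrict f (carrier K) = (\<lambda>x\<in>carrier K. t \<odot>\<^bsub>K\<^esub> x)"
      using bij unfolding bij_betw_def by blast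
    have "f x = t \<odot>\<^bsub>K\<^esub> x" if "x \<in> carrier K" for x using fun_cong[OF t(2), of x] that by simp
    with t(1) show "\<exists>t\<in>carrier T. \<forall>x\<in>carrier K. f x = t \<odot>\<^bsub>K\<^esub> x" by blast
  next
    fix t assume t: "t \<in> carrier T" "\<forall>x\<in>carrier K. t \<odot>\<^bsub>K\<^esub> x = \<zero>\<^bsub>K\<^esub>"
    have "(\<lambda>x\<in>carrier K. t \<odot>\<^bsub>K\<^esub> x) = (\<lambda>x\<in>carrier K. \<zero>\<^bsub>T\<^esub> \<odot>\<^bsub>K\<^esub> x)" using t(2) by (auto simp: fun_eq_iff)
    then show "t = \<zero>\<^bsub>T\<^esub>" using bij t(1) unfolding bij_betw_def inj_on_def by simp
  next
    fix t
    have "ext_van L (std_res L K') (\<lambda>_. std_diff L) K' t"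
      using Ext[of "Suc t"] trivial_Ext_iff[OF K' K', of t] by simp
    then show "ext_van L (\<lambda>i. free_module L {..<m i}) \<delta> K' t"
      by (rule ext_van_compare[OF res resolution_std[OF K'] projective_free[OF L] projective_std[OF K'] K'])
  qed
  then show ?thesis by blast
qed

lemma right_part_simps [simp]:
  "carrier (right_part K) = carrier K" "ring.add (right_part K) = ring.add K" "\<zero>\<^bsub>right_part K\<^esub> = \<zero>\<^bsub>K\<^esub>"
  "r \<odot>\<^bsub>right_part K\<^esub> x = rsmult K x r"
  by (simp_all add: right_part_def)

text \<open>The kernel of a differential does not depend on the ring that acts, so the left syzygy
  is also the syzygy of the right-hand resolution.\<close>

lemma special_semidualizing_resolutions:
  assumes "special_semidualizing S R d C K"
  obtains F \<delta> \<epsilon> where "resolution S F \<delta> \<epsilon> C" "resolution (op_ring R) (\<lambda>i. right_part (F i)) \<delta> \<epsilon> (right_part C)"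
    "\<And>i. fg_free S (F i)" "\<And>i. fg_free (op_ring R) (right_part (F i))"
    "K = F (d - 1)\<lparr>carrier := syzygy F \<delta> \<epsilon> C (d - 1)\<rparr>"
    "right_part K = right_part (F (d - 1))\<lparr>carrier := syzygy (\<lambda>i. right_part (F i)) \<delta> \<epsilon> (right_part C) (d - 1)\<rparr>"
proof -
  obtain F \<delta> \<epsilon> where F: "super_fp_resolution S R F \<delta> \<epsilon> C" and K: "K = F (d - 1)\<lparr>carrier := syzygy F \<delta> \<epsilon> C (d - 1)\<rparr>"
    using assms by (auto simp: special_semidualizing_def)
  have K': "right_part K = right_part (F (d - 1))\<lparr>carrier := syzygy (\<lambda>i. right_part (F i)) \<delta> \<epsilon> (right_part C) (d - 1)\<rparr>"
    by (cases "d - 1") (simp_all add: K right_part_def syzygy_def kernel_def)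
  show thesis by (rule that[OF _ _ _ _ K K']) (use F in \<open>simp_all add: super_fp_resolution_def resolution_def\<close>)
qed

text \<open>The terms of the resolution of \<open>C\<close> from degree \<open>d\<close> on resolve
  \<open>K\<close>. Hence \<open>Ext^(t+1)(K, I)\<close> is \<open>Ext^(d+t+1)(C, I)\<close>, which
  vanishes for an \<open>(n, d)\<close>-injective \<open>I\<close>.\<close>

lemma special_semidualizing_left:
  assumes K: "special_semidualizing S R d C K" and d: "d \<ge> 1"
  shows "finitely_presented S \<infinity> K" and "nd_injective S n d I \<Longrightarrow> ext_acyclic S K I"
proof -
  obtain F \<delta> \<epsilon> where F: "resolution S F \<delta> \<epsilon> C" "resolution (op_ring R) (\<lambda>i. right_part (F i)) \<delta> \<epsilon> (right_part C)"
    and fg: "\<And>i. fg_free S (F i)" "\<And>i. fg_free (op_ring R) (right_part (F i))"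
    and K': "K = F (d - 1)\<lparr>carrier := syzygy F \<delta> \<epsilon> C (d - 1)\<rparr>"
      "right_part K = right_part (F (d - 1))\<lparr>carrier := syzygy (\<lambda>i. right_part (F i)) \<delta> \<epsilon> (right_part C) (d - 1)\<rparr>"
    by (rule special_semidualizing_resolutions[OF K]) (rule that, assumption+)
  note sh = resolution_shift[OF F(1), of "d - 1", folded K'(1)] and fg = fg(1)
  show "finitely_presented S \<infinity> K" by (rule finitely_presentedI[OF sh fg])
  show "ext_acyclic S K I" if I: "nd_injective S n d I"
  proof (rule ext_acyclicI[OF sh fg])
    show "left_module S I" using I by (simp add: nd_injective_def)
    \<comment> \<open>As \<open>d\<close> is positive, \<open>Suc (d - 1)\<close> is
      \<open>d\<close>; degree \<open>t\<close> of the shifted resolution is degree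
      \<open>d + t\<close> of the original one.\<close>
    show "ext_van S (\<lambda>i. F (Suc (d - 1) + i)) (\<lambda>i. \<delta> (Suc (d - 1) + i)) I t" for t
      using nd_injective_ext_van[OF I F(1) fg, of "d + t"] d by (simp add: ext_van_def)
  qed
qed

text \<open>The same shift for the right-hand resolution, with \<open>Tor\<close> in place of
  \<open>Ext\<close>.\<close>

lemma special_semidualizing_right:
  assumes K: "special_semidualizing S R d C K" and d: "d \<ge> 1"
  shows "finitely_presented (op_ring R) \<infinity> (right_part K)"
    and "nd_flat R n d N \<Longrightarrow> tor_acyclic R (right_part K) N"
proof -
  obtain F \<delta> \<epsilon> where F: "resolution S F \<delta> \<epsilon> C" "resolution (op_ring R) (\<lambda>i. right_part (F i)) \<delta> \<epsilon> (right_part C)"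
    and fg: "\<And>i. fg_free S (F i)" "\<And>i. fg_free (op_ring R) (right_part (F i))"
    and K': "K = F (d - 1)\<lparr>carrier := syzygy F \<delta> \<epsilon> C (d - 1)\<rparr>"
      "right_part K = right_part (F (d - 1))\<lparr>carrier := syzygy (\<lambda>i. right_part (F i)) \<delta> \<epsilon> (right_part C) (d - 1)\<rparr>"
    by (rule special_semidualizing_resolutions[OF K]) (rule that, assumption+)
  note sh = resolution_shift[OF F(2), of "d - 1", folded K'(2)] and fg = fg(2)
  show "finitely_presented (op_ring R) \<infinity> (right_part K)" by (rule finitely_presentedI[OF sh fg])
  show "tor_acyclic R (right_part K) N" if N: "nd_flat R n d N"
  proof (rule tor_acyclicI[OF sh fg])
    show "left_module R N" using N by (simp add: nd_flat_def)
    show "tor_van R (\<lambda>i. right_part (F (Suc (d - 1) + i))) (\<lambda>i. \<delta> (Suc (d - 1) + i)) N t" for t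
      using nd_flat_tor_van[OF N F(2) fg, of "d + t"] d by (simp add: tor_van_def)
  qed
qed

section \<open>Summands in the injective class\<close>

lemma hom_module_simps [simp]:
  "carrier (hom_module S K I) = left_hom S K I \<inter> extensional (carrier K)"
  "f \<oplus>\<^bsub>hom_module S K I\<^esub> g = (\<lambda>x\<in>carrier K. f x \<oplus>\<^bsub>I\<^esub> g x)"
  "\<zero>\<^bsub>hom_module S K I\<^esub> = (\<lambda>x\<in>carrier K. \<zero>\<^bsub>I\<^esub>)"
  "r \<odot>\<^bsub>hom_module S K I\<^esub> f = (\<lambda>x\<in>carrier K. f (rsmult K x r))"
  by (simp_all add: hom_module_def hom_group_def)

text \<open>The isomorphism \<open>\<psi>\<close> turns the summands into complementary submodules
  of \<open>Hom(K, I)\<close>. The span of the values of the first one is a retract of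
  \<open>I\<close>, hence \<open>(n, d)\<close>-injective, and \<open>\<psi>\<close> identifies
  \<open>A\<close> with the homomorphisms into that span.\<close>

lemma I_class_direct_summand:
  fixes R :: "'r ring" and S :: "'s ring" and C :: "('s, 'r, 'c) bimodule" and K :: "('s, 'r, 'k) bimodule"
  assumes d: "d \<ge> 1" and special: "special_semidualizing S R d C K"
    and M: "M \<in> I_class TYPE('i) S R n d K" and A: "left_module R A" and B: "left_module R B"
    and M_iso: "module_iso R M (direct_sum A B)"
  shows "A \<in> I_class TYPE('i) S R n d K"
proof -
  obtain I :: "('s, 'i) module" where M': "left_module R M" and I: "nd_injective S n d I"
    and HI: "module_iso R M (hom_module S K I)"
    using M by (auto simp: I_class_def)
  have semi: "semidualizing S R K" using special by (simp add: special_semidualizing_def)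
  have K: "left_module S K" and K': "left_module (op_ring R) (right_part K)"
    and bi: "\<And>s r x. \<lbrakk>s \<in> carrier S; r \<in> carrier R; x \<in> carrier K\<rbrakk> \<Longrightarrow> rsmult K (s \<odot>\<^bsub>K\<^esub> x) r = s \<odot>\<^bsub>K\<^esub> rsmult K x r"
    using semi by (auto simp: semidualizing_def is_bimodule_def)
  note left = special_semidualizing_left[OF special d]
  have "\<exists>m \<delta> \<epsilon>. dual_resolution S K (op_ring R) m \<delta> \<epsilon> (right_part K)"
    by (rule dual_resolution_exists[OF K K'])
      (use semi bi left(1) special_semidualizing_right(1)[OF special d] in \<open>auto simp: semidualizing_def\<close>)
  then obtain m \<delta> \<epsilon> where D: "dual_resolution S K (op_ring R) m \<delta> \<epsilon> (right_part K)" by blast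
  interpret D: dual_resolution S K "op_ring R" m \<delta> \<epsilon> "right_part K" by (rule D)
  have Im: "left_module S I" using I by (simp add: nd_injective_def)
  have "dual_injective S K (op_ring R) m \<delta> \<epsilon> (right_part K) I"
    by (intro dual_injective.intro D Im dual_injective_axioms.intro D.Z_hom_extends[OF Im left(2)[OF I] nd_injective_ext_van[OF I]])
  then interpret E: dual_injective S K "op_ring R" m \<delta> \<epsilon> "right_part K" I .
  interpret A: left_module R A by fact
  interpret B: left_module R B by fact
  let ?H = "hom_module S K I" and ?AB = "direct_sum A B"
  obtain \<psi> where \<psi>: "\<psi> \<in> left_hom R ?AB ?H" and bij: "bij_betw \<psi> (carrier ?AB) (carrier ?H)"
    using module_iso_trans[OF module_iso_sym[OF M' M_iso] HI] by (auto simp: module_iso_def)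
  interpret AB: left_module R ?AB by (rule left_module_direct_sum[OF A B])
  interpret HG: comm_group "hom_group S K I" by (rule comm_group_hom_group[OF K Im])
  \<comment> \<open>Zero is recognised as the only idempotent of the group
    \<open>hom_group S K I\<close>; the module laws of \<open>?H\<close> have not been
    established.\<close>
  have \<psi>0: "\<psi> (\<zero>\<^bsub>A\<^esub>, \<zero>\<^bsub>B\<^esub>) = (\<lambda>x\<in>carrier K. \<zero>\<^bsub>I\<^esub>)"
  proof -
    have "\<psi> (\<zero>\<^bsub>A\<^esub>, \<zero>\<^bsub>B\<^esub>) \<oplus>\<^bsub>?H\<^esub> \<psi> (\<zero>\<^bsub>A\<^esub>, \<zero>\<^bsub>B\<^esub>) = \<psi> (\<zero>\<^bsub>A\<^esub>, \<zero>\<^bsub>B\<^esub>)"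
      using left_hom_add[OF \<psi>, of "(\<zero>\<^bsub>A\<^esub>, \<zero>\<^bsub>B\<^esub>)" "(\<zero>\<^bsub>A\<^esub>, \<zero>\<^bsub>B\<^esub>)"] by simp
    moreover have "\<psi> (\<zero>\<^bsub>A\<^esub>, \<zero>\<^bsub>B\<^esub>) \<in> carrier ?H" using left_hom_closed[OF \<psi>, of "(\<zero>\<^bsub>A\<^esub>, \<zero>\<^bsub>B\<^esub>)"] by simp
    ultimately show ?thesis using HG.idempotent_eq_one[of "\<psi> (\<zero>\<^bsub>A\<^esub>, \<zero>\<^bsub>B\<^esub>)"] by (simp add: hom_group_def)
  qed
  have rs: "rsmult K x r \<in> carrier K" if "x \<in> carrier K" "r \<in> carrier R" for x r
    using left_module.smult_closed[OF K', of r x] that by simp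
  have restr: "restrict f (carrier K) \<in> carrier ?H" if "f \<in> left_hom S K I" for f
    using left_hom_cong[OF K that, of "restrict f (carrier K)"] by auto
  \<comment> \<open>The image of \<open>U\<close> under \<open>\<psi>\<close>, enlarged to all
    functions that agree on \<open>K\<close> with one of its members: \<open>\<psi>\<close> yields
    extensional functions, while \<open>hom_submodule\<close> must be closed under changes outside
    \<open>carrier K\<close>.\<close>
  define part where "part U = {f \<in> left_hom S K I. restrict f (carrier K) \<in> \<psi> ` U}" for U
  have sub: "E.hom_submodule (part U)"
    if U: "U \<subseteq> carrier ?AB" "(\<zero>\<^bsub>A\<^esub>, \<zero>\<^bsub>B\<^esub>) \<in> U" "\<And>x y. \<lbrakk>x \<in> U; y \<in> U\<rbrakk> \<Longrightarrow> x \<oplus>\<^bsub>?AB\<^esub> y \<in> U"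
      "\<And>r x. \<lbrakk>r \<in> carrier R; x \<in> U\<rbrakk> \<Longrightarrow> r \<odot>\<^bsub>?AB\<^esub> x \<in> U" for U
    unfolding E.hom_submodule_def
  proof (intro conjI ballI allI impI)
    show "part U \<subseteq> left_hom S K I" by (auto simp: part_def)
    show "(\<lambda>_. \<zero>\<^bsub>I\<^esub>) \<in> part U"
      using left_hom_const_zero[OF Im] imageI[OF U(2), of \<psi>] \<psi>0 by (simp add: part_def)
    fix f assume f: "f \<in> part U"
    then obtain u where u: "u \<in> U" "restrict f (carrier K) = \<psi> u" and fh: "f \<in> left_hom S K I" by (auto simp: part_def)
    have fx: "f x = \<psi> u x" if "x \<in> carrier K" for x using fun_cong[OF u(2), of x] that by simp
    have u': "u \<in> carrier ?AB" using U(1) u(1) by blast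
    show "(\<lambda>x. f x \<oplus>\<^bsub>I\<^esub> g x) \<in> part U" if g: "g \<in> part U" for g
    proof -
      obtain v where v: "v \<in> U" "restrict g (carrier K) = \<psi> v" and gh: "g \<in> left_hom S K I" using g by (auto simp: part_def)
      have gx: "g x = \<psi> v x" if "x \<in> carrier K" for x using fun_cong[OF v(2), of x] that by simp
      have v': "v \<in> carrier ?AB" using U(1) v(1) by blast
      have "restrict (\<lambda>x. f x \<oplus>\<^bsub>I\<^esub> g x) (carrier K) = \<psi> (u \<oplus>\<^bsub>?AB\<^esub> v)"
        unfolding left_hom_add[OF \<psi> u' v'] by (auto simp: fx gx)
      then show ?thesis
        using left_hom_plus[OF Im fh gh] U(3)[OF u(1) v(1)] by (auto simp: part_def)
    qed
    show "(\<lambda>x. f (l \<odot>\<^bsub>right_part K\<^esub> x)) \<in> part U" if l: "l \<in> carrier (op_ring R)" for l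
    proof -
      have l': "l \<in> carrier R" using l by simp
      have "restrict (\<lambda>x. f (rsmult K x l)) (carrier K) = \<psi> (l \<odot>\<^bsub>?AB\<^esub> u)"
        unfolding left_hom_smult[OF \<psi> l' u'] using rs[OF _ l'] by (auto simp: fx)
      then show ?thesis
        using left_hom_compose[OF D.act_hom'[OF l] fh] U(4)[OF l' u(1)] by (auto simp: part_def)
    qed
    show "g \<in> part U" if "\<forall>x\<in>carrier K. g x = f x" for g
    proof -
      have "g \<in> left_hom S K I" by (rule left_hom_cong[OF K fh]) (use that in simp)
      moreover have "restrict g (carrier K) = restrict f (carrier K)" using that by auto
      ultimately show ?thesis using f by (simp add: part_def)
    qed
  qed
  let ?A = "part (carrier A \<times> {\<zero>\<^bsub>B\<^esub>})" and ?B = "part ({\<zero>\<^bsub>A\<^esub>} \<times> carrier B)"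
  have subA: "E.hom_submodule ?A" and subB: "E.hom_submodule ?B"
    by (rule sub; auto)+
  have \<psi>split: "\<psi> (a, b) = (\<lambda>x\<in>carrier K. \<psi> (a, \<zero>\<^bsub>B\<^esub>) x \<oplus>\<^bsub>I\<^esub> \<psi> (\<zero>\<^bsub>A\<^esub>, b) x)" if "a \<in> carrier A" "b \<in> carrier B" for a b
    using left_hom_add[OF \<psi>, of "(a, \<zero>\<^bsub>B\<^esub>)" "(\<zero>\<^bsub>A\<^esub>, b)"] that by simp
  have mem: "\<psi> u \<in> left_hom S K I" "restrict (\<psi> u) (carrier K) = \<psi> u" if "u \<in> carrier ?AB" for u
    using left_hom_closed[OF \<psi> that] by (auto simp: extensional_restrict)
  have dec: "\<exists>a\<in>?A. \<exists>b\<in>?B. \<forall>x\<in>carrier K. f x = a x \<oplus>\<^bsub>I\<^esub> b x" if f: "f \<in> left_hom S K I" for f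
  proof -
    have "restrict f (carrier K) \<in> \<psi> ` carrier ?AB" using restr[OF f] bij by (simp add: bij_betw_def)
    then obtain a b where ab: "a \<in> carrier A" "b \<in> carrier B" "restrict f (carrier K) = \<psi> (a, b)" by auto
    have "f x = \<psi> (a, \<zero>\<^bsub>B\<^esub>) x \<oplus>\<^bsub>I\<^esub> \<psi> (\<zero>\<^bsub>A\<^esub>, b) x" if x: "x \<in> carrier K" for x
      using fun_cong[OF ab(3), of x] x fun_cong[OF \<psi>split[OF ab(1,2)], of x] by simp
    moreover have "\<psi> (a, \<zero>\<^bsub>B\<^esub>) \<in> ?A" "\<psi> (\<zero>\<^bsub>A\<^esub>, b) \<in> ?B" using mem ab by (auto simp: part_def)
    ultimately show ?thesis by blast
  qed
  have disj: "f x = \<zero>\<^bsub>I\<^esub>" if f: "f \<in> ?A" "f \<in> ?B" "x \<in> carrier K" for f x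
  proof -
    obtain a b where ab: "a \<in> carrier A" "b \<in> carrier B" "restrict f (carrier K) = \<psi> (a, \<zero>\<^bsub>B\<^esub>)" "restrict f (carrier K) = \<psi> (\<zero>\<^bsub>A\<^esub>, b)"
      using f by (auto simp: part_def)
    have "(a, \<zero>\<^bsub>B\<^esub>) = (\<zero>\<^bsub>A\<^esub>, b)" using bij ab by (intro inj_onD[OF bij_betw_imp_inj_on[OF bij]]) auto
    then have "restrict f (carrier K) = (\<lambda>x\<in>carrier K. \<zero>\<^bsub>I\<^esub>)" using ab(3) \<psi>0 by simp
    from fun_cong[OF this, of x] f(3) show ?thesis by simp
  qed
  let ?I = "I\<lparr>carrier := E.value_span ?A\<rparr>"
  have "\<exists>p\<in>left_hom S I ?I. \<forall>x\<in>E.value_span ?A. p x = x"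
    by (rule E.value_span_retract[OF subA subB]) (erule dec, rule disj, assumption+)
  then obtain p where p: "p \<in> left_hom S I ?I" "\<And>x. x \<in> E.value_span ?A \<Longrightarrow> p x = x" by blast
  have I': "left_module S ?I" by (rule E.value_span_module[OF subA subB]) (erule dec, rule disj, assumption+)
  have in_A: "f \<in> ?A \<longleftrightarrow> (\<forall>x\<in>carrier K. f x \<in> E.value_span ?A)" if "f \<in> left_hom S K I" for f
    by (rule E.in_A_iff[OF subA subB _ _ that]) (erule dec, rule disj, assumption+)
  have spI: "E.value_span ?A \<subseteq> carrier I" by (rule E.value_span_closed[OF subA])
  have "nd_injective S n d ?I"
    by (rule nd_injective_retract[OF I I' _ p(1), of "\<lambda>x. x"]) (use spI p(2) in \<open>auto intro!: left_homI\<close>)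
  moreover have "module_iso R A (hom_module S K ?I)"
  proof -
    \<comment> \<open>A homomorphism into the span is a homomorphism into \<open>I\<close> with
      values in the span, and by \<open>in_A\<close> these are the members of
      \<open>?A\<close>.\<close>
    have hom_iff: "f \<in> left_hom S K ?I \<longleftrightarrow> f \<in> ?A" for f
    proof
      assume f: "f \<in> left_hom S K ?I"
      have "f \<in> left_hom S K I"
        using left_hom_closed[OF f] left_hom_add[OF f] left_hom_smult[OF f] spI by (intro left_homI) auto
      then show "f \<in> ?A"
        using in_A left_hom_closed[OF f] by simp
    next
      assume f: "f \<in> ?A"
      then have fh: "f \<in> left_hom S K I" by (simp add: part_def)
      show "f \<in> left_hom S K ?I"
        using E.apply_in_span[OF subA f] by (intro left_homI) (auto simp: left_hom_add[OF fh] left_hom_smult[OF fh])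
    qed
    have car: "carrier (hom_module S K ?I) = \<psi> ` (carrier A \<times> {\<zero>\<^bsub>B\<^esub>})"
    proof (intro equalityI subsetI)
      fix f assume "f \<in> carrier (hom_module S K ?I)"
      then have "f \<in> ?A" "f \<in> extensional (carrier K)" by (simp_all add: hom_iff)
      then show "f \<in> \<psi> ` (carrier A \<times> {\<zero>\<^bsub>B\<^esub>})" by (simp add: part_def extensional_restrict)
    next
      fix f assume f: "f \<in> \<psi> ` (carrier A \<times> {\<zero>\<^bsub>B\<^esub>})"
      then have "f \<in> carrier ?H" using left_hom_closed[OF \<psi>] by auto
      with f have "f \<in> ?A" "f \<in> extensional (carrier K)" by (simp_all add: part_def extensional_restrict)
      then show "f \<in> carrier (hom_module S K ?I)" by (simp add: hom_iff)
    qed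
    have "(\<lambda>a. \<psi> (a, \<zero>\<^bsub>B\<^esub>)) \<in> left_hom R A (hom_module S K ?I)"
    proof (rule left_homI)
      fix a assume a: "a \<in> carrier A"
      show "\<psi> (a, \<zero>\<^bsub>B\<^esub>) \<in> carrier (hom_module S K ?I)" unfolding car using a by blast
      show "\<psi> (a \<oplus>\<^bsub>A\<^esub> a', \<zero>\<^bsub>B\<^esub>) = \<psi> (a, \<zero>\<^bsub>B\<^esub>) \<oplus>\<^bsub>hom_module S K ?I\<^esub> \<psi> (a', \<zero>\<^bsub>B\<^esub>)" if "a' \<in> carrier A" for a'
        using left_hom_add[OF \<psi>, of "(a, \<zero>\<^bsub>B\<^esub>)" "(a', \<zero>\<^bsub>B\<^esub>)"] a that by simp
      show "\<psi> (r \<odot>\<^bsub>A\<^esub> a, \<zero>\<^bsub>B\<^esub>) = r \<odot>\<^bsub>hom_module S K ?I\<^esub> \<psi> (a, \<zero>\<^bsub>B\<^esub>)" if "r \<in> carrier R" for r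
        using left_hom_smult[OF \<psi> that, of "(a, \<zero>\<^bsub>B\<^esub>)"] a that by simp
    qed
    moreover have "bij_betw (\<lambda>a. \<psi> (a, \<zero>\<^bsub>B\<^esub>)) (carrier A) (carrier (hom_module S K ?I))"
      unfolding bij_betw_def
    proof
      show "inj_on (\<lambda>a. \<psi> (a, \<zero>\<^bsub>B\<^esub>)) (carrier A)"
        by (auto intro!: inj_onI dest!: inj_onD[OF bij_betw_imp_inj_on[OF bij]])
      show "(\<lambda>a. \<psi> (a, \<zero>\<^bsub>B\<^esub>)) ` carrier A = carrier (hom_module S K ?I)" unfolding car by auto
    qed
    ultimately show ?thesis unfolding module_iso_def by blast
  qed
  ultimately show ?thesis unfolding I_class_def using A by blast
qed

section \<open>Summands in the flat class\<close>

lemma tensor_module_simps [simp]: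
  "carrier (tensor_module R K N) = carrier (tensor_group R (right_part K) N)"
  "X \<oplus>\<^bsub>tensor_module R K N\<^esub> Y = X \<otimes>\<^bsub>tensor_group R (right_part K) N\<^esub> Y"
  "s \<odot>\<^bsub>tensor_module R K N\<^esub> X = tensor_map R (right_part K) N (\<lambda>x. s \<odot>\<^bsub>K\<^esub> x) X"
  by (simp_all add: tensor_module_def)

text \<open>The images of the summands under \<open>\<psi>\<close> are subgroups of
  \<open>K \<otimes> F\<close> that are stable under \<open>S\<close>. \<open>tens_part\<close> of
  the first is a retract of \<open>F\<close>, hence \<open>(n, d)\<close>-flat, and its tensor
  product with \<open>K\<close> gives back the image of \<open>A\<close>.\<close>

lemma F_class_direct_summand:
  fixes R :: "'r ring" and S :: "'s ring" and C :: "('s, 'r, 'c) bimodule" and K :: "('s, 'r, 'k) bimodule"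
  assumes d: "d \<ge> 1" and special: "special_semidualizing S R d C K"
    and M: "M \<in> F_class TYPE('f) S R n d K" and A: "left_module S A" and B: "left_module S B"
    and M_iso: "module_iso S M (direct_sum A B)"
  shows "A \<in> F_class TYPE('f) S R n d K"
proof -
  obtain F :: "('r, 'f) module" where M': "left_module S M" and F: "nd_flat R n d F"
    and TF: "module_iso S M (tensor_module R K F)"
    using M by (auto simp: F_class_def)
  have semi: "semidualizing S R K" using special by (simp add: special_semidualizing_def)
  have K: "left_module S K" and K': "left_module (op_ring R) (right_part K)"
    and bi: "\<And>s r x. \<lbrakk>s \<in> carrier S; r \<in> carrier R; x \<in> carrier K\<rbrakk> \<Longrightarrow> rsmult K (s \<odot>\<^bsub>K\<^esub> x) r = s \<odot>\<^bsub>K\<^esub> rsmult K x r"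
    using semi by (auto simp: semidualizing_def is_bimodule_def)
  note right = special_semidualizing_right[OF special d]
  have "\<exists>m \<delta> \<epsilon>. dual_resolution (op_ring R) (right_part K) S m \<delta> \<epsilon> K"
  proof (rule dual_resolution_exists[OF K' K])
    have "(\<lambda>r. \<lambda>x\<in>carrier K. rsmult K x r) \<in> iso (add_monoid R) (hom_group S K K)"
      using semi by (simp add: semidualizing_def)
    then show "(\<lambda>t. \<lambda>x\<in>carrier (right_part K). t \<odot>\<^bsub>right_part K\<^esub> x) \<in> iso (add_monoid (op_ring R)) (hom_group S K K)"
      by (simp add: iso_def hom_def)
  qed (use semi bi right(1) special_semidualizing_left(1)[OF special d] in \<open>auto simp: semidualizing_def\<close>)
  then obtain m \<delta> \<epsilon> where D: "dual_resolution (op_ring R) (right_part K) S m \<delta> \<epsilon> K" by blast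
  have Fm: "left_module R F" using F by (simp add: nd_flat_def)
  have "dual_flat R (right_part K) S m \<delta> \<epsilon> K F"
    by (rule dual_flatI[OF D Fm right(2)[OF F] nd_flat_tor_van[OF F]])
  then interpret E: dual_flat R "right_part K" S m \<delta> \<epsilon> K F .
  interpret A: left_module S A by fact
  interpret B: left_module S B by fact
  let ?H = "tensor_module R K F" and ?AB = "direct_sum A B" and ?G = "tensor_group R (right_part K) F"
  obtain \<psi> where \<psi>: "\<psi> \<in> left_hom S ?AB ?H" and bij: "bij_betw \<psi> (carrier ?AB) (carrier ?H)"
    using module_iso_trans[OF module_iso_sym[OF M' M_iso] TF] by (auto simp: module_iso_def)
  interpret AB: left_module S ?AB by (rule left_module_direct_sum[OF A B])
  interpret TK: tensor R "right_part K" F by (rule E.TK)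
  interpret G: comm_group ?G by (rule TK.group)
  have \<psi>c: "\<psi> u \<in> carrier ?G" if "u \<in> carrier ?AB" for u using left_hom_closed[OF \<psi> that] by simp
  have \<psi>add: "\<psi> (u \<oplus>\<^bsub>?AB\<^esub> v) = \<psi> u \<otimes>\<^bsub>?G\<^esub> \<psi> v" if "u \<in> carrier ?AB" "v \<in> carrier ?AB" for u v
    using left_hom_add[OF \<psi> that] by simp
  have \<psi>smult: "\<psi> (s \<odot>\<^bsub>?AB\<^esub> u) = E.act s (\<psi> u)" if "s \<in> carrier S" "u \<in> carrier ?AB" for s u
    using left_hom_smult[OF \<psi> that] by (simp add: E.act_def)
  have \<psi>0: "\<psi> (\<zero>\<^bsub>A\<^esub>, \<zero>\<^bsub>B\<^esub>) = \<one>\<^bsub>?G\<^esub>"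
    using \<psi>add[of "(\<zero>\<^bsub>A\<^esub>, \<zero>\<^bsub>B\<^esub>)" "(\<zero>\<^bsub>A\<^esub>, \<zero>\<^bsub>B\<^esub>)"] \<psi>c[of "(\<zero>\<^bsub>A\<^esub>, \<zero>\<^bsub>B\<^esub>)"]
    by (intro G.idempotent_eq_one) simp_all
  have sub: "subgroup (\<psi> ` U) ?G"
    if U: "U \<subseteq> carrier ?AB" "(\<zero>\<^bsub>A\<^esub>, \<zero>\<^bsub>B\<^esub>) \<in> U" "\<And>x y. \<lbrakk>x \<in> U; y \<in> U\<rbrakk> \<Longrightarrow> x \<oplus>\<^bsub>?AB\<^esub> y \<in> U"
      "\<And>x. x \<in> U \<Longrightarrow> \<ominus>\<^bsub>?AB\<^esub> x \<in> U" for U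
  proof
    show "\<psi> ` U \<subseteq> carrier ?G" using U(1) \<psi>c by blast
    show "\<one>\<^bsub>?G\<^esub> \<in> \<psi> ` U" using imageI[OF U(2), of \<psi>] by (simp add: \<psi>0)
    fix x assume "x \<in> \<psi> ` U"
    then obtain u where u: "u \<in> U" "x = \<psi> u" by blast
    have u': "u \<in> carrier ?AB" using U(1) u(1) by blast
    show "x \<otimes>\<^bsub>?G\<^esub> y \<in> \<psi> ` U" if y: "y \<in> \<psi> ` U" for y
    proof -
      obtain v where v: "v \<in> U" "y = \<psi> v" using y by blast
      have "x \<otimes>\<^bsub>?G\<^esub> y = \<psi> (u \<oplus>\<^bsub>?AB\<^esub> v)" using \<psi>add[OF u'] U(1) u v by auto
      then show ?thesis using U(3)[OF u(1) v(1)] by blast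
    qed
    have "\<psi> (\<ominus>\<^bsub>?AB\<^esub> u) \<otimes>\<^bsub>?G\<^esub> \<psi> u = \<one>\<^bsub>?G\<^esub>"
      unfolding \<psi>add[OF AB.M.a_inv_closed[OF u'] u', symmetric] AB.M.l_neg[OF u'] using \<psi>0 by simp
    then have "inv\<^bsub>?G\<^esub> x = \<psi> (\<ominus>\<^bsub>?AB\<^esub> u)"
      using \<psi>c[OF u'] \<psi>c[OF AB.M.a_inv_closed[OF u']] u(2) by (intro G.inv_equality) simp_all
    then show "inv\<^bsub>?G\<^esub> x \<in> \<psi> ` U" using U(4)[OF u(1)] by blast
  qed
  have neg: "\<ominus>\<^bsub>?AB\<^esub> (a, b) = (\<ominus>\<^bsub>A\<^esub> a, \<ominus>\<^bsub>B\<^esub> b)" if "a \<in> carrier A" "b \<in> carrier B" for a b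
    by (rule AB.M.minus_equality) (use that in \<open>simp_all add: A.M.l_neg B.M.l_neg\<close>)
  let ?A = "\<psi> ` (carrier A \<times> {\<zero>\<^bsub>B\<^esub>})" and ?B = "\<psi> ` ({\<zero>\<^bsub>A\<^esub>} \<times> carrier B)"
  have subA: "subgroup ?A ?G" and subB: "subgroup ?B ?G"
    by (rule sub; auto simp: neg)+
  have actA: "E.act s a \<in> ?A" if s: "s \<in> carrier S" and a: "a \<in> ?A" for s a
  proof -
    obtain a' where a': "a' \<in> carrier A" "a = \<psi> (a', \<zero>\<^bsub>B\<^esub>)" using a by blast
    have "E.act s a = \<psi> (s \<odot>\<^bsub>A\<^esub> a', \<zero>\<^bsub>B\<^esub>)" using \<psi>smult[OF s, of "(a', \<zero>\<^bsub>B\<^esub>)"] a' s by simp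
    then show ?thesis using a' s by auto
  qed
  have actB: "E.act s b \<in> ?B" if s: "s \<in> carrier S" and b: "b \<in> ?B" for s b
  proof -
    obtain b' where b': "b' \<in> carrier B" "b = \<psi> (\<zero>\<^bsub>A\<^esub>, b')" using b by blast
    have "E.act s b = \<psi> (\<zero>\<^bsub>A\<^esub>, s \<odot>\<^bsub>B\<^esub> b')" using \<psi>smult[OF s, of "(\<zero>\<^bsub>A\<^esub>, b')"] b' s by simp
    then show ?thesis using b' s by auto
  qed
  have dec: "\<exists>a\<in>?A. \<exists>b\<in>?B. X = a \<otimes>\<^bsub>?G\<^esub> b" if X: "X \<in> carrier ?G" for X
  proof -
    have "X \<in> \<psi> ` carrier ?AB" using bij X by (simp add: bij_betw_def)
    then obtain a b where ab: "a \<in> carrier A" "b \<in> carrier B" "X = \<psi> (a, b)" by auto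
    then have "X = \<psi> (a, \<zero>\<^bsub>B\<^esub>) \<otimes>\<^bsub>?G\<^esub> \<psi> (\<zero>\<^bsub>A\<^esub>, b)" using \<psi>add[of "(a, \<zero>\<^bsub>B\<^esub>)" "(\<zero>\<^bsub>A\<^esub>, b)"] by simp
    with ab show ?thesis by blast
  qed
  have disj: "X = \<one>\<^bsub>?G\<^esub>" if X: "X \<in> ?A" "X \<in> ?B" for X
  proof -
    obtain a b where ab: "a \<in> carrier A" "b \<in> carrier B" "X = \<psi> (a, \<zero>\<^bsub>B\<^esub>)" "X = \<psi> (\<zero>\<^bsub>A\<^esub>, b)" using X by auto
    have "(a, \<zero>\<^bsub>B\<^esub>) = (\<zero>\<^bsub>A\<^esub>, b)" using ab by (intro inj_onD[OF bij_betw_imp_inj_on[OF bij]]) auto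
    then show ?thesis using ab(3) \<psi>0 by simp
  qed
  note facts = subA subB actA actB dec disj
  let ?J = "F\<lparr>carrier := E.tens_part ?A\<rparr>"
  have "\<exists>p\<in>left_hom R F ?J. \<forall>x\<in>E.tens_part ?A. p x = x"
    by (rule E.tens_part_retract[OF facts])
  then obtain p where p: "p \<in> left_hom R F ?J" "\<And>x. x \<in> E.tens_part ?A \<Longrightarrow> p x = x" by blast
  have J: "left_module R ?J" by (rule E.tens_part_module[OF facts])
  have "nd_flat R n d ?J"
    by (rule nd_flat_retract[OF F J _ p(1), of "\<lambda>x. x"])
      (use E.tens_part_submodule(1)[OF facts subA] p(2) in \<open>auto intro!: left_homI\<close>)
  moreover have "module_iso S A (tensor_module R K ?J)"
  proof -
    have "\<exists>q\<in>hom ?G (tensor_group R (right_part K) ?J). bij_betw q ?A (carrier (tensor_group R (right_part K) ?J)) \<and>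
      (\<forall>l\<in>carrier S. \<forall>X\<in>carrier ?G. q (E.act l X) = tensor_map R (right_part K) ?J (\<lambda>x. l \<odot>\<^bsub>K\<^esub> x) (q X))"
      by (rule E.tens_part_tensor[OF facts])
    then obtain q where q: "q \<in> hom ?G (tensor_group R (right_part K) ?J)"
      "bij_betw q ?A (carrier (tensor_group R (right_part K) ?J))"
      "\<And>l X. \<lbrakk>l \<in> carrier S; X \<in> carrier ?G\<rbrakk> \<Longrightarrow> q (E.act l X) = tensor_map R (right_part K) ?J (\<lambda>x. l \<odot>\<^bsub>K\<^esub> x) (q X)"
      by blast
    have "(\<lambda>a. q (\<psi> (a, \<zero>\<^bsub>B\<^esub>))) \<in> left_hom S A (tensor_module R K ?J)"
    proof (rule left_homI)
      fix a assume a: "a \<in> carrier A"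
      have c: "\<psi> (a, \<zero>\<^bsub>B\<^esub>) \<in> carrier ?G" if "a \<in> carrier A" for a using \<psi>c that by simp
      show "q (\<psi> (a, \<zero>\<^bsub>B\<^esub>)) \<in> carrier (tensor_module R K ?J)" using hom_in_carrier[OF q(1) c[OF a]] by simp
      show "q (\<psi> (a \<oplus>\<^bsub>A\<^esub> a', \<zero>\<^bsub>B\<^esub>)) = q (\<psi> (a, \<zero>\<^bsub>B\<^esub>)) \<oplus>\<^bsub>tensor_module R K ?J\<^esub> q (\<psi> (a', \<zero>\<^bsub>B\<^esub>))" if a': "a' \<in> carrier A" for a'
        using \<psi>add[of "(a, \<zero>\<^bsub>B\<^esub>)" "(a', \<zero>\<^bsub>B\<^esub>)"] a a' hom_mult[OF q(1) c[OF a] c[OF a']] by simp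
      show "q (\<psi> (s \<odot>\<^bsub>A\<^esub> a, \<zero>\<^bsub>B\<^esub>)) = s \<odot>\<^bsub>tensor_module R K ?J\<^esub> q (\<psi> (a, \<zero>\<^bsub>B\<^esub>))" if s: "s \<in> carrier S" for s
        using \<psi>smult[OF s, of "(a, \<zero>\<^bsub>B\<^esub>)"] a s q(3)[OF s c[OF a]] by simp
    qed
    moreover have "bij_betw (\<lambda>a. \<psi> (a, \<zero>\<^bsub>B\<^esub>)) (carrier A) ?A"
      unfolding bij_betw_def by (auto intro!: inj_onI dest!: inj_onD[OF bij_betw_imp_inj_on[OF bij]])
    then have "bij_betw (\<lambda>a. q (\<psi> (a, \<zero>\<^bsub>B\<^esub>))) (carrier A) (carrier (tensor_module R K ?J))"
      using bij_betw_trans[OF _ q(2)] by (simp add: o_def)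
    ultimately show ?thesis unfolding module_iso_def by blast
  qed
  ultimately show ?thesis unfolding F_class_def using A by blast
qed

text \<open>Stating closure for the first summand covers both, because interchanging the summands is
  an isomorphism of direct sums.\<close>

theorem proposition3p15:
  fixes R :: "'r ring" and S :: "'s ring"
    and C :: "('s, 'r, 'c) bimodule" and K :: "('s, 'r, 'k) bimodule"
    and d :: nat and n :: enat
  assumes "ring R" and "ring S" and "d \<ge> 1" and "n > enat (d + 1)"
    and "special_semidualizing S R d C K"
  shows "(\<forall>(M :: ('r, 'm1) module) (A :: ('r, 'a1) module) (B :: ('r, 'b1) module).
           M \<in> I_class TYPE('i) S R n d K \<and> left_module R A \<and> left_module R B \<and>
           module_iso R M (direct_sum A B) \<longrightarrow> A \<in> I_class TYPE('i) S R n d K) \<and>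
         (\<forall>(M :: ('s, 'm2) module) (A :: ('s, 'a2) module) (B :: ('s, 'b2) module).
           M \<in> F_class TYPE('f) S R n d K \<and> left_module S A \<and> left_module S B \<and>
           module_iso S M (direct_sum A B) \<longrightarrow> A \<in> F_class TYPE('f) S R n d K)"
  using I_class_direct_summand[OF assms(3,5)] F_class_direct_summand[OF assms(3,5)] by blast

end
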